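(* Let $M$ and $N$ be $A_\infty$ modules over the $A_\infty$ ring spectrum $R$. Then there is a conditionally convergent spectral sequence $$E_2^{*,*}=\operatorname{Ext}_{R_*}^{*,*}(M_*,N_* )\implies [M,N]_R^{*}.$$ If $M$ has length at most $n$ with respect to the projective class $(\mathcal{P}_R,\mathcal{I}_R)$, then $E_{n+1}=E_\infty$.
   Context: Let $\mathcal{S}$ be the stable homotopy category. By an $A_\infty$ ring spectrum $R$ is meant any notion of structured ring spectrum such that the homotopy category $R\text{-Mod}$ of $A_\infty$ module spectra (module spectra with the maps that induce isomorphisms of homotopy groups inverted) is triangulated and satisfies the following: there is a free module functor $F:\mathcal{S}\to R\text{-Mod}$ left adjoint to a forgetful functor $U:R\text{-Mod}\to\mathcal{S}$; both $F$ and $U$ preserve triangles, commute with suspension, and commute with coproducts; and $UF$ is naturally isomorphic to $X\mapsto R\wedge X$. As throughout the paper, the triangulated category $R\text{-Mod}$ has all set-indexed coproducts. Write $R$ also for $FS^0$, $[M,N]_R$ for morphisms in $R\text{-Mod}$, $[M,N]_R^*$ for the graded version, and $M_*=\pi_*M=\pi_*(UM)$; so $[R,M]_R=\pi_0M$. $\operatorname{Ext}^{*,*}_{R_*}$ is Ext of graded $R_*$-modules. $\mathcal{P}_R$ is the class of retracts of coproducts of suspensions and desuspensions of $R$ in $R\text{-Mod}$, and $\mathcal{I}_R$ is the class of maps in $R\text{-Mod}$ that are zero in homotopy groups; $(\mathcal{P}_R,\mathcal{I}_R)$ is a projective class. Length: let $\mathcal{P}_{R,0}$ be the zero objects, $\mathcal{P}_{R,1}=\mathcal{P}_R$,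 and inductively let $\mathcal{P}_{R,n}$ be the class of retracts of objects $Y$ in exact triangles $X\to Y\to P\to\Sigma X$ with $X$ in $\mathcal{P}_{R,n-1}$, $P$ in $\mathcal{P}_R$; $M$ has length at most $n$ if $M$ is in $\mathcal{P}_{R,n}$. The spectral sequence is the Adams spectral sequence of this projective class: choose a sequence $M=M_0\to M_1\to M_2\to\cdots$ of maps in $\mathcal{I}_R$ with exact triangles $P_s\to M_s\to M_{s+1}\to\Sigma P_s$, each $P_s$ in $\mathcal{P}_R$; apply $[-,N]_R^*$ to get an exact couple. Conditionally convergent means $\varprojlim_s[M_s,N]_R^*=0=\varprojlim^1_s[M_s,N]_R^*$. *)

theory Defs
  imports "HOL-Algebra.Product_Groups" "HOL-Algebra.FiniteProduct"
begin

unbundle cardinal_syntax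

text \<open>
  Abelian groups are the commutative groups of HOL-Algebra, so addition appears as
  \<open>mult\<close>, zero as \<open>one\<close>, and isomorphism as \<open>\<cong>\<close>.
\<close>


section \<open>Categories, coproducts, functors\<close>

record ('o, 'a) cat =
  obj :: "'o set"
  arr :: "'a set"
  src :: "'a \<Rightarrow> 'o"
  tgt :: "'a \<Rightarrow> 'o"
  idn :: "'o \<Rightarrow> 'a"
  cmp :: "'a \<Rightarrow> 'a \<Rightarrow> 'a"  (infixr \<open>\<bullet>\<index>\<close> 70)

definition Mor :: "('o, 'a, 'x) cat_scheme \<Rightarrow> 'o \<Rightarrow> 'o \<Rightarrow> 'a set" where
  "Mor C X Y = {f \<in> arr C. src C f = X \<and> tgt C f = Y}"

locale category =
  fixes C :: "('o, 'a, 'x) cat_scheme" (structure)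
  assumes src_closed: "f \<in> arr C \<Longrightarrow> src C f \<in> obj C"
    and tgt_closed: "f \<in> arr C \<Longrightarrow> tgt C f \<in> obj C"
    and idn_closed: "X \<in> obj C \<Longrightarrow> idn C X \<in> Mor C X X"
    and cmp_closed: "\<lbrakk>f \<in> Mor C X Y; g \<in> Mor C Y Z\<rbrakk> \<Longrightarrow> g \<bullet> f \<in> Mor C X Z"
    and idn_left: "f \<in> Mor C X Y \<Longrightarrow> idn C Y \<bullet> f = f"
    and idn_right: "f \<in> Mor C X Y \<Longrightarrow> f \<bullet> idn C X = f"
    and cmp_assoc: "\<lbrakk>f \<in> Mor C W X; g \<in> Mor C X Y; h \<in> Mor C Y Z\<rbrakk>
      \<Longrightarrow> (h \<bullet> g) \<bullet> f = h \<bullet> (g \<bullet> f)"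

definition inverse_arrows :: "('o, 'a, 'x) cat_scheme \<Rightarrow> 'a \<Rightarrow> 'a \<Rightarrow> bool" where
  "inverse_arrows C f g \<longleftrightarrow>
     f \<in> arr C \<and> g \<in> Mor C (tgt C f) (src C f) \<and>
     g \<bullet>\<^bsub>C\<^esub> f = idn C (src C f) \<and> f \<bullet>\<^bsub>C\<^esub> g = idn C (tgt C f)"

definition iso_arr :: "('o, 'a, 'x) cat_scheme \<Rightarrow> 'a \<Rightarrow> bool" where
  "iso_arr C f \<longleftrightarrow> (\<exists>g. inverse_arrows C f g)"

definition inv_arr :: "('o, 'a, 'x) cat_scheme \<Rightarrow> 'a \<Rightarrow> 'a" where
  "inv_arr C f = (THE g. inverse_arrows C f g)"

definition retract :: "('o, 'a, 'x) cat_scheme \<Rightarrow> 'o \<Rightarrow> 'o \<Rightarrow> bool" where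
  "retract C X Y \<longleftrightarrow>
     X \<in> obj C \<and> Y \<in> obj C \<and>
     (\<exists>i \<in> Mor C X Y. \<exists>p \<in> Mor C Y X. p \<bullet>\<^bsub>C\<^esub> i = idn C X)"

definition zero_object :: "('o, 'a, 'x) cat_scheme \<Rightarrow> 'o \<Rightarrow> bool" where
  "zero_object C Z \<longleftrightarrow>
     Z \<in> obj C \<and> (\<forall>Y \<in> obj C. (\<exists>!f. f \<in> Mor C Z Y) \<and> (\<exists>!f. f \<in> Mor C Y Z))"

definition is_coproduct ::
  "('o, 'a, 'x) cat_scheme \<Rightarrow> 'i set \<Rightarrow> ('i \<Rightarrow> 'o) \<Rightarrow> 'o \<Rightarrow> ('i \<Rightarrow> 'a) \<Rightarrow> bool" where
  "is_coproduct C I X P \<iota> \<longleftrightarrow>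
     P \<in> obj C \<and> (\<forall>i\<in>I. \<iota> i \<in> Mor C (X i) P) \<and>
     (\<forall>Y \<in> obj C. \<forall>f. (\<forall>i\<in>I. f i \<in> Mor C (X i) Y) \<longrightarrow>
        (\<exists>!h. h \<in> Mor C P Y \<and> (\<forall>i\<in>I. h \<bullet>\<^bsub>C\<^esub> \<iota> i = f i)))"

definition is_product ::
  "('o, 'a, 'x) cat_scheme \<Rightarrow> 'i set \<Rightarrow> ('i \<Rightarrow> 'o) \<Rightarrow> 'o \<Rightarrow> ('i \<Rightarrow> 'a) \<Rightarrow> bool" where
  "is_product C I X P \<pi> \<longleftrightarrow>
     P \<in> obj C \<and> (\<forall>i\<in>I. \<pi> i \<in> Mor C P (X i)) \<and>
     (\<forall>Y \<in> obj C. \<forall>f. (\<forall>i\<in>I. f i \<in> Mor C Y (X i)) \<longrightarrow>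
        (\<exists>!h. h \<in> Mor C Y P \<and> (\<forall>i\<in>I. \<pi> i \<bullet>\<^bsub>C\<^esub> h = f i)))"

text \<open>
  Sets versus classes. The objects and the arrows of a category form sets of HOL types here,
  and these play the role of classes; the sets of the ambient set theory are those of
  cardinality below a cardinal \<open>\<kappa>\<close>. For the sets of a Grothendieck universe, \<open>\<kappa>\<close> is the
  cardinality of the universe; only regularity and uncountability of \<open>\<kappa>\<close> are demanded.
  Some such bound is unavoidable: by Freyd's cardinality argument a category with a nonzero
  object cannot have coproducts indexed by all sets of its arrows. The index type \<open>'u\<close> is
  that of \<open>\<kappa>\<close>, so that every set of cardinality below \<open>\<kappa>\<close> has a copy in it.
\<close>

definition set_cardinal :: "'u rel \<Rightarrow> bool" where
  "set_cardinal \<kappa> \<longleftrightarrow> Card_order \<kappa> \<and> regularCard \<kappa> \<and> |UNIV :: nat set| <o \<kappa>"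

definition has_coproducts :: "'u rel \<Rightarrow> ('o, 'a, 'x) cat_scheme \<Rightarrow> bool" where
  "has_coproducts \<kappa> C \<longleftrightarrow>
     (\<forall>(I :: 'u set) X. |I| <o \<kappa> \<and> X ` I \<subseteq> obj C \<longrightarrow> (\<exists>P \<iota>. is_coproduct C I X P \<iota>))"

record ('o, 'a, 'p, 'b) cat_functor =
  fobj :: "'o \<Rightarrow> 'p"
  farr :: "'a \<Rightarrow> 'b"

definition is_functor ::
  "('o, 'a, 'x) cat_scheme \<Rightarrow> ('p, 'b, 'y) cat_scheme \<Rightarrow> ('o, 'a, 'p, 'b) cat_functor \<Rightarrow> bool" where
  "is_functor C D F \<longleftrightarrow>
     (\<forall>X \<in> obj C. fobj F X \<in> obj D \<and> farr F (idn C X) = idn D (fobj F X)) \<and>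
     (\<forall>X \<in> obj C. \<forall>Y \<in> obj C. \<forall>f \<in> Mor C X Y. farr F f \<in> Mor D (fobj F X) (fobj F Y)) \<and>
     (\<forall>X \<in> obj C. \<forall>Y \<in> obj C. \<forall>Z \<in> obj C. \<forall>f \<in> Mor C X Y. \<forall>g \<in> Mor C Y Z.
        farr F (g \<bullet>\<^bsub>C\<^esub> f) = farr F g \<bullet>\<^bsub>D\<^esub> farr F f)"

definition functor_comp ::
  "('p, 'b, 'q, 'c) cat_functor \<Rightarrow> ('o, 'a, 'p, 'b) cat_functor \<Rightarrow> ('o, 'a, 'q, 'c) cat_functor" where
  "functor_comp G F = \<lparr>fobj = fobj G \<circ> fobj F, farr = farr G \<circ> farr F\<rparr>"

definition natural_iso ::
  "('o, 'a, 'x) cat_scheme \<Rightarrow> ('p, 'b, 'y) cat_scheme \<Rightarrow> ('o, 'a, 'p, 'b) cat_functor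
   \<Rightarrow> ('o, 'a, 'p, 'b) cat_functor \<Rightarrow> ('o \<Rightarrow> 'b) \<Rightarrow> bool" where
  "natural_iso C D F G \<theta> \<longleftrightarrow>
     (\<forall>X \<in> obj C. \<theta> X \<in> Mor D (fobj F X) (fobj G X) \<and> iso_arr D (\<theta> X)) \<and>
     (\<forall>X \<in> obj C. \<forall>Y \<in> obj C. \<forall>f \<in> Mor C X Y.
        \<theta> Y \<bullet>\<^bsub>D\<^esub> farr F f = farr G f \<bullet>\<^bsub>D\<^esub> \<theta> X)"

definition preserves_coproducts ::
  "'u rel \<Rightarrow> ('o, 'a, 'x) cat_scheme \<Rightarrow> ('p, 'b, 'y) cat_scheme \<Rightarrow> ('o, 'a, 'p, 'b) cat_functor
   \<Rightarrow> bool" where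
  "preserves_coproducts \<kappa> C D F \<longleftrightarrow>
     (\<forall>(I :: 'u set) X P \<iota>. |I| <o \<kappa> \<and> X ` I \<subseteq> obj C \<and> is_coproduct C I X P \<iota> \<longrightarrow>
        is_coproduct D I (fobj F \<circ> X) (fobj F P) (farr F \<circ> \<iota>))"


section \<open>Triangulated categories\<close>

record ('o, 'a) preadd_cat = "('o, 'a) cat" +
  add :: "'a \<Rightarrow> 'a \<Rightarrow> 'a"
  zer :: "'o \<Rightarrow> 'o \<Rightarrow> 'a"

definition Hom :: "('o, 'a, 'x) preadd_cat_scheme \<Rightarrow> 'o \<Rightarrow> 'o \<Rightarrow> 'a monoid" where
  "Hom C X Y = \<lparr>carrier = Mor C X Y, monoid.mult = add C, one = zer C X Y\<rparr>"

definition neg :: "('o, 'a, 'x) preadd_cat_scheme \<Rightarrow> 'a \<Rightarrow> 'a" where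
  "neg C f = inv\<^bsub>Hom C (src C f) (tgt C f)\<^esub> f"

locale additive_category = category C
  for C :: "('o, 'a, 'x) preadd_cat_scheme" (structure) +
  assumes Hom_group: "\<lbrakk>X \<in> obj C; Y \<in> obj C\<rbrakk> \<Longrightarrow> comm_group (Hom C X Y)"
    and cmp_add_left: "\<lbrakk>f \<in> Mor C X Y; g \<in> Mor C Y Z; g' \<in> Mor C Y Z\<rbrakk>
      \<Longrightarrow> add C g g' \<bullet> f = add C (g \<bullet> f) (g' \<bullet> f)"
    and cmp_add_right: "\<lbrakk>f \<in> Mor C X Y; f' \<in> Mor C X Y; g \<in> Mor C Y Z\<rbrakk>
      \<Longrightarrow> g \<bullet> add C f f' = add C (g \<bullet> f) (g \<bullet> f')"
    and zero_object_exists: "\<exists>Z. zero_object C Z"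
    and binary_products: "\<lbrakk>X \<in> obj C; Y \<in> obj C\<rbrakk>
      \<Longrightarrow> \<exists>P \<pi>. is_product C (UNIV :: bool set) (\<lambda>b. if b then X else Y) P \<pi>"
    and binary_coproducts: "\<lbrakk>X \<in> obj C; Y \<in> obj C\<rbrakk>
      \<Longrightarrow> \<exists>P \<iota>. is_coproduct C (UNIV :: bool set) (\<lambda>b. if b then X else Y) P \<iota>"

text \<open>
  A triple \<open>(u, v, w)\<close> in \<open>tri\<close> is an exact triangle
  \<open>X \<rightarrow> Y \<rightarrow> Z \<rightarrow> \<Sigma>X\<close>. The suspension is an automorphism.
\<close>

record ('o, 'a) tri_cat = "('o, 'a) preadd_cat" +
  susp :: "'o \<Rightarrow> 'o"
  susp_arr :: "'a \<Rightarrow> 'a"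
  tri :: "('a \<times> 'a \<times> 'a) set"

definition candidate_triangle :: "('o, 'a, 'x) tri_cat_scheme \<Rightarrow> 'a \<Rightarrow> 'a \<Rightarrow> 'a \<Rightarrow> bool" where
  "candidate_triangle C u v w \<longleftrightarrow>
     u \<in> arr C \<and> v \<in> Mor C (tgt C u) (src C w) \<and> w \<in> Mor C (tgt C v) (susp C (src C u))"

locale triangulated_category = additive_category C
  for C :: "('o, 'a, 'x) tri_cat_scheme" (structure) +
  assumes susp_functor: "is_functor C C \<lparr>fobj = susp C, farr = susp_arr C\<rparr>"
    and susp_bij: "bij_betw (susp C) (obj C) (obj C)"
    and susp_arr_bij: "bij_betw (susp_arr C) (arr C) (arr C)"
    and susp_add: "\<lbrakk>f \<in> Mor C X Y; g \<in> Mor C X Y\<rbrakk>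
      \<Longrightarrow> susp_arr C (add C f g) = add C (susp_arr C f) (susp_arr C g)"
    and tri_candidate: "(u, v, w) \<in> tri C \<Longrightarrow> candidate_triangle C u v w"
    and tri_iso: "\<lbrakk>(u, v, w) \<in> tri C; candidate_triangle C u' v' w';
        f \<in> Mor C (src C u) (src C u'); g \<in> Mor C (tgt C u) (tgt C u');
        h \<in> Mor C (tgt C v) (tgt C v'); iso_arr C f; iso_arr C g; iso_arr C h;
        g \<bullet> u = u' \<bullet> f; h \<bullet> v = v' \<bullet> g; susp_arr C f \<bullet> w = w' \<bullet> h\<rbrakk>
      \<Longrightarrow> (u', v', w') \<in> tri C"
    and tri_id: "\<lbrakk>X \<in> obj C; zero_object C Z\<rbrakk>
      \<Longrightarrow> (idn C X, zer C X Z, zer C Z (susp C X)) \<in> tri C"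
    and tri_extend: "u \<in> arr C \<Longrightarrow> \<exists>v w. (u, v, w) \<in> tri C"
    and tri_rotate: "candidate_triangle C u v w \<Longrightarrow>
        (u, v, w) \<in> tri C \<longleftrightarrow> (v, w, neg C (susp_arr C u)) \<in> tri C"
    and tri_morphism: "\<lbrakk>(u, v, w) \<in> tri C; (u', v', w') \<in> tri C;
        f \<in> Mor C (src C u) (src C u'); g \<in> Mor C (tgt C u) (tgt C u'); g \<bullet> u = u' \<bullet> f\<rbrakk>
      \<Longrightarrow> \<exists>h \<in> Mor C (tgt C v) (tgt C v').
            h \<bullet> v = v' \<bullet> g \<and> susp_arr C f \<bullet> w = w' \<bullet> h"
    and tri_octahedral: "\<lbrakk>(u, j, k) \<in> tri C; (v, l, i) \<in> tri C; src C v = tgt C u;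
        (v \<bullet> u, m, n) \<in> tri C\<rbrakk>
      \<Longrightarrow> \<exists>f g. (f, g, susp_arr C j \<bullet> i) \<in> tri C \<and>
            f \<in> Mor C (tgt C j) (tgt C m) \<and> g \<in> Mor C (tgt C m) (tgt C l) \<and>
            f \<bullet> j = m \<bullet> v \<and> n \<bullet> f = k \<and> g \<bullet> m = l \<and> i \<bullet> g = susp_arr C u \<bullet> n"

definition shift :: "('o, 'a, 'x) tri_cat_scheme \<Rightarrow> int \<Rightarrow> 'o \<Rightarrow> 'o" where
  "shift C n = (if 0 \<le> n then susp C ^^ nat n
                else the_inv_into (obj C) (susp C) ^^ nat (- n))"

definition shift_arr :: "('o, 'a, 'x) tri_cat_scheme \<Rightarrow> int \<Rightarrow> 'a \<Rightarrow> 'a" where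
  "shift_arr C n = (if 0 \<le> n then susp_arr C ^^ nat n
                    else the_inv_into (arr C) (susp_arr C) ^^ nat (- n))"

text \<open>The graded morphism groups \<open>[X, Y]\<^sup>n = [X, \<Sigma>\<^sup>n Y]\<close>.\<close>

definition graded_Hom :: "('o, 'a, 'x) tri_cat_scheme \<Rightarrow> 'o \<Rightarrow> 'o \<Rightarrow> int \<Rightarrow> 'a monoid" where
  "graded_Hom C X Y n = Hom C X (shift C n Y)"

text \<open>
  A functor commuting with suspension (up to the natural isomorphism
  \<open>\<phi> X : F (\<Sigma>X) \<rightarrow> \<Sigma> (F X)\<close>) and preserving exact triangles.
\<close>

definition exact_functor ::
  "('o, 'a, 'x) tri_cat_scheme \<Rightarrow> ('p, 'b, 'y) tri_cat_scheme \<Rightarrow> ('o, 'a, 'p, 'b) cat_functor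
   \<Rightarrow> ('o \<Rightarrow> 'b) \<Rightarrow> bool" where
  "exact_functor C D F \<phi> \<longleftrightarrow>
     is_functor C D F \<and>
     (\<forall>X \<in> obj C. \<forall>Y \<in> obj C. \<forall>f \<in> Mor C X Y. \<forall>g \<in> Mor C X Y.
        farr F (add C f g) = add D (farr F f) (farr F g)) \<and>
     natural_iso C D (functor_comp F \<lparr>fobj = susp C, farr = susp_arr C\<rparr>)
       (functor_comp \<lparr>fobj = susp D, farr = susp_arr D\<rparr> F) \<phi> \<and>
     (\<forall>u v w. (u, v, w) \<in> tri C \<longrightarrow>
        (farr F u, farr F v, \<phi> (src C u) \<bullet>\<^bsub>D\<^esub> farr F w) \<in> tri D)"

primrec susp_iterate ::
  "('o, 'a, 'x) tri_cat_scheme \<Rightarrow> ('p, 'b, 'y) tri_cat_scheme \<Rightarrow> ('o, 'a, 'p, 'b) cat_functor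
   \<Rightarrow> ('o \<Rightarrow> 'b) \<Rightarrow> nat \<Rightarrow> 'o \<Rightarrow> 'b" where
  "susp_iterate C D F \<phi> 0 X = idn D (fobj F X)"
| "susp_iterate C D F \<phi> (Suc k) X =
     susp_arr D (susp_iterate C D F \<phi> k X) \<bullet>\<^bsub>D\<^esub> \<phi> ((susp C ^^ k) X)"

text \<open>
  The isomorphism \<open>F (\<Sigma>\<^sup>n X) \<rightarrow> \<Sigma>\<^sup>n (F X)\<close> induced by \<open>\<phi>\<close>. For \<open>n = -k < 0\<close> it is inverse
  to the \<open>k\<close>-fold desuspension of the isomorphism
  \<open>F X = F (\<Sigma>\<^sup>k \<Sigma>\<^sup>n X) \<rightarrow> \<Sigma>\<^sup>k (F (\<Sigma>\<^sup>n X))\<close>.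
\<close>

definition shift_iso ::
  "('o, 'a, 'x) tri_cat_scheme \<Rightarrow> ('p, 'b, 'y) tri_cat_scheme \<Rightarrow> ('o, 'a, 'p, 'b) cat_functor
   \<Rightarrow> ('o \<Rightarrow> 'b) \<Rightarrow> int \<Rightarrow> 'o \<Rightarrow> 'b" where
  "shift_iso C D F \<phi> n X =
     (if 0 \<le> n then susp_iterate C D F \<phi> (nat n) X
      else inv_arr D (shift_arr D n (susp_iterate C D F \<phi> (nat (- n)) (shift C n X))))"


section \<open>Stable homotopy categories\<close>

record ('o, 'a) monoidal =
  unit_obj :: "'o"
  tensor :: "'o \<Rightarrow> 'o \<Rightarrow> 'o"
  tensor_arr :: "'a \<Rightarrow> 'a \<Rightarrow> 'a"
  assoc :: "'o \<Rightarrow> 'o \<Rightarrow> 'o \<Rightarrow> 'a"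
  lunit :: "'o \<Rightarrow> 'a"
  runit :: "'o \<Rightarrow> 'a"
  braid :: "'o \<Rightarrow> 'o \<Rightarrow> 'a"

locale symmetric_monoidal = category C
  for C :: "('o, 'a, 'x) cat_scheme" (structure) +
  fixes T :: "('o, 'a) monoidal"
  assumes unit_closed: "unit_obj T \<in> obj C"
    and tensor_closed: "\<lbrakk>X \<in> obj C; Y \<in> obj C\<rbrakk> \<Longrightarrow> tensor T X Y \<in> obj C"
    and tensor_arr_closed: "\<lbrakk>f \<in> Mor C X X'; g \<in> Mor C Y Y'\<rbrakk>
      \<Longrightarrow> tensor_arr T f g \<in> Mor C (tensor T X Y) (tensor T X' Y')"
    and tensor_idn: "\<lbrakk>X \<in> obj C; Y \<in> obj C\<rbrakk>
      \<Longrightarrow> tensor_arr T (idn C X) (idn C Y) = idn C (tensor T X Y)"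
    and tensor_cmp: "\<lbrakk>f \<in> Mor C X X'; f' \<in> Mor C X' X''; g \<in> Mor C Y Y'; g' \<in> Mor C Y' Y''\<rbrakk>
      \<Longrightarrow> tensor_arr T (f' \<bullet> f) (g' \<bullet> g) = tensor_arr T f' g' \<bullet> tensor_arr T f g"
    and assoc_iso: "\<lbrakk>X \<in> obj C; Y \<in> obj C; Z \<in> obj C\<rbrakk>
      \<Longrightarrow> assoc T X Y Z \<in> Mor C (tensor T (tensor T X Y) Z) (tensor T X (tensor T Y Z))
          \<and> iso_arr C (assoc T X Y Z)"
    and lunit_iso: "X \<in> obj C
      \<Longrightarrow> lunit T X \<in> Mor C (tensor T (unit_obj T) X) X \<and> iso_arr C (lunit T X)"
    and runit_iso: "X \<in> obj C
      \<Longrightarrow> runit T X \<in> Mor C (tensor T X (unit_obj T)) X \<and> iso_arr C (runit T X)"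
    and braid_closed: "\<lbrakk>X \<in> obj C; Y \<in> obj C\<rbrakk>
      \<Longrightarrow> braid T X Y \<in> Mor C (tensor T X Y) (tensor T Y X)"
    and assoc_natural: "\<lbrakk>f \<in> Mor C X X'; g \<in> Mor C Y Y'; h \<in> Mor C Z Z'\<rbrakk>
      \<Longrightarrow> assoc T X' Y' Z' \<bullet> tensor_arr T (tensor_arr T f g) h
          = tensor_arr T f (tensor_arr T g h) \<bullet> assoc T X Y Z"
    and lunit_natural: "f \<in> Mor C X X'
      \<Longrightarrow> lunit T X' \<bullet> tensor_arr T (idn C (unit_obj T)) f = f \<bullet> lunit T X"
    and runit_natural: "f \<in> Mor C X X'
      \<Longrightarrow> runit T X' \<bullet> tensor_arr T f (idn C (unit_obj T)) = f \<bullet> runit T X"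
    and braid_natural: "\<lbrakk>f \<in> Mor C X X'; g \<in> Mor C Y Y'\<rbrakk>
      \<Longrightarrow> braid T X' Y' \<bullet> tensor_arr T f g = tensor_arr T g f \<bullet> braid T X Y"
    and pentagon: "\<lbrakk>W \<in> obj C; X \<in> obj C; Y \<in> obj C; Z \<in> obj C\<rbrakk>
      \<Longrightarrow> assoc T W X (tensor T Y Z) \<bullet> assoc T (tensor T W X) Y Z
          = tensor_arr T (idn C W) (assoc T X Y Z) \<bullet> assoc T W (tensor T X Y) Z
            \<bullet> tensor_arr T (assoc T W X Y) (idn C Z)"
    and triangle: "\<lbrakk>X \<in> obj C; Y \<in> obj C\<rbrakk>
      \<Longrightarrow> tensor_arr T (idn C X) (lunit T Y) \<bullet> assoc T X (unit_obj T) Y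
          = tensor_arr T (runit T X) (idn C Y)"
    and hexagon: "\<lbrakk>X \<in> obj C; Y \<in> obj C; Z \<in> obj C\<rbrakk>
      \<Longrightarrow> assoc T Y Z X \<bullet> braid T X (tensor T Y Z) \<bullet> assoc T X Y Z
          = tensor_arr T (idn C Y) (braid T X Z) \<bullet> assoc T Y X Z
            \<bullet> tensor_arr T (braid T X Y) (idn C Z)"
    and symmetry: "\<lbrakk>X \<in> obj C; Y \<in> obj C\<rbrakk>
      \<Longrightarrow> braid T Y X \<bullet> braid T X Y = idn C (tensor T X Y)"

definition tensor_with ::
  "('o, 'a, 'x) cat_scheme \<Rightarrow> ('o, 'a) monoidal \<Rightarrow> 'o \<Rightarrow> ('o, 'a, 'o, 'a) cat_functor" where
  "tensor_with C T X = \<lparr>fobj = tensor T X, farr = tensor_arr T (idn C X)\<rparr>"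

text \<open>
  \<open>K\<close> is compact when the canonical map
  \<open>\<Oplus>\<^sub>i [K, X\<^sub>i] \<rightarrow> [K, \<Coprod>\<^sub>i X\<^sub>i]\<close> is an isomorphism.
\<close>

definition compact_object :: "'u rel \<Rightarrow> ('o, 'a, 'x) preadd_cat_scheme \<Rightarrow> 'o \<Rightarrow> bool" where
  "compact_object \<kappa> C K \<longleftrightarrow>
     K \<in> obj C \<and>
     (\<forall>(I :: 'u set) X P \<iota>. |I| <o \<kappa> \<and> X ` I \<subseteq> obj C \<and> is_coproduct C I X P \<iota> \<longrightarrow>
        (\<lambda>f. finprod (Hom C K P) (\<lambda>i. \<iota> i \<bullet>\<^bsub>C\<^esub> f i) {i \<in> I. f i \<noteq> zer C K (X i)})
          \<in> iso (sum_group I (\<lambda>i. Hom C K (X i))) (Hom C K P))"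

text \<open>
  The structure of the stable homotopy category: a triangulated category with coproducts,
  a compatible symmetric monoidal smash product \<open>T\<close>, and unit \<open>S\<^sup>0 = unit_obj T\<close>
  a compact generator. Everything below is stated for an arbitrary such category. Homotopy
  groups have to be sets in the sense of \<open>\<kappa>\<close>; this is weaker than local smallness.
\<close>

locale stable_homotopy_category =
  triangulated_category C + symmetric_monoidal C T
  for \<kappa> :: "'u rel" and C :: "('o, 'a) tri_cat" (structure) and T :: "('o, 'a) monoidal" +
  assumes sets: "set_cardinal \<kappa>"
    and small_homotopy: "X \<in> obj C \<Longrightarrow> |Mor C (shift C n (unit_obj T)) X| <o \<kappa>"
    and coproducts: "has_coproducts \<kappa> C"
    and smash_exact: "X \<in> obj C \<Longrightarrow> \<exists>\<phi>. exact_functor C C (tensor_with C T X) \<phi>"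
    and smash_coproducts: "X \<in> obj C \<Longrightarrow> preserves_coproducts \<kappa> C C (tensor_with C T X)"
    and sphere_compact: "compact_object \<kappa> C (unit_obj T)"
    and sphere_generates: "\<lbrakk>X \<in> obj C; \<And>n. trivial_group (Hom C (shift C n (unit_obj T)) X)\<rbrakk>
      \<Longrightarrow> zero_object C X"


section \<open>Ring spectra and their modules\<close>

text \<open>
  \<open>adjn X M\<close> is the adjunction bijection \<open>[F X, M]\<^sub>R \<rightarrow> [X, U M]\<close>; \<open>free_susp\<close> and
  \<open>forget_susp\<close> are the isomorphisms by which \<open>F\<close> and \<open>U\<close> commute with suspension.
\<close>

record ('o, 'a, 'p, 'b) ring_spectrum =
  spectra :: "('o, 'a) tri_cat"
  smash :: "('o, 'a) monoidal"
  underlying :: "'o"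
  modules :: "('p, 'b) tri_cat"
  free :: "('o, 'a, 'p, 'b) cat_functor"
  free_susp :: "'o \<Rightarrow> 'b"
  forget :: "('p, 'b, 'o, 'a) cat_functor"
  forget_susp :: "'p \<Rightarrow> 'a"
  adjn :: "'o \<Rightarrow> 'p \<Rightarrow> 'b \<Rightarrow> 'a"

text \<open>The module \<open>R = F S\<^sup>0\<close>, and \<open>\<pi>\<^sub>n M = [\<Sigma>\<^sup>n S\<^sup>0, U M]\<close>.\<close>

definition ring_module :: "('o, 'a, 'p, 'b) ring_spectrum \<Rightarrow> 'p" where
  "ring_module R = fobj (free R) (unit_obj (smash R))"

definition sphere :: "('o, 'a, 'p, 'b) ring_spectrum \<Rightarrow> int \<Rightarrow> 'o" where
  "sphere R n = shift (spectra R) n (unit_obj (smash R))"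

definition homotopy :: "('o, 'a, 'p, 'b) ring_spectrum \<Rightarrow> 'p \<Rightarrow> int \<Rightarrow> 'a monoid" where
  "homotopy R M n = Hom (spectra R) (sphere R n) (fobj (forget R) M)"

definition homotopy_map :: "('o, 'a, 'p, 'b) ring_spectrum \<Rightarrow> 'b \<Rightarrow> 'a \<Rightarrow> 'a" where
  "homotopy_map R f x = farr (forget R) f \<bullet>\<^bsub>spectra R\<^esub> x"

locale A_infinity_ring_spectrum =
  fixes \<kappa> :: "'u rel" and R :: "('o, 'a, 'p, 'b) ring_spectrum"
  assumes spectra: "stable_homotopy_category \<kappa> (spectra R) (smash R)"
    and underlying_closed: "underlying R \<in> obj (spectra R)"
    and modules: "triangulated_category (modules R)"
    and modules_coproducts: "has_coproducts \<kappa> (modules R)"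
    and free_exact: "exact_functor (spectra R) (modules R) (free R) (free_susp R)"
    and free_coproducts: "preserves_coproducts \<kappa> (spectra R) (modules R) (free R)"
    and forget_exact: "exact_functor (modules R) (spectra R) (forget R) (forget_susp R)"
    and forget_coproducts: "preserves_coproducts \<kappa> (modules R) (spectra R) (forget R)"
    and adjn_bij: "\<lbrakk>X \<in> obj (spectra R); M \<in> obj (modules R)\<rbrakk> \<Longrightarrow>
      bij_betw (adjn R X M) (Mor (modules R) (fobj (free R) X) M)
        (Mor (spectra R) X (fobj (forget R) M))"
    and adjn_natural_left: "\<lbrakk>h \<in> Mor (spectra R) X' X; M \<in> obj (modules R);
        f \<in> Mor (modules R) (fobj (free R) X) M\<rbrakk> \<Longrightarrow>
      adjn R X' M (f \<bullet>\<^bsub>modules R\<^esub> farr (free R) h) = adjn R X M f \<bullet>\<^bsub>spectra R\<^esub> h"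
    and adjn_natural_right: "\<lbrakk>X \<in> obj (spectra R); f \<in> Mor (modules R) (fobj (free R) X) M;
        g \<in> Mor (modules R) M M'\<rbrakk> \<Longrightarrow>
      adjn R X M' (g \<bullet>\<^bsub>modules R\<^esub> f) = farr (forget R) g \<bullet>\<^bsub>spectra R\<^esub> adjn R X M f"
    and forget_free: "\<exists>\<theta>. natural_iso (spectra R) (spectra R) (functor_comp (forget R) (free R))
      (tensor_with (spectra R) (smash R) (underlying R)) \<theta>"
    and equivalences_inverted: "\<lbrakk>f \<in> Mor (modules R) M M';
        \<And>n. homotopy_map R f \<in> iso (homotopy R M n) (homotopy R M' n)\<rbrakk> \<Longrightarrow>
      iso_arr (modules R) f"


section \<open>Graded rings, graded modules and Ext\<close>

record 'r gr_ring =
  rgrp :: "int \<Rightarrow> 'r monoid"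
  rmul :: "int \<Rightarrow> int \<Rightarrow> 'r \<Rightarrow> 'r \<Rightarrow> 'r"
  rone :: "'r"

record ('r, 'm) gr_module =
  mgrp :: "int \<Rightarrow> 'm monoid"
  mact :: "int \<Rightarrow> int \<Rightarrow> 'r \<Rightarrow> 'm \<Rightarrow> 'm"

locale graded_ring =
  fixes A :: "'r gr_ring"
  assumes ring_group: "comm_group (rgrp A n)"
    and mul_left_hom: "r \<in> carrier (rgrp A m) \<Longrightarrow> rmul A m n r \<in> hom (rgrp A n) (rgrp A (m + n))"
    and mul_right_hom: "s \<in> carrier (rgrp A n)
      \<Longrightarrow> (\<lambda>r. rmul A m n r s) \<in> hom (rgrp A m) (rgrp A (m + n))"
    and rone_closed: "rone A \<in> carrier (rgrp A 0)"
    and rone_left: "r \<in> carrier (rgrp A n) \<Longrightarrow> rmul A 0 n (rone A) r = r"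
    and rone_right: "r \<in> carrier (rgrp A n) \<Longrightarrow> rmul A n 0 r (rone A) = r"
    and mul_assoc: "\<lbrakk>r \<in> carrier (rgrp A l); s \<in> carrier (rgrp A m); t \<in> carrier (rgrp A n)\<rbrakk>
      \<Longrightarrow> rmul A (l + m) n (rmul A l m r s) t = rmul A l (m + n) r (rmul A m n s t)"

locale graded_module = graded_ring A
  for A :: "'r gr_ring" and Q :: "('r, 'm) gr_module" +
  assumes module_group: "comm_group (mgrp Q n)"
    and act_left_hom: "r \<in> carrier (rgrp A m) \<Longrightarrow> mact Q m n r \<in> hom (mgrp Q n) (mgrp Q (m + n))"
    and act_right_hom: "x \<in> carrier (mgrp Q n)
      \<Longrightarrow> (\<lambda>r. mact Q m n r x) \<in> hom (rgrp A m) (mgrp Q (m + n))"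
    and act_one: "x \<in> carrier (mgrp Q n) \<Longrightarrow> mact Q 0 n (rone A) x = x"
    and act_assoc: "\<lbrakk>r \<in> carrier (rgrp A l); s \<in> carrier (rgrp A m); x \<in> carrier (mgrp Q n)\<rbrakk>
      \<Longrightarrow> mact Q (l + m) n (rmul A l m r s) x = mact Q l (m + n) r (mact Q m n s x)"

text \<open>
  Families of maps \<open>Q\<^sub>n \<rightarrow> Q'\<^sub>(n+d)\<close>, linear over the graded ring. Omitting the sign
  \<open>(-1)\<close> to the power \<open>d |r|\<close> does not change the resulting group up to isomorphism.
\<close>

definition gr_hom ::
  "'r gr_ring \<Rightarrow> ('r, 'm) gr_module \<Rightarrow> ('r, 'n) gr_module \<Rightarrow> int \<Rightarrow> (int \<Rightarrow> 'm \<Rightarrow> 'n) set" where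
  "gr_hom A Q Q' d =
     {f. (\<forall>n. f n \<in> hom (mgrp Q n) (mgrp Q' (n + d)) \<and> f n \<in> extensional (carrier (mgrp Q n))) \<and>
         (\<forall>m n. \<forall>r \<in> carrier (rgrp A m). \<forall>x \<in> carrier (mgrp Q n).
            f (m + n) (mact Q m n r x) = mact Q' m (n + d) r (f n x))}"

definition gr_Hom ::
  "'r gr_ring \<Rightarrow> ('r, 'm) gr_module \<Rightarrow> ('r, 'n) gr_module \<Rightarrow> int \<Rightarrow> (int \<Rightarrow> 'm \<Rightarrow> 'n) monoid" where
  "gr_Hom A Q Q' d =
     \<lparr>carrier = gr_hom A Q Q' d,
      monoid.mult = (\<lambda>f g n. \<lambda>x \<in> carrier (mgrp Q n). f n x \<otimes>\<^bsub>mgrp Q' (n + d)\<^esub> g n x),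
      one = (\<lambda>n. \<lambda>x \<in> carrier (mgrp Q n). \<one>\<^bsub>mgrp Q' (n + d)\<^esub>)\<rparr>"

text \<open>
  A graded module is free when it has a basis of homogeneous elements; \<open>b \<in> B d\<close> are the
  basis elements of degree \<open>d\<close>.
\<close>

definition graded_free :: "'r gr_ring \<Rightarrow> ('r, 'm) gr_module \<Rightarrow> bool" where
  "graded_free A Q \<longleftrightarrow>
     graded_module A Q \<and>
     (\<exists>B. (\<forall>d. B d \<subseteq> carrier (mgrp Q d)) \<and>
        (\<forall>n. (\<lambda>c. finprod (mgrp Q n) (\<lambda>(d, b). mact Q (n - d) d (c (d, b)) b)
                 {(d, b). b \<in> B d \<and> c (d, b) \<noteq> \<one>\<^bsub>rgrp A (n - d)\<^esub>})
             \<in> iso (sum_group (SIGMA d:UNIV. B d) (\<lambda>(d, b). rgrp A (n - d))) (mgrp Q n)))"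

text \<open>\<open>\<dots> \<rightarrow> Q 2 \<rightarrow> Q 1 \<rightarrow> Q 0 \<rightarrow> L \<rightarrow> 0\<close> with differentials \<open>\<delta> s : Q (s + 1) \<rightarrow> Q s\<close>.\<close>

definition free_resolution ::
  "'r gr_ring \<Rightarrow> ('r, 'm) gr_module \<Rightarrow> (nat \<Rightarrow> ('r, 'q) gr_module)
   \<Rightarrow> (nat \<Rightarrow> int \<Rightarrow> 'q \<Rightarrow> 'q) \<Rightarrow> (int \<Rightarrow> 'q \<Rightarrow> 'm) \<Rightarrow> bool" where
  "free_resolution A L Q \<delta> \<epsilon> \<longleftrightarrow>
     (\<forall>s. graded_free A (Q s)) \<and>
     (\<forall>s. \<delta> s \<in> gr_hom A (Q (Suc s)) (Q s) 0) \<and> \<epsilon> \<in> gr_hom A (Q 0) L 0 \<and>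
     (\<forall>n. \<epsilon> n ` carrier (mgrp (Q 0) n) = carrier (mgrp L n)) \<and>
     (\<forall>n. \<delta> 0 n ` carrier (mgrp (Q 1) n) = kernel (mgrp (Q 0) n) (mgrp L n) (\<epsilon> n)) \<and>
     (\<forall>s n. \<delta> (Suc s) n ` carrier (mgrp (Q (Suc (Suc s))) n)
            = kernel (mgrp (Q (Suc s)) n) (mgrp (Q s) n) (\<delta> s n))"

definition cochains ::
  "'r gr_ring \<Rightarrow> (nat \<Rightarrow> ('r, 'q) gr_module) \<Rightarrow> ('r, 'n) gr_module \<Rightarrow> nat \<Rightarrow> int
   \<Rightarrow> (int \<Rightarrow> 'q \<Rightarrow> 'n) monoid" where
  "cochains A Q L' s t = gr_Hom A (Q s) L' (- t)"

definition coboundary ::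
  "(nat \<Rightarrow> ('r, 'q) gr_module) \<Rightarrow> (nat \<Rightarrow> int \<Rightarrow> 'q \<Rightarrow> 'q) \<Rightarrow> nat
   \<Rightarrow> (int \<Rightarrow> 'q \<Rightarrow> 'n) \<Rightarrow> (int \<Rightarrow> 'q \<Rightarrow> 'n)" where
  "coboundary Q \<delta> s f = (\<lambda>n. \<lambda>x \<in> carrier (mgrp (Q (Suc s)) n). f n (\<delta> s n x))"

definition Hom_cohomology ::
  "'r gr_ring \<Rightarrow> (nat \<Rightarrow> ('r, 'q) gr_module) \<Rightarrow> (nat \<Rightarrow> int \<Rightarrow> 'q \<Rightarrow> 'q) \<Rightarrow> ('r, 'n) gr_module
   \<Rightarrow> nat \<Rightarrow> int \<Rightarrow> (int \<Rightarrow> 'q \<Rightarrow> 'n) set monoid" where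
  "Hom_cohomology A Q \<delta> L' s t =
     (cochains A Q L' s t)
       \<lparr>carrier := kernel (cochains A Q L' s t) (cochains A Q L' (Suc s) t) (coboundary Q \<delta> s)\<rparr>
     Mod
     (case s of 0 \<Rightarrow> {\<one>\<^bsub>cochains A Q L' 0 t\<^esub>}
      | Suc s' \<Rightarrow> coboundary Q \<delta> s' ` carrier (cochains A Q L' s' t))"

text \<open>
  \<open>Ext A L L' s t\<close> is \<open>Ext\<^sup>s\<^sup>,\<^sup>t\<^sub>A(L, L')\<close>: the cohomology of \<open>Hom\<^sub>A(Q, L')\<close> for a free
  resolution \<open>Q\<close> of \<open>L\<close>. The degree \<open>t\<close> is cohomological, that is, Ext with internal
  degree \<open>t\<close> comes from the maps lowering the degree by \<open>t\<close>. As a group it is determined up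
  to isomorphism; to name one, a resolution is chosen, with elements in a type that
  is infinite and at least as large as the ring and the module, so that there is one.
\<close>

definition Ext ::
  "'r gr_ring \<Rightarrow> ('r, 'm) gr_module \<Rightarrow> ('r, 'n) gr_module \<Rightarrow> nat \<Rightarrow> int
   \<Rightarrow> (int \<Rightarrow> ('r \<times> 'm) list \<Rightarrow> 'n) set monoid" where
  "Ext A L L' =
     (let (Q, \<delta>) = (SOME (Q, \<delta>). \<exists>\<epsilon>. free_resolution A L Q \<delta> \<epsilon>)
      in Hom_cohomology A Q \<delta> L')"


section \<open>The graded ring \<open>R\<^sub>*\<close> and its modules\<close>

text \<open>
  The identification \<open>[\<Sigma>\<^sup>n R, M]\<^sub>R \<cong> [F (\<Sigma>\<^sup>n S\<^sup>0), M]\<^sub>R \<cong> \<pi>\<^sub>n M\<close>, and its inverse.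
\<close>

definition to_homotopy :: "('o, 'a, 'p, 'b) ring_spectrum \<Rightarrow> 'p \<Rightarrow> int \<Rightarrow> 'b \<Rightarrow> 'a" where
  "to_homotopy R M n g =
     adjn R (sphere R n) M
       (g \<bullet>\<^bsub>modules R\<^esub>
        shift_iso (spectra R) (modules R) (free R) (free_susp R) n (unit_obj (smash R)))"

definition from_homotopy :: "('o, 'a, 'p, 'b) ring_spectrum \<Rightarrow> 'p \<Rightarrow> int \<Rightarrow> 'a \<Rightarrow> 'b" where
  "from_homotopy R M n =
     the_inv_into (Mor (modules R) (shift (modules R) n (ring_module R)) M) (to_homotopy R M n)"

text \<open>
  For \<open>r \<in> \<pi>\<^sub>m R\<close> and \<open>x \<in> \<pi>\<^sub>n M\<close>, with adjoints \<open>\<Sigma>\<^sup>m R \<rightarrow> R\<close> and \<open>\<Sigma>\<^sup>n R \<rightarrow> M\<close>, the product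
  \<open>r x\<close> is represented by the composite \<open>\<Sigma>\<^sup>n\<^sup>+\<^sup>m R \<rightarrow> \<Sigma>\<^sup>n R \<rightarrow> M\<close>. For \<open>F = R \<and> -\<close> this is the
  usual product \<open>S\<^sup>m \<and> S\<^sup>n \<rightarrow> R \<and> M \<rightarrow> M\<close>, and makes \<open>M\<^sub>*\<close> a left \<open>R\<^sub>*\<close>-module.
\<close>

definition homotopy_act ::
  "('o, 'a, 'p, 'b) ring_spectrum \<Rightarrow> 'p \<Rightarrow> int \<Rightarrow> int \<Rightarrow> 'a \<Rightarrow> 'a \<Rightarrow> 'a" where
  "homotopy_act R M m n r x =
     to_homotopy R M (m + n)
       (from_homotopy R M n x \<bullet>\<^bsub>modules R\<^esub>
        shift_arr (modules R) n (from_homotopy R (ring_module R) m r))"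

definition homotopy_ring :: "('o, 'a, 'p, 'b) ring_spectrum \<Rightarrow> 'a gr_ring" where
  "homotopy_ring R =
     \<lparr>rgrp = homotopy R (ring_module R),
      rmul = homotopy_act R (ring_module R),
      rone = to_homotopy R (ring_module R) 0 (idn (modules R) (ring_module R))\<rparr>"

definition homotopy_module :: "('o, 'a, 'p, 'b) ring_spectrum \<Rightarrow> 'p \<Rightarrow> ('a, 'a) gr_module" where
  "homotopy_module R M = \<lparr>mgrp = homotopy R M, mact = homotopy_act R M\<rparr>"


section \<open>The projective class and length\<close>

definition proj_objects :: "'u rel \<Rightarrow> ('o, 'a, 'p, 'b) ring_spectrum \<Rightarrow> 'p set" where
  "proj_objects \<kappa> R =
     {P. \<exists>(I :: 'u set) d Q \<iota>. |I| <o \<kappa> \<and>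
        is_coproduct (modules R) I (\<lambda>i. shift (modules R) (d i) (ring_module R)) Q \<iota> \<and>
        retract (modules R) P Q}"

definition null_maps :: "('o, 'a, 'p, 'b) ring_spectrum \<Rightarrow> 'b set" where
  "null_maps R =
     {f \<in> arr (modules R). \<forall>n. \<forall>x \<in> carrier (homotopy R (src (modules R) f) n).
        homotopy_map R f x = \<one>\<^bsub>homotopy R (tgt (modules R) f) n\<^esub>}"

fun proj_length :: "'u rel \<Rightarrow> ('o, 'a, 'p, 'b) ring_spectrum \<Rightarrow> nat \<Rightarrow> 'p set" where
  "proj_length \<kappa> R 0 = {M. zero_object (modules R) M}"
| "proj_length \<kappa> R (Suc 0) = proj_objects \<kappa> R"
| "proj_length \<kappa> R (Suc (Suc n)) =
     {M. \<exists>u v w. (u, v, w) \<in> tri (modules R) \<and>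
        src (modules R) u \<in> proj_length \<kappa> R (Suc n) \<and> tgt (modules R) v \<in> proj_objects \<kappa> R \<and>
        retract (modules R) M (tgt (modules R) u)}"


section \<open>Exact couples and their spectral sequences\<close>

text \<open>
  Cohomologically bigraded exact couples indexed by \<open>s \<ge> 0\<close>, with
  \<open>ci s t : D\<^sup>s\<^sup>+\<^sup>1\<^sup>,\<^sup>t\<^sup>-\<^sup>1 \<rightarrow> D\<^sup>s\<^sup>,\<^sup>t\<close>, \<open>cj s t : D\<^sup>s\<^sup>,\<^sup>t \<rightarrow> E\<^sup>s\<^sup>,\<^sup>t\<close> and
  \<open>ck s t : E\<^sup>s\<^sup>,\<^sup>t \<rightarrow> D\<^sup>s\<^sup>+\<^sup>1\<^sup>,\<^sup>t\<close>. The total degree is \<open>s + t\<close>.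
\<close>

record ('d, 'e) couple =
  cD :: "nat \<Rightarrow> int \<Rightarrow> 'd monoid"
  cE :: "nat \<Rightarrow> int \<Rightarrow> 'e monoid"
  ci :: "nat \<Rightarrow> int \<Rightarrow> 'd \<Rightarrow> 'd"
  cj :: "nat \<Rightarrow> int \<Rightarrow> 'd \<Rightarrow> 'e"
  ck :: "nat \<Rightarrow> int \<Rightarrow> 'e \<Rightarrow> 'd"

locale exact_couple =
  fixes X :: "('d, 'e) couple"
  assumes D_group: "comm_group (cD X s t)"
    and E_group: "comm_group (cE X s t)"
    and i_hom: "ci X s t \<in> hom (cD X (Suc s) (t - 1)) (cD X s t)"
    and j_hom: "cj X s t \<in> hom (cD X s t) (cE X s t)"
    and k_hom: "ck X s t \<in> hom (cE X s t) (cD X (Suc s) t)"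
    and exact_ij: "ci X s t ` carrier (cD X (Suc s) (t - 1))
      = kernel (cD X s t) (cE X s t) (cj X s t)"
    and exact_jk: "cj X s t ` carrier (cD X s t) = kernel (cE X s t) (cD X (Suc s) t) (ck X s t)"
    and exact_ki: "ck X s t ` carrier (cE X s t)
      = kernel (cD X (Suc s) t) (cD X s (t + 1)) (ci X s (t + 1))"

text \<open>The \<open>k\<close>-fold composite \<open>D\<^sup>s\<^sup>+\<^sup>k\<^sup>,\<^sup>t\<^sup>-\<^sup>k \<rightarrow> D\<^sup>s\<^sup>,\<^sup>t\<close> of the maps \<open>ci\<close>.\<close>

primrec ci_pow :: "('d, 'e) couple \<Rightarrow> nat \<Rightarrow> nat \<Rightarrow> int \<Rightarrow> 'd \<Rightarrow> 'd" where
  "ci_pow X 0 s t = id"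
| "ci_pow X (Suc k) s t = ci_pow X k s t \<circ> ci X (s + k) (t - int k)"

text \<open>
  The page \<open>E\<^sub>r\<close> (\<open>r \<ge> 1\<close>) of the iterated derived couple, as the subquotient \<open>Z\<^sub>r / B\<^sub>r\<close> of
  \<open>E\<^sub>1\<close> with \<open>Z\<^sub>r = k\<^sup>-\<^sup>1 (im i\<^sup>r\<^sup>-\<^sup>1)\<close> and \<open>B\<^sub>r = j (ker i\<^sup>r\<^sup>-\<^sup>1)\<close>. The minimum in \<open>B\<^sub>r\<close>
  appears because the maps \<open>ci\<close> leaving \<open>D\<^sup>s\<close> stop at \<open>D\<^sup>0\<close>.
\<close>

definition cycles :: "('d, 'e) couple \<Rightarrow> nat \<Rightarrow> nat \<Rightarrow> int \<Rightarrow> 'e set" where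
  "cycles X r s t =
     {x \<in> carrier (cE X s t).
        ck X s t x \<in> ci_pow X (r - 1) (s + 1) t ` carrier (cD X (s + r) (t - int r + 1))}"

definition boundaries :: "('d, 'e) couple \<Rightarrow> nat \<Rightarrow> nat \<Rightarrow> int \<Rightarrow> 'e set" where
  "boundaries X r s t =
     (let k = min (r - 1) s in
      cj X s t ` kernel (cD X s t) (cD X (s - k) (t + int k)) (ci_pow X k (s - k) (t + int k)))"

definition page :: "('d, 'e) couple \<Rightarrow> nat \<Rightarrow> nat \<Rightarrow> int \<Rightarrow> 'e set monoid" where
  "page X r s t = (cE X s t)\<lparr>carrier := cycles X r s t\<rparr> Mod boundaries X r s t"

definition page_inf :: "('d, 'e) couple \<Rightarrow> nat \<Rightarrow> int \<Rightarrow> 'e set monoid" where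
  "page_inf X s t =
     (cE X s t)\<lparr>carrier := (\<Inter>r\<in>{1..}. cycles X r s t)\<rparr> Mod (\<Union>r\<in>{1..}. boundaries X r s t)"

text \<open>
  \<open>d\<^sub>r : E\<^sub>r\<^sup>s\<^sup>,\<^sup>t \<rightarrow> E\<^sub>r\<^sup>s\<^sup>+\<^sup>r\<^sup>,\<^sup>t\<^sup>-\<^sup>r\<^sup>+\<^sup>1\<close> is \<open>j i\<^sup>1\<^sup>-\<^sup>r k\<close>; the set on the right is the full coset.
\<close>

definition page_diff :: "('d, 'e) couple \<Rightarrow> nat \<Rightarrow> nat \<Rightarrow> int \<Rightarrow> 'e set \<Rightarrow> 'e set" where
  "page_diff X r s t c =
     cj X (s + r) (t - int r + 1) `
       {y \<in> carrier (cD X (s + r) (t - int r + 1)).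
          \<exists>x\<in>c. ci_pow X (r - 1) (s + 1) t y = ck X s t x}"

definition page_homology ::
  "(nat \<Rightarrow> nat \<Rightarrow> int \<Rightarrow> 'g monoid) \<Rightarrow> (nat \<Rightarrow> nat \<Rightarrow> int \<Rightarrow> 'g \<Rightarrow> 'g) \<Rightarrow> nat \<Rightarrow> nat \<Rightarrow> int
   \<Rightarrow> 'g set monoid" where
  "page_homology E d r s t =
     (E r s t)\<lparr>carrier := kernel (E r s t) (E r (s + r) (t - int r + 1)) (d r s t)\<rparr>
     Mod
     (if r \<le> s then d r (s - r) (t + int r - 1) ` carrier (E r (s - r) (t + int r - 1))
      else {\<one>\<^bsub>E r s t\<^esub>})"

definition spectral_sequence ::
  "(nat \<Rightarrow> nat \<Rightarrow> int \<Rightarrow> 'g monoid) \<Rightarrow> (nat \<Rightarrow> nat \<Rightarrow> int \<Rightarrow> 'g \<Rightarrow> 'g) \<Rightarrow> bool" where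
  "spectral_sequence E d \<longleftrightarrow>
     (\<forall>r\<ge>1. \<forall>s t.
        comm_group (E r s t) \<and>
        d r s t \<in> hom (E r s t) (E r (s + r) (t - int r + 1)) \<and>
        (\<forall>x \<in> carrier (E r s t). d r (s + r) (t - int r + 1) (d r s t x)
            = \<one>\<^bsub>E r (s + r + r) (t - int r + 1 - int r + 1)\<^esub>) \<and>
        E (Suc r) s t \<cong> page_homology E d r s t)"

text \<open>
  For a tower \<open>\<dots> \<rightarrow> G 2 \<rightarrow> G 1 \<rightarrow> G 0\<close> with maps \<open>f s : G (s + 1) \<rightarrow> G s\<close>: the kernel
  and the cokernel of \<open>(x\<^sub>s) \<mapsto> (x\<^sub>s - f x\<^sub>s\<^sub>+\<^sub>1)\<close> on the product.
\<close>

definition tower_map :: "(nat \<Rightarrow> 'g monoid) \<Rightarrow> (nat \<Rightarrow> 'g \<Rightarrow> 'g) \<Rightarrow> (nat \<Rightarrow> 'g) \<Rightarrow> (nat \<Rightarrow> 'g)" where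
  "tower_map G f x = (\<lambda>s. x s \<otimes>\<^bsub>G s\<^esub> inv\<^bsub>G s\<^esub> f s (x (Suc s)))"

definition lim_tower :: "(nat \<Rightarrow> 'g monoid) \<Rightarrow> (nat \<Rightarrow> 'g \<Rightarrow> 'g) \<Rightarrow> (nat \<Rightarrow> 'g) monoid" where
  "lim_tower G f = (product_group UNIV G)
     \<lparr>carrier := kernel (product_group UNIV G) (product_group UNIV G) (tower_map G f)\<rparr>"

definition lim1_tower :: "(nat \<Rightarrow> 'g monoid) \<Rightarrow> (nat \<Rightarrow> 'g \<Rightarrow> 'g) \<Rightarrow> (nat \<Rightarrow> 'g) set monoid" where
  "lim1_tower G f =
     product_group UNIV G Mod tower_map G f ` carrier (product_group UNIV G)"

text \<open>In total degree \<open>u\<close> the tower is \<open>D\<^sup>s\<^sup>,\<^sup>u\<^sup>-\<^sup>s\<close>.\<close>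

definition conditionally_convergent :: "('d, 'e) couple \<Rightarrow> bool" where
  "conditionally_convergent X \<longleftrightarrow>
     (\<forall>u :: int.
        trivial_group (lim_tower (\<lambda>s. cD X s (u - int s)) (\<lambda>s. ci X s (u - int s))) \<and>
        trivial_group (lim1_tower (\<lambda>s. cD X s (u - int s)) (\<lambda>s. ci X s (u - int s))))"


section \<open>The Adams spectral sequence\<close>

text \<open>Triangles \<open>P\<^sub>s \<rightarrow> M\<^sub>s \<rightarrow> M\<^sub>s\<^sub>+\<^sub>1 \<rightarrow> \<Sigma>P\<^sub>s\<close> with maps \<open>resP\<close>, \<open>resM\<close>, \<open>resB\<close>.\<close>

record ('p, 'b) adams_res =
  objM :: "nat \<Rightarrow> 'p"
  objP :: "nat \<Rightarrow> 'p"
  resP :: "nat \<Rightarrow> 'b"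
  resM :: "nat \<Rightarrow> 'b"
  resB :: "nat \<Rightarrow> 'b"

definition adams_resolution ::
  "'u rel \<Rightarrow> ('o, 'a, 'p, 'b) ring_spectrum \<Rightarrow> 'p \<Rightarrow> ('p, 'b) adams_res \<Rightarrow> bool" where
  "adams_resolution \<kappa> R M T \<longleftrightarrow>
     objM T 0 = M \<and>
     (\<forall>s. objP T s \<in> proj_objects \<kappa> R \<and>
          resP T s \<in> Mor (modules R) (objP T s) (objM T s) \<and>
          resM T s \<in> Mor (modules R) (objM T s) (objM T (Suc s)) \<and>
          resB T s \<in> Mor (modules R) (objM T (Suc s)) (susp (modules R) (objP T s)) \<and>
          resM T s \<in> null_maps R \<and>
          (resP T s, resM T s, resB T s) \<in> tri (modules R))"

text \<open>
  The couple obtained by applying \<open>[-, N]\<^sub>R\<^sup>*\<close>: \<open>D\<^sup>s\<^sup>,\<^sup>t = [M\<^sub>s, N]\<^sup>s\<^sup>+\<^sup>t\<close> and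
  \<open>E\<^sup>s\<^sup>,\<^sup>t = [P\<^sub>s, N]\<^sup>s\<^sup>+\<^sup>t\<close>, with \<open>k\<close> the map
  \<open>[P\<^sub>s, \<Sigma>\<^sup>s\<^sup>+\<^sup>t N] \<cong> [\<Sigma>P\<^sub>s, \<Sigma>\<^sup>s\<^sup>+\<^sup>t\<^sup>+\<^sup>1 N] \<rightarrow> [M\<^sub>s\<^sub>+\<^sub>1, \<Sigma>\<^sup>s\<^sup>+\<^sup>t\<^sup>+\<^sup>1 N]\<close>.
\<close>

definition adams_couple ::
  "('o, 'a, 'p, 'b) ring_spectrum \<Rightarrow> 'p \<Rightarrow> ('p, 'b) adams_res \<Rightarrow> ('b, 'b) couple" where
  "adams_couple R N T =
     \<lparr>cD = (\<lambda>s t. graded_Hom (modules R) (objM T s) N (int s + t)),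
      cE = (\<lambda>s t. graded_Hom (modules R) (objP T s) N (int s + t)),
      ci = (\<lambda>s t f. f \<bullet>\<^bsub>modules R\<^esub> resM T s),
      cj = (\<lambda>s t f. f \<bullet>\<^bsub>modules R\<^esub> resP T s),
      ck = (\<lambda>s t f. susp_arr (modules R) f \<bullet>\<^bsub>modules R\<^esub> resB T s)\<rparr>"

end

theory Submission
  imports Defs "HOL-Library.Nat_Bijection"
begin

text \<open>
  The functors \<open>[-, N]\<^sup>*\<close> turn the triangles of a resolution into an exact couple. Maps out of a
  coproduct of shifts of \<open>R\<close> are determined by homotopy, and compactness of \<open>R\<close> makes the homotopy
  of such a coproduct a free \<open>R\<^sub>*\<close>-module; so the \<open>P\<^sub>s\<close> give a projective resolution of \<open>M\<^sub>*\<close>, and \<open>E\<^sub>1\<close>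
  with \<open>d\<^sub>1\<close> is \<open>Hom(-, N\<^sub>*)\<close> applied to it. Comparison of resolutions identifies \<open>E\<^sub>2\<close> with Ext.

  A composite of \<open>n\<close> maps that are zero in homotopy vanishes on a module of length \<open>n\<close>, and the
  cofiber \<open>M\<^sub>s\<close> inherits this property from \<open>M\<close>. Hence the \<open>n\<close>-fold composites of the tower are
  zero and \<open>E\<^sub>n\<^sub>+\<^sub>1 = E\<^sub>\<infinity>\<close>. For conditional convergence, one minus the shift map of \<open>\<Coprod>\<^sub>s M\<^sub>s\<close> is the
  identity in homotopy, hence invertible, and \<open>[-, N]\<close> turns it into the map whose kernel and cokernel
  are \<open>lim\<close> and \<open>lim\<^sup>1\<close>.
\<close>

section \<open>Subquotients of abelian groups\<close>

text \<open>Pages are explicit subquotients \<open>Z_r / B_r\<close> of \<open>E_1\<close>, not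
  iterated derived couples. That \<open>E_(r+1)\<close> is the homology of \<open>E_r\<close> is
  therefore proved by hand, once for every exact couple; in return \<open>E_\<infinity>\<close> and
  collapse become statements about subgroups of \<open>E_1\<close>. Two resolutions of
  \<open>M_*\<close> with different element types meet in the proof: the topological one consists of
  arrows and is only projective, the one behind \<open>Ext\<close> is free and consists of lists. A
  statement about all graded modules cannot quantify over their element types, so projectivity is
  expressed by a lifting property for one pair of modules at a time, and just the instances that a
  comparison of resolutions uses are assumed. The topology takes place in a triangulated category
  with a compact object \<open>G\<close> whose shifts detect isomorphisms; the ring spectrum enters
  at the end, when \<open>R\<close> is shown to be such an object. The homotopy of
  \<open>P_s\<close> is regraded by \<open>s\<close>, which turns the maps
  \<open>P_(s+1) \<rightarrow> \<Sigma>P_s\<close> into module homomorphisms of degree zero.\<close>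

context comm_group
begin

lemma r_coset_restrict: "H #>\<^bsub>G\<lparr>carrier := Z\<rparr>\<^esub> x = H #> x"
  by (simp add: r_coset_def)

lemma r_coset_eq_iff:
  assumes "subgroup B G" "x \<in> carrier G" "y \<in> carrier G"
  shows "B #> x = B #> y \<longleftrightarrow> x \<otimes> inv y \<in> B"
proof
  assume "B #> x = B #> y"
  then have "x \<in> B #> y" using rcos_self[OF assms(2,1)] by simp
  then show "x \<otimes> inv y \<in> B" using subgroup.rcos_module_imp[OF assms(1) is_group assms(3)] by blast
next
  assume "x \<otimes> inv y \<in> B"
  then have "x \<in> B #> y" using subgroup.rcos_module_rev[OF assms(1) is_group assms(3,2)] by blast
  then show "B #> x = B #> y" using repr_independence[OF _ assms(3,1)] by simp
qed

lemma r_coset_eq_subgroup_iff: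
  assumes "subgroup B G" "x \<in> carrier G"
  shows "B #> x = B \<longleftrightarrow> x \<in> B"
  using coset_join1[OF _ assms(2,1)] coset_join2[OF assms(2,1)] subgroup.subset[OF assms(1)] by blast

lemma in_r_coset_iff:
  assumes "subgroup B G" "x \<in> carrier G" "y \<in> carrier G"
  shows "y \<in> B #> x \<longleftrightarrow> y \<otimes> inv x \<in> B"
  using subgroup.rcos_module[OF assms(1) is_group assms(2,3)] .

lemma set_mult_r_coset:
  assumes "subgroup B G" "x \<in> carrier G" "y \<in> carrier G"
  shows "(B #> x) <#> (B #> y) = B #> (x \<otimes> y)"
  using normal.rcos_sum[of B G x y] assms subgroup_imp_normal by blast

lemma set_mult_restrict: "A <#>\<^bsub>G\<lparr>carrier := Z\<rparr>\<^esub> A' = A <#> A'"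
  by (simp add: set_mult_def)

lemma subgroup_comm_group: "subgroup Z G \<Longrightarrow> comm_group (G\<lparr>carrier := Z\<rparr>)"
proof -
  assume Z: "subgroup Z G"
  interpret S: group "G\<lparr>carrier := Z\<rparr>" using subgroup.subgroup_is_group[OF Z is_group] .
  show ?thesis
    using subgroup.mem_carrier[OF Z] by (intro S.group_comm_groupI) (simp add: m_comm)
qed

context
  fixes Z B :: "'a set"
  assumes Z: "subgroup Z G" and B: "subgroup B G" and BZ: "B \<subseteq> Z"
begin

lemma subquotient_comm_group: "comm_group (G\<lparr>carrier := Z\<rparr> Mod B)"
proof -
  interpret S: comm_group "G\<lparr>carrier := Z\<rparr>" using subgroup_comm_group[OF Z] .
  show ?thesis using S.abelian_FactGroup[OF subgroup_incl[OF B Z BZ]] .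
qed

lemma carrier_subquotient: "carrier (G\<lparr>carrier := Z\<rparr> Mod B) = (\<lambda>x. B #> x) ` Z"
  by (simp add: carrier_FactGroup r_coset_restrict)

lemma mult_subquotient:
  assumes "x \<in> Z" "y \<in> Z"
  shows "(B #> x) \<otimes>\<^bsub>G\<lparr>carrier := Z\<rparr> Mod B\<^esub> (B #> y) = B #> (x \<otimes> y)"
  using set_mult_r_coset[OF B] assms subgroup.subset[OF Z] by (auto simp: set_mult_restrict)

end

end

text \<open>Surjectivity is asked only modulo \<open>B'\<close> and additivity only on
  \<open>Z\<close>, because the maps to which this is applied offer no more: a chain map between
  resolutions, for instance, is inverted by another one only up to coboundaries. The condition on
  kernels makes the map of quotients injective.\<close>

lemma subquotient_iso:
  assumes G: "comm_group G" "subgroup Z G" "subgroup B G" "B \<subseteq> Z"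
    and H: "comm_group H" "subgroup Z' H" "subgroup B' H" "B' \<subseteq> Z'"
    and closed: "\<And>x. x \<in> Z \<Longrightarrow> a x \<in> Z'"
    and mult: "\<And>x y. \<lbrakk>x \<in> Z; y \<in> Z\<rbrakk> \<Longrightarrow> a (x \<otimes>\<^bsub>G\<^esub> y) = a x \<otimes>\<^bsub>H\<^esub> a y"
    and onto: "\<And>z. z \<in> Z' \<Longrightarrow> \<exists>x\<in>Z. a x \<otimes>\<^bsub>H\<^esub> inv\<^bsub>H\<^esub> z \<in> B'"
    and ker: "\<And>x. x \<in> Z \<Longrightarrow> a x \<in> B' \<longleftrightarrow> x \<in> B"
  shows "G\<lparr>carrier := Z\<rparr> Mod B \<cong> H\<lparr>carrier := Z'\<rparr> Mod B'"
proof -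
  interpret G: comm_group G by fact
  interpret H: comm_group H by fact
  interpret GZ: comm_group "G\<lparr>carrier := Z\<rparr>" using G.subgroup_comm_group[OF G(2)] .
  interpret Q: comm_group "H\<lparr>carrier := Z'\<rparr> Mod B'" by (rule H.subquotient_comm_group[OF H(2-4)])
  let ?h = "\<lambda>x. B' #>\<^bsub>H\<^esub> a x"
  have Z': "z \<in> carrier H" if "z \<in> Z'" for z using that subgroup.subset[OF H(2)] by blast
  have h: "?h \<in> hom (G\<lparr>carrier := Z\<rparr>) (H\<lparr>carrier := Z'\<rparr> Mod B')"
    by (rule homI) (auto simp: H.carrier_subquotient[OF H(2-4)] closed mult H.mult_subquotient[OF H(2-4)] simp del: mult_FactGroup)
  interpret h: group_hom "G\<lparr>carrier := Z\<rparr>" "H\<lparr>carrier := Z'\<rparr> Mod B'" ?h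
    by unfold_locales (rule h)
  have onto': "?h ` carrier (G\<lparr>carrier := Z\<rparr>) = carrier (H\<lparr>carrier := Z'\<rparr> Mod B')"
  proof (intro equalityI subsetI)
    fix c assume "c \<in> carrier (H\<lparr>carrier := Z'\<rparr> Mod B')"
    then obtain z where z: "z \<in> Z'" "c = B' #>\<^bsub>H\<^esub> z"
      unfolding H.carrier_subquotient[OF H(2-4)] by blast
    from onto[OF z(1)] obtain x where x: "x \<in> Z" "a x \<otimes>\<^bsub>H\<^esub> inv\<^bsub>H\<^esub> z \<in> B'" by blast
    then have "?h x = c"
      using H.r_coset_eq_iff[OF H(3), of "a x" z] z Z' closed by simp
    with x show "c \<in> ?h ` carrier (G\<lparr>carrier := Z\<rparr>)" by auto
  qed (use h.hom_closed in auto)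
  have "kernel (G\<lparr>carrier := Z\<rparr>) (H\<lparr>carrier := Z'\<rparr> Mod B') ?h = B"
    using ker G(4) H.r_coset_eq_subgroup_iff[OF H(3) Z'[OF closed]]
    unfolding kernel_def one_FactGroup by fastforce
  then show ?thesis using h.FactGroup_iso[OF onto'] by simp
qed


section \<open>The spectral sequence of an exact couple\<close>

context exact_couple
begin

text \<open>The differential of page \<open>Suc q\<close> ends at \<open>s + Suc q\<close>;
  otherwise the simplifier would turn this index into \<open>Suc (s + q)\<close> and break the match
  with the rules below.\<close>

declare add_Suc_right [simp del]

abbreviation "D s t \<equiv> cD X s t"
abbreviation "E s t \<equiv> cE X s t"

sublocale D: comm_group "cD X s t" for s t by (rule D_group)
sublocale E: comm_group "cE X s t" for s t by (rule E_group)
sublocale i: group_hom "cD X (Suc s) (t - 1)" "cD X s t" "ci X s t" for s t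
  by unfold_locales (rule i_hom)
sublocale j: group_hom "cD X s t" "cE X s t" "cj X s t" for s t
  by unfold_locales (rule j_hom)
sublocale k: group_hom "cE X s t" "cD X (Suc s) t" "ck X s t" for s t
  by unfold_locales (rule k_hom)

lemma ci_pow_hom: "ci_pow X q s t \<in> hom (D (s + q) (t - int q)) (D s t)"
proof (induction q)
  case 0
  show ?case by (simp add: hom_def)
next
  case (Suc q)
  have "ci X (s + q) (t - int q) \<in> hom (D (s + Suc q) (t - int (Suc q))) (D (s + q) (t - int q))"
    using i_hom[of "s + q" "t - int q"] by (simp add: add_Suc_right diff_diff_eq add.commute[of 1])
  from hom_compose[OF this Suc] show ?case by (simp only: ci_pow.simps)
qed

text \<open>The recursion splits off the map farthest from the target \<open>D s t\<close>; here the
  one next to the target is split off. This form compares the kernels of \<open>i^(r-1)\<close> and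
  \<open>i^r\<close> on a fixed source, hence \<open>B_r\<close> with
  \<open>B_(r+1)\<close>.\<close>

lemma ci_pow_Suc_left: "ci_pow X (Suc q) s t = ci X s t \<circ> ci_pow X q (Suc s) (t - 1)"
proof (induction q)
  case (Suc q)
  have *: "t - 1 - int q = t - int (Suc q)" by simp
  have "ci_pow X (Suc (Suc q)) s t = ci_pow X (Suc q) s t \<circ> ci X (s + Suc q) (t - int (Suc q))" by simp
  also have "\<dots> = ci X s t \<circ> (ci_pow X q (Suc s) (t - 1) \<circ> ci X (Suc s + q) (t - 1 - int q))"
    unfolding Suc * by (simp add: comp_assoc add_Suc_right)
  finally show ?case by (simp add: add_Suc_right)
qed simp

sublocale p: group_hom "cD X (s + q) (t - int q)" "cD X s t" "ci_pow X q s t" for q s t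
  by unfold_locales (rule ci_pow_hom)

section \<open>Cycles and boundaries\<close>

lemma pow_hom: "ci_pow X q (Suc s) t \<in> hom (D (s + Suc q) (t - int q)) (D (Suc s) t)"
  using ci_pow_hom[of q "Suc s" t] by (simp add: add_Suc_right)

lemma pow_group_hom: "group_hom (D (s + Suc q) (t - int q)) (D (Suc s) t) (ci_pow X q (Suc s) t)"
  by unfold_locales (rule pow_hom)

text \<open>With \<open>r = Suc q\<close> the truncated subtraction \<open>r - 1\<close> disappears
  and \<open>t - int r + 1\<close> becomes \<open>t - int q\<close>; later statements about pages
  use this form.\<close>

lemma cycles_Suc:
  "cycles X (Suc q) s t =
     {x \<in> carrier (E s t). ck X s t x \<in> ci_pow X q (Suc s) t ` carrier (D (s + Suc q) (t - int q))}"
  by (simp add: cycles_def add_Suc_right)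

lemma boundaries_Suc:
  "boundaries X (Suc q) (s + Suc q) (t - int q) =
     cj X (s + Suc q) (t - int q) `
       kernel (D (s + Suc q) (t - int q)) (D (Suc s) t) (ci_pow X q (Suc s) t)"
  by (simp add: boundaries_def)

text \<open>The maps leaving \<open>D^s\<close> end at \<open>D^0\<close> after \<open>s\<close>
  steps, so \<open>B_r\<close> is constant from \<open>r = s + 1\<close> on. This matches the
  absence of incoming differentials \<open>d_r\<close> with \<open>r > s\<close>.\<close>

lemma boundaries_small: "s \<le> q \<Longrightarrow> boundaries X (Suc q) s t = boundaries X (Suc s) s t"
  by (simp add: boundaries_def min_def)

lemma kj: "w \<in> carrier (D s t) \<Longrightarrow> ck X s t (cj X s t w) = \<one>\<^bsub>D (Suc s) t\<^esub>"
  using exact_jk[of s t] by (auto simp: kernel_def)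

lemma ji: "w \<in> carrier (D (Suc s) (t - 1)) \<Longrightarrow> cj X s t (ci X s t w) = \<one>\<^bsub>E s t\<^esub>"
  using exact_ij[of s t] by (auto simp: kernel_def)

lemma ik: "x \<in> carrier (E s t) \<Longrightarrow> ci X s (t + 1) (ck X s t x) = \<one>\<^bsub>D s (t + 1)\<^esub>"
  using exact_ki[of s t] by (auto simp: kernel_def)

lemma subgroup_cycles: "subgroup (cycles X (Suc q) s t) (E s t)"
proof -
  interpret P: group_hom "D (s + Suc q) (t - int q)" "D (Suc s) t" "ci_pow X q (Suc s) t"
    by (rule pow_group_hom)
  let ?I = "ci_pow X q (Suc s) t ` carrier (D (s + Suc q) (t - int q))"
  have I: "subgroup ?I (D (Suc s) t)" by (rule P.img_is_subgroup)
  show ?thesis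
    unfolding cycles_Suc
    using subgroup.one_closed[OF I] subgroup.m_closed[OF I] subgroup.m_inv_closed[OF I]
    by (intro E.subgroupI) (auto simp del: image_iff imageE)
qed

lemma boundaries_group_hom:
  assumes "q \<le> s"
  shows "group_hom (D s t) (D (s - q) (t + int q)) (ci_pow X q (s - q) (t + int q))"
  using ci_pow_hom[of q "s - q" "t + int q"] assms by (unfold_locales) simp

lemma boundaries_eq:
  "boundaries X r s t =
    cj X s t ` kernel (D s t) (D (s - min (r - 1) s) (t + int (min (r - 1) s)))
      (ci_pow X (min (r - 1) s) (s - min (r - 1) s) (t + int (min (r - 1) s)))"
  by (simp add: boundaries_def Let_def)

lemma subgroup_boundaries: "subgroup (boundaries X r s t) (E s t)"
proof -
  interpret P: group_hom "D s t" "D (s - min (r - 1) s) (t + int (min (r - 1) s))"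
      "ci_pow X (min (r - 1) s) (s - min (r - 1) s) (t + int (min (r - 1) s))"
    by (rule boundaries_group_hom) simp
  show ?thesis unfolding boundaries_eq
    by (rule j.subgroup_img_is_subgroup[OF P.subgroup_kernel])
qed

lemma boundaries_k: "b \<in> boundaries X r s t \<Longrightarrow> ck X s t b = \<one>\<^bsub>D (Suc s) t\<^esub>"
  unfolding boundaries_eq using kj by (auto simp: kernel_def)

text \<open>Since \<open>k j = 0\<close>, a boundary of any page is killed by \<open>k\<close>, and
  zero lifts along every power of \<open>i\<close>.\<close>

lemma boundaries_subset_cycles: "boundaries X r s t \<subseteq> cycles X (Suc q) s t"
proof
  fix b assume b: "b \<in> boundaries X r s t"
  interpret P: group_hom "D (s + Suc q) (t - int q)" "D (Suc s) t" "ci_pow X q (Suc s) t"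
    by (rule pow_group_hom)
  have "ck X s t b = ci_pow X q (Suc s) t \<one>\<^bsub>D (s + Suc q) (t - int q)\<^esub>"
    by (simp only: boundaries_k[OF b] P.hom_one)
  then show "b \<in> cycles X (Suc q) s t"
    unfolding cycles_Suc using subgroup.mem_carrier[OF subgroup_boundaries b] by blast
qed

lemmas page_facts = subgroup_cycles subgroup_boundaries boundaries_subset_cycles

section \<open>Pages and their differentials\<close>

lemma page_comm_group: "comm_group (page X (Suc q) s t)"
  unfolding page_def by (rule E.subquotient_comm_group[OF page_facts])

lemma carrier_page:
  "carrier (page X (Suc q) s t) = (\<lambda>x. boundaries X (Suc q) s t #>\<^bsub>E s t\<^esub> x) ` cycles X (Suc q) s t"
  unfolding page_def by (rule E.carrier_subquotient[OF page_facts])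

text \<open>A single lift \<open>y\<close> of \<open>k x\<close> along \<open>i^(r-1)\<close>
  computes \<open>d_r\<close>. All lifts differ by \<open>ker i^(r-1)\<close>, and \<open>j\<close>
  sends this kernel exactly onto \<open>B_r\<close> at the target, so the set in the definition of
  \<open>page_diff\<close> is one full coset. Changing \<open>x\<close> within its class does not
  affect \<open>k x\<close>, because boundaries are killed by \<open>k\<close>.\<close>

lemma page_diff_eq:
  assumes x: "x \<in> carrier (E s t)" and y: "y \<in> carrier (D (s + Suc q) (t - int q))"
    and xy: "ci_pow X q (Suc s) t y = ck X s t x"
  shows "page_diff X (Suc q) s t (boundaries X (Suc q) s t #>\<^bsub>E s t\<^esub> x)
    = boundaries X (Suc q) (s + Suc q) (t - int q) #>\<^bsub>E (s + Suc q) (t - int q)\<^esub> cj X (s + Suc q) (t - int q) y"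
    (is "?L = ?B' #>\<^bsub>?E\<^esub> ?j y")
proof -
  let ?D = "D (s + Suc q) (t - int q)" and ?p = "ci_pow X q (Suc s) t"
  interpret P: group_hom ?D "D (Suc s) t" ?p by (rule pow_group_hom)
  have kx: "ck X s t x' = ck X s t x" if "x' \<in> boundaries X (Suc q) s t #>\<^bsub>E s t\<^esub> x" for x'
  proof -
    from that obtain b where b: "b \<in> boundaries X (Suc q) s t" "x' = b \<otimes>\<^bsub>E s t\<^esub> x"
      unfolding r_coset_def by blast
    then show ?thesis using x boundaries_k[OF b(1)] subgroup.mem_carrier[OF subgroup_boundaries b(1)]
      by simp
  qed
  have xc: "x \<in> boundaries X (Suc q) s t #>\<^bsub>E s t\<^esub> x"
    by (rule E.rcos_self[OF x subgroup_boundaries])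
  have "?L = ?j ` {y' \<in> carrier ?D. ?p y' = ck X s t x}"
  proof -
    have "(\<exists>x'\<in>boundaries X (Suc q) s t #>\<^bsub>E s t\<^esub> x. ?p y' = ck X s t x') \<longleftrightarrow> ?p y' = ck X s t x" for y'
      using kx xc by metis
    then show ?thesis unfolding page_diff_def by (simp add: add_Suc_right)
  qed
  also have "{y' \<in> carrier ?D. ?p y' = ck X s t x} = kernel ?D (D (Suc s) t) ?p #>\<^bsub>?D\<^esub> y"
  proof (intro equalityI subsetI)
    fix y' assume "y' \<in> {y' \<in> carrier ?D. ?p y' = ck X s t x}"
    then have y': "y' \<in> carrier ?D" "?p y' = ?p y" using xy by simp_all
    have "y' \<otimes>\<^bsub>?D\<^esub> inv\<^bsub>?D\<^esub> y \<in> kernel ?D (D (Suc s) t) ?p" using y y' by (simp add: kernel_def)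
    then show "y' \<in> kernel ?D (D (Suc s) t) ?p #>\<^bsub>?D\<^esub> y"
      using D.in_r_coset_iff[OF P.subgroup_kernel y y'(1)] by simp
  qed (use y xy k.hom_closed[OF x] in \<open>auto simp: r_coset_def kernel_def\<close>)
  also have "?j ` (kernel ?D (D (Suc s) t) ?p #>\<^bsub>?D\<^esub> y) = ?B' #>\<^bsub>?E\<^esub> ?j y"
  proof -
    have "?j (w \<otimes>\<^bsub>?D\<^esub> y) = ?j w \<otimes>\<^bsub>?E\<^esub> ?j y" if "w \<in> kernel ?D (D (Suc s) t) ?p" for w
      using that y j.hom_mult[of w] by (simp add: kernel_def)
    then show ?thesis unfolding boundaries_Suc r_coset_def by (auto simp: image_UN)
  qed
  finally show ?thesis .
qed

lemma page_diff_hom: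
  "page_diff X (Suc q) s t \<in> hom (page X (Suc q) s t) (page X (Suc q) (s + Suc q) (t - int q))"
  (is "?d \<in> hom ?P ?P'")
proof (rule homI)
  let ?D = "D (s + Suc q) (t - int q)" and ?p = "ci_pow X q (Suc s) t"
    and ?E' = "E (s + Suc q) (t - int q)" and ?j = "cj X (s + Suc q) (t - int q)"
    and ?B = "boundaries X (Suc q) s t" and ?B' = "boundaries X (Suc q) (s + Suc q) (t - int q)"
  interpret P: group_hom ?D "D (Suc s) t" ?p by (rule pow_group_hom)
  have jZ: "?j y \<in> cycles X (Suc q) (s + Suc q) (t - int q)" if y: "y \<in> carrier ?D" for y
  proof -
    interpret P': group_hom "D (s + Suc q + Suc q) (t - int q - int q)" "D (Suc (s + Suc q)) (t - int q)"
        "ci_pow X q (Suc (s + Suc q)) (t - int q)"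
      by (rule pow_group_hom)
    have "ck X (s + Suc q) (t - int q) (?j y)
        = ci_pow X q (Suc (s + Suc q)) (t - int q) \<one>\<^bsub>D (s + Suc q + Suc q) (t - int q - int q)\<^esub>"
      by (simp only: kj[OF y] P'.hom_one)
    then show ?thesis unfolding cycles_Suc using y D.one_closed[of "s + Suc q + Suc q" "t - int q - int q"] j.hom_closed[OF y] by blast
  qed
  have rep: "\<exists>x y. c = ?B #>\<^bsub>E s t\<^esub> x \<and> x \<in> cycles X (Suc q) s t \<and> x \<in> carrier (E s t) \<and> y \<in> carrier ?D \<and> ?p y = ck X s t x"
    if "c \<in> carrier ?P" for c
  proof -
    from that obtain x where x: "c = ?B #>\<^bsub>E s t\<^esub> x" "x \<in> cycles X (Suc q) s t"
      unfolding carrier_page by blast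
    from x(2) obtain y where "x \<in> carrier (E s t)" "y \<in> carrier ?D" "ck X s t x = ?p y"
      unfolding cycles_Suc by blast
    with x show ?thesis by metis
  qed
  show "?d c \<in> carrier ?P'" if c: "c \<in> carrier ?P" for c
  proof -
    from rep[OF c] obtain x y where xy: "c = ?B #>\<^bsub>E s t\<^esub> x" "x \<in> carrier (E s t)" "y \<in> carrier ?D" "?p y = ck X s t x"
      by blast
    show ?thesis unfolding xy(1) page_diff_eq[OF xy(2-4)] carrier_page using jZ[OF xy(3)] by blast
  qed
  show "?d (c \<otimes>\<^bsub>?P\<^esub> c') = ?d c \<otimes>\<^bsub>?P'\<^esub> ?d c'" if c: "c \<in> carrier ?P" "c' \<in> carrier ?P" for c c'
  proof -
    from rep[OF c(1)] obtain x y where xy: "c = ?B #>\<^bsub>E s t\<^esub> x" "x \<in> cycles X (Suc q) s t"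
      "x \<in> carrier (E s t)" "y \<in> carrier ?D" "?p y = ck X s t x" by blast
    from rep[OF c(2)] obtain x' y' where xy': "c' = ?B #>\<^bsub>E s t\<^esub> x'" "x' \<in> cycles X (Suc q) s t"
      "x' \<in> carrier (E s t)" "y' \<in> carrier ?D" "?p y' = ck X s t x'" by blast
    have "c \<otimes>\<^bsub>?P\<^esub> c' = ?B #>\<^bsub>E s t\<^esub> (x \<otimes>\<^bsub>E s t\<^esub> x')"
      unfolding xy(1) xy'(1) page_def by (rule E.mult_subquotient[OF page_facts xy(2) xy'(2)])
    also have "?d \<dots> = ?B' #>\<^bsub>?E'\<^esub> ?j (y \<otimes>\<^bsub>?D\<^esub> y')"
      using xy xy' by (intro page_diff_eq) auto
    also have "?j (y \<otimes>\<^bsub>?D\<^esub> y') = ?j y \<otimes>\<^bsub>?E'\<^esub> ?j y'"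
      using xy xy' by simp
    also have "?B' #>\<^bsub>?E'\<^esub> (?j y \<otimes>\<^bsub>?E'\<^esub> ?j y') = (?B' #>\<^bsub>?E'\<^esub> ?j y) \<otimes>\<^bsub>?P'\<^esub> (?B' #>\<^bsub>?E'\<^esub> ?j y')"
      unfolding page_def by (rule E.mult_subquotient[OF page_facts jZ jZ, symmetric]) (use xy xy' in auto)
    finally show ?thesis unfolding xy(1) xy'(1) page_diff_eq[OF xy(3-5)] page_diff_eq[OF xy'(3-5)] .
  qed
qed

text \<open>The class \<open>d_r x\<close> is represented by \<open>j y\<close>, and
  \<open>k (j y)\<close> vanishes, so the second differential may be computed with the zero
  lift.\<close>

lemma page_diff_square:
  assumes c: "c \<in> carrier (page X (Suc q) s t)"
  shows "page_diff X (Suc q) (s + Suc q) (t - int q) (page_diff X (Suc q) s t c)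
    = \<one>\<^bsub>page X (Suc q) (s + Suc q + Suc q) (t - int q - int q)\<^esub>"
proof -
  let ?D = "D (s + Suc q) (t - int q)" and ?p = "ci_pow X q (Suc s) t"
    and ?j = "cj X (s + Suc q) (t - int q)"
  from c obtain x y where xy: "c = boundaries X (Suc q) s t #>\<^bsub>E s t\<^esub> x" "x \<in> carrier (E s t)"
      "y \<in> carrier ?D" "?p y = ck X s t x"
    unfolding carrier_page unfolding cycles_Suc by auto
  interpret P': group_hom "D (s + Suc q + Suc q) (t - int q - int q)" "D (Suc (s + Suc q)) (t - int q)"
        "ci_pow X q (Suc (s + Suc q)) (t - int q)"
      by (rule pow_group_hom)
  have "ci_pow X q (Suc (s + Suc q)) (t - int q) \<one>\<^bsub>D (s + Suc q + Suc q) (t - int q - int q)\<^esub>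
      = ck X (s + Suc q) (t - int q) (?j y)"
    by (simp only: kj[OF xy(3)] P'.hom_one)
  note page_diff_eq[OF j.hom_closed[OF xy(3)] D.one_closed this]
  then show ?thesis
    unfolding xy(1) page_diff_eq[OF xy(2-4)]
    using E.coset_mult_one[OF subgroup.subset[OF subgroup_boundaries]] by (simp add: page_def)
qed

text \<open>Sending a cycle of the next page to its class in \<open>E_r\<close> induces the
  isomorphism. Two facts carry it: \<open>ker d_r\<close> is \<open>Z_(r+1) / B_r\<close>, since
  \<open>j y\<close> lying in \<open>B_r\<close> lets \<open>y\<close> be corrected into the image
  of \<open>i\<close>; and the image of the incoming \<open>d_r\<close> is
  \<open>B_(r+1) / B_r\<close>, since \<open>ker i = im k\<close>.\<close>

lemma page_homology_iso: "page X (Suc (Suc q)) s t \<cong> page_homology (page X) (page_diff X) (Suc q) s t"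
proof -
  let ?P = "page X (Suc q) s t" and ?P' = "page X (Suc q) (s + Suc q) (t - int q)"
    and ?d = "page_diff X (Suc q) s t"
    and ?B = "boundaries X (Suc q) s t" and ?Z = "cycles X (Suc q) s t"
    and ?B' = "boundaries X (Suc q) (s + Suc q) (t - int q)" and ?E' = "E (s + Suc q) (t - int q)"
    and ?j = "cj X (s + Suc q) (t - int q)" and ?D = "D (s + Suc q) (t - int q)"
    and ?p = "ci_pow X q (Suc s) t"
  let ?I = "if Suc q \<le> s then page_diff X (Suc q) (s - Suc q) (t + int (Suc q) - 1)
              ` carrier (page X (Suc q) (s - Suc q) (t + int (Suc q) - 1))
            else {\<one>\<^bsub>?P\<^esub>}"
  interpret P: comm_group ?P by (rule page_comm_group)
  interpret P': comm_group ?P' by (rule page_comm_group)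
  interpret d: group_hom ?P ?P' ?d by unfold_locales (rule page_diff_hom)
  interpret p: group_hom ?D "D (Suc s) t" ?p by (rule pow_group_hom)
  have idx: "t - int (Suc q) + 1 = t - int q" by simp
  have cycles_Suc2: "cycles X (Suc (Suc q)) s t = {x \<in> carrier (E s t).
      ck X s t x \<in> ci_pow X (Suc q) (Suc s) t ` carrier (D (Suc (s + Suc q)) (t - int q - 1))}"
    unfolding cycles_Suc by (simp only: add_Suc_right diff_diff_eq of_nat_Suc add.commute)
  have pc: "x \<in> ?Z \<Longrightarrow> ?B #>\<^bsub>E s t\<^esub> x \<in> carrier ?P" for x by (auto simp: carrier_page)
  have pm: "\<lbrakk>x \<in> ?Z; y \<in> ?Z\<rbrakk> \<Longrightarrow> ?B #>\<^bsub>E s t\<^esub> (x \<otimes>\<^bsub>E s t\<^esub> y) = (?B #>\<^bsub>E s t\<^esub> x) \<otimes>\<^bsub>?P\<^esub> (?B #>\<^bsub>E s t\<^esub> y)" for x y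
    unfolding page_def by (simp only: E.mult_subquotient[OF page_facts])
  have ZZ: "cycles X (Suc (Suc q)) s t \<subseteq> ?Z"
  proof
    fix x assume "x \<in> cycles X (Suc (Suc q)) s t"
    then obtain z where x: "x \<in> carrier (E s t)" and z: "z \<in> carrier (D (Suc (s + Suc q)) (t - int q - 1))"
      "ck X s t x = ci_pow X (Suc q) (Suc s) t z" unfolding cycles_Suc2 by blast
    have "ci X (Suc s + q) (t - int q) z \<in> carrier ?D"
      using i.hom_closed[OF z(1)] by (simp add: add_Suc_right)
    then show "x \<in> ?Z" unfolding cycles_Suc using x z by auto
  qed
  have I: "subgroup ?I ?P \<and> ?I \<subseteq> kernel ?P ?P' ?d \<and>
      (\<forall>x\<in>?Z. ?B #>\<^bsub>E s t\<^esub> x \<in> ?I \<longleftrightarrow> x \<in> boundaries X (Suc (Suc q)) s t)"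
  proof (cases "Suc q \<le> s")
    \<comment> \<open>No differential arrives when \<open>r > s\<close>; correspondingly
      \<open>B_(r+1) = B_r\<close>, and the unit of \<open>E_r\<close> is the coset
      \<open>B_r\<close> itself.\<close>
    case False
    have x1: "x \<in> ?Z \<Longrightarrow> x \<in> carrier (E s t)" for x by (simp add: cycles_Suc)
    have "boundaries X (Suc (Suc q)) s t = ?B"
      using boundaries_small[of s q t] boundaries_small[of s "Suc q" t] False by simp
    moreover have "\<one>\<^bsub>?P\<^esub> = ?B" by (simp add: page_def)
    ultimately show ?thesis using False P.triv_subgroup x1 d.hom_one P.one_closed
        E.r_coset_eq_subgroup_iff[OF subgroup_boundaries x1]
      by (auto simp: kernel_def simp del: d.hom_one)
  next
    case True
    \<comment> \<open>\<open>(s0, t0)\<close> is the source of the differential that arrives at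
      \<open>(s, t)\<close>.\<close>
    define s0 t0 where "s0 = s - Suc q" and "t0 = t + int q"
    have st: "s = s0 + Suc q" "t = t0 - int q" using True by (simp_all add: s0_def t0_def)
    let ?e = "page_diff X (Suc q) s0 t0" and ?Q = "page X (Suc q) s0 t0"
      and ?u = "ci_pow X q (Suc s0) t0"
    interpret P0: comm_group ?Q by (rule page_comm_group)
    interpret d0: group_hom ?Q ?P ?e
      by (rule group_hom.intro[OF P0.group_axioms P.group_axioms], rule group_hom_axioms.intro)
        (rule page_diff_hom[of q s0 t0, folded st])
    interpret p0: group_hom "D s t" "D (Suc s0) t0" ?u using pow_group_hom[of s0 q t0, folded st] .
    have tt: "t + int (Suc q) - 1 = t0" by (simp add: t0_def)
    have Ieq: "?I = ?e ` carrier ?Q" using True by (simp only: tt s0_def[symmetric] if_True)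
    have B2: "boundaries X (Suc (Suc q)) s t
        = cj X s t ` kernel (D s t) (D s0 (t0 + 1)) (ci_pow X (Suc q) s0 (t0 + 1))"
      using boundaries_eq[of "Suc (Suc q)" s t] True
      by (simp add: s0_def[symmetric] t0_def min_def algebra_simps del: ci_pow.simps)
    have pS: "ci_pow X (Suc q) s0 (t0 + 1) w = ci X s0 (t0 + 1) (?u w)" for w
      unfolding ci_pow_Suc_left by simp
    interpret p1: group_hom "D s t" "D s0 (t0 + 1)" "ci_pow X (Suc q) s0 (t0 + 1)"
    proof (rule group_hom.intro[OF D.group_axioms D.group_axioms], rule group_hom_axioms.intro)
      have "t0 + 1 - int (Suc q) = t" by (simp add: t0_def)
      then show "ci_pow X (Suc q) s0 (t0 + 1) \<in> hom (D s t) (D s0 (t0 + 1))"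
        using ci_pow_hom[of "Suc q" s0 "t0 + 1"] st(1) by (simp del: ci_pow.simps)
    qed
    have dd: "?d c \<in> {\<one>\<^bsub>?P'\<^esub>}" if "c \<in> ?e ` carrier ?Q" for c
      using that page_diff_square[of _ q s0 t0] unfolding st by auto
    have B1: "?B = cj X s t ` kernel (D s t) (D (Suc s0) t0) ?u"
      unfolding st by (rule boundaries_Suc)
    have B12: "?B \<subseteq> boundaries X (Suc (Suc q)) s t"
      unfolding B1 B2 using pS i.hom_one[of s0 "t0 + 1"] by (auto simp: kernel_def simp del: ci_pow.simps)
    have "?B #>\<^bsub>E s t\<^esub> x \<in> ?e ` carrier ?Q \<longleftrightarrow> x \<in> boundaries X (Suc (Suc q)) s t" if x: "x \<in> ?Z" for x
    proof
      assume "?B #>\<^bsub>E s t\<^esub> x \<in> ?e ` carrier ?Q"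
      then obtain x0 y where xy: "x0 \<in> carrier (E s0 t0)" "y \<in> carrier (D s t)" "?u y = ck X s0 t0 x0"
        and e: "?B #>\<^bsub>E s t\<^esub> x = ?e (boundaries X (Suc q) s0 t0 #>\<^bsub>E s0 t0\<^esub> x0)"
        unfolding carrier_page unfolding cycles_Suc st by auto
      have "?B #>\<^bsub>E s t\<^esub> x = ?B #>\<^bsub>E s t\<^esub> cj X s t y"
        using e page_diff_eq[OF xy(1) _ xy(3)] xy(2) unfolding st by simp
      then have 1: "x \<otimes>\<^bsub>E s t\<^esub> inv\<^bsub>E s t\<^esub> cj X s t y \<in> ?B"
        using E.r_coset_eq_iff[OF subgroup_boundaries] x xy by (simp add: cycles_Suc)
      have 2: "cj X s t y \<in> boundaries X (Suc (Suc q)) s t"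
        unfolding B2 using xy pS ik[of x0 s0 t0] by (auto simp: kernel_def simp del: ci_pow.simps)
      have "x = (x \<otimes>\<^bsub>E s t\<^esub> inv\<^bsub>E s t\<^esub> cj X s t y) \<otimes>\<^bsub>E s t\<^esub> cj X s t y"
        using x xy by (simp add: cycles_Suc E.m_assoc)
      then show "x \<in> boundaries X (Suc (Suc q)) s t"
        using subgroup.m_closed[OF subgroup_boundaries subsetD[OF B12 1] 2] by simp
    next
      assume "x \<in> boundaries X (Suc (Suc q)) s t"
      then obtain w where w: "w \<in> carrier (D s t)" "ci X s0 (t0 + 1) (?u w) = \<one>\<^bsub>D s0 (t0 + 1)\<^esub>" "x = cj X s t w"
        unfolding B2 pS by (auto simp: kernel_def pS simp del: ci_pow.simps)
      \<comment> \<open>\<open>i^r w = 0\<close> says that \<open>i^(r-1) w\<close> lies in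
        \<open>ker i = im k\<close>; a preimage under \<open>k\<close> is the element whose
        differential is the class of \<open>x = j w\<close>.\<close>
      then have "?u w \<in> kernel (D (Suc s0) t0) (D s0 (t0 + 1)) (ci X s0 (t0 + 1))"
        by (simp add: kernel_def)
      then obtain x0 where x0: "x0 \<in> carrier (E s0 t0)" "?u w = ck X s0 t0 x0"
        unfolding exact_ki[symmetric] by auto
      have "x0 \<in> cycles X (Suc q) s0 t0" 
        unfolding cycles_Suc using image_eqI[where f = ?u, OF x0(2)[symmetric] w(1)[unfolded st]] x0(1) by simp
      then have "boundaries X (Suc q) s0 t0 #>\<^bsub>E s0 t0\<^esub> x0 \<in> carrier ?Q" by (auto simp: carrier_page)
      moreover have "?e (boundaries X (Suc q) s0 t0 #>\<^bsub>E s0 t0\<^esub> x0) = ?B #>\<^bsub>E s t\<^esub> x"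
        using page_diff_eq[OF x0(1) _ x0(2)] w unfolding st by simp
      ultimately show "?B #>\<^bsub>E s t\<^esub> x \<in> ?e ` carrier ?Q" by (metis image_eqI)
    qed
    moreover have "?e ` carrier ?Q \<subseteq> kernel ?P ?P' ?d" using dd by (auto simp: kernel_def)
    ultimately show ?thesis unfolding Ieq using d0.img_is_subgroup by blast
  qed
  have "page X (Suc (Suc q)) s t \<cong> ?P\<lparr>carrier := kernel ?P ?P' ?d\<rparr> Mod ?I"
    unfolding page_def[of X "Suc (Suc q)"]
  proof (rule subquotient_iso[where a = "\<lambda>x. ?B #>\<^bsub>E s t\<^esub> x"])
    fix x assume x: "x \<in> cycles X (Suc (Suc q)) s t"
    then obtain z where xc: "x \<in> carrier (E s t)" and z: "z \<in> carrier (D (Suc (s + Suc q)) (t - int q - 1))"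
      "ck X s t x = ci_pow X (Suc q) (Suc s) t z" unfolding cycles_Suc2 by blast
    let ?y = "ci X (s + Suc q) (t - int q) z"
    note z' = z(1)
    have y: "?y \<in> carrier ?D" using i.hom_closed[OF z'] by simp
    have "?p ?y = ck X s t x" using z(2) by (simp add: add_Suc_right)
    from page_diff_eq[OF xc y this] have "?d (?B #>\<^bsub>E s t\<^esub> x) = ?B'"
      using ji[OF z'] E.coset_mult_one[OF subgroup.subset[OF subgroup_boundaries]] by simp
    then show "?B #>\<^bsub>E s t\<^esub> x \<in> kernel ?P ?P' ?d"
      using pc ZZ x by (auto simp: kernel_def page_def)
    show "?B #>\<^bsub>E s t\<^esub> x \<in> ?I \<longleftrightarrow> x \<in> boundaries X (Suc (Suc q)) s t"
      using I x ZZ by blast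
  next
    fix c assume "c \<in> kernel ?P ?P' ?d"
    then have c: "c \<in> carrier ?P" "?d c = ?B'" by (auto simp: kernel_def page_def)
    from c(1) obtain x y where xy: "c = ?B #>\<^bsub>E s t\<^esub> x" "x \<in> carrier (E s t)"
        "y \<in> carrier ?D" "?p y = ck X s t x"
      unfolding carrier_page unfolding cycles_Suc by auto
    have "?B' #>\<^bsub>?E'\<^esub> ?j y = ?B'" using page_diff_eq[OF xy(2-4)] c(2) xy(1) by simp
    then have "?j y \<in> ?B'" using E.r_coset_eq_subgroup_iff[OF subgroup_boundaries] xy(3) by simp
    then obtain w where w: "w \<in> carrier ?D" "?p w = \<one>\<^bsub>D (Suc s) t\<^esub>" "?j y = ?j w"
      unfolding boundaries_Suc by (auto simp: kernel_def)
    \<comment> \<open>Subtracting \<open>w\<close> does not change the image under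
      \<open>i^(r-1)\<close>, but now \<open>j\<close> vanishes, so \<open>?v\<close> comes from one
      step further up the tower. Thus \<open>x\<close> itself, without correction, is a cycle of the
      next page.\<close>
    let ?v = "y \<otimes>\<^bsub>?D\<^esub> inv\<^bsub>?D\<^esub> w"
    have "?v \<in> kernel ?D ?E' ?j" using w xy(3) by (simp add: kernel_def)
    then obtain z where z: "z \<in> carrier (D (Suc (s + Suc q)) (t - int q - 1))" "?v = ci X (s + Suc q) (t - int q) z"
      unfolding exact_ij[symmetric] by auto
    have "?p ?v = ck X s t x" using w xy by simp
    then have "ck X s t x = ci_pow X (Suc q) (Suc s) t z" using z(2) by (simp add: add_Suc_right)
    then have x: "x \<in> cycles X (Suc (Suc q)) s t" unfolding cycles_Suc2 using xy(2) z(1) by blast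
    have "(?B #>\<^bsub>E s t\<^esub> x) \<otimes>\<^bsub>?P\<^esub> inv\<^bsub>?P\<^esub> c = \<one>\<^bsub>?P\<^esub>" using c(1) xy(1) by simp
    then show "\<exists>x\<in>cycles X (Suc (Suc q)) s t. (?B #>\<^bsub>E s t\<^esub> x) \<otimes>\<^bsub>?P\<^esub> inv\<^bsub>?P\<^esub> c \<in> ?I"
      using x subgroup.one_closed[OF conjunct1[OF I]] by metis
  next
    show "subgroup (kernel ?P ?P' ?d) ?P" by (rule d.subgroup_kernel)
    show "?B #>\<^bsub>E s t\<^esub> (x \<otimes>\<^bsub>E s t\<^esub> y) = (?B #>\<^bsub>E s t\<^esub> x) \<otimes>\<^bsub>?P\<^esub> (?B #>\<^bsub>E s t\<^esub> y)"
      if "x \<in> cycles X (Suc (Suc q)) s t" "y \<in> cycles X (Suc (Suc q)) s t" for x y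
      using that ZZ pm by blast
  qed (use page_facts I page_comm_group E_group in blast)+
  then show ?thesis unfolding page_homology_def idx .
qed

theorem spectral_sequence: "spectral_sequence (page X) (page_diff X)"
  unfolding spectral_sequence_def
proof (intro allI impI)
  fix r s t assume "(1::nat) \<le> r"
  then obtain q where r: "r = Suc q" by (cases r) auto
  have 1: "t - int (Suc q) + 1 = t - int q" for t by simp
  show "comm_group (page X r s t) \<and>
        page_diff X r s t \<in> hom (page X r s t) (page X r (s + r) (t - int r + 1)) \<and>
        (\<forall>x \<in> carrier (page X r s t). page_diff X r (s + r) (t - int r + 1) (page_diff X r s t x)
            = \<one>\<^bsub>page X r (s + r + r) (t - int r + 1 - int r + 1)\<^esub>) \<and>
        page X (Suc r) s t \<cong> page_homology (page X) (page_diff X) r s t"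
    unfolding r 1 using page_comm_group page_diff_hom page_diff_square page_homology_iso by auto
qed

end

section \<open>Graded homomorphisms\<close>

text \<open>Elements of \<open>gr_hom\<close> are extensional in each degree, so composites and
  identities are restricted to the carrier of the source; equalities of homomorphisms are then
  equalities of functions.\<close>

definition gr_comp :: "('r, 'p) gr_module \<Rightarrow> (int \<Rightarrow> 'q \<Rightarrow> 'n) \<Rightarrow> (int \<Rightarrow> 'p \<Rightarrow> 'q) \<Rightarrow> int \<Rightarrow> 'p \<Rightarrow> 'n" where
  "gr_comp P f \<phi> = (\<lambda>n. \<lambda>x \<in> carrier (mgrp P n). f n (\<phi> n x))"

definition gr_id :: "('r, 'p) gr_module \<Rightarrow> int \<Rightarrow> 'p \<Rightarrow> 'p" where
  "gr_id P = (\<lambda>n. \<lambda>x \<in> carrier (mgrp P n). x)"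

lemma gr_homI:
  assumes "\<And>n x. x \<in> carrier (mgrp Q n) \<Longrightarrow> f n x \<in> carrier (mgrp Q' (n + d))"
    and "\<And>n x y. \<lbrakk>x \<in> carrier (mgrp Q n); y \<in> carrier (mgrp Q n)\<rbrakk>
      \<Longrightarrow> f n (x \<otimes>\<^bsub>mgrp Q n\<^esub> y) = f n x \<otimes>\<^bsub>mgrp Q' (n + d)\<^esub> f n y"
    and "\<And>n. f n \<in> extensional (carrier (mgrp Q n))"
    and "\<And>m n r x. \<lbrakk>r \<in> carrier (rgrp A m); x \<in> carrier (mgrp Q n)\<rbrakk>
      \<Longrightarrow> f (m + n) (mact Q m n r x) = mact Q' m (n + d) r (f n x)"
  shows "f \<in> gr_hom A Q Q' d"
  using assms by (auto simp: gr_hom_def hom_def)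

lemma gr_hom_hom: "f \<in> gr_hom A Q Q' d \<Longrightarrow> f n \<in> hom (mgrp Q n) (mgrp Q' (n + d))"
  by (simp add: gr_hom_def)

lemma gr_hom_closed:
  "\<lbrakk>f \<in> gr_hom A Q Q' d; x \<in> carrier (mgrp Q n)\<rbrakk> \<Longrightarrow> f n x \<in> carrier (mgrp Q' (n + d))"
  by (rule hom_in_carrier[OF gr_hom_hom])

lemma gr_hom_closed0:
  "\<lbrakk>f \<in> gr_hom A Q Q' 0; x \<in> carrier (mgrp Q n)\<rbrakk> \<Longrightarrow> f n x \<in> carrier (mgrp Q' n)"
  using gr_hom_closed[of f A Q Q' 0] by simp

lemma gr_hom_mult:
  "\<lbrakk>f \<in> gr_hom A Q Q' d; x \<in> carrier (mgrp Q n); y \<in> carrier (mgrp Q n)\<rbrakk>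
    \<Longrightarrow> f n (x \<otimes>\<^bsub>mgrp Q n\<^esub> y) = f n x \<otimes>\<^bsub>mgrp Q' (n + d)\<^esub> f n y"
  by (rule hom_mult[OF gr_hom_hom])

lemma gr_hom_act:
  "\<lbrakk>f \<in> gr_hom A Q Q' d; r \<in> carrier (rgrp A m); x \<in> carrier (mgrp Q n)\<rbrakk>
    \<Longrightarrow> f (m + n) (mact Q m n r x) = mact Q' m (n + d) r (f n x)"
  by (simp add: gr_hom_def)

lemma gr_hom_ext: "f \<in> gr_hom A Q Q' d \<Longrightarrow> f n \<in> extensional (carrier (mgrp Q n))"
  by (simp add: gr_hom_def)

lemma gr_hom_eqI:
  assumes "f \<in> gr_hom A Q Q' d" "g \<in> gr_hom A Q Q'' e"
    and "\<And>n x. x \<in> carrier (mgrp Q n) \<Longrightarrow> f n x = g n x"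
  shows "f = g"
proof
  fix n show "f n = g n"
    by (rule extensionalityI[OF gr_hom_ext[OF assms(1)] gr_hom_ext[OF assms(2)] assms(3)])
qed

lemma carrier_gr_Hom [simp]: "carrier (gr_Hom A Q Q' d) = gr_hom A Q Q' d"
  and one_gr_Hom: "\<one>\<^bsub>gr_Hom A Q Q' d\<^esub> = (\<lambda>n. \<lambda>x \<in> carrier (mgrp Q n). \<one>\<^bsub>mgrp Q' (n + d)\<^esub>)"
  and mult_gr_Hom: "f \<otimes>\<^bsub>gr_Hom A Q Q' d\<^esub> g
    = (\<lambda>n. \<lambda>x \<in> carrier (mgrp Q n). f n x \<otimes>\<^bsub>mgrp Q' (n + d)\<^esub> g n x)"
  by (simp_all add: gr_Hom_def)

section \<open>Groups of graded homomorphisms\<close>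

context graded_module
begin

sublocale M: comm_group "mgrp Q n" for n by (rule module_group)
sublocale R: comm_group "rgrp A n" for n by (rule ring_group)

lemma act_closed: "\<lbrakk>r \<in> carrier (rgrp A m); x \<in> carrier (mgrp Q n)\<rbrakk> \<Longrightarrow> mact Q m n r x \<in> carrier (mgrp Q (m + n))"
  by (rule hom_in_carrier[OF act_left_hom])

lemma act_mult: "\<lbrakk>r \<in> carrier (rgrp A m); x \<in> carrier (mgrp Q n); y \<in> carrier (mgrp Q n)\<rbrakk>
  \<Longrightarrow> mact Q m n r (x \<otimes>\<^bsub>mgrp Q n\<^esub> y) = mact Q m n r x \<otimes>\<^bsub>mgrp Q (m + n)\<^esub> mact Q m n r y"
  by (rule hom_mult[OF act_left_hom])

lemma act_zero: "r \<in> carrier (rgrp A m) \<Longrightarrow> mact Q m n r \<one>\<^bsub>mgrp Q n\<^esub> = \<one>\<^bsub>mgrp Q (m + n)\<^esub>"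
  by (rule hom_one[OF act_left_hom M.group_axioms M.group_axioms])

lemma act_zero_left: "x \<in> carrier (mgrp Q n) \<Longrightarrow> mact Q m n \<one>\<^bsub>rgrp A m\<^esub> x = \<one>\<^bsub>mgrp Q (m + n)\<^esub>"
  using hom_one[OF act_right_hom R.group_axioms M.group_axioms] by simp

lemma act_inv: "\<lbrakk>r \<in> carrier (rgrp A m); x \<in> carrier (mgrp Q n)\<rbrakk>
  \<Longrightarrow> mact Q m n r (inv\<^bsub>mgrp Q n\<^esub> x) = inv\<^bsub>mgrp Q (m + n)\<^esub> mact Q m n r x"
proof -
  assume r: "r \<in> carrier (rgrp A m)" and x: "x \<in> carrier (mgrp Q n)"
  interpret h: group_hom "mgrp Q n" "mgrp Q (m + n)" "mact Q m n r"
    by unfold_locales (rule act_left_hom[OF r])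
  show ?thesis using x by simp
qed

end

lemma gr_Hom_comm_group:
  assumes Q: "graded_module A Q" and Q': "graded_module A Q'"
  shows "comm_group (gr_Hom A Q Q' d)"
proof -
  interpret Q: graded_module A Q by fact
  interpret Q': graded_module A Q' by fact
  let ?H = "gr_Hom A Q Q' d"
  note closed = gr_hom_closed[of _ A Q Q' d]
  show ?thesis
  proof (rule comm_groupI)
    fix f g assume "f \<in> carrier ?H" "g \<in> carrier ?H"
    then have f: "f \<in> gr_hom A Q Q' d" and g: "g \<in> gr_hom A Q Q' d" by simp_all
    show "f \<otimes>\<^bsub>?H\<^esub> g \<in> carrier ?H"
      unfolding carrier_gr_Hom mult_gr_Hom
    proof (rule gr_homI)
      fix n x y assume xy: "x \<in> carrier (mgrp Q n)" "y \<in> carrier (mgrp Q n)"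
      then show "(\<lambda>x\<in>carrier (mgrp Q n). f n x \<otimes>\<^bsub>mgrp Q' (n + d)\<^esub> g n x) (x \<otimes>\<^bsub>mgrp Q n\<^esub> y)
        = (\<lambda>x\<in>carrier (mgrp Q n). f n x \<otimes>\<^bsub>mgrp Q' (n + d)\<^esub> g n x) x \<otimes>\<^bsub>mgrp Q' (n + d)\<^esub>
          (\<lambda>x\<in>carrier (mgrp Q n). f n x \<otimes>\<^bsub>mgrp Q' (n + d)\<^esub> g n x) y"
        using gr_hom_mult[OF f xy] gr_hom_mult[OF g xy] closed[OF f] closed[OF g]
        by (simp add: Q'.M.m_ac)
    next
      fix m n r x assume rx: "r \<in> carrier (rgrp A m)" "x \<in> carrier (mgrp Q n)"
      have [simp]: "m + (n + d) = m + n + d" by simp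
      show "(\<lambda>x\<in>carrier (mgrp Q (m + n)). f (m + n) x \<otimes>\<^bsub>mgrp Q' (m + n + d)\<^esub> g (m + n) x) (mact Q m n r x)
        = mact Q' m (n + d) r ((\<lambda>x\<in>carrier (mgrp Q n). f n x \<otimes>\<^bsub>mgrp Q' (n + d)\<^esub> g n x) x)"
        using rx gr_hom_act[OF f rx] gr_hom_act[OF g rx] Q'.act_mult[OF rx(1) closed[OF f rx(2)] closed[OF g rx(2)]]
          Q.act_closed[OF rx] by simp
    qed (use closed[OF f] closed[OF g] in auto)
    show "f \<otimes>\<^bsub>?H\<^esub> g = g \<otimes>\<^bsub>?H\<^esub> f"
      unfolding mult_gr_Hom using closed[OF f] closed[OF g] by (auto intro!: ext simp: Q'.M.m_comm)
    fix h assume "h \<in> carrier ?H"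
    then have h: "h \<in> gr_hom A Q Q' d" by simp
    show "f \<otimes>\<^bsub>?H\<^esub> g \<otimes>\<^bsub>?H\<^esub> h = f \<otimes>\<^bsub>?H\<^esub> (g \<otimes>\<^bsub>?H\<^esub> h)"
      unfolding mult_gr_Hom using closed[OF f] closed[OF g] closed[OF h]
      by (auto intro!: ext simp: Q'.M.m_assoc)
  next
    show "\<one>\<^bsub>?H\<^esub> \<in> carrier ?H"
      unfolding carrier_gr_Hom one_gr_Hom
      by (rule gr_homI) (auto simp: Q.act_closed Q'.act_zero add.assoc)
  next
    fix f assume "f \<in> carrier ?H"
    then have f: "f \<in> gr_hom A Q Q' d" by simp
    show "\<one>\<^bsub>?H\<^esub> \<otimes>\<^bsub>?H\<^esub> f = f"
      unfolding mult_gr_Hom one_gr_Hom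
    proof
      fix n show "(\<lambda>x\<in>carrier (mgrp Q n). (\<lambda>x\<in>carrier (mgrp Q n). \<one>\<^bsub>mgrp Q' (n + d)\<^esub>) x \<otimes>\<^bsub>mgrp Q' (n + d)\<^esub> f n x) = f n"
        by (rule extensionalityI[OF _ gr_hom_ext[OF f]]) (use closed[OF f] in auto)
    qed
    let ?g = "\<lambda>n. \<lambda>x\<in>carrier (mgrp Q n). inv\<^bsub>mgrp Q' (n + d)\<^esub> f n x"
    have "?g \<in> gr_hom A Q Q' d"
    proof (rule gr_homI)
      fix n x y assume xy: "x \<in> carrier (mgrp Q n)" "y \<in> carrier (mgrp Q n)"
      then show "?g n (x \<otimes>\<^bsub>mgrp Q n\<^esub> y) = ?g n x \<otimes>\<^bsub>mgrp Q' (n + d)\<^esub> ?g n y"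
        using gr_hom_mult[OF f xy] closed[OF f] by (simp add: Q'.M.inv_mult)
    next
      fix m n r x assume rx: "r \<in> carrier (rgrp A m)" "x \<in> carrier (mgrp Q n)"
      have [simp]: "m + (n + d) = m + n + d" by simp
      show "?g (m + n) (mact Q m n r x) = mact Q' m (n + d) r (?g n x)"
        using rx gr_hom_act[OF f rx] Q'.act_inv[OF rx(1) closed[OF f rx(2)]] Q.act_closed[OF rx] by simp
    qed (use closed[OF f] in auto)
    moreover have "?g \<otimes>\<^bsub>?H\<^esub> f = \<one>\<^bsub>?H\<^esub>"
      unfolding mult_gr_Hom one_gr_Hom using closed[OF f] by (auto intro!: ext)
    ultimately show "\<exists>g\<in>carrier ?H. g \<otimes>\<^bsub>?H\<^esub> f = \<one>\<^bsub>?H\<^esub>" by auto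
  qed
qed

lemma gr_comp_apply: "x \<in> carrier (mgrp P n) \<Longrightarrow> gr_comp P f \<phi> n x = f n (\<phi> n x)"
  by (simp add: gr_comp_def)

lemma gr_comp_closed:
  assumes P: "graded_module A P" and \<phi>: "\<phi> \<in> gr_hom A P Q 0" and f: "f \<in> gr_hom A Q L e"
  shows "gr_comp P f \<phi> \<in> gr_hom A P L e"
proof -
  interpret P: graded_module A P by fact
  note \<phi>c = gr_hom_closed0[OF \<phi>]
  show ?thesis
  proof (rule gr_homI)
    fix n x y assume xy: "x \<in> carrier (mgrp P n)" "y \<in> carrier (mgrp P n)"
    then show "gr_comp P f \<phi> n (x \<otimes>\<^bsub>mgrp P n\<^esub> y)
        = gr_comp P f \<phi> n x \<otimes>\<^bsub>mgrp L (n + e)\<^esub> gr_comp P f \<phi> n y"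
      using gr_hom_mult[OF \<phi> xy] gr_hom_mult[OF f \<phi>c \<phi>c] by (simp add: gr_comp_def)
  next
    fix m n r x assume rx: "r \<in> carrier (rgrp A m)" "x \<in> carrier (mgrp P n)"
    show "gr_comp P f \<phi> (m + n) (mact P m n r x) = mact L m (n + e) r (gr_comp P f \<phi> n x)"
      using gr_hom_act[OF \<phi> rx] gr_hom_act[OF f rx(1) \<phi>c[OF rx(2)]] P.act_closed[OF rx] rx
      by (simp add: gr_comp_def)
  qed (use gr_hom_closed[OF f \<phi>c] in \<open>auto simp: gr_comp_def\<close>)
qed

lemma gr_comp_assoc:
  assumes "\<phi> \<in> gr_hom A P Q 0"
  shows "gr_comp P (gr_comp Q f \<psi>) \<phi> = gr_comp P f (gr_comp P \<psi> \<phi>)"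
  using gr_hom_closed0[OF assms] by (auto simp: gr_comp_def intro!: ext)

lemma gr_id_closed: "graded_module A P \<Longrightarrow> gr_id P \<in> gr_hom A P P 0"
proof -
  assume "graded_module A P"
  then interpret graded_module A P .
  show ?thesis by (rule gr_homI) (auto simp: gr_id_def act_closed)
qed

lemma gr_comp_id: "f \<in> gr_hom A P Q e \<Longrightarrow> gr_comp P f (gr_id P) = f"
proof
  fix n assume f: "f \<in> gr_hom A P Q e"
  show "gr_comp P f (gr_id P) n = f n"
    by (rule extensionalityI[OF _ gr_hom_ext[OF f]]) (auto simp: gr_comp_def gr_id_def)
qed

lemma gr_id_comp: "\<phi> \<in> gr_hom A P Q 0 \<Longrightarrow> gr_comp P (gr_id Q) \<phi> = \<phi>"
proof
  fix n assume \<phi>: "\<phi> \<in> gr_hom A P Q 0"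
  show "gr_comp P (gr_id Q) \<phi> n = \<phi> n"
    by (rule extensionalityI[OF _ gr_hom_ext[OF \<phi>]])
      (auto simp: gr_comp_def gr_id_def gr_hom_closed0[OF \<phi>])
qed

lemma gr_comp_left_group_hom:
  assumes P: "graded_module A P" and Q: "graded_module A Q" and L: "graded_module A L"
    and \<phi>: "\<phi> \<in> gr_hom A P Q 0"
  shows "group_hom (gr_Hom A Q L e) (gr_Hom A P L e) (\<lambda>f. gr_comp P f \<phi>)"
proof -
  interpret G: comm_group "gr_Hom A Q L e" by (rule gr_Hom_comm_group[OF Q L])
  interpret H: comm_group "gr_Hom A P L e" by (rule gr_Hom_comm_group[OF P L])
  show ?thesis
  proof (unfold_locales, rule homI)
    show "gr_comp P f \<phi> \<in> carrier (gr_Hom A P L e)" if "f \<in> carrier (gr_Hom A Q L e)" for f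
      using gr_comp_closed[OF P \<phi>] that by simp
  qed (auto intro!: ext simp: mult_gr_Hom gr_comp_def gr_hom_closed0[OF \<phi>])
qed

lemma gr_comp_right_group_hom:
  assumes P: "graded_module A P" and Q: "graded_module A Q" and L: "graded_module A L"
    and f: "f \<in> gr_hom A Q L e"
  shows "group_hom (gr_Hom A P Q 0) (gr_Hom A P L e) (gr_comp P f)"
proof -
  interpret G: comm_group "gr_Hom A P Q 0" by (rule gr_Hom_comm_group[OF P Q])
  interpret H: comm_group "gr_Hom A P L e" by (rule gr_Hom_comm_group[OF P L])
  show ?thesis
  proof (unfold_locales, rule homI)
    show "gr_comp P f \<phi> \<in> carrier (gr_Hom A P L e)" if "\<phi> \<in> carrier (gr_Hom A P Q 0)" for \<phi>
      using gr_comp_closed[OF P _ f] that by simp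
  qed (auto intro!: ext simp: mult_gr_Hom gr_comp_def gr_hom_mult[OF f gr_hom_closed0 gr_hom_closed0])
qed

text \<open>Projectivity of \<open>P\<close> tested on one pair \<open>X\<close>, \<open>Y\<close>.
  Asking for containment of images, where the usual definition asks for surjectivity of
  \<open>g\<close>, covers lifts into kernels without forming kernel modules.\<close>

definition lifting :: "'r gr_ring \<Rightarrow> ('r, 'p) gr_module \<Rightarrow> ('r, 'x) gr_module \<Rightarrow> ('r, 'y) gr_module \<Rightarrow> bool" where
  "lifting A P X Y \<longleftrightarrow>
     (\<forall>f \<in> gr_hom A P Y 0. \<forall>g \<in> gr_hom A X Y 0.
        (\<forall>n. f n ` carrier (mgrp P n) \<subseteq> g n ` carrier (mgrp X n)) \<longrightarrow>
        (\<exists>h \<in> gr_hom A P X 0. gr_comp P g h = f))"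

text \<open>The lift is \<open>h i\<close> for a lift \<open>h\<close> of \<open>f p\<close>. This
  passes from coproducts of shifts of \<open>R\<close> to their retracts.\<close>

lemma lifting_retract:
  assumes Q: "graded_module A Q" and P: "graded_module A P"
    and i: "i \<in> gr_hom A P Q 0" and p: "p \<in> gr_hom A Q P 0" and pi: "gr_comp P p i = gr_id P"
    and l: "lifting A Q X Y"
  shows "lifting A P X Y"
  unfolding lifting_def
proof (intro ballI impI)
  fix f g assume f: "f \<in> gr_hom A P Y 0" and g: "g \<in> gr_hom A X Y 0"
    and s: "\<forall>n. f n ` carrier (mgrp P n) \<subseteq> g n ` carrier (mgrp X n)"
  have fp: "gr_comp Q f p \<in> gr_hom A Q Y 0" by (rule gr_comp_closed[OF Q p f])
  have "\<forall>n. gr_comp Q f p n ` carrier (mgrp Q n) \<subseteq> g n ` carrier (mgrp X n)"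
    using s gr_hom_closed0[OF p] by (auto simp: gr_comp_apply image_subset_iff)
  then obtain h where h: "h \<in> gr_hom A Q X 0" "gr_comp Q g h = gr_comp Q f p"
    using l fp g unfolding lifting_def by blast
  have "gr_comp P g (gr_comp P h i) = gr_comp P (gr_comp Q g h) i" using gr_comp_assoc[OF i] by metis
  also have "\<dots> = f" unfolding h(2) gr_comp_assoc[OF i] pi by (rule gr_comp_id[OF f])
  finally show "\<exists>h \<in> gr_hom A P X 0. gr_comp P g h = f" using gr_comp_closed[OF P i h(1)] by blast
qed

section \<open>Resolutions and their cohomology\<close>

text \<open>\<open>free_resolution\<close> with freeness dropped: the modules obtained from the
  objects \<open>P_s\<close> are only retracts of free ones, and projectivity enters separately
  through \<open>lifting\<close>.\<close>

definition resolution ::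
  "'r gr_ring \<Rightarrow> ('r, 'm) gr_module \<Rightarrow> (nat \<Rightarrow> ('r, 'q) gr_module)
   \<Rightarrow> (nat \<Rightarrow> int \<Rightarrow> 'q \<Rightarrow> 'q) \<Rightarrow> (int \<Rightarrow> 'q \<Rightarrow> 'm) \<Rightarrow> bool" where
  "resolution A L Q \<delta> \<epsilon> \<longleftrightarrow>
     graded_module A L \<and> (\<forall>s. graded_module A (Q s)) \<and>
     (\<forall>s. \<delta> s \<in> gr_hom A (Q (Suc s)) (Q s) 0) \<and> \<epsilon> \<in> gr_hom A (Q 0) L 0 \<and>
     (\<forall>n. \<epsilon> n ` carrier (mgrp (Q 0) n) = carrier (mgrp L n)) \<and>
     (\<forall>n. \<delta> 0 n ` carrier (mgrp (Q 1) n) = kernel (mgrp (Q 0) n) (mgrp L n) (\<epsilon> n)) \<and>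
     (\<forall>s n. \<delta> (Suc s) n ` carrier (mgrp (Q (Suc (Suc s))) n)
            = kernel (mgrp (Q (Suc s)) n) (mgrp (Q s) n) (\<delta> s n))"

lemma free_resolution_resolution:
  "\<lbrakk>graded_module A L; free_resolution A L Q \<delta> \<epsilon>\<rbrakk> \<Longrightarrow> resolution A L Q \<delta> \<epsilon>"
  by (auto simp: free_resolution_def resolution_def graded_free_def)

locale graded_resolution =
  fixes A :: "'r gr_ring" and L :: "('r, 'm) gr_module" and Q :: "nat \<Rightarrow> ('r, 'q) gr_module"
    and \<delta> :: "nat \<Rightarrow> int \<Rightarrow> 'q \<Rightarrow> 'q" and \<epsilon> :: "int \<Rightarrow> 'q \<Rightarrow> 'm"
  assumes res: "resolution A L Q \<delta> \<epsilon>"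
begin

lemma module: "graded_module A (Q s)" and L: "graded_module A L"
  and \<delta>: "\<delta> s \<in> gr_hom A (Q (Suc s)) (Q s) 0" and \<epsilon>: "\<epsilon> \<in> gr_hom A (Q 0) L 0"
  and \<epsilon>_onto: "\<epsilon> n ` carrier (mgrp (Q 0) n) = carrier (mgrp L n)"
  and exact_0: "\<delta> 0 n ` carrier (mgrp (Q (Suc 0)) n) = kernel (mgrp (Q 0) n) (mgrp L n) (\<epsilon> n)"
  and exact_Suc: "\<delta> (Suc s) n ` carrier (mgrp (Q (Suc (Suc s))) n)
            = kernel (mgrp (Q (Suc s)) n) (mgrp (Q s) n) (\<delta> s n)"
  using res by (auto simp: resolution_def)

sublocale Q: graded_module A "Q s" for s by (rule module)
sublocale L: graded_module A L by (rule L)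

lemma \<epsilon>\<delta>: "x \<in> carrier (mgrp (Q (Suc 0)) n) \<Longrightarrow> \<epsilon> n (\<delta> 0 n x) = \<one>\<^bsub>mgrp L n\<^esub>"
  using exact_0[of n] by (auto simp: kernel_def)

lemma \<delta>\<delta>: "x \<in> carrier (mgrp (Q (Suc (Suc s))) n) \<Longrightarrow> \<delta> s n (\<delta> (Suc s) n x) = \<one>\<^bsub>mgrp (Q s) n\<^esub>"
  using exact_Suc[of s n] by (auto simp: kernel_def)

lemma \<delta>\<delta>_one: "gr_comp (Q (Suc (Suc s))) (\<delta> s) (\<delta> (Suc s)) = \<one>\<^bsub>gr_Hom A (Q (Suc (Suc s))) (Q s) 0\<^esub>"
  unfolding one_gr_Hom gr_comp_def using \<delta>\<delta> by (auto intro!: ext)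

end

lemma gr_hom_one: "\<lbrakk>f \<in> gr_hom A P Q 0; graded_module A P; graded_module A Q\<rbrakk>
  \<Longrightarrow> f n \<one>\<^bsub>mgrp P n\<^esub> = \<one>\<^bsub>mgrp Q n\<^esub>"
  using hom_one[OF gr_hom_hom[of f A P Q 0 n]]
  by (simp add: graded_module.module_group comm_group.axioms(2))

lemma (in group_hom) hom_diff:
  "\<lbrakk>x \<in> carrier G; y \<in> carrier G\<rbrakk> \<Longrightarrow> h (x \<otimes> inv y) = h x \<otimes>\<^bsub>H\<^esub> inv\<^bsub>H\<^esub> h y"
  by simp

text \<open>The comparison theorem: the identity of \<open>L\<close> is lifted degree by
  degree.\<close>

lemma chain_lift:
  assumes P: "resolution A L P \<delta> \<epsilon>" and Q: "resolution A L Q \<delta>' \<epsilon>'"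
    and l_zero: "lifting A (P 0) (Q 0) L" and l_Suc: "\<And>s. lifting A (P (Suc s)) (Q (Suc s)) (Q s)"
  shows "\<exists>\<phi>. (\<forall>s. \<phi> s \<in> gr_hom A (P s) (Q s) 0) \<and> gr_comp (P 0) \<epsilon>' (\<phi> 0) = \<epsilon> \<and>
    (\<forall>s. gr_comp (P (Suc s)) (\<delta>' s) (\<phi> (Suc s)) = gr_comp (P (Suc s)) (\<phi> s) (\<delta> s))"
proof -
  interpret P: graded_resolution A L P \<delta> \<epsilon> by unfold_locales fact
  interpret Q: graded_resolution A L Q \<delta>' \<epsilon>' by unfold_locales fact
  let ?im = "\<lambda>s n. \<delta>' s n ` carrier (mgrp (Q (Suc s)) n)"
  \<comment> \<open>The last clause is what the next choice needs: the composite of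
    \<open>\<phi>\<close> with the differential must land in the image of \<open>\<delta>'\<close>.
    It is part of the invariant because it follows from exactness only together with the commuting
    square of the previous step.\<close>
  let ?P = "\<lambda>s \<phi>. \<phi> \<in> gr_hom A (P s) (Q s) 0 \<and> (s = 0 \<longrightarrow> gr_comp (P 0) \<epsilon>' \<phi> = \<epsilon>) \<and>
    (\<forall>n. \<forall>x \<in> carrier (mgrp (P (Suc s)) n). \<phi> n (\<delta> s n x) \<in> ?im s n)"
  let ?R = "\<lambda>s \<phi> \<psi>. gr_comp (P (Suc s)) (\<delta>' s) \<psi> = gr_comp (P (Suc s)) \<phi> (\<delta> s)"
  have "\<exists>\<phi>. \<forall>s. ?P s (\<phi> s) \<and> ?R s (\<phi> s) (\<phi> (Suc s))"
  proof (rule dependent_nat_choice)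
    have "\<forall>n. \<epsilon> n ` carrier (mgrp (P 0) n) \<subseteq> \<epsilon>' n ` carrier (mgrp (Q 0) n)"
      using P.\<epsilon>_onto Q.\<epsilon>_onto by simp
    then obtain \<phi> where \<phi>: "\<phi> \<in> gr_hom A (P 0) (Q 0) 0" "gr_comp (P 0) \<epsilon>' \<phi> = \<epsilon>"
      using l_zero P.\<epsilon> Q.\<epsilon> unfolding lifting_def by blast
    have "\<phi> n (\<delta> 0 n x) \<in> ?im 0 n" if x: "x \<in> carrier (mgrp (P (Suc 0)) n)" for n x
    proof -
      have dx: "\<delta> 0 n x \<in> carrier (mgrp (P 0) n)" by (rule gr_hom_closed0[OF P.\<delta> x])
      have "\<epsilon>' n (\<phi> n (\<delta> 0 n x)) = \<one>\<^bsub>mgrp L n\<^esub>"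
        using gr_comp_apply[OF dx, of \<epsilon>' \<phi>] P.\<epsilon>\<delta>[OF x] \<phi>(2) by simp
      then show ?thesis unfolding Q.exact_0 using gr_hom_closed0[OF \<phi>(1) dx] by (simp add: kernel_def)
    qed
    with \<phi> show "\<exists>\<phi>. ?P 0 \<phi>" by blast
  next
    fix \<phi> s assume \<phi>: "?P s \<phi>"
    have f: "gr_comp (P (Suc s)) \<phi> (\<delta> s) \<in> gr_hom A (P (Suc s)) (Q s) 0"
      by (rule gr_comp_closed[OF P.module P.\<delta>]) (use \<phi> in blast)
    have "\<forall>n. gr_comp (P (Suc s)) \<phi> (\<delta> s) n ` carrier (mgrp (P (Suc s)) n) \<subseteq> ?im s n"
      using \<phi> by (auto simp: gr_comp_apply)
    then obtain \<psi> where \<psi>: "\<psi> \<in> gr_hom A (P (Suc s)) (Q (Suc s)) 0" "?R s \<phi> \<psi>"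
      using l_Suc[of s] f Q.\<delta>[of s] unfolding lifting_def by blast
    have "\<psi> n (\<delta> (Suc s) n x) \<in> ?im (Suc s) n" if x: "x \<in> carrier (mgrp (P (Suc (Suc s))) n)" for n x
    proof -
      have dx: "\<delta> (Suc s) n x \<in> carrier (mgrp (P (Suc s)) n)" by (rule gr_hom_closed0[OF P.\<delta> x])
      have "\<delta>' s n (\<psi> n (\<delta> (Suc s) n x)) = \<phi> n \<one>\<^bsub>mgrp (P s) n\<^esub>"
        using gr_comp_apply[OF dx, of "\<delta>' s" \<psi>] gr_comp_apply[OF dx, of \<phi> "\<delta> s"] P.\<delta>\<delta>[OF x] \<psi>(2) by simp
      also have "\<dots> = \<one>\<^bsub>mgrp (Q s) n\<^esub>" using gr_hom_one \<phi> P.module Q.module by blast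
      finally show ?thesis unfolding Q.exact_Suc using gr_hom_closed0[OF \<psi>(1) dx] by (simp add: kernel_def)
    qed
    with \<psi> show "\<exists>\<psi>. ?P (Suc s) \<psi> \<and> ?R s \<phi> \<psi>" by blast
  qed
  then obtain \<phi> where \<phi>: "\<forall>s. ?P s (\<phi> s) \<and> ?R s (\<phi> s) (\<phi> (Suc s))" by blast
  then show ?thesis by blast
qed

text \<open>Each \<open>h\<close> lifts \<open>\<theta> - h \<delta>\<close> along the next
  differential. The invariant \<open>\<delta> h \<delta> = \<delta> \<theta>\<close> says that this
  difference is killed by \<open>\<delta>\<close>, hence by exactness lies in the image of the next
  differential.\<close>

lemma null_homotopy:
  assumes P: "resolution A L P \<delta> \<epsilon>" and l: "\<And>s. lifting A (P s) (P (Suc s)) (P s)"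
    and \<theta>: "\<And>s. \<theta> s \<in> gr_hom A (P s) (P s) 0"
    and \<epsilon>\<theta>: "gr_comp (P 0) \<epsilon> (\<theta> 0) = \<one>\<^bsub>gr_Hom A (P 0) L 0\<^esub>"
    and \<delta>\<theta>: "\<And>s. gr_comp (P (Suc s)) (\<delta> s) (\<theta> (Suc s)) = gr_comp (P (Suc s)) (\<theta> s) (\<delta> s)"
  shows "\<exists>h. (\<forall>s. h s \<in> gr_hom A (P s) (P (Suc s)) 0) \<and> gr_comp (P 0) (\<delta> 0) (h 0) = \<theta> 0 \<and>
    (\<forall>s. gr_comp (P (Suc s)) (\<delta> (Suc s)) (h (Suc s)) \<otimes>\<^bsub>gr_Hom A (P (Suc s)) (P (Suc s)) 0\<^esub>
         gr_comp (P (Suc s)) (h s) (\<delta> s) = \<theta> (Suc s))"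
proof -
  interpret P: graded_resolution A L P \<delta> \<epsilon> by unfold_locales fact
  let ?P = "\<lambda>s h. h \<in> gr_hom A (P s) (P (Suc s)) 0 \<and> (s = 0 \<longrightarrow> gr_comp (P 0) (\<delta> 0) h = \<theta> 0) \<and>
    gr_comp (P (Suc s)) (\<delta> s) (gr_comp (P (Suc s)) h (\<delta> s)) = gr_comp (P (Suc s)) (\<delta> s) (\<theta> (Suc s))"
  let ?R = "\<lambda>s h k. gr_comp (P (Suc s)) (\<delta> (Suc s)) k \<otimes>\<^bsub>gr_Hom A (P (Suc s)) (P (Suc s)) 0\<^esub>
         gr_comp (P (Suc s)) h (\<delta> s) = \<theta> (Suc s)"
  have "\<exists>h. \<forall>s. ?P s (h s) \<and> ?R s (h s) (h (Suc s))"
  proof (rule dependent_nat_choice)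
    have "\<theta> 0 n ` carrier (mgrp (P 0) n) \<subseteq> \<delta> 0 n ` carrier (mgrp (P (Suc 0)) n)" for n
    proof -
      have "\<epsilon> n (\<theta> 0 n x) = \<one>\<^bsub>mgrp L n\<^esub>" if "x \<in> carrier (mgrp (P 0) n)" for x
        using fun_cong[OF fun_cong[OF \<epsilon>\<theta>, of n], of x] that by (simp add: gr_comp_def one_gr_Hom)
      then show ?thesis unfolding P.exact_0 using gr_hom_closed0[OF \<theta>] by (auto simp: kernel_def)
    qed
    then obtain h where h: "h \<in> gr_hom A (P 0) (P (Suc 0)) 0" "gr_comp (P 0) (\<delta> 0) h = \<theta> 0"
      using l[of 0] \<theta>[of 0] P.\<delta>[of 0] unfolding lifting_def by blast
    have "gr_comp (P (Suc 0)) (\<delta> 0) (gr_comp (P (Suc 0)) h (\<delta> 0)) = gr_comp (P (Suc 0)) (\<theta> 0) (\<delta> 0)"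
      unfolding gr_comp_assoc[OF P.\<delta>, symmetric] h(2) ..
    then show "\<exists>h. ?P 0 h" using h \<delta>\<theta> by auto
  next
    fix h s assume h: "?P s h"
    let ?G = "gr_Hom A (P (Suc s)) (P (Suc s)) 0"
    interpret G: comm_group ?G by (rule gr_Hom_comm_group[OF P.module P.module])
    define D where "D = \<theta> (Suc s) \<otimes>\<^bsub>?G\<^esub> inv\<^bsub>?G\<^esub> gr_comp (P (Suc s)) h (\<delta> s)"
    have hd: "gr_comp (P (Suc s)) h (\<delta> s) \<in> carrier ?G"
      using gr_comp_closed[OF P.module P.\<delta>] h by auto
    have th: "\<theta> (Suc s) \<in> carrier ?G" using \<theta> by simp
    have D: "D \<in> gr_hom A (P (Suc s)) (P (Suc s)) 0" using hd th G.m_closed G.inv_closed unfolding D_def carrier_gr_Hom by metis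
    interpret d: group_hom ?G "gr_Hom A (P (Suc s)) (P s) 0" "gr_comp (P (Suc s)) (\<delta> s)"
      by (rule gr_comp_right_group_hom[OF P.module P.module P.module P.\<delta>])
    have "gr_comp (P (Suc s)) (\<delta> s) D = \<one>\<^bsub>gr_Hom A (P (Suc s)) (P s) 0\<^esub>"
      unfolding D_def d.hom_diff[OF th hd] using h d.H.r_inv[OF d.hom_closed[OF th]] by simp
    then have \<delta>D: "\<delta> s n (D n x) = \<one>\<^bsub>mgrp (P s) n\<^esub>" if "x \<in> carrier (mgrp (P (Suc s)) n)" for n x
      using that by (auto simp: gr_comp_def one_gr_Hom fun_eq_iff) (metis restrict_apply')
    have "D n ` carrier (mgrp (P (Suc s)) n) \<subseteq> \<delta> (Suc s) n ` carrier (mgrp (P (Suc (Suc s))) n)" for n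
      unfolding P.exact_Suc using \<delta>D gr_hom_closed0[OF D] by (auto simp: kernel_def)
    then obtain k where k: "k \<in> gr_hom A (P (Suc s)) (P (Suc (Suc s))) 0" "gr_comp (P (Suc s)) (\<delta> (Suc s)) k = D"
      using l[of "Suc s"] D P.\<delta>[of "Suc s"] unfolding lifting_def by blast
    let ?S = "P (Suc (Suc s))"
    let ?H = "gr_Hom A ?S (P (Suc s)) 0"
    interpret H: comm_group ?H by (rule gr_Hom_comm_group[OF P.module P.module])
    interpret e: group_hom ?G ?H "\<lambda>f. gr_comp ?S f (\<delta> (Suc s))"
      by (rule gr_comp_left_group_hom[OF P.module P.module P.module P.\<delta>])
    have hh: "h \<in> gr_hom A (P s) (P (Suc s)) 0" using h by blast
    interpret f: group_hom "gr_Hom A ?S (P s) 0" ?H "gr_comp ?S h"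
      by (rule gr_comp_right_group_hom[OF P.module P.module P.module hh])
    have "gr_comp ?S (\<delta> (Suc s)) (gr_comp ?S k (\<delta> (Suc s))) = gr_comp ?S D (\<delta> (Suc s))"
      unfolding gr_comp_assoc[OF P.\<delta>, symmetric] k(2) ..
    also have "\<dots> = gr_comp ?S (\<theta> (Suc s)) (\<delta> (Suc s)) \<otimes>\<^bsub>?H\<^esub>
        inv\<^bsub>?H\<^esub> gr_comp ?S (gr_comp (P (Suc s)) h (\<delta> s)) (\<delta> (Suc s))"
      unfolding D_def by (rule e.hom_diff[OF th hd])
    also have "gr_comp ?S (gr_comp (P (Suc s)) h (\<delta> s)) (\<delta> (Suc s)) = \<one>\<^bsub>?H\<^esub>"
      unfolding gr_comp_assoc[OF P.\<delta>] P.\<delta>\<delta>_one by simp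
    finally have "gr_comp ?S (\<delta> (Suc s)) (gr_comp ?S k (\<delta> (Suc s))) = gr_comp ?S (\<delta> (Suc s)) (\<theta> (Suc (Suc s)))"
      using e.hom_closed[OF th] by (simp add: \<delta>\<theta>)
    moreover have "?R s h k" 
      unfolding k(2) D_def G.m_assoc[OF th G.inv_closed[OF hd] hd] G.l_inv[OF hd] G.r_one[OF th] ..
    ultimately show "\<exists>k. ?P (Suc s) k \<and> ?R s h k" using k by blast
  qed
  then obtain h where h: "\<forall>s. ?P s (h s) \<and> ?R s (h s) (h (Suc s))" by blast
  then show ?thesis by blast
qed

section \<open>Cohomology of Hom into a fixed module\<close>

context graded_resolution
begin

lemma coboundary_eq: "coboundary Q \<delta> s f = gr_comp (Q (Suc s)) f (\<delta> s)"
  by (simp add: coboundary_def gr_comp_def)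

definition cocycles :: "('r, 'n) gr_module \<Rightarrow> nat \<Rightarrow> int \<Rightarrow> (int \<Rightarrow> 'q \<Rightarrow> 'n) set" where
  "cocycles L' s t = {f \<in> gr_hom A (Q s) L' (- t). gr_comp (Q (Suc s)) f (\<delta> s) = \<one>\<^bsub>gr_Hom A (Q (Suc s)) L' (- t)\<^esub>}"

definition cobounds :: "('r, 'n) gr_module \<Rightarrow> nat \<Rightarrow> int \<Rightarrow> (int \<Rightarrow> 'q \<Rightarrow> 'n) set" where
  "cobounds L' s t = (case s of 0 \<Rightarrow> {\<one>\<^bsub>gr_Hom A (Q 0) L' (- t)\<^esub>}
     | Suc s' \<Rightarrow> (\<lambda>f. gr_comp (Q (Suc s')) f (\<delta> s')) ` gr_hom A (Q s') L' (- t))"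

lemma Hom_cohomology_eq:
  "Hom_cohomology A Q \<delta> L' s t = (gr_Hom A (Q s) L' (- t))\<lparr>carrier := cocycles L' s t\<rparr> Mod cobounds L' s t"
proof -
  have "cobounds L' s t = (case s of 0 \<Rightarrow> {\<one>\<^bsub>cochains A Q L' 0 t\<^esub>}
      | Suc s' \<Rightarrow> coboundary Q \<delta> s' ` carrier (cochains A Q L' s' t))"
    by (cases s) (simp_all add: cobounds_def cochains_def coboundary_eq)
  then show ?thesis
    by (simp add: Hom_cohomology_def cochains_def cocycles_def kernel_def coboundary_eq)
qed

context
  fixes L' :: "('r, 'n) gr_module"
  assumes L': "graded_module A L'"
begin

lemma pull_group_hom:
  "group_hom (gr_Hom A (Q s) L' e) (gr_Hom A (Q (Suc s)) L' e) (\<lambda>f. gr_comp (Q (Suc s)) f (\<delta> s))"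
  by (rule gr_comp_left_group_hom[OF module module L' \<delta>])

lemma cocycles_subgroup: "subgroup (cocycles L' s t) (gr_Hom A (Q s) L' (- t))"
  using group_hom.subgroup_kernel[OF pull_group_hom[of s "- t"]] by (simp add: kernel_def cocycles_def)

lemma cobounds_subgroup: "subgroup (cobounds L' s t) (gr_Hom A (Q s) L' (- t))"
proof (cases s)
  case 0
  interpret G: comm_group "gr_Hom A (Q 0) L' (- t)" by (rule gr_Hom_comm_group[OF module L'])
  show ?thesis using G.triv_subgroup by (simp add: cobounds_def 0)
next
  case (Suc s')
  then show ?thesis using group_hom.img_is_subgroup[OF pull_group_hom[of s' "- t"]]
    by (simp add: cobounds_def)
qed

lemma cobounds_cocycles: "cobounds L' s t \<subseteq> cocycles L' s t"
proof (cases s)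
  case 0
  then show ?thesis using subgroup.one_closed[OF cocycles_subgroup[of s t]] by (simp add: cobounds_def)
next
  case (Suc s')
  have "gr_comp (Q (Suc (Suc s'))) (gr_comp (Q (Suc s')) f (\<delta> s')) (\<delta> (Suc s'))
     = \<one>\<^bsub>gr_Hom A (Q (Suc (Suc s'))) L' (- t)\<^esub>" if f: "f \<in> gr_hom A (Q s') L' (- t)" for f
  proof -
    interpret f: group_hom "gr_Hom A (Q (Suc (Suc s'))) (Q s') 0" "gr_Hom A (Q (Suc (Suc s'))) L' (- t)"
      "gr_comp (Q (Suc (Suc s'))) f" by (rule gr_comp_right_group_hom[OF module module L' f])
    show ?thesis unfolding gr_comp_assoc[OF \<delta>] \<delta>\<delta>_one by simp
  qed
  then show ?thesis using gr_comp_closed[OF module \<delta>] by (auto simp: Suc cobounds_def cocycles_def)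
qed

text \<open>\<open>\<chi> - 1\<close> lies over zero on \<open>L\<close>, so it equals
  \<open>\<delta> h + h \<delta>\<close>. For a cocycle \<open>z\<close> the term
  \<open>z \<delta> h\<close> vanishes and \<open>z h \<delta>\<close> is a coboundary; in degree
  zero only the first term occurs.\<close>

lemma chain_endo_cohomologous:
  assumes l: "\<And>s. lifting A (Q s) (Q (Suc s)) (Q s)"
    and \<chi>: "\<And>s. \<chi> s \<in> gr_hom A (Q s) (Q s) 0"
    and \<epsilon>\<chi>: "gr_comp (Q 0) \<epsilon> (\<chi> 0) = \<epsilon>"
    and \<delta>\<chi>: "\<And>s. gr_comp (Q (Suc s)) (\<delta> s) (\<chi> (Suc s)) = gr_comp (Q (Suc s)) (\<chi> s) (\<delta> s)"
    and z: "z \<in> cocycles L' s t"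
  shows "gr_comp (Q s) z (\<chi> s) \<otimes>\<^bsub>gr_Hom A (Q s) L' (- t)\<^esub> inv\<^bsub>gr_Hom A (Q s) L' (- t)\<^esub> z \<in> cobounds L' s t"
proof -
  let ?E = "\<lambda>s. gr_Hom A (Q s) (Q s) 0"
  define \<theta> where "\<theta> s = \<chi> s \<otimes>\<^bsub>?E s\<^esub> inv\<^bsub>?E s\<^esub> gr_id (Q s)" for s
  have E: "comm_group (?E s)" for s by (rule gr_Hom_comm_group[OF module module])
  have \<chi>': "\<chi> s \<in> carrier (?E s)" and i': "gr_id (Q s) \<in> carrier (?E s)" for s
    using \<chi> gr_id_closed[OF module] by auto
  have \<theta>: "\<theta> s \<in> gr_hom A (Q s) (Q s) 0" for s
  proof -
    interpret E: comm_group "?E s" by (rule E)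
    show ?thesis using E.m_closed[OF \<chi>' E.inv_closed[OF i']] by (simp add: \<theta>_def)
  qed
  have r: "gr_comp (Q s) f (\<theta> s) = gr_comp (Q s) f (\<chi> s) \<otimes>\<^bsub>gr_Hom A (Q s) K e\<^esub> inv\<^bsub>gr_Hom A (Q s) K e\<^esub> f"
    if f: "f \<in> gr_hom A (Q s) K e" and K: "graded_module A K" for f e s and K :: "('r, 'k) gr_module"
  proof -
    interpret h: group_hom "?E s" "gr_Hom A (Q s) K e" "gr_comp (Q s) f"
      by (rule gr_comp_right_group_hom[OF module module K f])
    show ?thesis unfolding \<theta>_def h.hom_diff[OF \<chi>' i'] gr_comp_id[OF f] ..
  qed
  have "gr_comp (Q 0) \<epsilon> (\<theta> 0) = \<one>\<^bsub>gr_Hom A (Q 0) L 0\<^esub>"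
  proof -
    interpret K: comm_group "gr_Hom A (Q 0) L 0" by (rule gr_Hom_comm_group[OF module L])
    show ?thesis unfolding r[OF \<epsilon> L] \<epsilon>\<chi> using \<epsilon> by (simp add: K.r_inv)
  qed
  moreover have "gr_comp (Q (Suc s)) (\<delta> s) (\<theta> (Suc s)) = gr_comp (Q (Suc s)) (\<theta> s) (\<delta> s)" for s
  proof -
    interpret h: group_hom "?E s" "gr_Hom A (Q (Suc s)) (Q s) 0" "\<lambda>f. gr_comp (Q (Suc s)) f (\<delta> s)"
      by (rule gr_comp_left_group_hom[OF module module module \<delta>])
    show ?thesis unfolding r[OF \<delta> module] \<delta>\<chi> unfolding \<theta>_def h.hom_diff[OF \<chi>' i'] gr_id_comp[OF \<delta>] ..
  qed
  ultimately obtain h where h: "\<And>s. h s \<in> gr_hom A (Q s) (Q (Suc s)) 0" "gr_comp (Q 0) (\<delta> 0) (h 0) = \<theta> 0"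
    "\<And>s. gr_comp (Q (Suc s)) (\<delta> (Suc s)) (h (Suc s)) \<otimes>\<^bsub>?E (Suc s)\<^esub> gr_comp (Q (Suc s)) (h s) (\<delta> s) = \<theta> (Suc s)"
    using null_homotopy[OF res l \<theta>] by blast
  have z': "z \<in> gr_hom A (Q s) L' (- t)" "gr_comp (Q (Suc s)) z (\<delta> s) = \<one>\<^bsub>gr_Hom A (Q (Suc s)) L' (- t)\<^esub>"
    using z by (auto simp: cocycles_def)
  have zdh: "gr_comp (Q s) z (gr_comp (Q s) (\<delta> s) (h s)) = \<one>\<^bsub>gr_Hom A (Q s) L' (- t)\<^esub>"
  proof -
    interpret k: group_hom "gr_Hom A (Q (Suc s)) L' (- t)" "gr_Hom A (Q s) L' (- t)" "\<lambda>f. gr_comp (Q s) f (h s)"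
      by (rule gr_comp_left_group_hom[OF module module L' h(1)])
    show ?thesis unfolding gr_comp_assoc[OF h(1), symmetric] z'(2) by simp
  qed
  have "gr_comp (Q s) z (\<theta> s) \<in> cobounds L' s t"
  proof (cases s)
    case 0
    then show ?thesis using zdh h(2) by (simp add: cobounds_def)
  next
    case (Suc s')
    interpret k: group_hom "?E s" "gr_Hom A (Q s) L' (- t)" "gr_comp (Q s) z"
      by (rule gr_comp_right_group_hom[OF module module L' z'(1)])
    have 1: "gr_comp (Q s) (\<delta> s) (h s) \<in> carrier (?E s)" using gr_comp_closed[OF module h(1) \<delta>] by simp
    have 2: "gr_comp (Q s) (h s') (\<delta> s') \<in> carrier (?E s)" using gr_comp_closed[OF module \<delta> h(1)] Suc by simp
    have 3: "gr_comp (Q s') z (h s') \<in> gr_hom A (Q s') L' (- t)"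
      using gr_comp_closed[OF module h(1)] z'(1) Suc by blast
    have 4: "gr_comp (Q s) z (gr_comp (Q s) (h s') (\<delta> s')) = gr_comp (Q s) (gr_comp (Q s') z (h s')) (\<delta> s')"
      using gr_comp_assoc[OF \<delta>] Suc by metis
    have "gr_comp (Q s) z (\<theta> s) = gr_comp (Q s) z (gr_comp (Q s) (\<delta> s) (h s) \<otimes>\<^bsub>?E s\<^esub> gr_comp (Q s) (h s') (\<delta> s'))"
      using h(3)[of s'] Suc by simp
    also have "\<dots> = gr_comp (Q s) (gr_comp (Q s') z (h s')) (\<delta> s')"
      using k.hom_mult[OF 1 2] zdh k.hom_closed[OF 2] 4 by simp
    finally show ?thesis using 3 Suc by (auto simp: cobounds_def)
  qed
  then show ?thesis unfolding r[OF z'(1) L'] .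
qed

end

end

text \<open>Chain maps in both directions exist by lifting, and both composites lie over the
  identity of \<open>L\<close>, hence act as the identity modulo coboundaries. The element types of
  \<open>P\<close> and \<open>Q\<close> differ, so the lifting property is assumed for each of the
  four combinations separately.\<close>

theorem Hom_cohomology_iso:
  fixes P :: "nat \<Rightarrow> ('r, 'p) gr_module" and Q :: "nat \<Rightarrow> ('r, 'q) gr_module" and L :: "('r, 'm) gr_module"
    and L' :: "('r, 'n) gr_module"
  assumes P: "resolution A L P \<delta> \<epsilon>" and Q: "resolution A L Q \<delta>' \<epsilon>'" and L': "graded_module A L'"
    and PP: "\<And>s. lifting A (P s) (P (Suc s)) (P s)" and QQ: "\<And>s. lifting A (Q s) (Q (Suc s)) (Q s)"
    and PQ: "lifting A (P 0) (Q 0) L" "\<And>s. lifting A (P (Suc s)) (Q (Suc s)) (Q s)"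
    and QP: "lifting A (Q 0) (P 0) L" "\<And>s. lifting A (Q (Suc s)) (P (Suc s)) (P s)"
  shows "Hom_cohomology A P \<delta> L' s t \<cong> Hom_cohomology A Q \<delta>' L' s t"
proof -
  interpret P: graded_resolution A L P \<delta> \<epsilon> by unfold_locales fact
  interpret Q: graded_resolution A L Q \<delta>' \<epsilon>' by unfold_locales fact
  obtain \<phi> where \<phi>: "\<And>s. \<phi> s \<in> gr_hom A (P s) (Q s) 0" "gr_comp (P 0) \<epsilon>' (\<phi> 0) = \<epsilon>"
    "\<And>s. gr_comp (P (Suc s)) (\<delta>' s) (\<phi> (Suc s)) = gr_comp (P (Suc s)) (\<phi> s) (\<delta> s)"
    using chain_lift[OF P Q PQ] by blast
  obtain \<psi> where \<psi>: "\<And>s. \<psi> s \<in> gr_hom A (Q s) (P s) 0" "gr_comp (Q 0) \<epsilon> (\<psi> 0) = \<epsilon>'"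
    "\<And>s. gr_comp (Q (Suc s)) (\<delta> s) (\<psi> (Suc s)) = gr_comp (Q (Suc s)) (\<psi> s) (\<delta>' s)"
    using chain_lift[OF Q P QP] by blast
  let ?G = "gr_Hom A (P s) L' (- t)" and ?H = "gr_Hom A (Q s) L' (- t)"
  interpret G: comm_group ?G by (rule gr_Hom_comm_group[OF P.module L'])
  interpret H: comm_group ?H by (rule gr_Hom_comm_group[OF Q.module L'])
  let ?Z = "P.cocycles L' s t" and ?B = "P.cobounds L' s t"
  let ?Y = "Q.cocycles L' s t" and ?C = "Q.cobounds L' s t"
  interpret a: group_hom ?G ?H "\<lambda>f. gr_comp (Q s) f (\<psi> s)"
    by (rule gr_comp_left_group_hom[OF Q.module P.module L' \<psi>(1)])
  have a: "gr_comp (Q s) f (\<psi> s) \<in> ?Y" if f: "f \<in> ?Z" for f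
  proof -
    have f': "f \<in> gr_hom A (P s) L' (- t)" "gr_comp (P (Suc s)) f (\<delta> s) = \<one>\<^bsub>gr_Hom A (P (Suc s)) L' (- t)\<^esub>"
      using f by (auto simp: P.cocycles_def)
    interpret k: group_hom "gr_Hom A (P (Suc s)) L' (- t)" "gr_Hom A (Q (Suc s)) L' (- t)" "\<lambda>f. gr_comp (Q (Suc s)) f (\<psi> (Suc s))"
      by (rule gr_comp_left_group_hom[OF Q.module P.module L' \<psi>(1)])
    have "gr_comp (Q (Suc s)) (gr_comp (Q s) f (\<psi> s)) (\<delta>' s) = \<one>\<^bsub>gr_Hom A (Q (Suc s)) L' (- t)\<^esub>"
      unfolding gr_comp_assoc[OF Q.\<delta>] \<psi>(3)[symmetric] gr_comp_assoc[OF \<psi>(1), symmetric] f'(2) by simp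
    then show ?thesis using gr_comp_closed[OF Q.module \<psi>(1) f'(1)] by (simp add: Q.cocycles_def)
  qed
  have b: "gr_comp (P s) f (\<phi> s) \<in> ?Z" if f: "f \<in> ?Y" for f
  proof -
    have f': "f \<in> gr_hom A (Q s) L' (- t)" "gr_comp (Q (Suc s)) f (\<delta>' s) = \<one>\<^bsub>gr_Hom A (Q (Suc s)) L' (- t)\<^esub>"
      using f by (auto simp: Q.cocycles_def)
    interpret k: group_hom "gr_Hom A (Q (Suc s)) L' (- t)" "gr_Hom A (P (Suc s)) L' (- t)" "\<lambda>f. gr_comp (P (Suc s)) f (\<phi> (Suc s))"
      by (rule gr_comp_left_group_hom[OF P.module Q.module L' \<phi>(1)])
    have "gr_comp (P (Suc s)) (gr_comp (P s) f (\<phi> s)) (\<delta> s) = \<one>\<^bsub>gr_Hom A (P (Suc s)) L' (- t)\<^esub>"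
      unfolding gr_comp_assoc[OF P.\<delta>] \<phi>(3)[symmetric] gr_comp_assoc[OF \<phi>(1), symmetric] f'(2) by simp
    then show ?thesis using gr_comp_closed[OF P.module \<phi>(1) f'(1)] by (simp add: P.cocycles_def)
  qed
  have aB: "gr_comp (Q s) f (\<psi> s) \<in> ?C" if f: "f \<in> ?B" for f
  proof (cases s)
    case 0
    then show ?thesis using f a.hom_one by (simp add: P.cobounds_def Q.cobounds_def)
  next
    case (Suc s')
    with f obtain g where g: "g \<in> gr_hom A (P s') L' (- t)" "f = gr_comp (P (Suc s')) g (\<delta> s')"
      by (auto simp: P.cobounds_def)
    have "gr_comp (Q s) f (\<psi> s) = gr_comp (Q (Suc s')) (gr_comp (Q s') g (\<psi> s')) (\<delta>' s')"
      unfolding g(2) Suc gr_comp_assoc[OF Q.\<delta>] \<psi>(3)[symmetric] gr_comp_assoc[OF \<psi>(1)] ..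
    then show ?thesis using gr_comp_closed[OF Q.module \<psi>(1) g(1)] Suc by (auto simp: Q.cobounds_def)
  qed
  have bC: "gr_comp (P s) f (\<phi> s) \<in> ?B" if f: "f \<in> ?C" for f
  proof (cases s)
    case 0
    interpret b: group_hom ?H ?G "\<lambda>f. gr_comp (P s) f (\<phi> s)"
      by (rule gr_comp_left_group_hom[OF P.module Q.module L' \<phi>(1)])
    show ?thesis using f b.hom_one 0 by (simp add: P.cobounds_def Q.cobounds_def)
  next
    case (Suc s')
    with f obtain g where g: "g \<in> gr_hom A (Q s') L' (- t)" "f = gr_comp (Q (Suc s')) g (\<delta>' s')"
      by (auto simp: Q.cobounds_def)
    have "gr_comp (P s) f (\<phi> s) = gr_comp (P (Suc s')) (gr_comp (P s') g (\<phi> s')) (\<delta> s')"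
      unfolding g(2) Suc gr_comp_assoc[OF P.\<delta>] \<phi>(3)[symmetric] gr_comp_assoc[OF \<phi>(1)] ..
    then show ?thesis using gr_comp_closed[OF P.module \<phi>(1) g(1)] Suc by (auto simp: P.cobounds_def)
  qed
  have ab: "gr_comp (Q s) (gr_comp (P s) z (\<phi> s)) (\<psi> s) \<otimes>\<^bsub>?H\<^esub> inv\<^bsub>?H\<^esub> z \<in> ?C" if z: "z \<in> ?Y" for z
    unfolding gr_comp_assoc[OF \<psi>(1)]
  proof (rule Q.chain_endo_cohomologous[OF L' QQ _ _ _ z])
    show "gr_comp (Q s) (\<phi> s) (\<psi> s) \<in> gr_hom A (Q s) (Q s) 0" for s
      by (rule gr_comp_closed[OF Q.module \<psi>(1) \<phi>(1)])
    show "gr_comp (Q 0) \<epsilon>' (gr_comp (Q 0) (\<phi> 0) (\<psi> 0)) = \<epsilon>'"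
      unfolding gr_comp_assoc[OF \<psi>(1), symmetric] \<phi>(2) by (rule \<psi>(2))
    show "gr_comp (Q (Suc s)) (\<delta>' s) (gr_comp (Q (Suc s)) (\<phi> (Suc s)) (\<psi> (Suc s)))
        = gr_comp (Q (Suc s)) (gr_comp (Q s) (\<phi> s) (\<psi> s)) (\<delta>' s)" for s
      unfolding gr_comp_assoc[OF \<psi>(1), symmetric] \<phi>(3)
      unfolding gr_comp_assoc[OF \<psi>(1)] gr_comp_assoc[OF Q.\<delta>] \<psi>(3) ..
  qed
  have ba: "gr_comp (P s) (gr_comp (Q s) z (\<psi> s)) (\<phi> s) \<otimes>\<^bsub>?G\<^esub> inv\<^bsub>?G\<^esub> z \<in> ?B" if z: "z \<in> ?Z" for z
    unfolding gr_comp_assoc[OF \<phi>(1)]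
  proof (rule P.chain_endo_cohomologous[OF L' PP _ _ _ z])
    show "gr_comp (P s) (\<psi> s) (\<phi> s) \<in> gr_hom A (P s) (P s) 0" for s
      by (rule gr_comp_closed[OF P.module \<phi>(1) \<psi>(1)])
    show "gr_comp (P 0) \<epsilon> (gr_comp (P 0) (\<psi> 0) (\<phi> 0)) = \<epsilon>"
      unfolding gr_comp_assoc[OF \<phi>(1), symmetric] \<psi>(2) by (rule \<phi>(2))
    show "gr_comp (P (Suc s)) (\<delta> s) (gr_comp (P (Suc s)) (\<psi> (Suc s)) (\<phi> (Suc s)))
        = gr_comp (P (Suc s)) (gr_comp (P s) (\<psi> s) (\<phi> s)) (\<delta> s)" for s
      unfolding gr_comp_assoc[OF \<phi>(1), symmetric] \<psi>(3)
      unfolding gr_comp_assoc[OF \<phi>(1)] gr_comp_assoc[OF P.\<delta>] \<phi>(3) ..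
  qed
  note fP = P.cocycles_subgroup[OF L'] P.cobounds_subgroup[OF L'] P.cobounds_cocycles[OF L']
  note fQ = Q.cocycles_subgroup[OF L'] Q.cobounds_subgroup[OF L'] Q.cobounds_cocycles[OF L']
  have Zc: "f \<in> ?Z \<Longrightarrow> f \<in> carrier ?G" for f using subgroup.mem_carrier[OF fP(1)] .
  show ?thesis
    unfolding P.Hom_cohomology_eq Q.Hom_cohomology_eq
  proof (rule subquotient_iso[OF G.comm_group_axioms fP H.comm_group_axioms fQ, where a = "\<lambda>f. gr_comp (Q s) f (\<psi> s)"])
    show "gr_comp (Q s) f (\<psi> s) \<in> ?Y" if "f \<in> ?Z" for f by (rule a[OF that])
    show "gr_comp (Q s) (f \<otimes>\<^bsub>?G\<^esub> g) (\<psi> s) = gr_comp (Q s) f (\<psi> s) \<otimes>\<^bsub>?H\<^esub> gr_comp (Q s) g (\<psi> s)"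
      if "f \<in> ?Z" "g \<in> ?Z" for f g using a.hom_mult Zc that by blast
    show "\<exists>x\<in>?Z. gr_comp (Q s) x (\<psi> s) \<otimes>\<^bsub>?H\<^esub> inv\<^bsub>?H\<^esub> z \<in> ?C" if "z \<in> ?Y" for z
      using ab[OF that] b[OF that] by blast
    show "gr_comp (Q s) f (\<psi> s) \<in> ?C \<longleftrightarrow> f \<in> ?B" if f: "f \<in> ?Z" for f
    proof
      assume "gr_comp (Q s) f (\<psi> s) \<in> ?C"
      from bC[OF this] have 1: "gr_comp (P s) (gr_comp (Q s) f (\<psi> s)) (\<phi> s) \<in> ?B" (is "?f \<in> ?B") .
      have c: "?f \<in> carrier ?G" using subgroup.mem_carrier[OF fP(2) 1] .
      \<comment> \<open>Injectivity: \<open>?f\<close> differs from \<open>f\<close> by the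
        coboundary of \<open>ba\<close>, so \<open>f\<close> is a coboundary as soon as
        \<open>?f\<close> is.\<close>
      have "f = inv\<^bsub>?G\<^esub> (?f \<otimes>\<^bsub>?G\<^esub> inv\<^bsub>?G\<^esub> f) \<otimes>\<^bsub>?G\<^esub> ?f"
        using c Zc[OF f] by (simp add: G.inv_mult G.m_ac del: carrier_gr_Hom)
      then show "f \<in> ?B" using subgroup.m_closed[OF fP(2) subgroup.m_inv_closed[OF fP(2) ba[OF f]] 1] by simp
    qed (rule aB)
  qed
qed

section \<open>Free graded modules\<close>

text \<open>For infinite \<open>F\<close> both products are the unit by convention, which
  \<open>h\<close> preserves.\<close>

lemma hom_finprod:
  assumes G: "comm_group G" and H: "comm_group H" and h: "h \<in> hom G H" and f: "f \<in> F \<rightarrow> carrier G"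
  shows "h (finprod G f F) = finprod H (\<lambda>i. h (f i)) F"
proof -
  interpret G: comm_group G by fact
  interpret H: comm_group H by fact
  interpret h: group_hom G H h by unfold_locales fact
  show ?thesis using f
  proof (induction F rule: infinite_finite_induct)
    case (insert a F)
    then have "(\<lambda>i. h (f i)) \<in> F \<rightarrow> carrier H" by (auto simp: Pi_iff)
    with insert show ?case by (simp add: Pi_iff)
  qed auto
qed

text \<open>Degree \<open>n\<close> of the free module on generators of degrees \<open>d i\<close>:
  such a generator takes coefficients of degree \<open>n - d i\<close>.\<close>

definition coefs :: "'r gr_ring \<Rightarrow> 'i set \<Rightarrow> ('i \<Rightarrow> int) \<Rightarrow> int \<Rightarrow> ('i \<Rightarrow> 'r) monoid" where
  "coefs A I d n = sum_group I (\<lambda>i. rgrp A (n - d i))"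

definition supp :: "'r gr_ring \<Rightarrow> 'i set \<Rightarrow> ('i \<Rightarrow> int) \<Rightarrow> int \<Rightarrow> ('i \<Rightarrow> 'r) \<Rightarrow> 'i set" where
  "supp A I d n c = {i \<in> I. c i \<noteq> \<one>\<^bsub>rgrp A (n - d i)\<^esub>}"

definition lin_comb ::
  "'r gr_ring \<Rightarrow> ('r, 'm) gr_module \<Rightarrow> 'i set \<Rightarrow> ('i \<Rightarrow> int) \<Rightarrow> ('i \<Rightarrow> 'm) \<Rightarrow> int \<Rightarrow> ('i \<Rightarrow> 'r) \<Rightarrow> 'm" where
  "lin_comb A Q I d b n c =
     finprod (mgrp Q n) (\<lambda>i. mact Q (n - d i) (d i) (c i) (b i)) (supp A I d n c)"

definition scale :: "'r gr_ring \<Rightarrow> 'i set \<Rightarrow> ('i \<Rightarrow> int) \<Rightarrow> int \<Rightarrow> int \<Rightarrow> 'r \<Rightarrow> ('i \<Rightarrow> 'r) \<Rightarrow> 'i \<Rightarrow> 'r" where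
  "scale A I d m n r c = (\<lambda>i\<in>I. rmul A m (n - d i) r (c i))"

definition single :: "'r gr_ring \<Rightarrow> 'i set \<Rightarrow> ('i \<Rightarrow> int) \<Rightarrow> int \<Rightarrow> 'i \<Rightarrow> 'r \<Rightarrow> 'i \<Rightarrow> 'r" where
  "single A I d n i r = (\<lambda>j\<in>I. if j = i then r else \<one>\<^bsub>rgrp A (n - d j)\<^esub>)"

text \<open>The basis is an indexed family, as a coproduct provides it, whereas
  \<open>graded_free\<close> wants a set of homogeneous elements. Bijectivity is enough, since
  \<open>lin_comb\<close> is additive and linear anyway (\<open>lin_comb_hom\<close>,
  \<open>lin_comb_scale\<close>).\<close>

definition free_on ::
  "'r gr_ring \<Rightarrow> ('r, 'm) gr_module \<Rightarrow> 'i set \<Rightarrow> ('i \<Rightarrow> int) \<Rightarrow> ('i \<Rightarrow> 'm) \<Rightarrow> bool" where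
  "free_on A Q I d b \<longleftrightarrow>
     graded_module A Q \<and> (\<forall>i\<in>I. b i \<in> carrier (mgrp Q (d i))) \<and>
     (\<forall>n. bij_betw (lin_comb A Q I d b n) (carrier (coefs A I d n)) (carrier (mgrp Q n)))"

context graded_ring
begin

sublocale R: comm_group "rgrp A n" for n by (rule ring_group)

lemma rmul_closed: "\<lbrakk>r \<in> carrier (rgrp A m); s \<in> carrier (rgrp A n)\<rbrakk> \<Longrightarrow> rmul A m n r s \<in> carrier (rgrp A (m + n))"
  by (rule hom_in_carrier[OF mul_left_hom])

lemma rmul_one_right: "r \<in> carrier (rgrp A m) \<Longrightarrow> rmul A m n r \<one>\<^bsub>rgrp A n\<^esub> = \<one>\<^bsub>rgrp A (m + n)\<^esub>"
  by (rule hom_one[OF mul_left_hom R.group_axioms R.group_axioms])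

lemma carrier_coefs: "carrier (coefs A I d n) = {c \<in> \<Pi>\<^sub>E i\<in>I. carrier (rgrp A (n - d i)). finite (supp A I d n c)}"
  unfolding coefs_def supp_def by (rule carrier_sum_group) (rule R.group_axioms)

lemma mult_coefs: "x \<otimes>\<^bsub>coefs A I d n\<^esub> y = (\<lambda>i\<in>I. x i \<otimes>\<^bsub>rgrp A (n - d i)\<^esub> y i)"
  by (simp add: coefs_def)

lemma coefs_comm_group: "comm_group (coefs A I d n)"
proof -
  interpret S: group "coefs A I d n" unfolding coefs_def by (rule sum_group) (rule R.group_axioms)
  show ?thesis
    by (rule S.group_comm_groupI)
      (auto simp: carrier_coefs mult_coefs PiE_iff intro!: restrict_ext R.m_comm)
qed

lemma coefs_closed: "\<lbrakk>c \<in> carrier (coefs A I d n); i \<in> I\<rbrakk> \<Longrightarrow> c i \<in> carrier (rgrp A (n - d i))"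
  by (auto simp: carrier_coefs)

lemma coefs_eqI:
  "\<lbrakk>c \<in> carrier (coefs A I d n); c' \<in> carrier (coefs A I d n'); \<And>i. i \<in> I \<Longrightarrow> c i = c' i\<rbrakk> \<Longrightarrow> c = c'"
  by (rule extensionalityI[of _ I]) (auto simp: carrier_coefs PiE_iff)

lemma proj_coefs_hom: "i \<in> I \<Longrightarrow> (\<lambda>c. c i) \<in> hom (coefs A I d n) (rgrp A (n - d i))"
  by (rule homI) (auto simp: coefs_closed mult_coefs)

lemma single_closed:
  assumes "i \<in> I" "r \<in> carrier (rgrp A (n - d i))"
  shows "single A I d n i r \<in> carrier (coefs A I d n)"
proof -
  have "supp A I d n (single A I d n i r) \<subseteq> {i}" by (auto simp: supp_def single_def)
  then show ?thesis using assms by (auto simp: carrier_coefs single_def intro: finite_subset)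
qed

lemma scale_closed:
  assumes r: "r \<in> carrier (rgrp A m)" and c: "c \<in> carrier (coefs A I d n)"
  shows "scale A I d m n r c \<in> carrier (coefs A I d (m + n))"
proof -
  have "supp A I d (m + n) (scale A I d m n r c) \<subseteq> supp A I d n c"
    using rmul_one_right[OF r] by (auto simp: supp_def scale_def add_diff_eq)
  moreover have "rmul A m (n - d i) r (c i) \<in> carrier (rgrp A (m + n - d i))" if "i \<in> I" for i
    using rmul_closed[OF r coefs_closed[OF c that]] by (simp add: add_diff_eq)
  ultimately show ?thesis
    using c by (auto simp: carrier_coefs scale_def intro: finite_subset)
qed

text \<open>Evaluation at a coordinate \<open>j\<close> is a homomorphism, so it passes through the
  product, where only the term \<open>i = j\<close> survives.\<close>

lemma coefs_decomp:
  assumes c: "c \<in> carrier (coefs A I d n)"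
  shows "finprod (coefs A I d n) (\<lambda>i. single A I d n i (c i)) (supp A I d n c) = c"
proof (rule coefs_eqI)
  interpret S: comm_group "coefs A I d n" by (rule coefs_comm_group)
  have s: "(\<lambda>i. single A I d n i (c i)) \<in> supp A I d n c \<rightarrow> carrier (coefs A I d n)"
    using single_closed[where d = d] coefs_closed[OF c] by (auto simp: supp_def)
  then show "finprod (coefs A I d n) (\<lambda>i. single A I d n i (c i)) (supp A I d n c) \<in> carrier (coefs A I d n)"
    by (rule S.finprod_closed)
  fix j assume j: "j \<in> I"
  have fin: "finite (supp A I d n c)" using c by (simp add: carrier_coefs)
  have "finprod (coefs A I d n) (\<lambda>i. single A I d n i (c i)) (supp A I d n c) j
     = finprod (rgrp A (n - d j)) (\<lambda>i. single A I d n i (c i) j) (supp A I d n c)"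
    by (rule hom_finprod[OF coefs_comm_group ring_group proj_coefs_hom[OF j] s])
  also have "\<dots> = finprod (rgrp A (n - d j)) (\<lambda>i. if j = i then c i else \<one>\<^bsub>rgrp A (n - d j)\<^esub>) (insert j (supp A I d n c))"
    by (rule R.finprod_mono_neutral_cong_left) (use fin j coefs_closed[OF c] in \<open>auto simp: single_def supp_def\<close>)
  also have "\<dots> = finprod (rgrp A (n - d j)) (\<lambda>i. if j = i then c j else \<one>\<^bsub>rgrp A (n - d j)\<^esub>) (insert j (supp A I d n c))"
    by (rule R.finprod_cong') (use j coefs_closed[OF c] in auto)
  also have "\<dots> = c j"
    using R.finprod_singleton[of j "insert j (supp A I d n c)" "\<lambda>_. c j"] fin j coefs_closed[OF c] by simp
  finally show "finprod (coefs A I d n) (\<lambda>i. single A I d n i (c i)) (supp A I d n c) j = c j" .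
qed (rule c)

end

context graded_module
begin

context
  fixes I :: "'i set" and d :: "'i \<Rightarrow> int" and b :: "'i \<Rightarrow> 'm"
  assumes b: "\<And>i. i \<in> I \<Longrightarrow> b i \<in> carrier (mgrp Q (d i))"
begin

lemma act_basis_closed:
  assumes "i \<in> I" "r \<in> carrier (rgrp A (n - d i))"
  shows "mact Q (n - d i) (d i) r (b i) \<in> carrier (mgrp Q n)"
  using act_closed[OF assms(2) b[OF assms(1)]] by simp

lemma act_basis_one: "i \<in> I \<Longrightarrow> mact Q (n - d i) (d i) \<one>\<^bsub>rgrp A (n - d i)\<^esub> (b i) = \<one>\<^bsub>mgrp Q n\<^esub>"
  using act_zero_left[OF b, of i "n - d i"] by simp

text \<open>The definition sums over the support of each family, but adding two linear combinations
  requires a common finite index set; the additional coefficients contribute zero.\<close>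

lemma lin_comb_superset:
  assumes c: "c \<in> carrier (coefs A I d n)" and F: "finite F" "supp A I d n c \<subseteq> F" "F \<subseteq> I"
  shows "lin_comb A Q I d b n c = finprod (mgrp Q n) (\<lambda>i. mact Q (n - d i) (d i) (c i) (b i)) F"
  unfolding lin_comb_def
proof (rule M.finprod_mono_neutral_cong_left[OF F(1,2)])
  show "mact Q (n - d i) (d i) (c i) (b i) = \<one>\<^bsub>mgrp Q n\<^esub>" if "i \<in> F - supp A I d n c" for i
    using that F(3) act_basis_one[of i n] by (auto simp: supp_def)
  show "(\<lambda>i. mact Q (n - d i) (d i) (c i) (b i)) \<in> F \<rightarrow> carrier (mgrp Q n)"
    using act_basis_closed coefs_closed[OF c] F(3) by auto
qed simp

lemma lin_comb_closed:
  assumes c: "c \<in> carrier (coefs A I d n)"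
  shows "lin_comb A Q I d b n c \<in> carrier (mgrp Q n)"
  unfolding lin_comb_def
  by (rule M.finprod_closed) (use act_basis_closed coefs_closed[OF c] in \<open>auto simp: supp_def\<close>)

lemma lin_comb_mult:
  assumes c: "c \<in> carrier (coefs A I d n)" and c': "c' \<in> carrier (coefs A I d n)"
  shows "lin_comb A Q I d b n (c \<otimes>\<^bsub>coefs A I d n\<^esub> c')
    = lin_comb A Q I d b n c \<otimes>\<^bsub>mgrp Q n\<^esub> lin_comb A Q I d b n c'"
proof -
  interpret S: comm_group "coefs A I d n" by (rule coefs_comm_group)
  let ?F = "supp A I d n c \<union> supp A I d n c'"
  let ?t = "\<lambda>c i. mact Q (n - d i) (d i) (c i) (b i)"
  have F: "finite ?F" "?F \<subseteq> I" using c c' by (auto simp: carrier_coefs supp_def)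
  have t: "?t c \<in> ?F \<rightarrow> carrier (mgrp Q n)" if "c \<in> carrier (coefs A I d n)" for c
    using act_basis_closed coefs_closed[OF that] F(2) by auto
  have s: "supp A I d n (c \<otimes>\<^bsub>coefs A I d n\<^esub> c') \<subseteq> ?F" by (auto simp: supp_def mult_coefs)
  have "lin_comb A Q I d b n (c \<otimes>\<^bsub>coefs A I d n\<^esub> c') = finprod (mgrp Q n) (?t (c \<otimes>\<^bsub>coefs A I d n\<^esub> c')) ?F"
    by (rule lin_comb_superset[OF S.m_closed[OF c c'] F(1) s F(2)])
  also have "\<dots> = finprod (mgrp Q n) (\<lambda>i. ?t c i \<otimes>\<^bsub>mgrp Q n\<^esub> ?t c' i) ?F"
  proof (rule M.finprod_cong')
    show "(\<lambda>i. ?t c i \<otimes>\<^bsub>mgrp Q n\<^esub> ?t c' i) \<in> ?F \<rightarrow> carrier (mgrp Q n)" using t[OF c] t[OF c'] by (auto simp: Pi_iff)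
    fix i assume "i \<in> ?F"
    then have i: "i \<in> I" using F by blast
    show "?t (c \<otimes>\<^bsub>coefs A I d n\<^esub> c') i = ?t c i \<otimes>\<^bsub>mgrp Q n\<^esub> ?t c' i"
      using hom_mult[OF act_right_hom[OF b[OF i]] coefs_closed[OF c i] coefs_closed[OF c' i]] i
      by (simp add: mult_coefs)
  qed simp
  also have "\<dots> = finprod (mgrp Q n) (?t c) ?F \<otimes>\<^bsub>mgrp Q n\<^esub> finprod (mgrp Q n) (?t c') ?F"
    by (rule M.finprod_multf[OF t[OF c] t[OF c']])
  finally show ?thesis using lin_comb_superset[OF c F(1) _ F(2)] lin_comb_superset[OF c' F(1) _ F(2)] by simp
qed

lemma lin_comb_hom: "lin_comb A Q I d b n \<in> hom (coefs A I d n) (mgrp Q n)"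
  by (rule homI) (auto simp: lin_comb_closed lin_comb_mult)

lemma lin_comb_single:
  assumes i: "i \<in> I" and r: "r \<in> carrier (rgrp A (n - d i))"
  shows "lin_comb A Q I d b n (single A I d n i r) = mact Q (n - d i) (d i) r (b i)"
proof -
  have "supp A I d n (single A I d n i r) \<subseteq> {i}" by (auto simp: supp_def single_def)
  from lin_comb_superset[OF single_closed[where d = d, OF i r] _ this] i
  show ?thesis using act_basis_closed[OF i r] by (simp add: single_def)
qed

lemma lin_comb_basis: "i \<in> I \<Longrightarrow> lin_comb A Q I d b (d i) (single A I d (d i) i (rone A)) = b i"
  using lin_comb_single[of i "rone A" "d i"] rone_closed act_one[OF b] by simp

lemma lin_comb_scale:
  assumes r: "r \<in> carrier (rgrp A m)" and c: "c \<in> carrier (coefs A I d n)"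
  shows "lin_comb A Q I d b (m + n) (scale A I d m n r c) = mact Q m n r (lin_comb A Q I d b n c)"
proof -
  let ?F = "supp A I d n c"
  have F: "finite ?F" "?F \<subseteq> I" using c by (auto simp: carrier_coefs supp_def)
  have s: "supp A I d (m + n) (scale A I d m n r c) \<subseteq> ?F"
    using rmul_one_right[OF r] by (auto simp: supp_def scale_def add_diff_eq)
  have "lin_comb A Q I d b (m + n) (scale A I d m n r c)
      = finprod (mgrp Q (m + n)) (\<lambda>i. mact Q (m + n - d i) (d i) (scale A I d m n r c i) (b i)) ?F"
    by (rule lin_comb_superset[OF scale_closed[OF r c] F(1) s F(2)])
  also have "\<dots> = finprod (mgrp Q (m + n)) (\<lambda>i. mact Q m n r (mact Q (n - d i) (d i) (c i) (b i))) ?F"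
  proof (rule M.finprod_cong')
    show "(\<lambda>i. mact Q m n r (mact Q (n - d i) (d i) (c i) (b i))) \<in> ?F \<rightarrow> carrier (mgrp Q (m + n))"
      using act_closed[OF r act_basis_closed] coefs_closed[OF c] F(2) by auto
    fix i assume "i \<in> ?F"
    then have i: "i \<in> I" using F by blast
    show "mact Q (m + n - d i) (d i) (scale A I d m n r c i) (b i) = mact Q m n r (mact Q (n - d i) (d i) (c i) (b i))"
      using act_assoc[OF r coefs_closed[OF c i] b[OF i]] i by (simp add: scale_def add_diff_eq)
  qed simp
  also have "\<dots> = mact Q m n r (finprod (mgrp Q n) (\<lambda>i. mact Q (n - d i) (d i) (c i) (b i)) ?F)"
    by (rule hom_finprod[OF module_group module_group act_left_hom[OF r], symmetric])
      (use act_basis_closed coefs_closed[OF c] F(2) in auto)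
  finally show ?thesis by (simp add: lin_comb_def)
qed

lemma gr_hom_lin_comb:
  assumes X: "graded_module A X" and f: "f \<in> gr_hom A Q X 0" and c: "c \<in> carrier (coefs A I d n)"
  shows "f n (lin_comb A Q I d b n c) = lin_comb A X I d (\<lambda>i. f (d i) (b i)) n c"
proof -
  interpret X: graded_module A X by fact
  let ?F = "supp A I d n c"
  have F: "?F \<subseteq> I" by (auto simp: supp_def)
  have t: "(\<lambda>i. mact Q (n - d i) (d i) (c i) (b i)) \<in> ?F \<rightarrow> carrier (mgrp Q n)"
    using act_basis_closed coefs_closed[OF c] F by auto
  have fh: "f n \<in> hom (mgrp Q n) (mgrp X n)" using gr_hom_hom[OF f, of n] by simp
  have "f n (lin_comb A Q I d b n c) = finprod (mgrp X n) (\<lambda>i. f n (mact Q (n - d i) (d i) (c i) (b i))) ?F"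
    unfolding lin_comb_def by (rule hom_finprod[OF module_group X.module_group fh t])
  also have "\<dots> = finprod (mgrp X n) (\<lambda>i. mact X (n - d i) (d i) (c i) (f (d i) (b i))) ?F"
  proof (rule X.M.finprod_cong')
    fix i assume "i \<in> ?F"
    then have i: "i \<in> I" using F by blast
    show "f n (mact Q (n - d i) (d i) (c i) (b i)) = mact X (n - d i) (d i) (c i) (f (d i) (b i))"
      using gr_hom_act[OF f coefs_closed[OF c i] b[OF i]] by simp
  next
    show "(\<lambda>i. mact X (n - d i) (d i) (c i) (f (d i) (b i))) \<in> ?F \<rightarrow> carrier (mgrp X n)"
      using X.act_basis_closed[of I "\<lambda>i. f (d i) (b i)" d] gr_hom_closed0[OF f b] coefs_closed[OF c] F by auto
  qed simp
  finally show ?thesis by (simp add: lin_comb_def)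
qed

end

end

text \<open>The map evaluates the coordinates \<open>co n x\<close> on the prescribed images
  \<open>y\<close>. It is additive and linear because coordinates are, by injectivity of
  \<open>lin_comb\<close>.\<close>

lemma free_on_extend:
  assumes Q: "free_on A Q I d b" and X: "graded_module A X" and y: "\<And>i. i \<in> I \<Longrightarrow> y i \<in> carrier (mgrp X (d i))"
  shows "\<exists>h \<in> gr_hom A Q X 0. \<forall>i\<in>I. h (d i) (b i) = y i"
proof -
  interpret Q: graded_module A Q using Q by (simp add: free_on_def)
  interpret X: graded_module A X by fact
  have b: "\<And>i. i \<in> I \<Longrightarrow> b i \<in> carrier (mgrp Q (d i))"
    and bij: "\<And>n. bij_betw (lin_comb A Q I d b n) (carrier (coefs A I d n)) (carrier (mgrp Q n))"
    using Q by (auto simp: free_on_def)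
  define co where "co n = inv_into (carrier (coefs A I d n)) (lin_comb A Q I d b n)" for n
  have co: "co n x \<in> carrier (coefs A I d n)" "lin_comb A Q I d b n (co n x) = x"
    if "x \<in> carrier (mgrp Q n)" for n x
    using that bij_betw_imp_surj_on[OF bij[of n]] f_inv_into_f[of x "lin_comb A Q I d b n" "carrier (coefs A I d n)"]
    unfolding co_def by (auto intro: inv_into_into)
  have co_lin: "co n (lin_comb A Q I d b n c) = c" if "c \<in> carrier (coefs A I d n)" for n c
    using that bij_betw_imp_inj_on[OF bij[of n]] unfolding co_def by simp
  define h where "h = (\<lambda>n. \<lambda>x\<in>carrier (mgrp Q n). lin_comb A X I d y n (co n x))"
  have "h \<in> gr_hom A Q X 0"
  proof (rule gr_homI)
    fix n x x' assume x: "x \<in> carrier (mgrp Q n)" and x': "x' \<in> carrier (mgrp Q n)"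
    interpret S: comm_group "coefs A I d n" by (rule Q.coefs_comm_group)
    have "co n (x \<otimes>\<^bsub>mgrp Q n\<^esub> x') = co n x \<otimes>\<^bsub>coefs A I d n\<^esub> co n x'"
      using co_lin[OF S.m_closed[OF co(1)[OF x] co(1)[OF x']]] Q.lin_comb_mult[OF b co(1)[OF x] co(1)[OF x']]
        co(2)[OF x] co(2)[OF x'] by simp
    then show "h n (x \<otimes>\<^bsub>mgrp Q n\<^esub> x') = h n x \<otimes>\<^bsub>mgrp X (n + 0)\<^esub> h n x'"
      using x x' X.lin_comb_mult[OF y co(1)[OF x] co(1)[OF x']] by (simp add: h_def)
  next
    fix m n r x assume r: "r \<in> carrier (rgrp A m)" and x: "x \<in> carrier (mgrp Q n)"
    have "co (m + n) (mact Q m n r x) = scale A I d m n r (co n x)"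
      using co_lin[OF Q.scale_closed[OF r co(1)[OF x]]] Q.lin_comb_scale[OF b r co(1)[OF x]] co(2)[OF x] by simp
    then show "h (m + n) (mact Q m n r x) = mact X m (n + 0) r (h n x)"
      using X.lin_comb_scale[OF y r co(1)[OF x]] x Q.act_closed[OF r x] by (simp add: h_def)
  qed (use X.lin_comb_closed[OF y co(1)] in \<open>auto simp: h_def\<close>)
  moreover have "h (d i) (b i) = y i" if i: "i \<in> I" for i
  proof -
    have s: "single A I d (d i) i (rone A) \<in> carrier (coefs A I d (d i))"
      by (rule Q.single_closed[OF i]) (simp add: Q.rone_closed)
    have "co (d i) (b i) = single A I d (d i) i (rone A)"
      using co_lin[OF s] Q.lin_comb_basis[where d = d and b = b, OF b i] by simp
    then show ?thesis using X.lin_comb_basis[where d = d and b = y, OF y i] b[OF i] by (simp add: h_def)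
  qed
  ultimately show ?thesis by blast
qed

lemma free_on_eqI:
  assumes Q: "free_on A Q I d b" and X: "graded_module A X"
    and f: "f \<in> gr_hom A Q X 0" and g: "g \<in> gr_hom A Q X 0"
    and eq: "\<And>i. i \<in> I \<Longrightarrow> f (d i) (b i) = g (d i) (b i)"
  shows "f = g"
proof (rule gr_hom_eqI[OF f g])
  interpret Q: graded_module A Q using Q by (simp add: free_on_def)
  interpret X: graded_module A X by fact
  have b: "\<And>i. i \<in> I \<Longrightarrow> b i \<in> carrier (mgrp Q (d i))" using Q by (auto simp: free_on_def)
  fix n x assume "x \<in> carrier (mgrp Q n)"
  then obtain c where c: "c \<in> carrier (coefs A I d n)" "x = lin_comb A Q I d b n c"
    using Q unfolding free_on_def by (metis bij_betw_imp_surj_on imageE)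
  have "lin_comb A X I d (\<lambda>i. f (d i) (b i)) n c = lin_comb A X I d (\<lambda>i. g (d i) (b i)) n c"
    unfolding lin_comb_def
    by (rule X.M.finprod_cong') (use eq X.act_basis_closed[of I "\<lambda>i. g (d i) (b i)" d] gr_hom_closed0[OF g b] Q.coefs_closed[OF c(1)]
      in \<open>auto simp: supp_def\<close>)
  moreover have "f n x = lin_comb A X I d (\<lambda>i. f (d i) (b i)) n c"
    unfolding c(2) by (rule Q.gr_hom_lin_comb) (use b X f c(1) in auto)
  moreover have "g n x = lin_comb A X I d (\<lambda>i. g (d i) (b i)) n c"
    unfolding c(2) by (rule Q.gr_hom_lin_comb) (use b X g c(1) in auto)
  ultimately show "f n x = g n x" by simp
qed

lemma free_on_lifting:
  assumes Q: "free_on A Q I d b" and X: "graded_module A X" and Y: "graded_module A Y"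
  shows "lifting A Q X Y"
  unfolding lifting_def
proof (intro ballI impI)
  fix f g assume f: "f \<in> gr_hom A Q Y 0" and g: "g \<in> gr_hom A X Y 0"
    and s: "\<forall>n. f n ` carrier (mgrp Q n) \<subseteq> g n ` carrier (mgrp X n)"
  have "\<exists>x\<in>carrier (mgrp X (d i)). g (d i) x = f (d i) (b i)" if "i \<in> I" for i
  proof -
    have "b i \<in> carrier (mgrp Q (d i))" using Q that by (simp add: free_on_def)
    then have "f (d i) (b i) \<in> g (d i) ` carrier (mgrp X (d i))" using s by blast
    then show ?thesis by (metis imageE)
  qed
  then obtain y where y: "\<And>i. i \<in> I \<Longrightarrow> y i \<in> carrier (mgrp X (d i))" "\<And>i. i \<in> I \<Longrightarrow> g (d i) (y i) = f (d i) (b i)"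
    by metis
  from free_on_extend[OF Q X, of y] y(1) obtain h where h: "h \<in> gr_hom A Q X 0" "\<And>i. i \<in> I \<Longrightarrow> h (d i) (b i) = y i"
    by blast
  have Qm: "graded_module A Q" and b: "\<And>i. i \<in> I \<Longrightarrow> b i \<in> carrier (mgrp Q (d i))" using Q by (auto simp: free_on_def)
  have "gr_comp Q g h = f"
    by (rule free_on_eqI[OF Q Y gr_comp_closed[OF Qm h(1) g] f]) (simp add: gr_comp_apply[OF b] h(2) y(2))
  then show "\<exists>h \<in> gr_hom A Q X 0. gr_comp Q g h = f" using h(1) by blast
qed

text \<open>Serves to trade an arbitrary index set for the pairs of a degree and a basis element
  that \<open>graded_free\<close> uses.\<close>

lemma free_on_reindex:
  assumes Q: "free_on A Q I d b" and \<sigma>: "bij_betw \<sigma> J I"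
  shows "free_on A Q J (\<lambda>j. d (\<sigma> j)) (\<lambda>j. b (\<sigma> j))"
proof -
  interpret Q: graded_module A Q using Q by (simp add: free_on_def)
  let ?d = "\<lambda>j. d (\<sigma> j)" and ?b = "\<lambda>j. b (\<sigma> j)"
  have b: "\<And>i. i \<in> I \<Longrightarrow> b i \<in> carrier (mgrp Q (d i))" using Q by (auto simp: free_on_def)
  have \<sigma>I: "\<sigma> j \<in> I" if "j \<in> J" for j using \<sigma> that by (auto simp: bij_betw_def)
  have inj: "inj_on \<sigma> J" using \<sigma> by (simp add: bij_betw_def)
  have "bij_betw (lin_comb A Q J ?d ?b n) (carrier (coefs A J ?d n)) (carrier (mgrp Q n))" for n
  proof -
    let ?\<rho> = "\<lambda>c. \<lambda>j\<in>J. c (\<sigma> j)"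
    have sup: "\<sigma> ` supp A J ?d n (?\<rho> c) = supp A I d n c" if "c \<in> carrier (coefs A I d n)" for c
      using \<sigma> by (auto simp: supp_def bij_betw_def)
    have \<rho>c: "?\<rho> c \<in> carrier (coefs A J ?d n)" if c: "c \<in> carrier (coefs A I d n)" for c
    proof -
      have "finite (supp A J ?d n (?\<rho> c))"
        using sup[OF c] c inj by (metis (no_types, lifting) finite_imageD inj_on_subset Q.carrier_coefs mem_Collect_eq supp_def subsetI)
      then show ?thesis using Q.coefs_closed[OF c] \<sigma>I by (auto simp: Q.carrier_coefs)
    qed
    have bij: "bij_betw ?\<rho> (carrier (coefs A I d n)) (carrier (coefs A J ?d n))"
    proof (rule bij_betwI')
      fix c c' assume c: "c \<in> carrier (coefs A I d n)" "c' \<in> carrier (coefs A I d n)"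
      show "(?\<rho> c = ?\<rho> c') = (c = c')"
      proof
        assume e: "?\<rho> c = ?\<rho> c'"
        show "c = c'"
        proof (rule Q.coefs_eqI[OF c])
          fix i assume "i \<in> I"
          then obtain j where "j \<in> J" "i = \<sigma> j" using \<sigma> by (auto simp: bij_betw_def)
          then show "c i = c' i" using fun_cong[OF e, of j] by simp
        qed
      qed simp
    next
      fix e assume e: "e \<in> carrier (coefs A J ?d n)"
      define c where "c = (\<lambda>i\<in>I. e (inv_into J \<sigma> i))"
      have inv: "inv_into J \<sigma> i \<in> J" "\<sigma> (inv_into J \<sigma> i) = i" if "i \<in> I" for i
        using that \<sigma> by (auto simp: bij_betw_def intro: inv_into_into f_inv_into_f)
      have "supp A I d n c \<subseteq> \<sigma> ` supp A J ?d n e"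
      proof
        fix i assume "i \<in> supp A I d n c"
        then have i: "i \<in> I" "e (inv_into J \<sigma> i) \<noteq> \<one>\<^bsub>rgrp A (n - d i)\<^esub>" by (auto simp: supp_def c_def)
        then have "inv_into J \<sigma> i \<in> supp A J ?d n e" using inv[OF i(1)] by (simp add: supp_def)
        then show "i \<in> \<sigma> ` supp A J ?d n e" using inv(2)[OF i(1)] by (metis image_eqI)
      qed
      then have "finite (supp A I d n c)" using e by (auto simp: Q.carrier_coefs intro: finite_subset)
      then have "c \<in> carrier (coefs A I d n)"
        using inv Q.coefs_closed[OF e inv(1)] by (auto simp: Q.carrier_coefs c_def)
      moreover have "?\<rho> c = e"
        by (rule Q.coefs_eqI[OF \<rho>c[OF calculation] e]) (use \<sigma>I inj in \<open>simp add: c_def\<close>)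
      ultimately show "\<exists>c\<in>carrier (coefs A I d n). e = ?\<rho> c" by blast
    qed (rule \<rho>c)
    have "lin_comb A Q J ?d ?b n (?\<rho> c) = lin_comb A Q I d b n c" if c: "c \<in> carrier (coefs A I d n)" for c
    proof -
      have "lin_comb A Q I d b n c
          = finprod (mgrp Q n) (\<lambda>j. mact Q (n - ?d j) (?d j) (c (\<sigma> j)) (?b j)) (supp A J ?d n (?\<rho> c))"
        unfolding lin_comb_def sup[OF c, symmetric]
        by (rule Q.M.finprod_reindex)
          (use Q.act_basis_closed[where b = b and d = d and I = I, OF b] Q.coefs_closed[OF c] \<sigma>I inj in \<open>auto simp: supp_def inj_on_def\<close>)
      also have "\<dots> = lin_comb A Q J ?d ?b n (?\<rho> c)"
        unfolding lin_comb_def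
        by (rule Q.M.finprod_cong') (use Q.act_basis_closed[where b = b and d = d and I = I, OF b] Q.coefs_closed[OF c] \<sigma>I in \<open>auto simp: supp_def\<close>)
      finally show ?thesis by simp
    qed
    then have "bij_betw (lin_comb A Q J ?d ?b n \<circ> ?\<rho>) (carrier (coefs A I d n)) (carrier (mgrp Q n))"
      using Q bij_betw_cong[of "carrier (coefs A I d n)" "lin_comb A Q J ?d ?b n \<circ> ?\<rho>" "lin_comb A Q I d b n"]
      by (simp add: free_on_def)
    then show ?thesis using bij_betw_comp_iff[OF bij] by blast
  qed
  then show ?thesis using Q b \<sigma>I by (simp add: free_on_def)
qed

lemma graded_free_iff: "graded_free A Q \<longleftrightarrow> (\<exists>B. free_on A Q (SIGMA d:UNIV. B d) fst snd)"
proof -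
  have "(\<lambda>c. finprod (mgrp Q n) (\<lambda>(d, b). mact Q (n - d) d (c (d, b)) b)
           {(d, b). b \<in> B d \<and> c (d, b) \<noteq> \<one>\<^bsub>rgrp A (n - d)\<^esub>})
      \<in> iso (sum_group (SIGMA d:UNIV. B d) (\<lambda>(d, b). rgrp A (n - d))) (mgrp Q n)
    \<longleftrightarrow> bij_betw (lin_comb A Q (SIGMA d:UNIV. B d) fst snd n) (carrier (coefs A (SIGMA d:UNIV. B d) fst n)) (carrier (mgrp Q n))"
    if Q: "graded_module A Q" and B: "\<forall>d. B d \<subseteq> carrier (mgrp Q d)" for B n
  proof -
    interpret Q: graded_module A Q by fact
    have "(\<lambda>c. finprod (mgrp Q n) (\<lambda>(d, b). mact Q (n - d) d (c (d, b)) b)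
           {(d, b). b \<in> B d \<and> c (d, b) \<noteq> \<one>\<^bsub>rgrp A (n - d)\<^esub>}) = lin_comb A Q (SIGMA d:UNIV. B d) fst snd n"
    proof
      fix c
      have "{(d, b). b \<in> B d \<and> c (d, b) \<noteq> \<one>\<^bsub>rgrp A (n - d)\<^esub>} = supp A (SIGMA d:UNIV. B d) fst n c"
        by (auto simp: supp_def)
      then show "finprod (mgrp Q n) (\<lambda>(d, b). mact Q (n - d) d (c (d, b)) b)
           {(d, b). b \<in> B d \<and> c (d, b) \<noteq> \<one>\<^bsub>rgrp A (n - d)\<^esub>} = lin_comb A Q (SIGMA d:UNIV. B d) fst snd n c"
        by (simp add: lin_comb_def case_prod_unfold)
    qed
    moreover have "lin_comb A Q (SIGMA d:UNIV. B d) fst snd n \<in> hom (coefs A (SIGMA d:UNIV. B d) fst n) (mgrp Q n)"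
      by (rule Q.lin_comb_hom) (use B[rule_format] in fastforce)
    ultimately show ?thesis by (simp add: iso_def coefs_def case_prod_unfold)
  qed
  then show ?thesis unfolding graded_free_def free_on_def by auto blast+
qed

section \<open>Existence of free resolutions\<close>

lemma ex_inj_pair:
  assumes "infinite (UNIV :: 'q set)"
  shows "\<exists>p :: 'q \<times> 'q \<Rightarrow> 'q. inj p"
proof -
  have "|UNIV \<times> UNIV :: ('q \<times> 'q) set| =o |UNIV :: 'q set|"
    by (rule card_of_Times_same_infinite[OF assms])
  then obtain p :: "'q \<times> 'q \<Rightarrow> 'q" where "bij_betw p (UNIV \<times> UNIV) UNIV"
    using card_of_ordIso by blast
  then show ?thesis by (auto simp: bij_betw_def)
qed

lemma ex_inj_list:
  assumes "infinite (UNIV :: 'q set)"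
  shows "\<exists>e :: 'q list \<Rightarrow> 'q. inj e"
proof -
  obtain p :: "'q \<times> 'q \<Rightarrow> 'q" where p: "inj p" using ex_inj_pair[OF assms] by blast
  obtain \<iota> :: "nat \<Rightarrow> 'q" where \<iota>: "inj \<iota>" using infinite_countable_subset[OF assms] by blast
  define f where "f = rec_list (\<iota> 0) (\<lambda>x _ y. p (x, y))"
  have f: "f [] = \<iota> 0" "f (x # xs) = p (x, f xs)" for x xs by (simp_all add: f_def)
  have inj: "length xs = length ys \<Longrightarrow> f xs = f ys \<Longrightarrow> xs = ys" for xs ys
    by (induction xs ys rule: list_induct2) (auto simp: f dest: injD[OF p])
  \<comment> \<open>Folding with \<open>p\<close> alone need not separate lists of different length,
    since the start value may itself be the code of a pair; so the length is recorded.\<close>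
  have "inj (\<lambda>xs. p (\<iota> (length xs), f xs))"
    by (rule injI) (auto dest!: injD[OF p] injD[OF \<iota>] inj)
  then show ?thesis by blast
qed

lemma ex_inj_index:
  assumes inf: "infinite (UNIV :: 'q set)" and g: "inj (g :: 'm \<Rightarrow> 'q)"
  shows "\<exists>\<phi> :: int \<times> 'm \<Rightarrow> 'q. inj \<phi>"
proof -
  obtain p :: "'q \<times> 'q \<Rightarrow> 'q" where p: "inj p" using ex_inj_pair[OF inf] by blast
  obtain \<iota> :: "nat \<Rightarrow> 'q" where \<iota>: "inj \<iota>" using infinite_countable_subset[OF inf] by blast
  have "inj (\<lambda>(k, x). p (\<iota> (int_encode k), g x))"
    by (rule injI) (auto dest!: injD[OF p] injD[OF \<iota>] injD[OF inj_int_encode] injD[OF g])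
  then show ?thesis by blast
qed

text \<open>A coefficient family is determined by the finite set of coded pairs (index, value) over
  its support, and a finite set is coded by a list of its elements. All modules of a resolution
  thereby fit into one type.\<close>

lemma (in graded_ring) ex_inj_coefs:
  assumes inf: "infinite (UNIV :: 'q set)" and \<phi>: "inj (\<phi> :: 'i \<Rightarrow> 'q)" and g: "inj (g :: 'r \<Rightarrow> 'q)"
  shows "\<exists>E :: ('i \<Rightarrow> 'r) \<Rightarrow> 'q. inj_on E (carrier (coefs A I d n))"
proof -
  obtain p :: "'q \<times> 'q \<Rightarrow> 'q" where p: "inj p" using ex_inj_pair[OF inf] by blast
  obtain e :: "'q list \<Rightarrow> 'q" where e: "inj e" using ex_inj_list[OF inf] by blast
  define S where "S c = (\<lambda>i. p (\<phi> i, g (c i))) ` supp A I d n c" for c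
  \<comment> \<open>The chosen list depends only on \<open>S c\<close>, and \<open>set\<close>
    recovers \<open>S c\<close> from it.\<close>
  define E where "E c = e (SOME xs. set xs = S c)" for c
  have "inj_on E (carrier (coefs A I d n))"
  proof (rule inj_onI)
    fix c c' assume c: "c \<in> carrier (coefs A I d n)" and c': "c' \<in> carrier (coefs A I d n)" and eq: "E c = E c'"
    have set: "set (SOME xs. set xs = S c) = S c" if "c \<in> carrier (coefs A I d n)" for c
      by (rule someI_ex, rule finite_list) (use that in \<open>simp add: S_def carrier_coefs\<close>)
    have SS: "S c = S c'"
    proof -
      have "S c = set (SOME xs. set xs = S c)" by (rule set[OF c, symmetric])
      also have "\<dots> = set (SOME xs. set xs = S c')" by (simp only: injD[OF e eq[unfolded E_def]])
      also have "\<dots> = S c'" by (rule set[OF c'])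
      finally show ?thesis .
    qed
    have mem: "p (\<phi> i, g r) \<in> S c \<longleftrightarrow> i \<in> supp A I d n c \<and> c i = r" for i r c
      unfolding S_def by (auto dest!: injD[OF p] injD[OF \<phi>] injD[OF g])
    show "c = c'"
    proof (rule coefs_eqI[OF c c'])
      fix i assume i: "i \<in> I"
      show "c i = c' i"
      proof (cases "i \<in> supp A I d n c \<or> i \<in> supp A I d n c'")
        case True
        then show ?thesis using mem[of i "c i" c] mem[of i "c i" c'] mem[of i "c' i" c] mem[of i "c' i" c']
          unfolding SS by blast
      next
        case False
        then show ?thesis using i by (simp add: supp_def)
      qed
    qed
  qed
  then show ?thesis by blast
qed

text \<open>Coefficient groups consist of functions, whereas a resolution must keep one element type
  in all its terms; so the group structure is copied along an injection.\<close>

definition transport :: "('a \<Rightarrow> 'b) \<Rightarrow> 'a monoid \<Rightarrow> 'b monoid" where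
  "transport e G =
     \<lparr>carrier = e ` carrier G,
      monoid.mult = (\<lambda>x y. e (inv_into (carrier G) e x \<otimes>\<^bsub>G\<^esub> inv_into (carrier G) e y)),
      one = e \<one>\<^bsub>G\<^esub>\<rparr>"

lemma transport_iso:
  assumes G: "comm_group G" and e: "inj_on e (carrier G)"
  shows "comm_group (transport e G)" "e \<in> iso G (transport e G)"
proof -
  interpret G: comm_group G by fact
  show 1: "e \<in> iso G (transport e G)"
    using e by (auto simp: transport_def iso_def hom_def bij_betw_def)
  have "monoid (transport e G)"
    using e by (intro monoidI) (auto simp: transport_def G.m_assoc)
  then show "comm_group (transport e G)"
    using G.iso_imp_comm_group[OF is_isoI[OF 1]] by blast
qed

section \<open>Free modules with a prescribed element type\<close>

context graded_ring
begin

lemma scale_mult: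
  assumes r: "r \<in> carrier (rgrp A m)" and c: "c \<in> carrier (coefs A I d n)" "c' \<in> carrier (coefs A I d n)"
  shows "scale A I d m n r (c \<otimes>\<^bsub>coefs A I d n\<^esub> c')
    = scale A I d m n r c \<otimes>\<^bsub>coefs A I d (m + n)\<^esub> scale A I d m n r c'"
  unfolding scale_def mult_coefs
  using hom_mult[OF mul_left_hom[OF r] coefs_closed[OF c(1)] coefs_closed[OF c(2)]]
  by (auto intro!: restrict_ext simp: add_diff_eq)

lemma scale_mult_left:
  assumes c: "c \<in> carrier (coefs A I d n)" and r: "r \<in> carrier (rgrp A m)" "r' \<in> carrier (rgrp A m)"
  shows "scale A I d m n (r \<otimes>\<^bsub>rgrp A m\<^esub> r') c
    = scale A I d m n r c \<otimes>\<^bsub>coefs A I d (m + n)\<^esub> scale A I d m n r' c"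
  unfolding scale_def mult_coefs
  using hom_mult[OF mul_right_hom[OF coefs_closed[OF c]] r]
  by (auto intro!: restrict_ext simp: add_diff_eq)

lemma scale_one: "c \<in> carrier (coefs A I d n) \<Longrightarrow> scale A I d 0 n (rone A) c = c"
  by (rule extensionalityI[of _ I]) (auto simp: scale_def rone_left coefs_closed, auto simp: carrier_coefs PiE_iff)

lemma scale_scale:
  assumes "r \<in> carrier (rgrp A l)" "s \<in> carrier (rgrp A m)" "c \<in> carrier (coefs A I d n)"
  shows "scale A I d (l + m) n (rmul A l m r s) c = scale A I d l (m + n) r (scale A I d m n s c)"
  unfolding scale_def
  using mul_assoc[OF assms(1,2) coefs_closed[OF assms(3)]]
  by (auto intro!: restrict_ext simp: add_diff_eq)

lemma scale_single:
  assumes "i \<in> I" "r \<in> carrier (rgrp A m)"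
  shows "scale A I d m (d i) r (single A I d (d i) i (rone A)) = single A I d (m + d i) i r"
  unfolding scale_def single_def
  using assms rone_right[OF assms(2)] rmul_one_right[OF assms(2)]
  by (auto intro!: restrict_ext simp: add_diff_eq)

end

definition free_mod :: "'r gr_ring \<Rightarrow> 'i set \<Rightarrow> ('i \<Rightarrow> int) \<Rightarrow> (int \<Rightarrow> ('i \<Rightarrow> 'r) \<Rightarrow> 'q) \<Rightarrow> ('r, 'q) gr_module" where
  "free_mod A I d E =
     \<lparr>mgrp = (\<lambda>n. transport (E n) (coefs A I d n)),
      mact = (\<lambda>m n r x. E (m + n) (scale A I d m n r (inv_into (carrier (coefs A I d n)) (E n) x)))\<rparr>"

lemma free_mod_free_on:
  assumes A: "graded_ring A" and E: "\<And>n. inj_on (E n) (carrier (coefs A I d n))"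
  shows "free_on A (free_mod A I d E) I d (\<lambda>i. E (d i) (single A I d (d i) i (rone A)))"
proof -
  interpret A: graded_ring A by fact
  let ?F = "free_mod A I d E"
  have G: "mgrp ?F n = transport (E n) (coefs A I d n)" for n by (simp add: free_mod_def)
  have Fc: "comm_group (mgrp ?F n)" and iso: "E n \<in> iso (coefs A I d n) (mgrp ?F n)" for n
    unfolding G by (rule transport_iso[OF A.coefs_comm_group E])+
  have Eh: "E n \<in> hom (coefs A I d n) (mgrp ?F n)" for n using iso by (simp add: iso_def)
  have carr: "carrier (mgrp ?F n) = E n ` carrier (coefs A I d n)" for n by (simp add: G transport_def)
  have act: "mact ?F m n r (E n c) = E (m + n) (scale A I d m n r c)" if "c \<in> carrier (coefs A I d n)" for m n r c
    using E that by (simp add: free_mod_def)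
  have Em: "E n c \<otimes>\<^bsub>mgrp ?F n\<^esub> E n c' = E n (c \<otimes>\<^bsub>coefs A I d n\<^esub> c')"
    if "c \<in> carrier (coefs A I d n)" "c' \<in> carrier (coefs A I d n)" for n c c'
    using hom_mult[OF Eh that] by simp
  interpret S: comm_group "coefs A I d n" for n by (rule A.coefs_comm_group)
  have F: "graded_module A ?F"
  proof (intro graded_module.intro graded_module_axioms.intro)
    show "graded_ring A" by (rule A)
    show "comm_group (mgrp ?F n)" for n by (rule Fc)
    fix m n r assume r: "r \<in> carrier (rgrp A m)"
    show "mact ?F m n r \<in> hom (mgrp ?F n) (mgrp ?F (m + n))"
    proof (rule homI)
      fix x y assume "x \<in> carrier (mgrp ?F n)" "y \<in> carrier (mgrp ?F n)"
      then obtain c c' where c: "c \<in> carrier (coefs A I d n)" "x = E n c" "c' \<in> carrier (coefs A I d n)" "y = E n c'"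
        unfolding carr by blast
      show "mact ?F m n r (x \<otimes>\<^bsub>mgrp ?F n\<^esub> y) = mact ?F m n r x \<otimes>\<^bsub>mgrp ?F (m + n)\<^esub> mact ?F m n r y"
        unfolding c(2,4) Em[OF c(1,3)] act[OF c(1)] act[OF c(3)] act[OF S.m_closed[OF c(1,3)]]
          Em[OF A.scale_closed[OF r c(1)] A.scale_closed[OF r c(3)]] A.scale_mult[OF r c(1,3)] ..
    next
      fix x assume "x \<in> carrier (mgrp ?F n)"
      then obtain c where c: "c \<in> carrier (coefs A I d n)" "x = E n c" unfolding carr by blast
      show "mact ?F m n r x \<in> carrier (mgrp ?F (m + n))"
        unfolding carr c(2) act[OF c(1)] by (rule imageI[OF A.scale_closed[OF r c(1)]])
    qed
  next
    fix x m n assume "x \<in> carrier (mgrp ?F n)"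
    then obtain c where c: "c \<in> carrier (coefs A I d n)" "x = E n c" unfolding carr by blast
    show "(\<lambda>r. mact ?F m n r x) \<in> hom (rgrp A m) (mgrp ?F (m + n))"
      unfolding c(2) act[OF c(1)]
      by (rule homI) (auto simp: carr A.scale_closed[OF _ c(1)] Em A.scale_mult_left[OF c(1)])
    show "mact ?F 0 n (rone A) x = x" unfolding c(2) act[OF c(1)] using A.scale_one[OF c(1)] by simp
    fix r s l assume r: "r \<in> carrier (rgrp A l)" "s \<in> carrier (rgrp A m)"
    show "mact ?F (l + m) n (rmul A l m r s) x = mact ?F l (m + n) r (mact ?F m n s x)"
      unfolding c(2) act[OF c(1)] act[OF A.scale_closed[OF r(2) c(1)]] A.scale_scale[OF r c(1)] by (simp add: add.assoc)
  qed
  interpret F: graded_module A ?F by (rule F)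
  let ?b = "\<lambda>i. E (d i) (single A I d (d i) i (rone A))"
  have sc: "single A I d (d i) i (rone A) \<in> carrier (coefs A I d (d i))" if "i \<in> I" for i
    by (rule A.single_closed[OF that]) (simp add: A.rone_closed)
  have b: "?b i \<in> carrier (mgrp ?F (d i))" if "i \<in> I" for i unfolding carr using sc[OF that] by blast
  have "lin_comb A ?F I d ?b n c = E n c" if c: "c \<in> carrier (coefs A I d n)" for n c
  proof -
    have "E n c = E n (finprod (coefs A I d n) (\<lambda>i. single A I d n i (c i)) (supp A I d n c))"
      using A.coefs_decomp[OF c] by simp
    also have "\<dots> = finprod (mgrp ?F n) (\<lambda>i. E n (single A I d n i (c i))) (supp A I d n c)"
      by (rule hom_finprod[OF A.coefs_comm_group Fc Eh])
        (auto simp: supp_def A.single_closed[where d = d] A.coefs_closed[OF c])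
    also have "\<dots> = lin_comb A ?F I d ?b n c"
      unfolding lin_comb_def
    proof (rule F.M.finprod_cong')
      show "(\<lambda>i. mact ?F (n - d i) (d i) (c i) (?b i)) \<in> supp A I d n c \<rightarrow> carrier (mgrp ?F n)"
        using F.act_basis_closed[where d = d and b = ?b and I = I, OF b] A.coefs_closed[OF c] by (auto simp: supp_def)
      fix i assume "i \<in> supp A I d n c"
      then have i: "i \<in> I" by (simp add: supp_def)
      show "E n (single A I d n i (c i)) = mact ?F (n - d i) (d i) (c i) (?b i)"
        unfolding act[OF sc[OF i]] using A.scale_single[where d = d, OF i A.coefs_closed[OF c i]] by simp
    qed simp
    finally show ?thesis by simp
  qed
  then have "bij_betw (lin_comb A ?F I d ?b n) (carrier (coefs A I d n)) (carrier (mgrp ?F n))" for n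
    using iso[of n] bij_betw_cong[of "carrier (coefs A I d n)" "lin_comb A ?F I d ?b n" "E n"] by (simp add: iso_def)
  then show ?thesis using F b by (simp add: free_on_def)
qed

lemma (in graded_module) trivial_of_rone:
  assumes "rone A = \<one>\<^bsub>rgrp A 0\<^esub>" "x \<in> carrier (mgrp Q n)"
  shows "x = \<one>\<^bsub>mgrp Q n\<^esub>"
  using act_one[OF assms(2)] act_zero_left[OF assms(2), of 0] assms(1) by simp

text \<open>A basis given as a set must not repeat elements, hence the injectivity condition. Over
  the zero ring the members of the family may coincide, but there every module is zero and the empty
  basis serves, so injectivity is asked only when \<open>1 \<noteq> 0\<close>.\<close>

lemma free_on_graded_free:
  assumes Q: "free_on A Q I d b" and inj: "rone A \<noteq> \<one>\<^bsub>rgrp A 0\<^esub> \<Longrightarrow> inj_on (\<lambda>i. (d i, b i)) I"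
  shows "graded_free A Q"
proof -
  interpret Q: graded_module A Q using Q by (simp add: free_on_def)
  show ?thesis
  proof (cases "rone A = \<one>\<^bsub>rgrp A 0\<^esub>")
    case True
    have "carrier (coefs A {} fst n) = {\<lambda>_. undefined}" for n :: int by (auto simp: Q.carrier_coefs supp_def)
    moreover have "carrier (mgrp Q n) = {\<one>\<^bsub>mgrp Q n\<^esub>}" for n using Q.trivial_of_rone[OF True] by auto
    ultimately have "free_on A Q (SIGMA d:UNIV. {}) fst snd"
      using Q.graded_module_axioms by (auto simp: free_on_def bij_betw_def lin_comb_def supp_def)
    then show ?thesis unfolding graded_free_iff by (intro exI[of _ "\<lambda>_. {}"])
  next
    case False
    define B where "B k = {b i |i. i \<in> I \<and> d i = k}" for k
    let ?\<tau> = "\<lambda>i. (d i, b i)"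
    have \<tau>: "bij_betw ?\<tau> I (SIGMA k:UNIV. B k)"
      using inj[OF False] by (auto simp: bij_betw_def B_def)
    let ?\<sigma> = "inv_into I ?\<tau>"
    have \<sigma>: "bij_betw ?\<sigma> (SIGMA k:UNIV. B k) I" by (rule bij_betw_inv_into[OF \<tau>])
    have \<tau>\<sigma>: "d (?\<sigma> j) = fst j" "b (?\<sigma> j) = snd j" if "j \<in> (SIGMA k:UNIV. B k)" for j
      using bij_betw_inv_into_right[OF \<tau> that] by (metis fst_conv snd_conv)+
    let ?J = "SIGMA k:UNIV. B k"
    have s: "supp A ?J (\<lambda>j. d (?\<sigma> j)) n c = supp A ?J fst n c" for n c
      using \<tau>\<sigma> by (auto simp: supp_def)
    have c: "carrier (coefs A ?J (\<lambda>j. d (?\<sigma> j)) n) = carrier (coefs A ?J fst n)" for n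
      unfolding Q.carrier_coefs s using \<tau>\<sigma> by (auto simp: PiE_iff)
    have F: "free_on A Q ?J (\<lambda>j. d (?\<sigma> j)) (\<lambda>j. b (?\<sigma> j))" by (rule free_on_reindex[OF Q \<sigma>])
    have B: "snd j \<in> carrier (mgrp Q (fst j))" if "j \<in> ?J" for j
      using F \<tau>\<sigma>[OF that] that unfolding free_on_def by metis
    have l: "lin_comb A Q ?J (\<lambda>j. d (?\<sigma> j)) (\<lambda>j. b (?\<sigma> j)) n e = lin_comb A Q ?J fst snd n e"
      if e: "e \<in> carrier (coefs A ?J fst n)" for n e
      unfolding lin_comb_def s
    proof (rule Q.M.finprod_cong')
      show "(\<lambda>j. mact Q (n - fst j) (fst j) (e j) (snd j)) \<in> supp A ?J fst n e \<rightarrow> carrier (mgrp Q n)"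
        using Q.act_basis_closed[where d = fst and b = snd and I = ?J, OF B] Q.coefs_closed[OF e]
        unfolding supp_def by blast
      fix j assume "j \<in> supp A ?J fst n e"
      then have "j \<in> ?J" by (simp add: supp_def)
      then show "mact Q (n - d (?\<sigma> j)) (d (?\<sigma> j)) (e j) (b (?\<sigma> j)) = mact Q (n - fst j) (fst j) (e j) (snd j)"
        by (simp only: \<tau>\<sigma>)
    qed simp
    have "bij_betw (lin_comb A Q ?J fst snd n) (carrier (coefs A ?J fst n)) (carrier (mgrp Q n))" for n
      using F bij_betw_cong[of "carrier (coefs A ?J fst n)" "lin_comb A Q ?J (\<lambda>j. d (?\<sigma> j)) (\<lambda>j. b (?\<sigma> j)) n"
        "lin_comb A Q ?J fst snd n", OF l] unfolding free_on_def c by blast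
    then have "free_on A Q ?J fst snd" using Q.graded_module_axioms B unfolding free_on_def by blast
    then show ?thesis unfolding graded_free_iff by blast
  qed
qed

text \<open>There is one generator for each homogeneous element of \<open>L\<close>, indexed by the
  pair (degree, element) and sent to that element.\<close>

lemma ex_free_cover:
  fixes L :: "('r, 'm) gr_module"
  assumes inf: "infinite (UNIV :: 'q set)" and f: "inj (f :: 'r \<Rightarrow> 'q)" and g: "inj (g :: 'm \<Rightarrow> 'q)"
    and L: "graded_module A L"
  shows "\<exists>(F :: ('r, 'q) gr_module) \<epsilon>. graded_free A F \<and> \<epsilon> \<in> gr_hom A F L 0 \<and>
    (\<forall>n. \<epsilon> n ` carrier (mgrp F n) = carrier (mgrp L n))"
proof -
  interpret L: graded_module A L by fact
  let ?I = "SIGMA k:UNIV. carrier (mgrp L k)" and ?d = "fst :: int \<times> 'm \<Rightarrow> int"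
  obtain \<phi> :: "int \<times> 'm \<Rightarrow> 'q" where \<phi>: "inj \<phi>" using ex_inj_index[OF inf g] by blast
  have "\<forall>n. \<exists>E :: (int \<times> 'm \<Rightarrow> 'r) \<Rightarrow> 'q. inj_on E (carrier (coefs A ?I ?d n))"
    using L.ex_inj_coefs[OF inf \<phi> f] by blast
  then obtain E :: "int \<Rightarrow> (int \<times> 'm \<Rightarrow> 'r) \<Rightarrow> 'q" where E: "\<And>n. inj_on (E n) (carrier (coefs A ?I ?d n))"
    by metis
  let ?F = "free_mod A ?I ?d E" and ?b = "\<lambda>i. E (?d i) (single A ?I ?d (?d i) i (rone A))"
  have F: "free_on A ?F ?I ?d ?b" by (rule free_mod_free_on[OF L.graded_ring_axioms E])
  \<comment> \<open>Two generators of the same degree have different coordinate vectors: one of them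
    takes the value \<open>1 \<noteq> 0\<close> where the other is zero.\<close>
  have "inj_on (\<lambda>i. (?d i, ?b i)) ?I" if "rone A \<noteq> \<one>\<^bsub>rgrp A 0\<^esub>"
  proof (rule inj_onI)
    fix i j assume i: "i \<in> ?I" and j: "j \<in> ?I" and "(?d i, ?b i) = (?d j, ?b j)"
    then have dij: "?d i = ?d j" and e: "?b i = ?b j" unfolding prod.inject by blast+
    have "E (?d i) (single A ?I ?d (?d i) i (rone A)) = E (?d i) (single A ?I ?d (?d i) j (rone A))"
      using e by (simp only: dij)
    moreover have "single A ?I ?d (?d i) i (rone A) \<in> carrier (coefs A ?I ?d (?d i))"
      by (rule L.single_closed[OF i]) (simp add: L.rone_closed)
    moreover have "single A ?I ?d (?d i) j (rone A) \<in> carrier (coefs A ?I ?d (?d i))"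
      by (rule L.single_closed[OF j]) (simp add: L.rone_closed dij)
    ultimately have "single A ?I ?d (?d i) i (rone A) = single A ?I ?d (?d i) j (rone A)"
      using inj_onD[OF E] by blast
    from fun_cong[OF this, of i] i that show "i = j" by (auto simp: single_def split: if_splits)
  qed
  then have free: "graded_free A ?F" by (rule free_on_graded_free[OF F])
  have "snd i \<in> carrier (mgrp L (?d i))" if "i \<in> ?I" for i using that by auto
  then obtain \<epsilon> where \<epsilon>: "\<epsilon> \<in> gr_hom A ?F L 0" "\<And>i. i \<in> ?I \<Longrightarrow> \<epsilon> (?d i) (?b i) = snd i"
    using free_on_extend[OF F L, of snd] by blast
  have "\<epsilon> n ` carrier (mgrp ?F n) = carrier (mgrp L n)" for n
  proof (intro equalityI subsetI)
    fix x assume x: "x \<in> carrier (mgrp L n)"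
    then have i: "(n, x) \<in> ?I" by simp
    have "?b (n, x) \<in> carrier (mgrp ?F (?d (n, x)))" using F i unfolding free_on_def by blast
    then show "x \<in> \<epsilon> n ` carrier (mgrp ?F n)" using \<epsilon>(2)[OF i] by (metis fst_conv snd_conv image_eqI)
  qed (use gr_hom_closed0[OF \<epsilon>(1)] in auto)
  then show ?thesis using free \<epsilon>(1) by blast
qed

section \<open>Resolving by covers of successive kernels\<close>

definition kernel_module ::
  "('r, 'm) gr_module \<Rightarrow> ('r, 'n) gr_module \<Rightarrow> (int \<Rightarrow> 'm \<Rightarrow> 'n) \<Rightarrow> ('r, 'm) gr_module" where
  "kernel_module Q P \<delta> =
     \<lparr>mgrp = (\<lambda>n. (mgrp Q n)\<lparr>carrier := kernel (mgrp Q n) (mgrp P n) (\<delta> n)\<rparr>), mact = mact Q\<rparr>"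

lemma kernel_module:
  assumes Q: "graded_module A Q" and P: "graded_module A P" and \<delta>: "\<delta> \<in> gr_hom A Q P 0"
  shows "graded_module A (kernel_module Q P \<delta>)"
proof -
  interpret Q: graded_module A Q by fact
  interpret P: graded_module A P by fact
  let ?K = "kernel_module Q P \<delta>"
  interpret d: group_hom "mgrp Q n" "mgrp P n" "\<delta> n" for n
    using gr_hom_hom[OF \<delta>, of n] by unfold_locales simp
  have G: "mgrp ?K n = (mgrp Q n)\<lparr>carrier := kernel (mgrp Q n) (mgrp P n) (\<delta> n)\<rparr>" and [simp]: "mact ?K = mact Q" for n
    by (simp_all add: kernel_module_def)
  have c: "x \<in> carrier (mgrp ?K n) \<longleftrightarrow> x \<in> carrier (mgrp Q n) \<and> \<delta> n x = \<one>\<^bsub>mgrp P n\<^esub>" for x n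
    by (simp add: G kernel_def)
  have m: "(\<otimes>\<^bsub>mgrp ?K n\<^esub>) = (\<otimes>\<^bsub>mgrp Q n\<^esub>)" for n by (simp add: G)
  have ac: "mact Q m n r x \<in> carrier (mgrp ?K (m + n))"
    if "r \<in> carrier (rgrp A m)" "x \<in> carrier (mgrp ?K n)" for m n r x
    using that Q.act_closed[OF that(1)] gr_hom_act[OF \<delta> that(1), of x n] P.act_zero[OF that(1)] by (simp add: c)
  show ?thesis
  proof (intro graded_module.intro graded_module_axioms.intro)
    show "graded_ring A" by (rule Q.graded_ring_axioms)
    show "comm_group (mgrp ?K n)" for n
      unfolding G by (rule Q.M.subgroup_comm_group[OF d.subgroup_kernel])
    show "mact ?K m n r \<in> hom (mgrp ?K n) (mgrp ?K (m + n))" if "r \<in> carrier (rgrp A m)" for m n r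
      by (rule homI) (use that ac Q.act_mult[OF that] in \<open>auto simp: m c\<close>)
    show "(\<lambda>r. mact ?K m n r x) \<in> hom (rgrp A m) (mgrp ?K (m + n))" if "x \<in> carrier (mgrp ?K n)" for m n x
      by (rule homI) (use that ac hom_mult[OF Q.act_right_hom[of x n m]] in \<open>auto simp: m c\<close>)
  qed (auto simp: c Q.act_one Q.act_assoc)
qed

lemma ex_free_kernel_cover:
  fixes Q :: "('r, 'm) gr_module"
  assumes inf: "infinite (UNIV :: 'q set)" and f: "inj (f :: 'r \<Rightarrow> 'q)" and g: "inj (g :: 'm \<Rightarrow> 'q)"
    and Q: "graded_module A Q" and P: "graded_module A P" and \<delta>: "\<delta> \<in> gr_hom A Q P 0"
  shows "\<exists>(F :: ('r, 'q) gr_module) \<epsilon>. graded_free A F \<and> \<epsilon> \<in> gr_hom A F Q 0 \<and>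
    (\<forall>n. \<epsilon> n ` carrier (mgrp F n) = kernel (mgrp Q n) (mgrp P n) (\<delta> n))"
proof -
  let ?K = "kernel_module Q P \<delta>"
  obtain F :: "('r, 'q) gr_module" and \<epsilon> where F: "graded_free A F" "\<epsilon> \<in> gr_hom A F ?K 0"
    "\<And>n. \<epsilon> n ` carrier (mgrp F n) = carrier (mgrp ?K n)"
    using ex_free_cover[OF inf f g kernel_module[OF Q P \<delta>]] by blast
  have K: "carrier (mgrp ?K n) = kernel (mgrp Q n) (mgrp P n) (\<delta> n)" "(\<otimes>\<^bsub>mgrp ?K n\<^esub>) = (\<otimes>\<^bsub>mgrp Q n\<^esub>)"
    "mact ?K = mact Q" for n by (simp_all add: kernel_module_def)
  have "\<epsilon> \<in> gr_hom A F Q 0"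
    using F(2) by (auto simp: gr_hom_def hom_def K Pi_iff kernel_def)
  then show ?thesis using F unfolding K by blast
qed

lemma ex_free_resolution:
  fixes L :: "('r, 'm) gr_module"
  assumes inf: "infinite (UNIV :: 'q set)" and f: "inj (f :: 'r \<Rightarrow> 'q)" and g: "inj (g :: 'm \<Rightarrow> 'q)"
    and L: "graded_module A L"
  shows "\<exists>(Q :: nat \<Rightarrow> ('r, 'q) gr_module) \<delta> \<epsilon>. free_resolution A L Q \<delta> \<epsilon>"
proof -
  have gm: "graded_free A F \<Longrightarrow> graded_module A F" for F :: "('r, 'q) gr_module" by (simp add: graded_free_def)
  obtain F :: "('r, 'q) gr_module" and \<epsilon> where F: "graded_free A F" "\<epsilon> \<in> gr_hom A F L 0"
    "\<And>n. \<epsilon> n ` carrier (mgrp F n) = carrier (mgrp L n)"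
    using ex_free_cover[OF inf f g L] by blast
  obtain F' :: "('r, 'q) gr_module" and \<delta>' where F': "graded_free A F'" "\<delta>' \<in> gr_hom A F' F 0"
    "\<And>n. \<delta>' n ` carrier (mgrp F' n) = kernel (mgrp F n) (mgrp L n) (\<epsilon> n)"
    using ex_free_kernel_cover[OF inf f inj_on_id2 gm[OF F(1)] L F(2)] by blast
  \<comment> \<open>The state of the recursion is a pair of consecutive terms with the map between
    them, because the next term covers the kernel of that map. The clause for \<open>s = 0\<close>
    fixes the start, where the kernel covered was that of \<open>\<epsilon>\<close>.\<close>
  let ?P = "\<lambda>s (P, Q, \<delta>). graded_free A P \<and> graded_free A Q \<and> \<delta> \<in> gr_hom A Q P 0 \<and> (s = (0::nat) \<longrightarrow> P = F \<and> Q = F' \<and> \<delta> = \<delta>')"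
  let ?R = "\<lambda>s (P, Q, \<delta>) (P', Q', \<gamma>). P' = Q \<and> (\<forall>n. \<gamma> n ` carrier (mgrp Q' n) = kernel (mgrp Q n) (mgrp P n) (\<delta> n))"
  have "\<exists>X. \<forall>s. ?P s (X s) \<and> ?R s (X s) (X (Suc s))"
  proof (rule dependent_nat_choice)
    show "\<exists>x. ?P 0 x" using F F' by auto
    fix x s assume x: "?P s x"
    obtain P Q \<delta> where [simp]: "x = (P, Q, \<delta>)" by (cases x)
    have "graded_module A P" "graded_module A Q" "\<delta> \<in> gr_hom A Q P 0" using x gm by auto
    from ex_free_kernel_cover[OF inf f inj_on_id2 this(2,1,3)]
    obtain Q' :: "('r, 'q) gr_module" and \<gamma> where "graded_free A Q'" "\<gamma> \<in> gr_hom A Q' Q 0"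
      "\<forall>n. \<gamma> n ` carrier (mgrp Q' n) = kernel (mgrp Q n) (mgrp P n) (\<delta> n)" by blast
    then show "\<exists>y. ?P (Suc s) y \<and> ?R s x y" using x by (intro exI[of _ "(Q, Q', \<gamma>)"]) auto
  qed
  then obtain X where XX: "\<forall>s. ?P s (X s) \<and> ?R s (X s) (X (Suc s))" by (elim exE) (rule that)
  note X = conjunct1[OF XX[rule_format]] conjunct2[OF XX[rule_format]]
  define Q where "Q s = fst (X s)" for s
  define \<delta> where "\<delta> s = snd (snd (X s))" for s
  have Xs: "X s = (Q s, Q (Suc s), \<delta> s)" for s
    using X(2)[of s] by (cases "X s"; cases "X (Suc s)") (auto simp: Q_def \<delta>_def)
  have "free_resolution A L Q \<delta> \<epsilon>"
    unfolding free_resolution_def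
    using X(1) X(2) X(1)[of 0] F F' by (auto simp: Xs)
  then show ?thesis by blast
qed

text \<open>\<open>SOME\<close> in the definition of \<open>Ext\<close> picks a genuine resolution
  because one exists in the type \<open>('r \<times> 'm) list\<close>: it is infinite and receives
  injections from the ring and from the module as singleton lists.\<close>

lemma Ext_eq:
  fixes L :: "('r, 'm) gr_module"
  assumes L: "graded_module A L"
  shows "\<exists>(Q :: nat \<Rightarrow> ('r, ('r \<times> 'm) list) gr_module) \<delta> \<epsilon>.
    free_resolution A L Q \<delta> \<epsilon> \<and> Ext A L L' = Hom_cohomology A Q \<delta> L'"
proof -
  have "infinite (UNIV :: ('r \<times> 'm) list set)" by (rule infinite_UNIV_listI)
  moreover have "inj (\<lambda>r. [(r, undefined)] :: ('r \<times> 'm) list)" "inj (\<lambda>x. [(undefined, x)] :: ('r \<times> 'm) list)"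
    by (auto simp: inj_def)
  ultimately have "\<exists>(Q :: nat \<Rightarrow> ('r, ('r \<times> 'm) list) gr_module) \<delta> \<epsilon>. free_resolution A L Q \<delta> \<epsilon>"
    using ex_free_resolution L by blast
  then have ex: "\<exists>p :: (nat \<Rightarrow> ('r, ('r \<times> 'm) list) gr_module) \<times> _. (case p of (Q, \<delta>) \<Rightarrow> \<exists>\<epsilon>. free_resolution A L Q \<delta> \<epsilon>)"
    by auto
  define p :: "(nat \<Rightarrow> ('r, ('r \<times> 'm) list) gr_module) \<times> _"
    where "p = (SOME (Q, \<delta>). \<exists>\<epsilon>. free_resolution A L Q \<delta> \<epsilon>)"
  obtain Q \<delta> where p: "p = (Q, \<delta>)" by (cases p)
  have "\<exists>\<epsilon>. free_resolution A L Q \<delta> \<epsilon>" using someI_ex[OF ex] p unfolding p_def by auto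
  moreover have "Ext A L L' = Hom_cohomology A Q \<delta> L'"
    using p unfolding Ext_def p_def by simp
  ultimately show ?thesis by blast
qed

section \<open>Additive and triangulated categories\<close>

context category
begin

lemma Mor_src: "f \<in> Mor C X Y \<Longrightarrow> X \<in> obj C" and Mor_tgt: "f \<in> Mor C X Y \<Longrightarrow> Y \<in> obj C"
  using src_closed tgt_closed by (auto simp: Mor_def)

lemma iso_arrI:
  assumes "f \<in> Mor C X Y" "g \<in> Mor C Y X" "g \<bullet> f = idn C X" "f \<bullet> g = idn C Y"
  shows "iso_arr C f"
  unfolding iso_arr_def inverse_arrows_def using assms by (auto simp: Mor_def)

lemma iso_arrE:
  assumes "iso_arr C f" "f \<in> Mor C X Y"
  obtains g where "g \<in> Mor C Y X" "g \<bullet> f = idn C X" "f \<bullet> g = idn C Y"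
  using assms unfolding iso_arr_def inverse_arrows_def by (auto simp: Mor_def)

lemma coproductE:
  assumes "is_coproduct C I X P \<iota>" "Y \<in> obj C" "\<And>i. i \<in> I \<Longrightarrow> f i \<in> Mor C (X i) Y"
  obtains h where "h \<in> Mor C P Y" "\<And>i. i \<in> I \<Longrightarrow> h \<bullet> \<iota> i = f i"
proof -
  have "\<exists>!h. h \<in> Mor C P Y \<and> (\<forall>i\<in>I. h \<bullet> \<iota> i = f i)"
    using assms by (simp add: is_coproduct_def)
  then show thesis using that by (elim ex1E) blast
qed

lemma coproduct_eqI:
  assumes P: "is_coproduct C I X P \<iota>" and h: "h \<in> Mor C P Y" "h' \<in> Mor C P Y"
    and eq: "\<And>i. i \<in> I \<Longrightarrow> h \<bullet> \<iota> i = h' \<bullet> \<iota> i"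
  shows "h = h'"
proof -
  have \<iota>: "\<And>i. i \<in> I \<Longrightarrow> \<iota> i \<in> Mor C (X i) P" using P by (simp add: is_coproduct_def)
  have "\<forall>i\<in>I. h \<bullet> \<iota> i \<in> Mor C (X i) Y" using cmp_closed[OF \<iota> h(1)] by blast
  then have "\<exists>!k. k \<in> Mor C P Y \<and> (\<forall>i\<in>I. k \<bullet> \<iota> i = h \<bullet> \<iota> i)"
    using P Mor_tgt[OF h(1)] by (simp add: is_coproduct_def)
  then show ?thesis using h eq by (metis (no_types, lifting))
qed

end

lemma carrier_Hom [simp]: "carrier (Hom C X Y) = Mor C X Y"
  and mult_Hom [simp]: "(\<otimes>\<^bsub>Hom C X Y\<^esub>) = add C"
  and one_Hom [simp]: "\<one>\<^bsub>Hom C X Y\<^esub> = zer C X Y"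
  by (simp_all add: Hom_def)

context additive_category
begin

lemma Hom_comm_group: "f \<in> Mor C X Y \<Longrightarrow> comm_group (Hom C X Y)"
  using Hom_group Mor_src Mor_tgt by blast

lemma neg_eq: "f \<in> Mor C X Y \<Longrightarrow> neg C f = inv\<^bsub>Hom C X Y\<^esub> f"
  by (auto simp: neg_def Mor_def)

lemma zer_closed: "\<lbrakk>X \<in> obj C; Y \<in> obj C\<rbrakk> \<Longrightarrow> zer C X Y \<in> Mor C X Y"
  using monoid.one_closed[of "Hom C X Y"] Hom_group[of X Y]
  by (simp add: comm_group_def comm_monoid_def)

lemma add_closed: "\<lbrakk>f \<in> Mor C X Y; g \<in> Mor C X Y\<rbrakk> \<Longrightarrow> add C f g \<in> Mor C X Y"
proof -
  assume f: "f \<in> Mor C X Y" "g \<in> Mor C X Y"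
  interpret H: comm_group "Hom C X Y" by (rule Hom_comm_group[OF f(1)])
  show ?thesis using H.m_closed[of f g] f by simp
qed

lemma neg_closed: "f \<in> Mor C X Y \<Longrightarrow> neg C f \<in> Mor C X Y"
proof -
  assume f: "f \<in> Mor C X Y"
  interpret H: comm_group "Hom C X Y" by (rule Hom_comm_group[OF f])
  show ?thesis using H.inv_closed[of f] f by (simp add: neg_eq[OF f])
qed

lemma add_zer: "f \<in> Mor C X Y \<Longrightarrow> add C f (zer C X Y) = f" and zer_add: "f \<in> Mor C X Y \<Longrightarrow> add C (zer C X Y) f = f"
  and add_neg: "f \<in> Mor C X Y \<Longrightarrow> add C f (neg C f) = zer C X Y"
  and neg_add: "f \<in> Mor C X Y \<Longrightarrow> add C (neg C f) f = zer C X Y"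
  and neg_neg: "f \<in> Mor C X Y \<Longrightarrow> neg C (neg C f) = f"
proof -
  assume f: "f \<in> Mor C X Y"
  interpret H: comm_group "Hom C X Y" by (rule Hom_comm_group[OF f])
  note n = neg_eq[OF f] and nc = neg_closed[OF f]
  show "add C f (zer C X Y) = f" using H.r_one[of f] f by simp
  show "add C (zer C X Y) f = f" using H.l_one[of f] f by simp
  show "add C f (neg C f) = zer C X Y" using H.r_inv[of f] f by (simp add: n)
  show "add C (neg C f) f = zer C X Y" using H.l_inv[of f] f by (simp add: n)
  show "neg C (neg C f) = f" unfolding neg_eq[OF nc] unfolding n using H.inv_inv[of f] f by simp
qed

lemma precomp_group_hom:
  assumes f: "f \<in> Mor C X Y" and Z: "Z \<in> obj C"
  shows "group_hom (Hom C Y Z) (Hom C X Z) (\<lambda>g. g \<bullet> f)"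
proof -
  interpret G: comm_group "Hom C Y Z" by (rule Hom_group[OF Mor_tgt[OF f] Z])
  interpret H: comm_group "Hom C X Z" by (rule Hom_group[OF Mor_src[OF f] Z])
  show ?thesis by unfold_locales (auto simp: hom_def cmp_closed[OF f] cmp_add_left[OF f])
qed

lemma postcomp_group_hom:
  assumes g: "g \<in> Mor C Y Z" and X: "X \<in> obj C"
  shows "group_hom (Hom C X Y) (Hom C X Z) (\<lambda>f. g \<bullet> f)"
proof -
  interpret G: comm_group "Hom C X Y" by (rule Hom_group[OF X Mor_src[OF g]])
  interpret H: comm_group "Hom C X Z" by (rule Hom_group[OF X Mor_tgt[OF g]])
  show ?thesis by unfold_locales (auto simp: hom_def cmp_closed[OF _ g] cmp_add_right[OF _ _ g])
qed

lemma zer_cmp: "\<lbrakk>f \<in> Mor C X Y; Z \<in> obj C\<rbrakk> \<Longrightarrow> zer C Y Z \<bullet> f = zer C X Z"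
  using group_hom.hom_one[OF precomp_group_hom[of f X Y Z]] by simp

lemma cmp_zer: "\<lbrakk>g \<in> Mor C Y Z; X \<in> obj C\<rbrakk> \<Longrightarrow> g \<bullet> zer C X Y = zer C X Z"
  using group_hom.hom_one[OF postcomp_group_hom[of g Y Z X]] by simp

lemma neg_cmp: "\<lbrakk>f \<in> Mor C X Y; g \<in> Mor C Y Z\<rbrakk> \<Longrightarrow> neg C g \<bullet> f = neg C (g \<bullet> f)"
  using group_hom.hom_inv[OF precomp_group_hom[of f X Y Z], of g] Mor_tgt[of g Y Z]
    neg_eq[of g Y Z] neg_eq[of "g \<bullet> f" X Z] cmp_closed[of f X Y g Z] by simp

lemma cmp_neg: "\<lbrakk>f \<in> Mor C X Y; g \<in> Mor C Y Z\<rbrakk> \<Longrightarrow> g \<bullet> neg C f = neg C (g \<bullet> f)"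
  using group_hom.hom_inv[OF postcomp_group_hom[of g Y Z X], of f] Mor_src[of f X Y]
    neg_eq[of f X Y] neg_eq[of "g \<bullet> f" X Z] cmp_closed[of f X Y g Z] by simp

lemma zero_object_iff: "zero_object C Z \<longleftrightarrow> Z \<in> obj C \<and> idn C Z = zer C Z Z"
proof
  assume Z: "zero_object C Z"
  then have "Z \<in> obj C" by (simp add: zero_object_def)
  then show "Z \<in> obj C \<and> idn C Z = zer C Z Z"
    using Z idn_closed[of Z] zer_closed[of Z Z] unfolding zero_object_def by blast
next
  assume Z: "Z \<in> obj C \<and> idn C Z = zer C Z Z"
  have "f = zer C Z Y" if f: "f \<in> Mor C Z Y" for f Y
    using idn_right[OF f] cmp_zer[OF f, of Z] Z by simp
  moreover have "f = zer C Y Z" if f: "f \<in> Mor C Y Z" for f Y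
    using idn_left[OF f] zer_cmp[OF f, of Z] Z by simp
  ultimately show "zero_object C Z" using Z zer_closed unfolding zero_object_def by blast
qed

lemma zero_object_from: "\<lbrakk>zero_object C Z; f \<in> Mor C Z Y\<rbrakk> \<Longrightarrow> f = zer C Z Y"
  using idn_right[of f Z Y] cmp_zer[of f Z Y Z] by (auto simp: zero_object_iff)

end

text \<open>Common form of \<open>shift\<close> on objects and \<open>shift_arr\<close> on arrows,
  so that the laws of iterated suspension and desuspension are proved once, for a bijection of a
  set.\<close>

definition int_pow_on :: "'a set \<Rightarrow> ('a \<Rightarrow> 'a) \<Rightarrow> int \<Rightarrow> 'a \<Rightarrow> 'a" where
  "int_pow_on A f n = (if 0 \<le> n then f ^^ nat n else the_inv_into A f ^^ nat (- n))"

lemma shift_int_pow_on: "shift C n = int_pow_on (obj C) (susp C) n"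
  and shift_arr_int_pow_on: "shift_arr C n = int_pow_on (arr C) (susp_arr C) n"
  by (simp_all add: shift_def shift_arr_def int_pow_on_def)

context
  fixes A :: "'a set" and f :: "'a \<Rightarrow> 'a"
  assumes f: "bij_betw f A A"
begin

lemma inv_on_closed: "x \<in> A \<Longrightarrow> the_inv_into A f x \<in> A" and f_inv_on: "x \<in> A \<Longrightarrow> f (the_inv_into A f x) = x"
  and inv_on_f: "x \<in> A \<Longrightarrow> the_inv_into A f (f x) = x" and f_closed: "x \<in> A \<Longrightarrow> f x \<in> A"
  using f bij_betw_the_inv_into[OF f]
  by (auto simp: bij_betw_def f_the_inv_into_f the_inv_into_f_f)

lemma int_pow_on_closed: "x \<in> A \<Longrightarrow> int_pow_on A f n x \<in> A"
proof -
  assume x: "x \<in> A"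
  have "(f ^^ k) x \<in> A" "(the_inv_into A f ^^ k) x \<in> A" for k
    by (induction k) (auto simp: x f_closed inv_on_closed)
  then show ?thesis by (simp add: int_pow_on_def)
qed

lemma int_pow_on_0: "int_pow_on A f 0 x = x" by (simp add: int_pow_on_def)

lemma int_pow_on_add1: 
  assumes x: "x \<in> A"
  shows "int_pow_on A f (1 + n) x = f (int_pow_on A f n x)"
proof (cases "0 \<le> n")
  case True
  then have "nat (1 + n) = Suc (nat n)" by simp
  then show ?thesis using True by (simp add: int_pow_on_def)
next
  case False
  define k where "k = nat (- n) - 1"
  have k: "nat (- n) = Suc k" "n = - int k - 1" using False by (simp_all add: k_def)
  have c: "(the_inv_into A f ^^ k) x \<in> A" by (induction k) (auto simp: x inv_on_closed)
  have "int_pow_on A f (1 + n) x = (the_inv_into A f ^^ k) x" by (simp add: int_pow_on_def k(2))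
  moreover have "int_pow_on A f n x = the_inv_into A f ((the_inv_into A f ^^ k) x)"
    using False by (simp add: int_pow_on_def k(1))
  ultimately show ?thesis using f_inv_on[OF c] by simp
qed

lemma int_pow_on_sub1:
  assumes x: "x \<in> A"
  shows "int_pow_on A f (n - 1) x = the_inv_into A f (int_pow_on A f n x)"
  using int_pow_on_add1[OF x, of "n - 1"] inv_on_f[OF int_pow_on_closed[OF x]] by simp

lemma int_pow_on_add:
  assumes x: "x \<in> A"
  shows "int_pow_on A f (m + n) x = int_pow_on A f m (int_pow_on A f n x)"
proof (induction m rule: int_induct[where k = 0])
  case base
  show ?case by (simp add: int_pow_on_0)
next
  case (step1 i)
  have "i + 1 + n = 1 + (i + n)" "i + 1 = 1 + i" by simp_all
  then show ?case using step1 int_pow_on_add1[OF x] int_pow_on_add1[OF int_pow_on_closed[OF x]] by metis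
next
  case (step2 i)
  have "i - 1 + n = (i + n) - 1" by simp
  then show ?case using step2 int_pow_on_sub1[OF x] int_pow_on_sub1[OF int_pow_on_closed[OF x]] by metis
qed

end

section \<open>Suspension, desuspension and shifts\<close>

context triangulated_category
begin

lemma susp_closed: "X \<in> obj C \<Longrightarrow> susp C X \<in> obj C"
  and susp_idn: "X \<in> obj C \<Longrightarrow> susp_arr C (idn C X) = idn C (susp C X)"
  and susp_mor: "f \<in> Mor C X Y \<Longrightarrow> susp_arr C f \<in> Mor C (susp C X) (susp C Y)"
  using susp_functor Mor_src Mor_tgt unfolding is_functor_def by simp_all

lemma susp_cmp: "\<lbrakk>f \<in> Mor C X Y; g \<in> Mor C Y Z\<rbrakk> \<Longrightarrow> susp_arr C (g \<bullet> f) = susp_arr C g \<bullet> susp_arr C f"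
  using susp_functor Mor_src[of f X Y] Mor_src[of g Y Z] Mor_tgt[of g Y Z]
  unfolding is_functor_def by simp

lemma susp_obj_inj: "\<lbrakk>X \<in> obj C; Y \<in> obj C; susp C X = susp C Y\<rbrakk> \<Longrightarrow> X = Y"
  using susp_bij by (meson bij_betw_imp_inj_on inj_onD)

lemma Mor_arr: "f \<in> Mor C X Y \<Longrightarrow> f \<in> arr C" by (simp add: Mor_def)

lemma susp_mor_inj: "\<lbrakk>f \<in> Mor C X Y; g \<in> Mor C X Y; susp_arr C f = susp_arr C g\<rbrakk> \<Longrightarrow> f = g"
  using susp_arr_bij Mor_arr by (meson bij_betw_imp_inj_on inj_onD)

text \<open>Suspension is assumed bijective on the set of all arrows; that the preimage of
  \<open>g\<close> runs from \<open>X\<close> to \<open>Y\<close> follows from injectivity on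
  objects.\<close>

lemma susp_mor_surj:
  assumes X: "X \<in> obj C" and Y: "Y \<in> obj C" and g: "g \<in> Mor C (susp C X) (susp C Y)"
  obtains f where "f \<in> Mor C X Y" "susp_arr C f = g"
proof -
  have "g \<in> susp_arr C ` arr C" using susp_arr_bij Mor_arr[OF g] by (simp add: bij_betw_def)
  then obtain f where f: "f \<in> arr C" "susp_arr C f = g" by blast
  have fm: "f \<in> Mor C (src C f) (tgt C f)" using f by (simp add: Mor_def)
  have "susp C (src C f) = susp C X" "susp C (tgt C f) = susp C Y"
    using susp_mor[OF fm] g f(2) by (simp_all add: Mor_def)
  then have "src C f = X" "tgt C f = Y"
    using susp_obj_inj X Y src_closed[OF f(1)] tgt_closed[OF f(1)] by blast+
  then show thesis using that fm f(2) by simp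
qed

lemma susp_hom: "\<lbrakk>X \<in> obj C; Y \<in> obj C\<rbrakk> \<Longrightarrow> group_hom (Hom C X Y) (Hom C (susp C X) (susp C Y)) (susp_arr C)"
  using Hom_group susp_closed
  by (auto intro!: group_hom.intro group_hom_axioms.intro simp: comm_group.axioms(2) hom_def susp_mor susp_add)

lemma susp_zer: "\<lbrakk>X \<in> obj C; Y \<in> obj C\<rbrakk> \<Longrightarrow> susp_arr C (zer C X Y) = zer C (susp C X) (susp C Y)"
  using group_hom.hom_one[OF susp_hom[of X Y]] by simp

lemma shift_closed: "X \<in> obj C \<Longrightarrow> shift C n X \<in> obj C"
  unfolding shift_int_pow_on by (rule int_pow_on_closed[OF susp_bij])

lemma shift_0: "shift C 0 X = X" by (simp add: shift_def)

lemma shift_shift: "X \<in> obj C \<Longrightarrow> shift C m (shift C n X) = shift C (m + n) X"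
  unfolding shift_int_pow_on by (rule int_pow_on_add[OF susp_bij, symmetric])

lemma susp_shift: "X \<in> obj C \<Longrightarrow> susp C (shift C n X) = shift C (1 + n) X"
  unfolding shift_int_pow_on by (rule int_pow_on_add1[OF susp_bij, symmetric])

lemma shift_arr_0: "shift_arr C 0 f = f" by (simp add: shift_arr_def)

lemma shift_arr_add: "f \<in> Mor C X Y \<Longrightarrow> shift_arr C m (shift_arr C n f) = shift_arr C (m + n) f"
  unfolding shift_arr_int_pow_on by (rule int_pow_on_add[OF susp_arr_bij Mor_arr, symmetric])

lemma shift_arr_1: "f \<in> Mor C X Y \<Longrightarrow> shift_arr C (1 + n) f = susp_arr C (shift_arr C n f)"
  unfolding shift_arr_int_pow_on by (rule int_pow_on_add1[OF susp_arr_bij Mor_arr])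

lemma desusp_mor:
  assumes X: "X \<in> obj C" and Y: "Y \<in> obj C" and g: "g \<in> Mor C X Y"
  shows "the_inv_into (arr C) (susp_arr C) g \<in> Mor C (the_inv_into (obj C) (susp C) X) (the_inv_into (obj C) (susp C) Y)"
proof -
  let ?d = "the_inv_into (obj C) (susp C)"
  have "?d X \<in> obj C" "?d Y \<in> obj C" "susp C (?d X) = X" "susp C (?d Y) = Y"
    using inv_on_closed[OF susp_bij] f_inv_on[OF susp_bij] X Y by auto
  then obtain f where f: "f \<in> Mor C (?d X) (?d Y)" "susp_arr C f = g" using susp_mor_surj g by metis
  have "the_inv_into (arr C) (susp_arr C) g = f"
    using inv_on_f[OF susp_arr_bij Mor_arr[OF f(1)]] f(2) by simp
  then show ?thesis using f(1) by simp
qed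

lemma shift_mor: "f \<in> Mor C X Y \<Longrightarrow> shift_arr C n f \<in> Mor C (shift C n X) (shift C n Y)"
proof -
  assume f: "f \<in> Mor C X Y"
  note X = Mor_src[OF f] and Y = Mor_tgt[OF f]
  show ?thesis
  proof (induction n rule: int_induct[where k = 0])
    case base
    show ?case using f by (simp add: shift_0 shift_arr_0)
  next
    case (step1 i)
    then show ?case using susp_mor[OF step1(2)] shift_arr_1[OF f, of i] susp_shift[OF X, of i] susp_shift[OF Y, of i]
      by (simp add: add.commute)
  next
    case (step2 i)
    show ?case
      using desusp_mor[OF shift_closed[OF X] shift_closed[OF Y] step2(2)]
        int_pow_on_sub1[OF susp_bij X, of i] int_pow_on_sub1[OF susp_bij Y, of i] int_pow_on_sub1[OF susp_arr_bij Mor_arr[OF f], of i]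
      by (simp add: shift_int_pow_on shift_arr_int_pow_on)
  qed
qed

lemma shift_arr_cancel: "f \<in> Mor C X Y \<Longrightarrow> shift_arr C (- n) (shift_arr C n f) = f"
  by (simp add: shift_arr_add shift_arr_0)

lemma shift_mor_inj: "\<lbrakk>f \<in> Mor C X Y; g \<in> Mor C X Y; shift_arr C n f = shift_arr C n g\<rbrakk> \<Longrightarrow> f = g"
  by (metis shift_arr_cancel)

lemma shift_mor_surj:
  assumes X: "X \<in> obj C" and Y: "Y \<in> obj C" and g: "g \<in> Mor C (shift C n X) (shift C n Y)"
  shows "shift_arr C (- n) g \<in> Mor C X Y" "shift_arr C n (shift_arr C (- n) g) = g"
  using shift_mor[OF g, of "- n"] shift_shift[OF X, of "- n" n] shift_shift[OF Y, of "- n" n] shift_arr_add[OF g, of n "- n"]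
  by (simp_all add: shift_0 shift_arr_0)

lemma shift_cmp:
  assumes f: "f \<in> Mor C X Y" and g: "g \<in> Mor C Y Z"
  shows "shift_arr C n (g \<bullet> f) = shift_arr C n g \<bullet> shift_arr C n f"
proof (induction n rule: int_induct[where k = 0])
  case base
  show ?case by (simp add: shift_arr_0)
next
  case (step1 i)
  then show ?case using susp_cmp[OF shift_mor[OF f] shift_mor[OF g]] cmp_closed[OF f g]
      shift_arr_1[OF f, of i] shift_arr_1[OF g, of i] shift_arr_1[OF cmp_closed[OF f g], of i]
    by (simp add: add.commute)
next
  \<comment> \<open>Functoriality is assumed for suspension, not for its inverse. The equation in
    degree \<open>i - 1\<close> is therefore checked after suspending, where it becomes the
    induction hypothesis.\<close>
  case (step2 i)
  have e: "susp_arr C (shift_arr C (i - 1) k) = shift_arr C i k" if "k \<in> Mor C U V" for k U V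
    using shift_arr_1[OF that, of "i - 1"] by simp
  show ?case
  proof (rule susp_mor_inj)
    show "shift_arr C (i - 1) (g \<bullet> f) \<in> Mor C (shift C (i - 1) X) (shift C (i - 1) Z)"
      by (rule shift_mor[OF cmp_closed[OF f g]])
    show "shift_arr C (i - 1) g \<bullet> shift_arr C (i - 1) f \<in> Mor C (shift C (i - 1) X) (shift C (i - 1) Z)"
      by (rule cmp_closed[OF shift_mor[OF f] shift_mor[OF g]])
    show "susp_arr C (shift_arr C (i - 1) (g \<bullet> f)) = susp_arr C (shift_arr C (i - 1) g \<bullet> shift_arr C (i - 1) f)"
      unfolding susp_cmp[OF shift_mor[OF f] shift_mor[OF g]] e[OF f] e[OF g] e[OF cmp_closed[OF f g]]
      by (rule step2(2))
  qed
qed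

lemma shift_add:
  assumes f: "f \<in> Mor C X Y" and g: "g \<in> Mor C X Y"
  shows "shift_arr C n (add C f g) = add C (shift_arr C n f) (shift_arr C n g)"
proof (induction n rule: int_induct[where k = 0])
  case base
  show ?case by (simp add: shift_arr_0)
next
  case (step1 i)
  then show ?case using susp_add[OF shift_mor[OF f] shift_mor[OF g]]
      shift_arr_1[OF f, of i] shift_arr_1[OF g, of i] shift_arr_1[OF add_closed[OF f g], of i]
    by (simp add: add.commute)
next
  case (step2 i)
  have e: "susp_arr C (shift_arr C (i - 1) k) = shift_arr C i k" if "k \<in> Mor C U V" for k U V
    using shift_arr_1[OF that, of "i - 1"] by simp
  show ?case
  proof (rule susp_mor_inj)
    show "shift_arr C (i - 1) (add C f g) \<in> Mor C (shift C (i - 1) X) (shift C (i - 1) Y)"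
      by (rule shift_mor[OF add_closed[OF f g]])
    show "add C (shift_arr C (i - 1) f) (shift_arr C (i - 1) g) \<in> Mor C (shift C (i - 1) X) (shift C (i - 1) Y)"
      by (rule add_closed[OF shift_mor[OF f] shift_mor[OF g]])
    show "susp_arr C (shift_arr C (i - 1) (add C f g)) = susp_arr C (add C (shift_arr C (i - 1) f) (shift_arr C (i - 1) g))"
      unfolding susp_add[OF shift_mor[OF f] shift_mor[OF g]] e[OF f] e[OF g] e[OF add_closed[OF f g]]
      by (rule step2(2))
  qed
qed

lemma shift_iso_Hom:
  assumes X: "X \<in> obj C" and Y: "Y \<in> obj C"
  shows "shift_arr C n \<in> iso (Hom C X Y) (Hom C (shift C n X) (shift C n Y))"
proof (rule isoI)
  show "shift_arr C n \<in> hom (Hom C X Y) (Hom C (shift C n X) (shift C n Y))"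
    by (rule homI) (simp_all add: shift_mor shift_add)
  show "bij_betw (shift_arr C n) (carrier (Hom C X Y)) (carrier (Hom C (shift C n X) (shift C n Y)))"
    by (rule bij_betw_byWitness[of _ "shift_arr C (- n)"])
      (auto simp: shift_arr_add shift_arr_0 shift_mor shift_mor_surj[OF X Y])
qed

lemma shift_idn: "X \<in> obj C \<Longrightarrow> shift_arr C n (idn C X) = idn C (shift C n X)"
proof -
  assume X: "X \<in> obj C"
  note i = idn_closed[OF shift_closed[OF X, of n]]
  note s = shift_mor_surj[OF X X i]
  have "shift_arr C n (idn C X) = shift_arr C n (idn C X) \<bullet> shift_arr C n (shift_arr C (- n) (idn C (shift C n X)))"
    unfolding s(2) by (rule idn_right[OF shift_mor[OF idn_closed[OF X]], symmetric])
  also have "\<dots> = shift_arr C n (shift_arr C (- n) (idn C (shift C n X)))"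
    unfolding shift_cmp[OF s(1) idn_closed[OF X], symmetric] idn_left[OF s(1)] ..
  finally show ?thesis using s(2) by simp
qed

lemma shift_zer: "\<lbrakk>X \<in> obj C; Y \<in> obj C\<rbrakk> \<Longrightarrow> shift_arr C n (zer C X Y) = zer C (shift C n X) (shift C n Y)"
proof -
  assume XY: "X \<in> obj C" "Y \<in> obj C"
  have "shift_arr C n \<in> hom (Hom C X Y) (Hom C (shift C n X) (shift C n Y))"
    using shift_iso_Hom[OF XY] by (simp add: iso_def)
  from hom_one[OF this comm_group.axioms(2)[OF Hom_group[OF XY]]
      comm_group.axioms(2)[OF Hom_group[OF shift_closed[OF XY(1)] shift_closed[OF XY(2)]]]]
  show ?thesis by simp
qed

section \<open>Exactness of Hom on triangles\<close>

lemma tri_Mor: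
  assumes "(u, v, w) \<in> tri C" "u \<in> Mor C X Y" "v \<in> Mor C Y Z"
  shows "w \<in> Mor C Z (susp C X)"
proof -
  have "w \<in> Mor C (tgt C v) (susp C (src C u))"
    using tri_candidate[OF assms(1)] unfolding candidate_triangle_def by blast
  moreover have "tgt C v = Z" "src C u = X" using assms(2,3) by (simp_all add: Mor_def)
  ultimately show ?thesis by simp
qed

lemma candidate_triangleI:
  "\<lbrakk>u \<in> Mor C X Y; v \<in> Mor C Y Z; w \<in> Mor C Z (susp C X)\<rbrakk> \<Longrightarrow> candidate_triangle C u v w"
proof -
  assume uvw: "u \<in> Mor C X Y" "v \<in> Mor C Y Z" "w \<in> Mor C Z (susp C X)"
  then have "u \<in> arr C" "src C u = X" "tgt C u = Y" "tgt C v = Z" "src C w = Z" by (simp_all add: Mor_def)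
  then show ?thesis using uvw unfolding candidate_triangle_def by simp
qed

context
  fixes u v w X Y Z
  assumes tri: "(u, v, w) \<in> tri C" and u: "u \<in> Mor C X Y" and v: "v \<in> Mor C Y Z"
begin

lemma rotate: "(v, w, neg C (susp_arr C u)) \<in> tri C"
  using tri_rotate[OF tri_candidate[OF tri]] tri by blast

text \<open>The pair \<open>(1, u)\<close> maps the trivial triangle
  \<open>X = X \<rightarrow> 0\<close> to the given one; the third component factors
  \<open>v u\<close> through a zero object.\<close>

lemma tri_zero: "v \<bullet> u = zer C X Z"
proof -
  obtain K where K: "zero_object C K" using zero_object_exists by blast
  then have Oc: "K \<in> obj C" by (simp add: zero_object_iff)
  note X = Mor_src[OF u]
  have src: "src C u = X" "tgt C u = Y" "src C (idn C X) = X" "tgt C (idn C X) = X" "tgt C v = Z" "tgt C (zer C X K) = K"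
    using u v idn_closed[OF X] zer_closed[OF X Oc] by (auto simp: Mor_def)
  have "\<exists>h\<in>Mor C (tgt C (zer C X K)) (tgt C v). h \<bullet> zer C X K = v \<bullet> u \<and> susp_arr C (idn C X) \<bullet> zer C K (susp C X) = w \<bullet> h"
    by (rule tri_morphism[OF tri_id[OF X K] tri]) (use u idn_closed[OF X] idn_right[OF u] in \<open>simp_all add: src\<close>)
  then obtain h where "h \<in> Mor C K Z" "h \<bullet> zer C X K = v \<bullet> u" unfolding src by blast
  then show ?thesis using cmp_zer[OF _ X] by metis
qed

text \<open>Weak cokernels: \<open>f\<close> together with zero maps the triangle to
  \<open>0 \<rightarrow> N = N \<rightarrow> 0\<close>, and the third component is the wanted
  factorization.\<close>

lemma tri_factor_right:
  assumes f: "f \<in> Mor C Y N" and z: "f \<bullet> u = zer C X N"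
  obtains g where "g \<in> Mor C Z N" "g \<bullet> v = f"
proof -
  obtain K where K: "zero_object C K" using zero_object_exists by blast
  then have Oc: "K \<in> obj C" by (simp add: zero_object_iff)
  note X = Mor_src[OF u] and N = Mor_tgt[OF f] and sO = susp_closed[OF Oc]
  have SO: "zero_object C (susp C K)"
    using K susp_idn[OF Oc] susp_zer[OF Oc Oc] sO by (simp add: zero_object_iff)
  have cand: "candidate_triangle C (zer C K N) (idn C N) (zer C N (susp C K))"
    by (rule candidate_triangleI[OF zer_closed[OF Oc N] idn_closed[OF N] zer_closed[OF N sO]])
  have "neg C (susp_arr C (zer C K N)) = zer C (susp C K) (susp C N)"
    using zero_object_from[OF SO neg_closed[OF susp_mor[OF zer_closed[OF Oc N]]]] .
  then have t: "(zer C K N, idn C N, zer C N (susp C K)) \<in> tri C"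
    using tri_rotate[OF cand] tri_id[OF N SO] by simp
  have src: "src C u = X" "tgt C u = Y" "src C (zer C K N) = K" "tgt C (zer C K N) = N" "tgt C v = Z" "tgt C (idn C N) = N"
    using u v idn_closed[OF N] zer_closed[OF Oc N] by (auto simp: Mor_def)
  have "f \<bullet> u = zer C K N \<bullet> zer C X K" using z zer_cmp[OF zer_closed[OF X Oc] N] by simp
  from tri_morphism[OF tri t _ _ this] obtain h where "h \<in> Mor C Z N" "h \<bullet> v = idn C N \<bullet> f"
    unfolding src using f zer_closed[OF X Oc] by blast
  then show thesis using that idn_left[OF f] by simp
qed

text \<open>Weak kernels: \<open>g\<close> together with zero maps the triangle
  \<open>W \<rightarrow> 0 \<rightarrow> \<Sigma>W\<close> to the rotated one. The third component
  factors \<open>\<Sigma>g\<close> through \<open>\<Sigma>u\<close>; the signs of both rotations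
  cancel, and the factorization is desuspended.\<close>

lemma tri_factor_left:
  assumes g: "g \<in> Mor C W Y" and z: "v \<bullet> g = zer C W Z"
  obtains f where "f \<in> Mor C W X" "u \<bullet> f = g"
proof -
  obtain K where K: "zero_object C K" using zero_object_exists by blast
  then have Oc: "K \<in> obj C" by (simp add: zero_object_iff)
  note W = Mor_src[OF g] and X = Mor_src[OF u] and Z = Mor_tgt[OF v] and Y = Mor_tgt[OF u]
  note zc = zer_closed[OF W Oc] and zc' = zer_closed[OF Oc susp_closed[OF W]] and zZ = zer_closed[OF Oc Z]
  have w: "w \<in> Mor C Z (susp C X)" by (rule tri_Mor[OF tri u v])
  have t: "(zer C W K, zer C K (susp C W), neg C (susp_arr C (idn C W))) \<in> tri C"
    using tri_rotate[OF candidate_triangleI[OF idn_closed[OF W] zc zc']] tri_id[OF W K] by blast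
  have src: "src C v = Y" "tgt C v = Z" "src C (zer C W K) = W" "tgt C (zer C W K) = K" "tgt C w = susp C X"
      "tgt C (zer C K (susp C W)) = susp C W"
    using v w zc zc' by (auto simp: Mor_def)
  have "zer C K Z \<bullet> zer C W K = v \<bullet> g" using z zer_cmp[OF zc Z] by simp
  from tri_morphism[OF t rotate _ _ this] obtain h where h: "h \<in> Mor C (susp C W) (susp C X)"
    "susp_arr C g \<bullet> neg C (susp_arr C (idn C W)) = neg C (susp_arr C u) \<bullet> h"
    unfolding src using g zZ by blast
  obtain f where f: "f \<in> Mor C W X" "susp_arr C f = h" using susp_mor_surj[OF W X h(1)] by blast
  note sg = susp_mor[OF g] and su = susp_mor[OF u] and suf = cmp_closed[OF h(1) susp_mor[OF u]]
  have "neg C (susp_arr C g) = neg C (susp_arr C u \<bullet> h)"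
    using h(2) cmp_neg[OF idn_closed[OF susp_closed[OF W]] sg] neg_cmp[OF h(1) su] idn_right[OF sg] susp_idn[OF W] by simp
  then have "susp_arr C g = susp_arr C u \<bullet> h" using neg_neg[OF sg] neg_neg[OF suf] by metis
  also have "\<dots> = susp_arr C (u \<bullet> f)" using susp_cmp[OF f(1) u] f(2) by simp
  finally have "g = u \<bullet> f" by (rule susp_mor_inj[OF g cmp_closed[OF f(1) u]])
  then show thesis using that f(1) by blast
qed

end

end

section \<open>The exact couple of a tower of triangles\<close>

context triangulated_category
begin

context
  fixes u v w X Y Z
  assumes tri: "(u, v, w) \<in> tri C" and u: "u \<in> Mor C X Y" and v: "v \<in> Mor C Y Z"
begin

lemma tri_w: "w \<in> Mor C Z (susp C X)" by (rule tri_Mor[OF tri u v])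

lemma rotate_u: "neg C (susp_arr C u) \<in> Mor C (susp C X) (susp C Y)"
  by (rule neg_closed[OF susp_mor[OF u]])

lemma wv_zero: "w \<bullet> v = zer C Y (susp C X)"
  by (rule tri_zero[OF rotate[OF tri u v] v tri_w])

lemma uw_zero: "susp_arr C u \<bullet> w = zer C Z (susp C Y)"
proof -
  have "neg C (susp_arr C u) \<bullet> w = zer C Z (susp C Y)"
    by (rule tri_zero[OF rotate[OF rotate[OF tri u v] v tri_w] tri_w rotate_u])
  then have z: "neg C (susp_arr C u \<bullet> w) = zer C Z (susp C Y)" using neg_cmp[OF tri_w susp_mor[OF u]] by simp
  have c: "susp_arr C u \<bullet> w \<in> Mor C Z (susp C Y)" by (rule cmp_closed[OF tri_w susp_mor[OF u]])
  have "add C (neg C (susp_arr C u \<bullet> w)) (susp_arr C u \<bullet> w) = susp_arr C u \<bullet> w"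
    unfolding z by (rule zer_add[OF c])
  then show ?thesis using neg_add[OF c] by simp
qed

lemma w_factor:
  assumes N: "N \<in> obj C" and f: "f \<in> Mor C Z (susp C N)" "f \<bullet> v = zer C Y (susp C N)"
  obtains g where "g \<in> Mor C X N" "susp_arr C g \<bullet> w = f"
proof -
  obtain h where h: "h \<in> Mor C (susp C X) (susp C N)" "h \<bullet> w = f"
    using tri_factor_right[OF rotate[OF tri u v] v tri_w f] by blast
  then show thesis using susp_mor_surj[OF Mor_src[OF u] N h(1)] that by metis
qed

text \<open>In the triangle rotated twice, \<open>w\<close> is followed by
  \<open>- \<Sigma>u\<close>. The factorization found there is desuspended and negated.\<close>

lemma u_factor:
  assumes f: "f \<in> Mor C X N" "susp_arr C f \<bullet> w = zer C Z (susp C N)"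
  obtains g where "g \<in> Mor C Y N" "g \<bullet> u = f"
proof -
  obtain h where h: "h \<in> Mor C (susp C Y) (susp C N)" "h \<bullet> neg C (susp_arr C u) = susp_arr C f"
    using tri_factor_right[OF rotate[OF rotate[OF tri u v] v tri_w] tri_w rotate_u susp_mor[OF f(1)] f(2)] by blast
  obtain g where g: "g \<in> Mor C Y N" "susp_arr C g = h"
    using susp_mor_surj[OF Mor_tgt[OF u] Mor_tgt[OF f(1)] h(1)] by blast
  note sg = susp_mor[OF g(1)] and su = susp_mor[OF u]
  have n: "neg C g \<in> Mor C Y N" by (rule neg_closed[OF g(1)])
  have "susp_arr C (neg C g \<bullet> u) = susp_arr C f"
  proof -
    have "susp_arr C (neg C g) = neg C (susp_arr C g)"
      using group_hom.hom_inv[OF susp_hom[OF Mor_src[OF g(1)] Mor_tgt[OF g(1)]], of g] g(1)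
        neg_eq[OF g(1)] neg_eq[OF sg] by simp
    then show ?thesis using h(2) g(2) susp_cmp[OF u n] neg_cmp[OF su sg] cmp_neg[OF su sg] by simp
  qed
  then have "neg C g \<bullet> u = f" by (rule susp_mor_inj[OF cmp_closed[OF u n] f(1)])
  then show thesis using that n by blast
qed

end

end

text \<open>\<open>adams_couple\<close> for an arbitrary triangulated category, so that exactness,
  collapse and convergence are proved without reference to ring spectra.\<close>

definition hom_couple :: "('o, 'a, 'x) tri_cat_scheme \<Rightarrow> 'o \<Rightarrow> ('o, 'a) adams_res \<Rightarrow> ('a, 'a) couple" where
  "hom_couple C N T =
     \<lparr>cD = (\<lambda>s t. graded_Hom C (objM T s) N (int s + t)),
      cE = (\<lambda>s t. graded_Hom C (objP T s) N (int s + t)),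
      ci = (\<lambda>s t f. f \<bullet>\<^bsub>C\<^esub> resM T s),
      cj = (\<lambda>s t f. f \<bullet>\<^bsub>C\<^esub> resP T s),
      ck = (\<lambda>s t f. susp_arr C f \<bullet>\<^bsub>C\<^esub> resB T s)\<rparr>"

lemma adams_couple_eq: "adams_couple R N T = hom_couple (modules R) N T"
  by (simp add: adams_couple_def hom_couple_def)

locale triangle_tower = triangulated_category C for C :: "('o, 'a, 'x) tri_cat_scheme" (structure) +
  fixes T :: "('o, 'a) adams_res" and N :: 'o
  assumes N: "N \<in> obj C"
    and resP: "resP T s \<in> Mor C (objP T s) (objM T s)"
    and resM: "resM T s \<in> Mor C (objM T s) (objM T (Suc s))"
    and triT: "(resP T s, resM T s, resB T s) \<in> tri C"
begin

lemma resB: "resB T s \<in> Mor C (objM T (Suc s)) (susp C (objP T s))"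
  by (rule tri_Mor[OF triT resP resM])

lemma objM: "objM T s \<in> obj C" and objP: "objP T s \<in> obj C"
  using Mor_src[OF resM] Mor_src[OF resP] by auto

abbreviation "X \<equiv> hom_couple C N T"

lemma couple_simps:
  "cD X s t = Hom C (objM T s) (shift C (int s + t) N)" "cE X s t = Hom C (objP T s) (shift C (int s + t) N)"
  "ci X s t f = f \<bullet> resM T s" "cj X s t f = f \<bullet> resP T s" "ck X s t f = susp_arr C f \<bullet> resB T s"
  by (simp_all add: hom_couple_def graded_Hom_def)

lemma couple_fun: "ci X s t = (\<lambda>f. f \<bullet> resM T s)" "cj X s t = (\<lambda>f. f \<bullet> resP T s)"
  "ck X s t = (\<lambda>f. susp_arr C f \<bullet> resB T s)"
  by (simp_all add: hom_couple_def)

lemma sN: "shift C k N \<in> obj C" by (rule shift_closed[OF N])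

lemma ssN: "shift C (int (Suc s) + t) N = susp C (shift C (int s + t) N)"
  using susp_shift[OF N, of "int s + t"] by (simp add: add.assoc)

text \<open>The three exactness conditions are the weak cokernel property of the triangle \<open>P_s
  \<rightarrow> M_s \<rightarrow> M_(s+1) \<rightarrow> \<Sigma>P_s\<close> and of its two
  rotations; \<open>ssN\<close> matches the suspended target with the one at
  \<open>s + 1\<close>.\<close>

lemma hom_couple_exact: "exact_couple X"
proof (rule exact_couple.intro)
  fix s t
  let ?N = "shift C (int s + t) N"
  show "comm_group (cD X s t)" "comm_group (cE X s t)"
    unfolding couple_simps by (rule Hom_group[OF objM sN], rule Hom_group[OF objP sN])
  have i1: "int (Suc s) + (t - 1) = int s + t" by simp
  have i2: "int s + (t + 1) = int (Suc s) + t" by simp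
  interpret i: group_hom "Hom C (objM T (Suc s)) ?N" "Hom C (objM T s) ?N" "\<lambda>f. f \<bullet> resM T s"
    by (rule precomp_group_hom[OF resM sN])
  interpret j: group_hom "Hom C (objM T s) ?N" "Hom C (objP T s) ?N" "\<lambda>f. f \<bullet> resP T s"
    by (rule precomp_group_hom[OF resP sN])
  interpret k: group_hom "Hom C (susp C (objP T s)) (susp C ?N)" "Hom C (objM T (Suc s)) (susp C ?N)" "\<lambda>f. f \<bullet> resB T s"
    by (rule precomp_group_hom[OF resB susp_closed[OF sN]])
  interpret S: group_hom "Hom C (objP T s) ?N" "Hom C (susp C (objP T s)) (susp C ?N)" "susp_arr C"
    by (rule susp_hom[OF objP sN])
  show "ci X s t \<in> hom (cD X (Suc s) (t - 1)) (cD X s t)"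
    unfolding couple_simps(1) i1 using i.homh by (simp add: couple_fun)
  show "cj X s t \<in> hom (cD X s t) (cE X s t)"
    unfolding couple_simps(1,2) using j.homh by (simp add: couple_fun)
  show "ck X s t \<in> hom (cE X s t) (cD X (Suc s) t)"
    unfolding couple_simps(1,2) ssN using hom_compose[OF S.homh k.homh] by (simp add: couple_fun comp_def)
  show "ci X s t ` carrier (cD X (Suc s) (t - 1)) = kernel (cD X s t) (cE X s t) (cj X s t)"
    unfolding couple_simps(1,2) i1
  proof (intro equalityI subsetI)
    fix f assume "f \<in> ci X s t ` carrier (Hom C (objM T (Suc s)) ?N)"
    then obtain g where g: "g \<in> Mor C (objM T (Suc s)) ?N" "f = g \<bullet> resM T s" by (auto simp: couple_simps)
    have "f \<bullet> resP T s = zer C (objP T s) ?N"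
      unfolding g(2) cmp_assoc[OF resP resM g(1)] tri_zero[OF triT resP resM] by (rule cmp_zer[OF g(1) objP])
    then show "f \<in> kernel (Hom C (objM T s) ?N) (Hom C (objP T s) ?N) (cj X s t)"
      using cmp_closed[OF resM g(1)] g(2) by (simp add: kernel_def couple_simps)
  next
    fix f assume "f \<in> kernel (Hom C (objM T s) ?N) (Hom C (objP T s) ?N) (cj X s t)"
    then have f: "f \<in> Mor C (objM T s) ?N" "f \<bullet> resP T s = zer C (objP T s) ?N"
      by (simp_all add: kernel_def couple_simps)
    obtain g where g: "g \<in> Mor C (objM T (Suc s)) ?N" "g \<bullet> resM T s = f"
      using tri_factor_right[OF triT resP resM f] .
    show "f \<in> ci X s t ` carrier (Hom C (objM T (Suc s)) ?N)"
      by (rule image_eqI[of _ _ g]) (simp_all add: couple_simps g)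
  qed
  show "cj X s t ` carrier (cD X s t) = kernel (cE X s t) (cD X (Suc s) t) (ck X s t)"
    unfolding couple_simps(1,2) ssN
  proof (intro equalityI subsetI)
    fix f assume "f \<in> cj X s t ` carrier (Hom C (objM T s) ?N)"
    then obtain g where g: "g \<in> Mor C (objM T s) ?N" "f = g \<bullet> resP T s" by (auto simp: couple_simps)
    have "susp_arr C f \<bullet> resB T s = zer C (objM T (Suc s)) (susp C ?N)"
      unfolding g(2) susp_cmp[OF resP g(1)] cmp_assoc[OF resB susp_mor[OF resP] susp_mor[OF g(1)]] uw_zero[OF triT resP resM]
      by (rule cmp_zer[OF susp_mor[OF g(1)] objM])
    then show "f \<in> kernel (Hom C (objP T s) ?N) (Hom C (objM T (Suc s)) (susp C ?N)) (ck X s t)"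
      using cmp_closed[OF resP g(1)] g(2) by (simp add: kernel_def couple_simps)
  next
    fix f assume "f \<in> kernel (Hom C (objP T s) ?N) (Hom C (objM T (Suc s)) (susp C ?N)) (ck X s t)"
    then have f: "f \<in> Mor C (objP T s) ?N" "susp_arr C f \<bullet> resB T s = zer C (objM T (Suc s)) (susp C ?N)"
      by (simp_all add: kernel_def couple_simps)
    obtain g where g: "g \<in> Mor C (objM T s) ?N" "g \<bullet> resP T s = f"
      using u_factor[OF triT resP resM f] .
    show "f \<in> cj X s t ` carrier (Hom C (objM T s) ?N)"
      by (rule image_eqI[of _ _ g]) (simp_all add: couple_simps g)
  qed
  show "ck X s t ` carrier (cE X s t) = kernel (cD X (Suc s) t) (cD X s (t + 1)) (ci X s (t + 1))"
    unfolding couple_simps(1,2) i2 ssN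
  proof (intro equalityI subsetI)
    fix f assume "f \<in> ck X s t ` carrier (Hom C (objP T s) ?N)"
    then obtain g where g: "g \<in> Mor C (objP T s) ?N" "f = susp_arr C g \<bullet> resB T s" by (auto simp: couple_simps)
    have "f \<bullet> resM T s = zer C (objM T s) (susp C ?N)"
      unfolding g(2) cmp_assoc[OF resM resB susp_mor[OF g(1)]] wv_zero[OF triT resP resM]
      by (rule cmp_zer[OF susp_mor[OF g(1)] objM])
    then show "f \<in> kernel (Hom C (objM T (Suc s)) (susp C ?N)) (Hom C (objM T s) (susp C ?N)) (ci X s (t + 1))"
      using cmp_closed[OF resB susp_mor[OF g(1)]] g(2) by (simp add: kernel_def couple_simps)
  next
    fix f assume "f \<in> kernel (Hom C (objM T (Suc s)) (susp C ?N)) (Hom C (objM T s) (susp C ?N)) (ci X s (t + 1))"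
    then have f: "f \<in> Mor C (objM T (Suc s)) (susp C ?N)" "f \<bullet> resM T s = zer C (objM T s) (susp C ?N)"
      by (simp_all add: kernel_def couple_simps)
    obtain g where g: "g \<in> Mor C (objP T s) ?N" "susp_arr C g \<bullet> resB T s = f"
      using w_factor[OF triT resP resM sN f] .
    show "f \<in> ck X s t ` carrier (Hom C (objP T s) ?N)"
      by (rule image_eqI[of _ _ g]) (simp_all add: couple_simps g)
  qed
qed

section \<open>Composites along the tower and collapse of the pages\<close>

primrec tower_arr :: "nat \<Rightarrow> nat \<Rightarrow> 'a" where
  "tower_arr s 0 = idn C (objM T s)"
| "tower_arr s (Suc k) = resM T (s + k) \<bullet> tower_arr s k"

lemma tower_arr: "tower_arr s k \<in> Mor C (objM T s) (objM T (s + k))"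
proof (induction k)
  case 0
  show ?case using idn_closed[OF objM] by simp
next
  case (Suc k)
  from cmp_closed[OF Suc resM] show ?case by simp
qed

lemma tower_arr_add: "tower_arr s (k + m) = tower_arr (s + k) m \<bullet> tower_arr s k"
proof (induction m)
  case 0
  show ?case using idn_left[OF tower_arr] by simp
next
  case (Suc m)
  have "resM T (s + k + m) \<in> Mor C (objM T (s + k + m)) (objM T (Suc (s + k + m)))" by (rule resM)
  then show ?case using Suc cmp_assoc[OF tower_arr[of s k] tower_arr[of "s + k" m] resM] by (simp add: add.assoc)
qed

lemma ci_pow_tower:
  "y \<in> Mor C (objM T (s + k)) Y \<Longrightarrow> ci_pow X k s t y = y \<bullet> tower_arr s k"
proof (induction k arbitrary: y)
  case 0
  then show ?case using idn_right by simp
next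
  case (Suc k)
  have y: "y \<in> Mor C (objM T (Suc (s + k))) Y" using Suc.prems by simp
  have "ci_pow X (Suc k) s t y = ci_pow X k s t (y \<bullet> resM T (s + k))" by (simp add: couple_simps)
  also have "\<dots> = (y \<bullet> resM T (s + k)) \<bullet> tower_arr s k" by (rule Suc.IH[OF cmp_closed[OF resM y]])
  finally show ?case using cmp_assoc[OF tower_arr resM y] by simp
qed

text \<open>If \<open>i^n = 0\<close>, then \<open>Z_r = ker k\<close> for all \<open>r > n\<close>.
  Boundaries stabilize at the same page: for \<open>s \<ge> n\<close> all of \<open>im j\<close> is
  already hit, and for \<open>s < n\<close> the number of available maps \<open>i\<close> is bounded
  by \<open>s\<close>.\<close>

lemma page_eq_page_inf:
  assumes z: "\<And>s. tower_arr s n = zer C (objM T s) (objM T (s + n))"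
  shows "page X (Suc n) = page_inf X"
proof (intro ext)
  fix s t
  interpret exact_couple X by (rule hom_couple_exact)
  have tz: "tower_arr s k = zer C (objM T s) (objM T (s + k))" if "n \<le> k" for s k
  proof -
    have "tower_arr s (n + m) = zer C (objM T s) (objM T (s + (n + m)))" for m
    proof (induction m)
      case 0
      show ?case using z by simp
    next
      case (Suc m)
      then show ?case using cmp_zer[OF resM[of "s + (n + m)"] objM[of s]] by (simp add: Nat.add_Suc_right)
    qed
    from this[of "k - n"] that show ?thesis by simp
  qed
  have pz: "ci_pow X k s t y = zer C (objM T s) (shift C (int s + t) N)"
    if "y \<in> carrier (cD X (s + k) (t - int k))" "n \<le> k" for y k s t
  proof -
    have y: "y \<in> Mor C (objM T (s + k)) (shift C (int s + t) N)" using that(1) by (simp add: couple_simps)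
    show ?thesis unfolding ci_pow_tower[OF y] tz[OF that(2)] by (rule cmp_zer[OF y objM])
  qed
  have cyc: "cycles X (Suc k) s t = {x \<in> carrier (cE X s t). ck X s t x = \<one>\<^bsub>cD X (Suc s) t\<^esub>}" if "n \<le> k" for k
  proof -
    interpret p: group_hom "cD X (s + Suc k) (t - int k)" "cD X (Suc s) t" "ci_pow X k (Suc s) t"
      by (rule pow_group_hom)
    have "ci_pow X k (Suc s) t ` carrier (cD X (s + Suc k) (t - int k)) = {\<one>\<^bsub>cD X (Suc s) t\<^esub>}"
    proof -
      have "ci_pow X k (Suc s) t y = \<one>\<^bsub>cD X (Suc s) t\<^esub>" if y: "y \<in> carrier (cD X (s + Suc k) (t - int k))" for y
      proof -
        have "y \<in> carrier (cD X (Suc s + k) (t - int k))" using y by (simp add: add_Suc_right)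
        from pz[OF this \<open>n \<le> k\<close>] show ?thesis by (simp add: couple_simps(1))
      qed
      moreover have "\<one>\<^bsub>cD X (Suc s) t\<^esub> \<in> ci_pow X k (Suc s) t ` carrier (cD X (s + Suc k) (t - int k))"
        using image_eqI[of _ "ci_pow X k (Suc s) t", OF p.hom_one[symmetric] D.one_closed] .
      ultimately show ?thesis by (intro equalityI image_subsetI) simp_all
    qed
    then show ?thesis unfolding cycles_Suc by simp
  qed
  have "(\<Inter>r\<in>{1..}. cycles X r s t) = cycles X (Suc n) s t"
  proof (intro equalityI subsetI)
    fix x assume x: "x \<in> cycles X (Suc n) s t"
    have "x \<in> cycles X r s t" if r1: "1 \<le> r" for r
    proof -
      obtain k where r: "r = Suc k" using r1 by (cases r) auto
      interpret p: group_hom "cD X (s + Suc k) (t - int k)" "cD X (Suc s) t" "ci_pow X k (Suc s) t"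
        by (rule pow_group_hom)
      have x': "x \<in> carrier (cE X s t)" "ck X s t x = ci_pow X k (Suc s) t \<one>\<^bsub>cD X (s + Suc k) (t - int k)\<^esub>"
        using x cyc[of n] p.hom_one by simp_all
      have "ck X s t x \<in> ci_pow X k (Suc s) t ` carrier (cD X (s + Suc k) (t - int k))"
        using image_eqI[of _ "ci_pow X k (Suc s) t", OF x'(2) D.one_closed] .
      then show ?thesis unfolding r cycles_Suc using x'(1) by simp
    qed
    then show "x \<in> (\<Inter>r\<in>{1..}. cycles X r s t)" by auto
  qed auto
  moreover have "(\<Union>r\<in>{1..}. boundaries X r s t) = boundaries X (Suc n) s t"
  proof (intro equalityI subsetI)
    fix x assume "x \<in> (\<Union>r\<in>{1..}. boundaries X r s t)"
    then obtain r where r: "x \<in> boundaries X r s t" by blast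
    define k where "k = min (r - 1) s"
    define m where "m = min n s"
    have ks: "k \<le> s" "m \<le> s" by (simp_all add: k_def m_def)
    from r obtain y where y: "y \<in> carrier (cD X s t)" "x = cj X s t y"
      "ci_pow X k (s - k) (t + int k) y = \<one>\<^bsub>cD X (s - k) (t + int k)\<^esub>"
      unfolding boundaries_eq k_def[symmetric] kernel_def by auto
    have yM: "y \<in> Mor C (objM T s) (shift C (int s + t) N)" using y(1) by (simp add: couple_simps)
    have cp: "ci_pow X l (s - l) (t + int l) y = y \<bullet> tower_arr (s - l) l" if "l \<le> s" for l
      by (rule ci_pow_tower) (use yM that in simp)
    have e: "int (s - l) + (t + int l) = int s + t" if "l \<le> s" for l using that by simp
    have "y \<bullet> tower_arr (s - m) m = zer C (objM T (s - m)) (shift C (int s + t) N)"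
    proof (cases "n \<le> s")
      case True
      then have "tower_arr (s - m) m = zer C (objM T (s - m)) (objM T s)" using z[of "s - n"] by (simp add: m_def)
      then show ?thesis using cmp_zer[OF yM objM] by simp
    next
      \<comment> \<open>The composite \<open>M_0 \<rightarrow> M_s\<close> need not vanish here, but
        it factors through \<open>M_(s-k) \<rightarrow> M_s\<close>, and \<open>y\<close> kills that
        map.\<close>
      case False
      then have m: "m = s" by (simp add: m_def)
      have "tower_arr 0 s = tower_arr (s - k) k \<bullet> tower_arr 0 (s - k)"
        using tower_arr_add[of 0 "s - k" k] ks by simp
      moreover have "tower_arr (s - k) k \<in> Mor C (objM T (s - k)) (objM T s)" using tower_arr[of "s - k" k] ks by simp
      moreover have "tower_arr 0 (s - k) \<in> Mor C (objM T 0) (objM T (s - k))" using tower_arr[of 0 "s - k"] by simp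
      ultimately have "y \<bullet> tower_arr 0 s = (y \<bullet> tower_arr (s - k) k) \<bullet> tower_arr 0 (s - k)"
        using cmp_assoc yM by metis
      also have "y \<bullet> tower_arr (s - k) k = zer C (objM T (s - k)) (shift C (int s + t) N)"
        using y(3) cp[OF ks(1)] e[OF ks(1)] by (simp add: couple_simps(1))
      also have "\<dots> \<bullet> tower_arr 0 (s - k) = zer C (objM T 0) (shift C (int s + t) N)"
        by (rule zer_cmp[OF _ sN]) (use tower_arr[of 0 "s - k"] in simp)
      finally show ?thesis using m by simp
    qed
    then have "ci_pow X m (s - m) (t + int m) y = \<one>\<^bsub>cD X (s - m) (t + int m)\<^esub>"
      using cp[OF ks(2)] e[OF ks(2)] by (simp add: couple_simps(1))
    then have "y \<in> kernel (cD X s t) (cD X (s - m) (t + int m)) (ci_pow X m (s - m) (t + int m))"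
      using y(1) by (simp add: kernel_def)
    then show "x \<in> boundaries X (Suc n) s t"
      unfolding boundaries_eq y(2) by (simp add: m_def)
  qed auto
  ultimately show "page X (Suc n) s t = page_inf X s t" by (simp add: page_def page_inf_def)
qed

end

section \<open>Compactly generated triangulated categories\<close>

lemma sum_group_iso:
  assumes G: "\<And>i. i \<in> I \<Longrightarrow> group (G i)" and H: "\<And>i. i \<in> I \<Longrightarrow> group (H i)"
    and \<phi>: "\<And>i. i \<in> I \<Longrightarrow> \<phi> i \<in> iso (G i) (H i)"
  shows "(\<lambda>c. \<lambda>i\<in>I. \<phi> i (c i)) \<in> iso (sum_group I G) (sum_group I H)"
proof (rule isoI)
  have one: "\<phi> i x = \<one>\<^bsub>H i\<^esub> \<longleftrightarrow> x = \<one>\<^bsub>G i\<^esub>" if "i \<in> I" "x \<in> carrier (G i)" for i x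
  proof -
    interpret h: group_hom "G i" "H i" "\<phi> i"
      by (intro group_hom.intro group_hom_axioms.intro) (use that G H \<phi> in \<open>auto simp: iso_def\<close>)
    have "inj_on (\<phi> i) (carrier (G i))" using \<phi>[OF that(1)] by (simp add: iso_def bij_betw_def)
    then show ?thesis using that(2) h.inj_on_one_iff h.hom_one by blast
  qed
  have cl: "\<phi> i x \<in> carrier (H i)" if "i \<in> I" "x \<in> carrier (G i)" for i x
    using \<phi>[OF that(1)] that(2) by (auto simp: iso_def hom_def)
  let ?\<Phi> = "\<lambda>c. \<lambda>i\<in>I. \<phi> i (c i)"
  have closed: "?\<Phi> c \<in> carrier (sum_group I H)" if "c \<in> carrier (sum_group I G)" for c
  proof -
    have c: "\<And>i. i \<in> I \<Longrightarrow> c i \<in> carrier (G i)" "finite {i \<in> I. c i \<noteq> \<one>\<^bsub>G i\<^esub>}"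
      using that by (auto simp: carrier_sum_group G)
    have "{i \<in> I. ?\<Phi> c i \<noteq> \<one>\<^bsub>H i\<^esub>} = {i \<in> I. c i \<noteq> \<one>\<^bsub>G i\<^esub>}" using one c(1) by auto
    then show ?thesis using c cl by (auto simp: carrier_sum_group H)
  qed
  show "?\<Phi> \<in> hom (sum_group I G) (sum_group I H)"
    by (rule homI) (auto simp: closed carrier_sum_group G PiE_iff intro!: restrict_ext hom_mult[of "\<phi> _"] iso_imp_homomorphism \<phi>)
  show "bij_betw ?\<Phi> (carrier (sum_group I G)) (carrier (sum_group I H))"
  proof (rule bij_betwI')
    fix c c' assume c: "c \<in> carrier (sum_group I G)" "c' \<in> carrier (sum_group I G)"
    show "(?\<Phi> c = ?\<Phi> c') = (c = c')"
    proof
      assume e: "?\<Phi> c = ?\<Phi> c'"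
      show "c = c'"
      proof (rule extensionalityI[of _ I])
        show "c \<in> extensional I" "c' \<in> extensional I" using c by (simp_all add: carrier_sum_group G PiE_iff)
        fix i assume i: "i \<in> I"
        then have "\<phi> i (c i) = \<phi> i (c' i)" using fun_cong[OF e, of i] by simp
        then show "c i = c' i"
          using i \<phi>[OF i] c by (auto simp: iso_def bij_betw_def carrier_sum_group G PiE_iff dest: inj_onD)
      qed
    qed simp
  next
    fix e assume e: "e \<in> carrier (sum_group I H)"
    define c where "c = (\<lambda>i\<in>I. inv_into (carrier (G i)) (\<phi> i) (e i))"
    have ei: "e i \<in> \<phi> i ` carrier (G i)" if "i \<in> I" for i
      using that \<phi>[OF that] e by (auto simp: iso_def bij_betw_def carrier_sum_group H PiE_iff)
    have c: "c i \<in> carrier (G i)" "\<phi> i (c i) = e i" if "i \<in> I" for i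
      using inv_into_into[OF ei[OF that]] f_inv_into_f[OF ei[OF that]] that by (simp_all add: c_def)
    have "c i = \<one>\<^bsub>G i\<^esub> \<longleftrightarrow> e i = \<one>\<^bsub>H i\<^esub>" if "i \<in> I" for i
      using one[OF that c(1)[OF that]] c(2)[OF that] by simp
    then have "{i \<in> I. c i \<noteq> \<one>\<^bsub>G i\<^esub>} = {i \<in> I. e i \<noteq> \<one>\<^bsub>H i\<^esub>}" by blast
    moreover have "c \<in> extensional I" by (simp add: c_def)
    ultimately have cc: "c \<in> carrier (sum_group I G)"
      using e c(1) by (simp add: carrier_sum_group G H PiE_iff)
    have "?\<Phi> c = e"
      by (rule extensionalityI[of _ I]) (use c(2) e in \<open>auto simp: carrier_sum_group H PiE_iff\<close>)
    then show "\<exists>c\<in>carrier (sum_group I G). e = ?\<Phi> c" using cc by blast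
  qed (rule closed)
qed

text \<open>Coproducts are indexed by subsets of the type of \<open>\<kappa>\<close> only; small
  sets of other types, such as sets of arrows or of numbers, are first copied there.\<close>

lemma ex_small_copy:
  fixes J :: "'j set" and \<kappa> :: "'u rel"
  assumes \<kappa>: "Card_order \<kappa>" and J: "|J| <o \<kappa>"
  shows "\<exists>(I :: 'u set) g. bij_betw g I J \<and> |I| <o \<kappa>"
proof -
  have "|J| \<le>o |Field \<kappa>|"
    using ordLeq_ordIso_trans[OF ordLess_imp_ordLeq[OF J] ordIso_symmetric[OF card_of_Field_ordIso[OF \<kappa>]]] .
  then obtain f where f: "inj_on f J" "f ` J \<subseteq> Field \<kappa>" using card_of_ordLeq by metis
  have b: "bij_betw f J (f ` J)" using f(1) by (simp add: bij_betw_def)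
  have "|f ` J| =o |J|" using card_of_ordIso b ordIso_symmetric by blast
  then have "|f ` J| <o \<kappa>" using J ordIso_ordLess_trans by blast
  then show ?thesis using bij_betw_inv_into[OF b] by blast
qed

text \<open>Regularity of \<open>\<kappa>\<close> bounds unions of fewer than
  \<open>\<kappa>\<close> small sets, and uncountability admits the integers as index set. This
  gathers the homotopy of an object in all degrees into one coproduct.\<close>

lemma set_cardinal_countable_Sigma:
  assumes \<kappa>: "set_cardinal \<kappa>" and F: "\<And>n. |F n| <o \<kappa>"
  shows "|SIGMA n:(UNIV :: int set). F n| <o \<kappa>"
proof -
  have c: "Card_order \<kappa>" "regularCard \<kappa>" "|UNIV :: nat set| <o \<kappa>" using \<kappa> by (auto simp: set_cardinal_def)
  have "|UNIV :: nat set| \<le>o |Field \<kappa>|"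
    using ordLeq_ordIso_trans[OF ordLess_imp_ordLeq[OF c(3)] ordIso_symmetric[OF card_of_Field_ordIso[OF c(1)]]] .
  then have "infinite (Field \<kappa>)"
    using card_of_ordLeq_finite[of "UNIV :: nat set" "Field \<kappa>"] by auto
  then have st: "stable \<kappa>" using regularCard_stable c by blast
  have "|UNIV :: int set| \<le>o |UNIV :: nat set|"
    using card_of_ordLeq[of "UNIV :: int set" "UNIV :: nat set"] inj_int_encode by blast
  then have "|UNIV :: int set| <o \<kappa>" using c(3) ordLeq_ordLess_trans by blast
  then show ?thesis using stable_elim[OF st] F by blast
qed

lemma (in category) coproduct_reindex:
  assumes P: "is_coproduct C J X P \<iota>" and g: "bij_betw g I J"
  shows "is_coproduct C I (\<lambda>i. X (g i)) P (\<lambda>i. \<iota> (g i))"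
  unfolding is_coproduct_def
proof (intro conjI ballI allI impI)
  have gI: "g i \<in> J" if "i \<in> I" for i using g that by (auto simp: bij_betw_def)
  show "P \<in> obj C" using P by (simp add: is_coproduct_def)
  show "\<iota> (g i) \<in> Mor C (X (g i)) P" if "i \<in> I" for i using P gI[OF that] by (simp add: is_coproduct_def)
  fix Y f assume Y: "Y \<in> obj C" and f: "\<forall>i\<in>I. f i \<in> Mor C (X (g i)) Y"
  let ?h = "inv_into I g"
  have h: "?h j \<in> I" "g (?h j) = j" if "j \<in> J" for j
    using bij_betw_inv_into_right[OF g that] bij_betw_inv_into[OF g] that by (auto simp: bij_betw_def)
  have hg: "?h (g i) = i" if "i \<in> I" for i using bij_betw_inv_into_left[OF g that] .
  have "f (?h j) \<in> Mor C (X j) Y" if "j \<in> J" for j using f h[OF that] by metis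
  then have "\<exists>!k. k \<in> Mor C P Y \<and> (\<forall>j\<in>J. k \<bullet> \<iota> j = f (?h j))" using P Y by (simp add: is_coproduct_def)
  moreover have "(\<forall>j\<in>J. k \<bullet> \<iota> j = f (?h j)) \<longleftrightarrow> (\<forall>i\<in>I. k \<bullet> \<iota> (g i) = f i)" for k
    using h hg gI by metis
  ultimately show "\<exists>!k. k \<in> Mor C P Y \<and> (\<forall>i\<in>I. k \<bullet> \<iota> (g i) = f i)" by simp
qed

text \<open>Maps out of \<open>\<Sigma>^n P\<close> are shifts of maps out of \<open>P\<close>, so
  the universal property is checked after shifting back by \<open>- n\<close>.\<close>

lemma (in triangulated_category) coproduct_shift:
  assumes P: "is_coproduct C I X P \<iota>"
  shows "is_coproduct C I (\<lambda>i. shift C n (X i)) (shift C n P) (\<lambda>i. shift_arr C n (\<iota> i))"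
  unfolding is_coproduct_def
proof (intro conjI ballI allI impI)
  have Po: "P \<in> obj C" and \<iota>: "\<And>i. i \<in> I \<Longrightarrow> \<iota> i \<in> Mor C (X i) P" using P by (auto simp: is_coproduct_def)
  show "shift C n P \<in> obj C" by (rule shift_closed[OF Po])
  show "shift_arr C n (\<iota> i) \<in> Mor C (shift C n (X i)) (shift C n P)" if "i \<in> I" for i by (rule shift_mor[OF \<iota>[OF that]])
  fix Y f assume Y: "Y \<in> obj C" and f: "\<forall>i\<in>I. f i \<in> Mor C (shift C n (X i)) Y"
  let ?Y = "shift C (- n) Y"
  have Yo: "?Y \<in> obj C" by (rule shift_closed[OF Y])
  have YY: "shift C n ?Y = Y" using shift_shift[OF Y, of n "- n"] by (simp add: shift_0)
  have fi: "shift_arr C (- n) (f i) \<in> Mor C (X i) ?Y" "shift_arr C n (shift_arr C (- n) (f i)) = f i" if "i \<in> I" for i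
    using shift_mor_surj[OF Mor_src[OF \<iota>[OF that]] Yo, of "f i" n] f that YY by auto
  obtain h where h: "h \<in> Mor C P ?Y" "\<And>i. i \<in> I \<Longrightarrow> h \<bullet> \<iota> i = shift_arr C (- n) (f i)"
    using coproductE[OF P Yo fi(1)] by blast
  show "\<exists>!k. k \<in> Mor C (shift C n P) Y \<and> (\<forall>i\<in>I. k \<bullet> shift_arr C n (\<iota> i) = f i)"
  proof (rule ex1I[of _ "shift_arr C n h"], intro conjI ballI)
    show "shift_arr C n h \<in> Mor C (shift C n P) Y" using shift_mor[OF h(1), of n] YY by simp
    show "shift_arr C n h \<bullet> shift_arr C n (\<iota> i) = f i" if "i \<in> I" for i
      using shift_cmp[OF \<iota>[OF that] h(1), of n] h(2)[OF that] fi(2)[OF that] by simp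
    fix k assume k: "k \<in> Mor C (shift C n P) Y \<and> (\<forall>i\<in>I. k \<bullet> shift_arr C n (\<iota> i) = f i)"
    have k': "k \<in> Mor C (shift C n P) (shift C n ?Y)" using k YY by simp
    note ks = shift_mor_surj[OF Po Yo k']
    have "shift_arr C (- n) k = h"
    proof (rule coproduct_eqI[OF P ks(1) h(1)])
      fix i assume i: "i \<in> I"
      show "shift_arr C (- n) k \<bullet> \<iota> i = h \<bullet> \<iota> i"
      proof (rule shift_mor_inj[OF cmp_closed[OF \<iota>[OF i] ks(1)] cmp_closed[OF \<iota>[OF i] h(1)]])
        show "shift_arr C n (shift_arr C (- n) k \<bullet> \<iota> i) = shift_arr C n (h \<bullet> \<iota> i)"
          using shift_cmp[OF \<iota>[OF i] ks(1), of n] ks(2) k i h(2)[OF i] fi(2)[OF i] by simp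
      qed
    qed
    then show "k = shift_arr C n h" using ks(2) by simp
  qed
qed

text \<open>Models the modules over \<open>R\<close>, with \<open>G = R\<close>. Homotopy groups are
  replaced by \<open>[\<Sigma>^n G, -]\<close>, and smallness and detection of isomorphisms are
  phrased in terms of these.\<close>

locale compact_triangulated = triangulated_category C for C :: "('o, 'a, 'x) tri_cat_scheme" (structure) +
  fixes \<kappa> :: "'u rel" and G :: 'o
  assumes sets: "set_cardinal \<kappa>"
    and coproducts: "has_coproducts \<kappa> C"
    and compact: "compact_object \<kappa> C G"
    and small: "X \<in> obj C \<Longrightarrow> |Mor C (shift C n G) X| <o \<kappa>"
    and detects_iso: "\<lbrakk>f \<in> Mor C M M';
        \<And>n. bij_betw (\<lambda>x. f \<bullet> x) (Mor C (shift C n G) M) (Mor C (shift C n G) M')\<rbrakk> \<Longrightarrow> iso_arr C f"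
begin

abbreviation S :: "int \<Rightarrow> 'o" where "S n \<equiv> shift C n G"

lemma G: "G \<in> obj C" using compact by (simp add: compact_object_def)

lemma S: "S n \<in> obj C" by (rule shift_closed[OF G])

lemma shift_S: "shift C m (S n) = S (m + n)" by (rule shift_shift[OF G])

text \<open>Compactness of \<open>G\<close> is applied to the desuspended coproduct and the result
  is shifted back. The conjugated isomorphism has then to be recognized as the canonical
  map.\<close>

lemma compact_S:
  fixes I :: "'u set"
  assumes I: "|I| <o \<kappa>" and P: "is_coproduct C I X P \<iota>"
  shows "(\<lambda>f. finprod (Hom C (S n) P) (\<lambda>i. \<iota> i \<bullet> f i) {i \<in> I. f i \<noteq> zer C (S n) (X i)})
    \<in> iso (sum_group I (\<lambda>i. Hom C (S n) (X i))) (Hom C (S n) P)" (is "?F \<in> _")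
proof -
  have Po: "P \<in> obj C" and \<iota>: "\<And>i. i \<in> I \<Longrightarrow> \<iota> i \<in> Mor C (X i) P" using P by (auto simp: is_coproduct_def)
  have Xo: "X i \<in> obj C" if "i \<in> I" for i by (rule Mor_src[OF \<iota>[OF that]])
  let ?X = "\<lambda>i. shift C (- n) (X i)" and ?P = "shift C (- n) P" and ?\<iota> = "\<lambda>i. shift_arr C (- n) (\<iota> i)"
  have "?X ` I \<subseteq> obj C" using shift_closed Xo by blast
  then have c: "(\<lambda>f. finprod (Hom C G ?P) (\<lambda>i. ?\<iota> i \<bullet> f i) {i \<in> I. f i \<noteq> zer C G (?X i)})
      \<in> iso (sum_group I (\<lambda>i. Hom C G (?X i))) (Hom C G ?P)" (is "?E \<in> _")
    using compact I coproduct_shift[OF P, of "- n"] unfolding compact_object_def by blast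
  have Pn: "shift C n ?P = P" using shift_shift[OF Po, of n "- n"] by (simp add: shift_0)
  have \<beta>: "shift_arr C n \<in> iso (Hom C G ?P) (Hom C (S n) P)"
    using shift_iso_Hom[OF G shift_closed[OF Po, of "- n"], of n] Pn by simp
  have Sn: "shift C (- n) (S n) = G" by (simp add: shift_S shift_0)
  have "(\<lambda>c. \<lambda>i\<in>I. shift_arr C (- n) (c i)) \<in> iso (sum_group I (\<lambda>i. Hom C (S n) (X i))) (sum_group I (\<lambda>i. Hom C G (?X i)))"
    (is "?\<alpha> \<in> _")
  proof (rule sum_group_iso)
    fix i assume i: "i \<in> I"
    show "group (Hom C (S n) (X i))" "group (Hom C G (?X i))"
      using Hom_group[OF S Xo[OF i]] Hom_group[OF G shift_closed[OF Xo[OF i]]] by (auto simp: comm_group.axioms(2))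
    show "shift_arr C (- n) \<in> iso (Hom C (S n) (X i)) (Hom C G (?X i))"
      using shift_iso_Hom[OF S[of n] Xo[OF i], of "- n"] Sn by simp
  qed
  from iso_set_trans[OF iso_set_trans[OF this c] \<beta>]
  have comp: "shift_arr C n \<circ> (?E \<circ> ?\<alpha>) \<in> iso (sum_group I (\<lambda>i. Hom C (S n) (X i))) (Hom C (S n) P)"
    by (simp add: comp_assoc)
  have eq: "(shift_arr C n \<circ> (?E \<circ> ?\<alpha>)) c = ?F c" if "c \<in> carrier (sum_group I (\<lambda>i. Hom C (S n) (X i)))" for c
  proof -
    have ci: "c i \<in> Mor C (S n) (X i)" if "i \<in> I" for i
      using that \<open>c \<in> _\<close> Hom_group[OF S Xo] by (auto simp: carrier_sum_group comm_group.axioms(2) PiE_iff)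
    have si: "shift_arr C (- n) (c i) \<in> Mor C G (?X i)" if "i \<in> I" for i
      using shift_mor[OF ci[OF that], of "- n"] Sn by simp
    have zi: "shift_arr C (- n) (c i) = zer C G (?X i) \<longleftrightarrow> c i = zer C (S n) (X i)" if "i \<in> I" for i
      using shift_zer[OF S Xo[OF that], of "- n" n] shift_mor_inj[OF ci[OF that] zer_closed[OF S Xo[OF that]], of "- n"] Sn
      by auto
    have set: "{i \<in> I. ?\<alpha> c i \<noteq> zer C G (?X i)} = {i \<in> I. c i \<noteq> zer C (S n) (X i)}" using zi by auto
    have m1: "?\<iota> i \<bullet> ?\<alpha> c i \<in> Mor C G ?P" if "i \<in> I" for i
      using cmp_closed[OF si[OF that] shift_mor[OF \<iota>[OF that]]] that by simp
    interpret H: comm_group "Hom C (S n) P" by (rule Hom_group[OF S Po])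
    have "shift_arr C n (?E (?\<alpha> c)) = finprod (Hom C (S n) P) (\<lambda>i. shift_arr C n (?\<iota> i \<bullet> ?\<alpha> c i)) {i \<in> I. ?\<alpha> c i \<noteq> zer C G (?X i)}"
      by (rule hom_finprod[OF Hom_group[OF G shift_closed[OF Po]] Hom_group[OF S Po] iso_imp_homomorphism[OF \<beta>]])
        (use m1 in auto)
    also have "\<dots> = ?F c"
      unfolding set
    proof (rule H.finprod_cong')
      show "(\<lambda>i. \<iota> i \<bullet> c i) \<in> {i \<in> I. c i \<noteq> zer C (S n) (X i)} \<rightarrow> carrier (Hom C (S n) P)"
        using cmp_closed[OF ci \<iota>] by auto
      fix i assume "i \<in> {i \<in> I. c i \<noteq> zer C (S n) (X i)}"
      then have i: "i \<in> I" by blast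
      have "shift_arr C n (?\<iota> i \<bullet> ?\<alpha> c i) = shift_arr C n (shift_arr C (- n) (\<iota> i \<bullet> c i))"
        using i shift_cmp[OF ci[OF i] \<iota>[OF i], of "- n"] by simp
      also have "\<dots> = \<iota> i \<bullet> c i" using shift_arr_add[OF cmp_closed[OF ci[OF i] \<iota>[OF i]], of n "- n"] by (simp add: shift_arr_0)
      finally show "shift_arr C n (?\<iota> i \<bullet> ?\<alpha> c i) = \<iota> i \<bullet> c i" .
    qed simp
    finally show ?thesis by simp
  qed
  have sg: "group (sum_group I (\<lambda>i. Hom C (S n) (X i)))"
    by (rule sum_group) (use Hom_group[OF S Xo] in \<open>auto simp: comm_group.axioms(2)\<close>)
  show ?thesis by (rule group.iso_eq[OF sg comp eq[symmetric]])
qed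

section \<open>Ghost maps, projective objects and resolutions\<close>

definition ghost :: "'a \<Rightarrow> bool" where
  "ghost f \<longleftrightarrow> f \<in> arr C \<and> (\<forall>n. \<forall>x \<in> Mor C (S n) (src C f). f \<bullet> x = zer C (S n) (tgt C f))"

definition projs :: "'o set" where
  "projs = {P. \<exists>(I :: 'u set) d Q \<iota>. |I| <o \<kappa> \<and> is_coproduct C I (\<lambda>i. S (d i)) Q \<iota> \<and> retract C P Q}"

lemma projsI:
  fixes I :: "'u set"
  assumes "|I| <o \<kappa>" "is_coproduct C I (\<lambda>i. S (d i)) Q \<iota>" "retract C P Q"
  shows "P \<in> projs"
  unfolding projs_def mem_Collect_eq by (intro exI conjI, fact+)

lemma ghost_iff: "f \<in> Mor C X Y \<Longrightarrow> ghost f \<longleftrightarrow> (\<forall>n. \<forall>x \<in> Mor C (S n) X. f \<bullet> x = zer C (S n) Y)"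
proof -
  assume "f \<in> Mor C X Y"
  then have "f \<in> arr C" "src C f = X" "tgt C f = Y" by (simp_all add: Mor_def)
  then show ?thesis by (simp add: ghost_def)
qed

lemma ghostD: "\<lbrakk>ghost f; f \<in> Mor C X Y; x \<in> Mor C (S n) X\<rbrakk> \<Longrightarrow> f \<bullet> x = zer C (S n) Y"
  using ghost_iff by blast

text \<open>By compactness a map \<open>S n \<rightarrow> P\<close> is a finite sum of maps through
  the summands, and each of these is killed by \<open>h\<close>.\<close>

lemma coproduct_ghost:
  fixes I :: "'u set"
  assumes I: "|I| <o \<kappa>" and P: "is_coproduct C I X P \<iota>" and h: "h \<in> Mor C P Y"
    and g: "\<And>i. i \<in> I \<Longrightarrow> ghost (h \<bullet> \<iota> i)"
  shows "ghost h"
  unfolding ghost_iff[OF h]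
proof (intro allI ballI)
  fix n x assume x: "x \<in> Mor C (S n) P"
  have \<iota>: "\<And>i. i \<in> I \<Longrightarrow> \<iota> i \<in> Mor C (X i) P" using P by (auto simp: is_coproduct_def)
  have Xo: "X i \<in> obj C" if "i \<in> I" for i by (rule Mor_src[OF \<iota>[OF that]])
  have "(\<lambda>f. finprod (Hom C (S n) P) (\<lambda>i. \<iota> i \<bullet> f i) {i \<in> I. f i \<noteq> zer C (S n) (X i)}) `
     carrier (sum_group I (\<lambda>i. Hom C (S n) (X i))) = Mor C (S n) P"
    using compact_S[OF I P, of n] by (simp add: iso_def bij_betw_def)
  then obtain f where f: "f \<in> carrier (sum_group I (\<lambda>i. Hom C (S n) (X i)))"
    "x = finprod (Hom C (S n) P) (\<lambda>i. \<iota> i \<bullet> f i) {i \<in> I. f i \<noteq> zer C (S n) (X i)}"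
    using x by blast
  have fi: "f i \<in> Mor C (S n) (X i)" if "i \<in> I" for i
    using that f(1) Hom_group[OF S Xo] by (auto simp: carrier_sum_group comm_group.axioms(2) PiE_iff)
  interpret H: comm_group "Hom C (S n) Y" by (rule Hom_group[OF S Mor_tgt[OF h]])
  have "h \<bullet> x = finprod (Hom C (S n) Y) (\<lambda>i. h \<bullet> (\<iota> i \<bullet> f i)) {i \<in> I. f i \<noteq> zer C (S n) (X i)}"
    unfolding f(2)
    by (rule hom_finprod[OF Hom_group[OF S Mor_src[OF h]] Hom_group[OF S Mor_tgt[OF h]]
        group_hom.homh[OF postcomp_group_hom[OF h S]]]) (use cmp_closed[OF fi \<iota>] in auto)
  also have "\<dots> = \<one>\<^bsub>Hom C (S n) Y\<^esub>"
  proof (rule H.finprod_one_eqI)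
    fix i assume "i \<in> {i \<in> I. f i \<noteq> zer C (S n) (X i)}"
    then have i: "i \<in> I" by blast
    have "h \<bullet> (\<iota> i \<bullet> f i) = (h \<bullet> \<iota> i) \<bullet> f i" using cmp_assoc[OF fi[OF i] \<iota>[OF i] h] by simp
    then show "h \<bullet> (\<iota> i \<bullet> f i) = \<one>\<^bsub>Hom C (S n) Y\<^esub>"
      using ghostD[OF g[OF i] cmp_closed[OF \<iota>[OF i] h] fi[OF i]] by simp
  qed
  finally show "h \<bullet> x = zer C (S n) Y" by simp
qed

lemma projs_obj: "P \<in> projs \<Longrightarrow> P \<in> obj C" by (auto simp: projs_def retract_def)

text \<open>On a coproduct of shifts of \<open>G\<close> a composite is determined by its
  restrictions to the summands; these are maps out of some \<open>S n\<close>, so the ghost kills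
  them. A retract inherits this.\<close>

lemma proj_ghost:
  assumes P: "P \<in> projs" and f: "f \<in> Mor C P X" and g: "g \<in> Mor C X Y" "ghost g"
  shows "g \<bullet> f = zer C P Y"
proof -
  from P obtain I :: "'u set" and d Q \<iota> i p where I: "|I| <o \<kappa>" and Q: "is_coproduct C I (\<lambda>i. S (d i)) Q \<iota>"
    and i: "i \<in> Mor C P Q" and p: "p \<in> Mor C Q P" and pi: "p \<bullet> i = idn C P"
    unfolding projs_def retract_def by blast
  have \<iota>: "\<And>i. i \<in> I \<Longrightarrow> \<iota> i \<in> Mor C (S (d i)) Q" and Qo: "Q \<in> obj C" using Q by (auto simp: is_coproduct_def)
  note Y = Mor_tgt[OF g(1)] and gf = cmp_closed[OF f g(1)]
  have "(g \<bullet> f) \<bullet> p = zer C Q Y"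
  proof (rule coproduct_eqI[OF Q cmp_closed[OF p gf] zer_closed[OF Qo Y]])
    fix j assume j: "j \<in> I"
    have "((g \<bullet> f) \<bullet> p) \<bullet> \<iota> j = g \<bullet> (f \<bullet> (p \<bullet> \<iota> j))"
      using cmp_assoc[OF \<iota>[OF j] p gf] cmp_assoc[OF cmp_closed[OF \<iota>[OF j] p] f g(1)] by simp
    also have "\<dots> = zer C (S (d j)) Y" by (rule ghostD[OF g(2,1) cmp_closed[OF cmp_closed[OF \<iota>[OF j] p] f]])
    finally show "((g \<bullet> f) \<bullet> p) \<bullet> \<iota> j = zer C Q Y \<bullet> \<iota> j" using zer_cmp[OF \<iota>[OF j] Y] by simp
  qed
  then have "(g \<bullet> f) \<bullet> (p \<bullet> i) = zer C P Y" using cmp_assoc[OF i p gf] zer_cmp[OF i Y] by simp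
  then show ?thesis unfolding pi idn_right[OF gf] .
qed

lemma projs_shift:
  assumes "P \<in> projs"
  shows "shift C n P \<in> projs"
proof -
  from assms obtain I :: "'u set" and d Q \<iota> i p where I: "|I| <o \<kappa>" and Q: "is_coproduct C I (\<lambda>i. S (d i)) Q \<iota>"
    and P: "P \<in> obj C" and Qo: "Q \<in> obj C" and i: "i \<in> Mor C P Q" and p: "p \<in> Mor C Q P" and pi: "p \<bullet> i = idn C P"
    unfolding projs_def retract_def by blast
  have "is_coproduct C I (\<lambda>i. S (n + d i)) (shift C n Q) (\<lambda>i. shift_arr C n (\<iota> i))"
    using coproduct_shift[OF Q, of n] by (simp add: shift_S)
  moreover have "retract C (shift C n P) (shift C n Q)"
    unfolding retract_def using shift_closed[OF P] shift_closed[OF Qo] shift_mor[OF i, of n] shift_mor[OF p, of n]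
      shift_cmp[OF i p, of n] pi shift_idn[OF P, of n] by metis
  ultimately show ?thesis by (rule projsI[OF I])
qed

text \<open>There is one summand \<open>S n\<close> for each degree \<open>n\<close> and each map
  \<open>S n \<rightarrow> M\<close>; the coproduct is small by regularity of
  \<open>\<kappa>\<close>.\<close>

lemma ex_proj_cover:
  assumes M: "M \<in> obj C"
  shows "\<exists>P\<in>projs. \<exists>p\<in>Mor C P M. \<forall>n. \<forall>x \<in> Mor C (S n) M. \<exists>y \<in> Mor C (S n) P. p \<bullet> y = x"
proof -
  let ?J = "SIGMA n:(UNIV :: int set). Mor C (S n) M"
  have "|?J| <o \<kappa>" by (rule set_cardinal_countable_Sigma[OF sets small[OF M]])
  then obtain I :: "'u set" and g where g: "bij_betw g I ?J" and I: "|I| <o \<kappa>"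
    using ex_small_copy[of \<kappa> ?J] sets by (auto simp: set_cardinal_def)
  have "(\<lambda>i. S (fst (g i))) ` I \<subseteq> obj C" using S by blast
  then obtain P \<iota> where P: "is_coproduct C I (\<lambda>i. S (fst (g i))) P \<iota>"
    using coproducts I unfolding has_coproducts_def by blast
  have Po: "P \<in> obj C" and \<iota>: "\<And>i. i \<in> I \<Longrightarrow> \<iota> i \<in> Mor C (S (fst (g i))) P" using P by (auto simp: is_coproduct_def)
  have "retract C P P" unfolding retract_def using Po idn_closed[OF Po] idn_left[OF idn_closed[OF Po]] by blast
  then have PP: "P \<in> projs" by (rule projsI[OF I P])
  have "snd (g i) \<in> Mor C (S (fst (g i))) M" if "i \<in> I" for i using g that by (auto simp: bij_betw_def)
  then obtain p where p: "p \<in> Mor C P M" "\<And>i. i \<in> I \<Longrightarrow> p \<bullet> \<iota> i = snd (g i)"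
    using coproductE[OF P M, of "\<lambda>i. snd (g i)"] by blast
  have "\<exists>y \<in> Mor C (S n) P. p \<bullet> y = x" if "x \<in> Mor C (S n) M" for n x
  proof -
    have "(n, x) \<in> g ` I" using that g by (simp add: bij_betw_def)
    then obtain i where "i \<in> I" "g i = (n, x)" by (metis imageE)
    then show ?thesis using \<iota>[of i] p(2)[of i] by auto
  qed
  then show ?thesis using PP p(1) by blast
qed

definition resolution_tower :: "'o \<Rightarrow> ('o, 'a) adams_res \<Rightarrow> bool" where
  "resolution_tower M T \<longleftrightarrow>
     objM T 0 = M \<and>
     (\<forall>s. objP T s \<in> projs \<and>
          resP T s \<in> Mor C (objP T s) (objM T s) \<and>
          resM T s \<in> Mor C (objM T s) (objM T (Suc s)) \<and>
          resB T s \<in> Mor C (objM T (Suc s)) (susp C (objP T s)) \<and>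
          ghost (resM T s) \<and>
          (resP T s, resM T s, resB T s) \<in> tri C)"

text \<open>The map \<open>i\<close> from an object to the cofiber of its projective cover
  \<open>p\<close> is a ghost: every \<open>x\<close> lifts through \<open>p\<close>, and
  \<open>i p = 0\<close>. Iterating gives the tower.\<close>

lemma ex_resolution_tower:
  assumes M: "M \<in> obj C"
  shows "\<exists>T. resolution_tower M T"
proof -
  let ?R = "\<lambda>X X' P p i b. P \<in> projs \<and> p \<in> Mor C P X \<and> i \<in> Mor C X X' \<and> b \<in> Mor C X' (susp C P) \<and> ghost i \<and> (p, i, b) \<in> tri C"
  have step: "\<exists>X'. X' \<in> obj C \<and> (\<exists>P p i b. ?R X X' P p i b)" if X: "X \<in> obj C" for X
  proof -
    obtain P p where P: "P \<in> projs" "p \<in> Mor C P X" "\<And>n x. x \<in> Mor C (S n) X \<Longrightarrow> \<exists>y \<in> Mor C (S n) P. p \<bullet> y = x"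
      using ex_proj_cover[OF X] by blast
    have p: "p \<in> arr C" "src C p = P" "tgt C p = X" using P(2) by (simp_all add: Mor_def)
    obtain i b where t: "(p, i, b) \<in> tri C" using tri_extend[OF p(1)] by blast
    \<comment> \<open>\<open>tri_extend\<close> provides arrows only; the cofiber is read off as the
      source of the connecting map.\<close>
    define X' where "X' = src C b"
    have i: "i \<in> Mor C X X'" using tri_candidate[OF t] p unfolding candidate_triangle_def X'_def by simp
    have b: "b \<in> Mor C X' (susp C P)" by (rule tri_Mor[OF t P(2) i])
    have "ghost i" unfolding ghost_iff[OF i]
    proof (intro allI ballI)
      fix n x assume "x \<in> Mor C (S n) X"
      then obtain y where y: "y \<in> Mor C (S n) P" "p \<bullet> y = x" using P(3) by blast
      have "i \<bullet> x = (i \<bullet> p) \<bullet> y" using cmp_assoc[OF y(1) P(2) i] y(2) by simp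
      then show "i \<bullet> x = zer C (S n) X'" using tri_zero[OF t P(2) i] zer_cmp[OF y(1) Mor_tgt[OF i]] by simp
    qed
    then have "?R X X' P p i b" using P t i b by simp
    then show ?thesis using Mor_tgt[OF i] by blast
  qed
  let ?Q = "\<lambda>s X X'. \<exists>P p i b. ?R X X' P p i b"
  have "\<exists>F. \<forall>s. (F s \<in> obj C \<and> (s = 0 \<longrightarrow> F s = M)) \<and> ?Q s (F s) (F (Suc s))"
    by (rule dependent_nat_choice) (use M step in auto)
  then obtain F where F: "F 0 = M" "\<And>s. \<exists>P p i b. ?R (F s) (F (Suc s)) P p i b" by blast
  then obtain P p i b where R: "\<And>s. ?R (F s) (F (Suc s)) (P s) (p s) (i s) (b s)" by metis
  have "resolution_tower M \<lparr>objM = F, objP = P, resP = p, resM = i, resB = b\<rparr>"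
    unfolding resolution_tower_def using F(1) R by simp
  then show ?thesis by blast
qed

section \<open>Powers of the ideal of ghosts and length\<close>

primrec ghost_power :: "nat \<Rightarrow> 'a set" where
  "ghost_power 0 = arr C"
| "ghost_power (Suc n) = {g \<bullet> f |f g X Y Z. f \<in> ghost_power n \<and> f \<in> Mor C X Y \<and> g \<in> Mor C Y Z \<and> ghost g}"

text \<open>A bound on the length in terms of composites of ghosts. It follows from
  \<open>proj_length\<close>, and it is the form in which the bound passes from \<open>M\<close> to
  the cofibers \<open>M_s\<close>.\<close>

definition ghost_length :: "nat \<Rightarrow> 'o \<Rightarrow> bool" where
  "ghost_length n M \<longleftrightarrow> (\<forall>X. \<forall>f \<in> ghost_power n. f \<in> Mor C M X \<longrightarrow> f = zer C M X)"

lemma Mor_unique: "\<lbrakk>f \<in> Mor C X Y; f \<in> Mor C X' Y'\<rbrakk> \<Longrightarrow> X' = X \<and> Y' = Y"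
  by (simp add: Mor_def)

lemma ghost_power_SucE:
  assumes "f \<in> ghost_power (Suc n)" "f \<in> Mor C X Z"
  obtains Y f' g where "f' \<in> ghost_power n" "f' \<in> Mor C X Y" "g \<in> Mor C Y Z" "ghost g" "f = g \<bullet> f'"
proof -
  from assms(1) obtain f' g X' Y Z' where f: "f' \<in> ghost_power n" "f' \<in> Mor C X' Y" "g \<in> Mor C Y Z'" "ghost g" "f = g \<bullet> f'"
    by auto
  have "X' = X \<and> Z' = Z" using Mor_unique[OF assms(2)] cmp_closed[OF f(2,3)] f(5) by simp
  then show thesis using that f by blast
qed

lemma ghost_power_SucI: "\<lbrakk>f \<in> ghost_power n; f \<in> Mor C X Y; g \<in> Mor C Y Z; ghost g\<rbrakk> \<Longrightarrow> g \<bullet> f \<in> ghost_power (Suc n)"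
  unfolding ghost_power.simps mem_Collect_eq by blast

text \<open>\<open>ghost_power 0\<close> consists of all arrows, so an arbitrary arrow may stand at
  the inner end of a composite and absorb \<open>h\<close>.\<close>

lemma ghost_power_precomp:
  "\<lbrakk>f \<in> ghost_power n; f \<in> Mor C X Y; h \<in> Mor C W X\<rbrakk> \<Longrightarrow> f \<bullet> h \<in> ghost_power n"
proof (induction n arbitrary: f Y)
  case 0
  then show ?case using Mor_arr[OF cmp_closed[OF 0(3,2)]] by simp
next
  case (Suc n)
  obtain V f' g where f: "f' \<in> ghost_power n" "f' \<in> Mor C X V" "g \<in> Mor C V Y" "ghost g" "f = g \<bullet> f'"
    using ghost_power_SucE[OF Suc.prems(1,2)] .
  have "f \<bullet> h = g \<bullet> (f' \<bullet> h)" unfolding f(5) by (rule cmp_assoc[OF Suc.prems(3) f(2,3)])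
  then show ?case using ghost_power_SucI[OF Suc.IH[OF f(1,2) Suc.prems(3)] cmp_closed[OF Suc.prems(3) f(2)] f(3,4)] by simp
qed

text \<open>Powers grow at the outer end, but here a ghost is added at the inner end. The base case
  uses that any arrow after a ghost is again a ghost.\<close>

lemma ghost_power_precomp_ghost:
  "\<lbrakk>f \<in> ghost_power n; f \<in> Mor C X Y; h \<in> Mor C W X; ghost h\<rbrakk> \<Longrightarrow> f \<bullet> h \<in> ghost_power (Suc n)"
proof (induction n arbitrary: f Y)
  case 0
  have "ghost (f \<bullet> h)"
  proof -
    have "(f \<bullet> h) \<bullet> x = zer C (S n) Y" if "x \<in> Mor C (S n) W" for n x
      using cmp_assoc[OF that 0(3,2)] ghostD[OF 0(4,3) that] cmp_zer[OF 0(2) S] by simp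
    then show ?thesis using ghost_iff[OF cmp_closed[OF 0(3,2)]] by blast
  qed
  note c = cmp_closed[OF 0(3,2)]
  have "(f \<bullet> h) \<bullet> idn C W \<in> ghost_power (Suc 0)"
    by (rule ghost_power_SucI[OF _ idn_closed[OF Mor_src[OF 0(3)]] c \<open>ghost (f \<bullet> h)\<close>])
      (use Mor_arr[OF idn_closed[OF Mor_src[OF 0(3)]]] in simp)
  then show ?case using idn_right[OF c] by simp
next
  case (Suc n)
  obtain V f' g where f: "f' \<in> ghost_power n" "f' \<in> Mor C X V" "g \<in> Mor C V Y" "ghost g" "f = g \<bullet> f'"
    using ghost_power_SucE[OF Suc.prems(1,2)] .
  have "f \<bullet> h = g \<bullet> (f' \<bullet> h)" unfolding f(5) by (rule cmp_assoc[OF Suc.prems(3) f(2,3)])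
  then show ?case using ghost_power_SucI[OF Suc.IH[OF f(1,2) Suc.prems(3,4)] cmp_closed[OF Suc.prems(3) f(2)] f(3,4)] by simp
qed

lemma ghost_length_proj:
  assumes P: "P \<in> projs"
  shows "ghost_length (Suc 0) P"
  unfolding ghost_length_def
proof (intro allI ballI impI)
  fix X f assume "f \<in> ghost_power (Suc 0)" "f \<in> Mor C P X"
  then obtain Y f' g where "f' \<in> Mor C P Y" "g \<in> Mor C Y X" "ghost g" "f = g \<bullet> f'" by (rule ghost_power_SucE)
  then show "f = zer C P X" using proj_ghost[OF P] by simp
qed

text \<open>The composite of the first \<open>n\<close> ghosts vanishes on \<open>X\<close>, so it
  factors through \<open>P\<close>, and the last ghost kills every map out of
  \<open>P\<close>.\<close>

lemma ghost_length_triangle: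
  assumes t: "(u, v, w) \<in> tri C" and u: "u \<in> Mor C X Y" and v: "v \<in> Mor C Y P"
    and X: "ghost_length n X" and P: "P \<in> projs"
  shows "ghost_length (Suc n) Y"
  unfolding ghost_length_def
proof (intro allI ballI impI)
  fix Z f assume "f \<in> ghost_power (Suc n)" "f \<in> Mor C Y Z"
  then obtain V f' g where f: "f' \<in> ghost_power n" "f' \<in> Mor C Y V" "g \<in> Mor C V Z" "ghost g" "f = g \<bullet> f'"
    by (rule ghost_power_SucE)
  have "f' \<bullet> u = zer C X V"
    using X ghost_power_precomp[OF f(1,2) u] cmp_closed[OF u f(2)] unfolding ghost_length_def by blast
  then obtain h where h: "h \<in> Mor C P V" "h \<bullet> v = f'" using tri_factor_right[OF t u v f(2)] by blast
  have "f = (g \<bullet> h) \<bullet> v" using cmp_assoc[OF v h(1) f(3)] h(2) f(5) by simp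
  then show "f = zer C Y Z" using proj_ghost[OF P h(1) f(3,4)] zer_cmp[OF v Mor_tgt[OF f(3)]] by simp
qed

lemma ghost_length_retract:
  assumes M: "retract C M Y" and Y: "ghost_length n Y"
  shows "ghost_length n M"
  unfolding ghost_length_def
proof (intro allI ballI impI)
  fix Z f assume f: "f \<in> ghost_power n" "f \<in> Mor C M Z"
  obtain i p where ip: "i \<in> Mor C M Y" "p \<in> Mor C Y M" "p \<bullet> i = idn C M" using M unfolding retract_def by blast
  have "f \<bullet> p = zer C Y Z"
    using Y ghost_power_precomp[OF f ip(2)] cmp_closed[OF ip(2) f(2)] unfolding ghost_length_def by blast
  then have "f \<bullet> (p \<bullet> i) = zer C M Z" using cmp_assoc[OF ip(1,2) f(2)] zer_cmp[OF ip(1) Mor_tgt[OF f(2)]] by simp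
  then show "f = zer C M Z" unfolding ip(3) idn_right[OF f(2)] .
qed

text \<open>
  The first \<open>n - 1\<close> of \<open>n\<close> composable ghosts out of the cofiber \<open>M'\<close> make up a composite of \<open>n\<close> ghosts
  out of \<open>M\<close> once preceded by \<open>M \<rightarrow> M'\<close>, so they factor through the projective object \<open>\<Sigma>P\<close>.
\<close>

lemma ghost_length_cofiber:
  assumes t: "(p, i, b) \<in> tri C" and p: "p \<in> Mor C P M" and i: "i \<in> Mor C M M'" and g: "ghost i"
    and P: "P \<in> projs" and M: "ghost_length (Suc n) M"
  shows "ghost_length (Suc n) M'"
  unfolding ghost_length_def
proof (intro allI ballI impI)
  fix Z f assume "f \<in> ghost_power (Suc n)" "f \<in> Mor C M' Z"
  then obtain V f' h where f: "f' \<in> ghost_power n" "f' \<in> Mor C M' V" "h \<in> Mor C V Z" "ghost h" "f = h \<bullet> f'"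
    by (rule ghost_power_SucE)
  note b = tri_Mor[OF t p i]
  have "f' \<bullet> i = zer C M V"
    using M ghost_power_precomp_ghost[OF f(1,2) i g] cmp_closed[OF i f(2)] unfolding ghost_length_def by blast
  then obtain k where k: "k \<in> Mor C (susp C P) V" "k \<bullet> b = f'"
    using tri_factor_right[OF rotate[OF t p i] i b f(2)] by blast
  have "susp C P \<in> projs" using projs_shift[OF P, of 1] by (simp add: shift_def)
  then have "h \<bullet> k = zer C (susp C P) Z" using proj_ghost k(1) f(3,4) by blast
  moreover have "f = (h \<bullet> k) \<bullet> b" using cmp_assoc[OF b k(1) f(3)] k(2) f(5) by simp
  ultimately show "f = zer C M' Z" using zer_cmp[OF b Mor_tgt[OF f(3)]] by simp
qed

end

section \<open>Conditional convergence and collapse\<close>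

lemma tower_map_hom:
  assumes G: "\<And>s. comm_group (G s)" and f: "\<And>s. f s \<in> hom (G (Suc s)) (G s)"
  shows "group_hom (product_group UNIV G) (product_group UNIV G) (tower_map G f)"
proof -
  interpret G: comm_group "G s" for s by (rule G)
  interpret f: group_hom "G (Suc s)" "G s" "f s" for s by unfold_locales (rule f)
  have "tower_map G f \<in> hom (product_group UNIV G) (product_group UNIV G)"
  proof (rule homI)
    fix x y assume "x \<in> carrier (product_group UNIV G)" "y \<in> carrier (product_group UNIV G)"
    then have xy: "x s \<in> carrier (G s)" "y s \<in> carrier (G s)" for s by (auto simp: PiE_iff)
    show "tower_map G f x \<in> carrier (product_group UNIV G)"
      using xy f.hom_closed by (simp add: tower_map_def PiE_iff)
    show "tower_map G f (x \<otimes>\<^bsub>product_group UNIV G\<^esub> y)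
        = tower_map G f x \<otimes>\<^bsub>product_group UNIV G\<^esub> tower_map G f y"
      using xy by (auto simp: tower_map_def G.inv_mult G.m_ac)
  qed
  then show ?thesis
    by (intro group_hom.intro group_hom_axioms.intro product_group) (auto intro: G.is_group)
qed

text \<open>Here and in \<open>lim1_tower_trivial\<close> the kernel and the cokernel of
  \<open>tower_map\<close> are described by sequences of elements, the form supplied by maps out of
  a coproduct.\<close>

lemma lim_tower_trivial:
  assumes G: "\<And>s. comm_group (G s)" and f: "\<And>s. f s \<in> hom (G (Suc s)) (G s)"
    and inj: "\<And>x. \<lbrakk>\<And>s. x s \<in> carrier (G s); \<And>s. x s \<otimes>\<^bsub>G s\<^esub> inv\<^bsub>G s\<^esub> f s (x (Suc s)) = \<one>\<^bsub>G s\<^esub>\<rbrakk> \<Longrightarrow> \<forall>s. x s = \<one>\<^bsub>G s\<^esub>"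
  shows "trivial_group (lim_tower G f)"
proof -
  interpret t: group_hom "product_group UNIV G" "product_group UNIV G" "tower_map G f"
    by (rule tower_map_hom) (rule G, rule f)
  let ?K = "kernel (product_group UNIV G) (product_group UNIV G) (tower_map G f)"
  have "group (lim_tower G f)"
    unfolding lim_tower_def by (rule subgroup.subgroup_is_group[OF t.subgroup_kernel t.G.is_group])
  moreover have "?K = {\<one>\<^bsub>product_group UNIV G\<^esub>}"
  proof (intro equalityI subsetI)
    fix x assume x: "x \<in> ?K"
    have "x s \<in> carrier (G s)" for s using x by (auto simp: kernel_def)
    moreover have "x s \<otimes>\<^bsub>G s\<^esub> inv\<^bsub>G s\<^esub> f s (x (Suc s)) = \<one>\<^bsub>G s\<^esub>" for s
    proof -
      have "tower_map G f x = \<one>\<^bsub>product_group UNIV G\<^esub>" using x by (simp only: kernel_def mem_Collect_eq)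
      from fun_cong[OF this, of s] show ?thesis by (simp add: tower_map_def)
    qed
    ultimately have "\<forall>s. x s = \<one>\<^bsub>G s\<^esub>" by (rule inj)
    then show "x \<in> {\<one>\<^bsub>product_group UNIV G\<^esub>}" by auto
  qed (use t.hom_one t.G.one_closed in \<open>simp add: kernel_def del: one_product_group carrier_product_group\<close>)
  ultimately show ?thesis by (simp add: trivial_group_def lim_tower_def)
qed

lemma lim1_tower_trivial:
  assumes G: "\<And>s. comm_group (G s)" and f: "\<And>s. f s \<in> hom (G (Suc s)) (G s)"
    and surj: "\<And>y. (\<And>s. y s \<in> carrier (G s)) \<Longrightarrow>
      \<exists>x. \<forall>s. x s \<in> carrier (G s) \<and> x s \<otimes>\<^bsub>G s\<^esub> inv\<^bsub>G s\<^esub> f s (x (Suc s)) = y s"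
  shows "trivial_group (lim1_tower G f)"
proof -
  interpret t: group_hom "product_group UNIV G" "product_group UNIV G" "tower_map G f"
    by (rule tower_map_hom) (rule G, rule f)
  let ?H = "product_group UNIV G"
  have im: "tower_map G f ` carrier ?H = carrier ?H"
  proof (intro equalityI subsetI)
    fix y assume "y \<in> carrier ?H"
    then have "y s \<in> carrier (G s)" for s by auto
    then obtain x where x: "\<forall>s. x s \<in> carrier (G s) \<and> x s \<otimes>\<^bsub>G s\<^esub> inv\<^bsub>G s\<^esub> f s (x (Suc s)) = y s" using surj by blast
    show "y \<in> tower_map G f ` carrier ?H"
      by (rule image_eqI[of _ _ x]) (use x in \<open>auto simp: tower_map_def\<close>)
  qed (use t.hom_closed in \<open>auto simp del: carrier_product_group\<close>)
  have n: "carrier ?H \<lhd> ?H" 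
    unfolding t.G.normal_inv_iff by (intro conjI ballI t.G.subgroup_self t.G.m_closed t.G.inv_closed)
  have "carrier (?H Mod carrier ?H) = {carrier ?H}"
    using t.G.coset_join2[OF _ t.G.subgroup_self] t.G.one_closed
    unfolding carrier_FactGroup by blast
  then show ?thesis using normal.factorgroup_is_group[OF n]
    unfolding lim1_tower_def im trivial_group_def by simp
qed

locale ghost_tower = compact_triangulated C \<kappa> G
  for C :: "('o, 'a, 'x) tri_cat_scheme" (structure) and \<kappa> :: "'u rel" and G +
  fixes M N :: 'o and T :: "('o, 'a) adams_res"
  assumes res: "resolution_tower M T" and N_obj: "N \<in> obj C"
begin

sublocale triangle_tower C T N
  by unfold_locales (use res N_obj in \<open>auto simp: resolution_tower_def\<close>)

lemma projP: "objP T s \<in> projs" and ghostM: "ghost (resM T s)" and objM_0: "objM T 0 = M"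
  using res by (auto simp: resolution_tower_def)

lemma tower_ghost_power: "tower_arr s k \<in> ghost_power k"
proof (induction k)
  case 0
  show ?case using Mor_arr[OF idn_closed[OF objM]] by simp
next
  case (Suc k)
  show ?case unfolding tower_arr.simps by (rule ghost_power_SucI[OF Suc tower_arr resM ghostM])
qed

lemma tower_ghost_length:
  assumes "ghost_length (Suc n) M"
  shows "ghost_length (Suc n) (objM T s)"
proof (induction s)
  case 0
  show ?case using assms objM_0 by simp
next
  case (Suc s)
  show ?case by (rule ghost_length_cofiber[OF triT resP resM ghostM projP Suc])
qed

lemma page_collapse:
  assumes "ghost_length (Suc n) M"
  shows "page X (Suc (Suc n)) = page_inf X"
  by (rule page_eq_page_inf)
    (use tower_ghost_length[OF assms] tower_ghost_power tower_arr in \<open>unfold ghost_length_def, blast\<close>)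

text \<open>
  On \<open>\<Coprod>\<^sub>s M\<^sub>s\<close> the shift map induced by the tower is zero in homotopy, so one minus the shift
  map induces the identity and is invertible. This is the vanishing of the homotopy colimit.
\<close>

lemma ex_telescope:
  shows "\<exists>P \<iota> e e'. is_coproduct C UNIV (objM T) P \<iota> \<and> e \<in> Mor C P P \<and> e' \<in> Mor C P P \<and>
    e' \<bullet> e = idn C P \<and> e \<bullet> e' = idn C P \<and>
    (\<forall>s. e \<bullet> \<iota> s = add C (\<iota> s) (neg C (\<iota> (Suc s) \<bullet> resM T s)))"
proof -
  have "Card_order \<kappa>" "|UNIV :: nat set| <o \<kappa>" using sets by (auto simp: set_cardinal_def)
  then obtain I :: "'u set" and g :: "'u \<Rightarrow> nat" where g: "bij_betw g I UNIV" and I: "|I| <o \<kappa>"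
    using ex_small_copy by blast
  have "(\<lambda>i. objM T (g i)) ` I \<subseteq> obj C" using objM by blast
  then obtain P \<gamma> where P: "is_coproduct C I (\<lambda>i. objM T (g i)) P \<gamma>"
    using coproducts I unfolding has_coproducts_def by blast
  let ?h = "inv_into I g"
  define \<iota> where "\<iota> s = \<gamma> (?h s)" for s
  have gh: "g (?h s) = s" for s using bij_betw_inv_into_right[OF g] by simp
  have hg: "?h (g i) = i" if "i \<in> I" for i by (rule bij_betw_inv_into_left[OF g that])
  have U: "is_coproduct C UNIV (objM T) P \<iota>"
    using coproduct_reindex[OF P bij_betw_inv_into[OF g]] by (simp add: gh \<iota>_def[abs_def])
  have Po: "P \<in> obj C" and \<iota>: "\<And>s. \<iota> s \<in> Mor C (objM T s) P" using U by (auto simp: is_coproduct_def)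
  note \<iota>r = cmp_closed[OF resM \<iota>]
  obtain h where h: "h \<in> Mor C P P" "\<And>s. h \<bullet> \<iota> s = \<iota> (Suc s) \<bullet> resM T s"
    by (rule coproductE[OF U Po, of "\<lambda>s. \<iota> (Suc s) \<bullet> resM T s"], rule \<iota>r, rule that) simp_all
  have gr: "ghost (\<iota> (Suc s) \<bullet> resM T s)" for s
  proof -
    have "(\<iota> (Suc s) \<bullet> resM T s) \<bullet> x = zer C (S n) P" if "x \<in> Mor C (S n) (objM T s)" for n x
      using cmp_assoc[OF that resM \<iota>] ghostD[OF ghostM resM that] cmp_zer[OF \<iota> S] by simp
    then show ?thesis using ghost_iff[OF \<iota>r] by blast
  qed
  \<comment> \<open>Compactness is available for index sets in the type of \<open>\<kappa>\<close>,
    so this uses the coproduct as indexed by \<open>I\<close> and not its copy over the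
    naturals.\<close>
  have gh: "ghost h"
  proof (rule coproduct_ghost[OF I P h(1)])
    fix i assume i: "i \<in> I"
    have "h \<bullet> \<gamma> i = \<iota> (Suc (g i)) \<bullet> resM T (g i)" using h(2)[of "g i"] hg[OF i] by (simp add: \<iota>_def)
    then show "ghost (h \<bullet> \<gamma> i)" using gr by simp
  qed
  define e where "e = add C (idn C P) (neg C h)"
  have nh: "neg C h \<in> Mor C P P" by (rule neg_closed[OF h(1)])
  have e: "e \<in> Mor C P P" unfolding e_def by (rule add_closed[OF idn_closed[OF Po] nh])
  have ef: "e \<bullet> f = add C f (neg C (h \<bullet> f))" if "f \<in> Mor C Y P" for f Y
    unfolding e_def using cmp_add_left[OF that idn_closed[OF Po] nh] idn_left[OF that] neg_cmp[OF that h(1)] by simp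
  have ex: "e \<bullet> x = x" if x: "x \<in> Mor C (S n) P" for n x
  proof -
    have z: "neg C (zer C (S n) P) = zer C (S n) P"
      using add_neg[OF zer_closed[OF S Po]] zer_add[OF neg_closed[OF zer_closed[OF S Po]]] by metis
    show ?thesis unfolding ef[OF x] ghostD[OF gh h(1) x] z by (rule add_zer[OF x])
  qed
  have "iso_arr C e"
  proof (rule detects_iso[OF e])
    fix n show "bij_betw (\<lambda>x. e \<bullet> x) (Mor C (S n) P) (Mor C (S n) P)"
      using bij_betw_cong[of "Mor C (S n) P" "\<lambda>x. e \<bullet> x" id "Mor C (S n) P"] ex by simp
  qed
  then obtain e' where e': "e' \<in> Mor C P P" "e' \<bullet> e = idn C P" "e \<bullet> e' = idn C P" using iso_arrE[OF _ e] by blast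
  have "e \<bullet> \<iota> s = add C (\<iota> s) (neg C (\<iota> (Suc s) \<bullet> resM T s))" for s
    using ef[OF \<iota>] h(2) by simp
  then show ?thesis using U e e' by blast
qed

lemma conditionally_convergent: "conditionally_convergent X"
  unfolding conditionally_convergent_def
proof (intro allI conjI)
  fix u :: int
  let ?N = "shift C u N"
  have No: "?N \<in> obj C" by (rule sN)
  obtain P \<iota> e e' where P: "is_coproduct C UNIV (objM T) P \<iota>" and e: "e \<in> Mor C P P" "e' \<in> Mor C P P"
    "e' \<bullet> e = idn C P" "e \<bullet> e' = idn C P" and e\<iota>: "\<And>s. e \<bullet> \<iota> s = add C (\<iota> s) (neg C (\<iota> (Suc s) \<bullet> resM T s))"
    using ex_telescope by blast
  have Po: "P \<in> obj C" and \<iota>: "\<And>s. \<iota> s \<in> Mor C (objM T s) P" using P by (auto simp: is_coproduct_def)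
  note \<iota>r = cmp_closed[OF resM \<iota>]
  \<comment> \<open>In a fixed total degree \<open>u\<close> the target \<open>\<Sigma>^u N\<close>
    does not depend on \<open>s\<close>, so the whole tower consists of maps into one object, and
    the same telescope serves every degree.\<close>
  have G: "(\<lambda>s. cD X s (u - int s)) = (\<lambda>s. Hom C (objM T s) ?N)" by (simp add: couple_simps(1))
  have F: "(\<lambda>s. ci X s (u - int s)) = (\<lambda>s f. f \<bullet> resM T s)" by (simp add: couple_fun)
  have comm: "comm_group (Hom C (objM T s) ?N)" for s by (rule Hom_group[OF objM No])
  have hom: "(\<lambda>f. f \<bullet> resM T s) \<in> hom (Hom C (objM T (Suc s)) ?N) (Hom C (objM T s) ?N)" for s
    by (rule group_hom.homh[OF precomp_group_hom[OF resM No]])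
  have diff: "x \<otimes>\<^bsub>Hom C (objM T s) ?N\<^esub> inv\<^bsub>Hom C (objM T s) ?N\<^esub> (y \<bullet> resM T s) = add C x (neg C (y \<bullet> resM T s))"
    if "y \<in> Mor C (objM T (Suc s)) ?N" for x y s
    using neg_eq[OF cmp_closed[OF resM that]] by simp
  \<comment> \<open>Restriction along the \<open>\<iota> s\<close> identifies maps out of
    \<open>P\<close> with sequences of maps out of the \<open>M_s\<close>; precomposition with
    \<open>e\<close> becomes the map \<open>x_s \<mapsto> x_s - i x_(s+1)\<close> of the
    tower.\<close>
  have key: "(f \<bullet> e) \<bullet> \<iota> s = add C (f \<bullet> \<iota> s) (neg C ((f \<bullet> \<iota> (Suc s)) \<bullet> resM T s))"
    if f: "f \<in> Mor C P ?N" for f s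
  proof -
    have "(f \<bullet> e) \<bullet> \<iota> s = f \<bullet> add C (\<iota> s) (neg C (\<iota> (Suc s) \<bullet> resM T s))"
      using cmp_assoc[OF \<iota> e(1) f] e\<iota> by simp
    also have "\<dots> = add C (f \<bullet> \<iota> s) (f \<bullet> neg C (\<iota> (Suc s) \<bullet> resM T s))"
      by (rule cmp_add_right[OF \<iota> neg_closed[OF \<iota>r] f])
    finally show ?thesis using cmp_neg[OF \<iota>r f] cmp_assoc[OF resM \<iota> f] by simp
  qed
  show "trivial_group (lim_tower (\<lambda>s. cD X s (u - int s)) (\<lambda>s. ci X s (u - int s)))"
    unfolding G F
  proof (rule lim_tower_trivial, rule comm, rule hom)
    fix x assume x: "\<And>s. x s \<in> carrier (Hom C (objM T s) ?N)"
      and z: "\<And>s. x s \<otimes>\<^bsub>Hom C (objM T s) ?N\<^esub> inv\<^bsub>Hom C (objM T s) ?N\<^esub> (x (Suc s) \<bullet> resM T s) = \<one>\<^bsub>Hom C (objM T s) ?N\<^esub>"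
    have x': "x s \<in> Mor C (objM T s) ?N" for s using x by simp
    have z': "add C (x s) (neg C (x (Suc s) \<bullet> resM T s)) = zer C (objM T s) ?N" for s
      using z[of s] unfolding diff[OF x'] by simp
    obtain f where f: "f \<in> Mor C P ?N" "\<And>s. f \<bullet> \<iota> s = x s"
      by (rule coproductE[OF P No, of x], rule x', rule that) simp_all
    have "f \<bullet> e = zer C P ?N"
      by (rule coproduct_eqI[OF P cmp_closed[OF e(1) f(1)] zer_closed[OF Po No]])
        (simp add: key[OF f(1)] f(2) z' zer_cmp[OF \<iota> No])
    then have "f \<bullet> (e \<bullet> e') = zer C P ?N" using cmp_assoc[OF e(2,1) f(1)] zer_cmp[OF e(2) No] by simp
    then have "f = zer C P ?N" unfolding e(4) idn_right[OF f(1)] .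
    then show "\<forall>s. x s = \<one>\<^bsub>Hom C (objM T s) ?N\<^esub>" using f(2) zer_cmp[OF \<iota> No] by simp
  qed
  show "trivial_group (lim1_tower (\<lambda>s. cD X s (u - int s)) (\<lambda>s. ci X s (u - int s)))"
    unfolding G F
  proof (rule lim1_tower_trivial, rule comm, rule hom)
    fix y assume "\<And>s. y s \<in> carrier (Hom C (objM T s) ?N)"
    then have y: "y s \<in> Mor C (objM T s) ?N" for s by simp
    obtain k where k: "k \<in> Mor C P ?N" "\<And>s. k \<bullet> \<iota> s = y s"
      by (rule coproductE[OF P No, of y], rule y, rule that) simp_all
    define f where "f = k \<bullet> e'"
    have f: "f \<in> Mor C P ?N" unfolding f_def by (rule cmp_closed[OF e(2) k(1)])
    have fe: "f \<bullet> e = k" unfolding f_def using cmp_assoc[OF e(1,2) k(1)] e(3) idn_right[OF k(1)] by simp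
    have "f \<bullet> \<iota> s \<in> carrier (Hom C (objM T s) ?N) \<and>
        (f \<bullet> \<iota> s) \<otimes>\<^bsub>Hom C (objM T s) ?N\<^esub> inv\<^bsub>Hom C (objM T s) ?N\<^esub> ((f \<bullet> \<iota> (Suc s)) \<bullet> resM T s) = y s" for s
      unfolding diff[OF cmp_closed[OF \<iota> f]] key[OF f, symmetric] unfolding fe k(2) using cmp_closed[OF \<iota> f] by simp
    then show "\<exists>x. \<forall>s. x s \<in> carrier (Hom C (objM T s) ?N) \<and>
        x s \<otimes>\<^bsub>Hom C (objM T s) ?N\<^esub> inv\<^bsub>Hom C (objM T s) ?N\<^esub> (x (Suc s) \<bullet> resM T s) = y s"
      by (intro exI[of _ "\<lambda>s. f \<bullet> \<iota> s"] allI)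
  qed
qed

end

section \<open>Modules over the endomorphism ring of a compact generator\<close>

text \<open>\<open>A\<close> is the graded endomorphism ring of \<open>G\<close> with the order
  reversed: \<open>r s\<close> corresponds to \<open>s\<close> after a shift of \<open>r\<close>, so
  that precomposition makes \<open>[S *, Y]\<close> a left module. The assumptions on
  \<open>A\<close> are its groups, the product formula and the unit; the ring axioms are derived
  from those of composition.\<close>

locale represented_ring = compact_triangulated C \<kappa> G
  for C :: "('o, 'a, 'x) tri_cat_scheme" (structure) and \<kappa> :: "'u rel" and G +
  fixes A :: "'r gr_ring" and \<rho> :: "int \<Rightarrow> 'r \<Rightarrow> 'a"
  assumes A_group: "comm_group (rgrp A n)"
    and \<rho>_iso: "\<rho> n \<in> iso (rgrp A n) (Hom C (S n) G)"
    and A_mul_closed: "\<lbrakk>r \<in> carrier (rgrp A m); s \<in> carrier (rgrp A n)\<rbrakk> \<Longrightarrow> rmul A m n r s \<in> carrier (rgrp A (m + n))"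
    and \<rho>_mul: "\<lbrakk>r \<in> carrier (rgrp A m); s \<in> carrier (rgrp A n)\<rbrakk>
      \<Longrightarrow> \<rho> (m + n) (rmul A m n r s) = \<rho> n s \<bullet> shift_arr C n (\<rho> m r)"
    and A_one_closed: "rone A \<in> carrier (rgrp A 0)"
    and \<rho>_one: "\<rho> 0 (rone A) = idn C G"
begin

lemma \<rho>_closed: "r \<in> carrier (rgrp A n) \<Longrightarrow> \<rho> n r \<in> Mor C (S n) G"
  using \<rho>_iso[of n] by (auto simp: iso_def hom_def)

lemma \<rho>_inj: "\<lbrakk>r \<in> carrier (rgrp A n); s \<in> carrier (rgrp A n); \<rho> n r = \<rho> n s\<rbrakk> \<Longrightarrow> r = s"
  using \<rho>_iso[of n] by (auto simp: iso_def bij_betw_def dest: inj_onD)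

lemma \<rho>_add: "\<lbrakk>r \<in> carrier (rgrp A n); s \<in> carrier (rgrp A n)\<rbrakk>
  \<Longrightarrow> \<rho> n (r \<otimes>\<^bsub>rgrp A n\<^esub> s) = add C (\<rho> n r) (\<rho> n s)"
  using \<rho>_iso[of n] by (auto simp: iso_def hom_def)

lemma shift_\<rho>: "r \<in> carrier (rgrp A m) \<Longrightarrow> shift_arr C n (\<rho> m r) \<in> Mor C (S (m + n)) (S n)"
  using shift_mor[OF \<rho>_closed, of r m n] by (simp add: shift_S add.commute)

lemma A_add_closed: "\<lbrakk>r \<in> carrier (rgrp A n); s \<in> carrier (rgrp A n)\<rbrakk> \<Longrightarrow> r \<otimes>\<^bsub>rgrp A n\<^esub> s \<in> carrier (rgrp A n)"
proof -
  interpret comm_group "rgrp A n" by (rule A_group)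
  show "\<lbrakk>r \<in> carrier (rgrp A n); s \<in> carrier (rgrp A n)\<rbrakk> \<Longrightarrow> r \<otimes>\<^bsub>rgrp A n\<^esub> s \<in> carrier (rgrp A n)" by simp
qed

lemma A_graded_ring: "graded_ring A"
proof (rule graded_ring.intro)
  fix m n l
  show "comm_group (rgrp A n)" by (rule A_group)
  show "rone A \<in> carrier (rgrp A 0)" by (rule A_one_closed)
  show "rmul A m n r \<in> hom (rgrp A n) (rgrp A (m + n))" if r: "r \<in> carrier (rgrp A m)" for r
  proof (rule homI)
    fix s s' assume s: "s \<in> carrier (rgrp A n)" "s' \<in> carrier (rgrp A n)"
    show "rmul A m n r (s \<otimes>\<^bsub>rgrp A n\<^esub> s') = rmul A m n r s \<otimes>\<^bsub>rgrp A (m + n)\<^esub> rmul A m n r s'"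
    proof (rule \<rho>_inj)
      show "\<rho> (m + n) (rmul A m n r (s \<otimes>\<^bsub>rgrp A n\<^esub> s')) = \<rho> (m + n) (rmul A m n r s \<otimes>\<^bsub>rgrp A (m + n)\<^esub> rmul A m n r s')"
        using r s by (simp add: \<rho>_mul \<rho>_add A_mul_closed A_add_closed
            cmp_add_left[OF shift_\<rho>[OF r, of n] \<rho>_closed[OF s(1)] \<rho>_closed[OF s(2)]])
    qed (use r s in \<open>simp_all add: A_mul_closed A_add_closed\<close>)
  qed (rule A_mul_closed[OF r])
  show "(\<lambda>r. rmul A m n r s) \<in> hom (rgrp A m) (rgrp A (m + n))" if s: "s \<in> carrier (rgrp A n)" for s
  proof (rule homI)
    fix r r' assume r: "r \<in> carrier (rgrp A m)" "r' \<in> carrier (rgrp A m)"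
    show "rmul A m n (r \<otimes>\<^bsub>rgrp A m\<^esub> r') s = rmul A m n r s \<otimes>\<^bsub>rgrp A (m + n)\<^esub> rmul A m n r' s"
    proof (rule \<rho>_inj)
      show "\<rho> (m + n) (rmul A m n (r \<otimes>\<^bsub>rgrp A m\<^esub> r') s) = \<rho> (m + n) (rmul A m n r s \<otimes>\<^bsub>rgrp A (m + n)\<^esub> rmul A m n r' s)"
        using r s by (simp add: \<rho>_mul \<rho>_add A_mul_closed A_add_closed shift_add[OF \<rho>_closed[OF r(1)] \<rho>_closed[OF r(2)]]
            cmp_add_right[OF shift_\<rho>[OF r(1), of n] shift_\<rho>[OF r(2), of n] \<rho>_closed[OF s]])
    qed (use r s in \<open>simp_all add: A_mul_closed A_add_closed\<close>)
  qed (rule A_mul_closed[OF _ s])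
  show "rmul A 0 n (rone A) r = r" if r: "r \<in> carrier (rgrp A n)" for r
  proof (rule \<rho>_inj)
    show "\<rho> n (rmul A 0 n (rone A) r) = \<rho> n r"
      using \<rho>_mul[OF A_one_closed r] by (simp add: \<rho>_one shift_idn[OF G] idn_right[OF \<rho>_closed[OF r]])
  qed (use A_mul_closed[OF A_one_closed r] r in simp_all)
  show "rmul A n 0 r (rone A) = r" if r: "r \<in> carrier (rgrp A n)" for r
  proof (rule \<rho>_inj)
    show "\<rho> n (rmul A n 0 r (rone A)) = \<rho> n r"
      using \<rho>_mul[OF r A_one_closed] by (simp add: \<rho>_one shift_arr_0 idn_left[OF \<rho>_closed[OF r]])
  qed (use A_mul_closed[OF r A_one_closed] r in simp_all)
  show "rmul A (l + m) n (rmul A l m r s) t = rmul A l (m + n) r (rmul A m n s t)"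
    if r: "r \<in> carrier (rgrp A l)" "s \<in> carrier (rgrp A m)" "t \<in> carrier (rgrp A n)" for r s t
  proof (rule \<rho>_inj)
    note rs = A_mul_closed[OF r(1,2)] and st = A_mul_closed[OF r(2,3)]
    have "\<rho> (l + m + n) (rmul A (l + m) n (rmul A l m r s) t) = \<rho> n t \<bullet> shift_arr C n (\<rho> m s \<bullet> shift_arr C m (\<rho> l r))"
      using \<rho>_mul[OF rs r(3)] \<rho>_mul[OF r(1,2)] by simp
    also have "\<dots> = \<rho> n t \<bullet> (shift_arr C n (\<rho> m s) \<bullet> shift_arr C (m + n) (\<rho> l r))"
      using shift_cmp[OF shift_\<rho>[OF r(1), of m] \<rho>_closed[OF r(2)], of n] shift_arr_add[OF \<rho>_closed[OF r(1)], of n m]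
      by (simp add: add.commute)
    also have "\<dots> = (\<rho> n t \<bullet> shift_arr C n (\<rho> m s)) \<bullet> shift_arr C (m + n) (\<rho> l r)"
      by (rule cmp_assoc[symmetric, OF shift_\<rho>[OF r(1)] shift_\<rho>[OF r(2)] \<rho>_closed[OF r(3)]])
    also have "\<dots> = \<rho> (l + (m + n)) (rmul A l (m + n) r (rmul A m n s t))"
      using \<rho>_mul[OF r(1) st] \<rho>_mul[OF r(2,3)] by simp
    finally show "\<rho> (l + m + n) (rmul A (l + m) n (rmul A l m r s) t) = \<rho> (l + m + n) (rmul A l (m + n) r (rmul A m n s t))"
      by (simp add: add.assoc)
    show "rmul A (l + m) n (rmul A l m r s) t \<in> carrier (rgrp A (l + m + n))" by (rule A_mul_closed[OF rs r(3)])
    show "rmul A l (m + n) r (rmul A m n s t) \<in> carrier (rgrp A (l + m + n))"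
      using A_mul_closed[OF r(1) st] by (simp add: add.assoc)
  qed
qed

sublocale A: graded_ring A by (rule A_graded_ring)

text \<open>Exhibits \<open>L\<close> as \<open>[S *, Y]\<close> up to isomorphism. Module axioms
  are proved once for such \<open>L\<close> and apply both to \<open>M_*\<close>, where
  \<open>\<tau>\<close> comes from the adjunction, and to regraded homotopy.\<close>

definition represents :: "('r, 'm) gr_module \<Rightarrow> 'o \<Rightarrow> (int \<Rightarrow> 'a \<Rightarrow> 'm) \<Rightarrow> bool" where
  "represents L Y \<tau> \<longleftrightarrow> Y \<in> obj C \<and> (\<forall>n. comm_group (mgrp L n)) \<and>
     (\<forall>n. \<tau> n \<in> iso (Hom C (S n) Y) (mgrp L n)) \<and>
     (\<forall>m n. \<forall>r \<in> carrier (rgrp A m). \<forall>x \<in> Mor C (S n) Y.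
        \<tau> (m + n) (x \<bullet> shift_arr C n (\<rho> m r)) = mact L m n r (\<tau> n x))"

context
  fixes L :: "('r, 'm) gr_module" and Y \<tau>
  assumes rep: "represents L Y \<tau>"
begin

lemma rep_iso: "\<tau> n \<in> iso (Hom C (S n) Y) (mgrp L n)" and rep_obj: "Y \<in> obj C"
  using rep by (auto simp: represents_def)

lemma rep_act: "\<lbrakk>r \<in> carrier (rgrp A m); x \<in> Mor C (S n) Y\<rbrakk>
    \<Longrightarrow> \<tau> (m + n) (x \<bullet> shift_arr C n (\<rho> m r)) = mact L m n r (\<tau> n x)"
  using rep by (auto simp: represents_def)

lemma rep_closed: "x \<in> Mor C (S n) Y \<Longrightarrow> \<tau> n x \<in> carrier (mgrp L n)"
  using rep_iso[of n] by (auto simp: iso_def hom_def)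

lemma rep_surj: "y \<in> carrier (mgrp L n) \<Longrightarrow> \<exists>x \<in> Mor C (S n) Y. y = \<tau> n x"
  using rep_iso[of n] by (auto simp: iso_def bij_betw_def)

lemma rep_inj: "\<lbrakk>x \<in> Mor C (S n) Y; y \<in> Mor C (S n) Y; \<tau> n x = \<tau> n y\<rbrakk> \<Longrightarrow> x = y"
  using rep_iso[of n] by (auto simp: iso_def bij_betw_def dest: inj_onD)

lemma rep_add: "\<lbrakk>x \<in> Mor C (S n) Y; y \<in> Mor C (S n) Y\<rbrakk> \<Longrightarrow> \<tau> n (add C x y) = \<tau> n x \<otimes>\<^bsub>mgrp L n\<^esub> \<tau> n y"
  using rep_iso[of n] by (auto simp: iso_def hom_def)

lemma rep_zer: "\<tau> n (zer C (S n) Y) = \<one>\<^bsub>mgrp L n\<^esub>"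
proof -
  have c: "comm_group (mgrp L n)" using rep by (simp add: represents_def)
  from hom_one[OF iso_imp_homomorphism[OF rep_iso[of n]] comm_group.axioms(2)[OF Hom_group[OF S rep_obj]] comm_group.axioms(2)[OF c]]
  show ?thesis by simp
qed

lemma rep_zero_iff: "x \<in> Mor C (S n) Y \<Longrightarrow> \<tau> n x = \<one>\<^bsub>mgrp L n\<^esub> \<longleftrightarrow> x = zer C (S n) Y"
  using rep_zer[of n] rep_inj[of x n "zer C (S n) Y"] zer_closed[OF S rep_obj] by auto

lemma rep_module: "graded_module A L"
proof (intro graded_module.intro graded_module_axioms.intro)
  fix m n l
  show "graded_ring A" by (rule A_graded_ring)
  show "comm_group (mgrp L n)" using rep by (simp add: represents_def)
  note xr = cmp_closed[OF shift_\<rho>]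
  show "mact L m n r \<in> hom (mgrp L n) (mgrp L (m + n))" if r: "r \<in> carrier (rgrp A m)" for r
  proof (rule homI)
    fix y assume "y \<in> carrier (mgrp L n)"
    then obtain x where x: "x \<in> Mor C (S n) Y" "y = \<tau> n x" using rep_surj by blast
    show "mact L m n r y \<in> carrier (mgrp L (m + n))"
      unfolding x(2) rep_act[OF r x(1), symmetric] by (rule rep_closed[OF xr[OF r x(1)]])
    fix y' assume "y' \<in> carrier (mgrp L n)"
    then obtain x' where x': "x' \<in> Mor C (S n) Y" "y' = \<tau> n x'" using rep_surj by blast
    show "mact L m n r (y \<otimes>\<^bsub>mgrp L n\<^esub> y') = mact L m n r y \<otimes>\<^bsub>mgrp L (m + n)\<^esub> mact L m n r y'"
      unfolding x(2) x'(2) rep_add[OF x(1) x'(1), symmetric] rep_act[OF r x(1), symmetric] rep_act[OF r x'(1), symmetric]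
        rep_act[OF r add_closed[OF x(1) x'(1)], symmetric] cmp_add_left[OF shift_\<rho>[OF r] x(1) x'(1)]
      by (rule rep_add[OF xr[OF r x(1)] xr[OF r x'(1)]])
  qed
  fix y assume "y \<in> carrier (mgrp L n)"
  then obtain x where x: "x \<in> Mor C (S n) Y" "y = \<tau> n x" using rep_surj by blast
  show "(\<lambda>r. mact L m n r y) \<in> hom (rgrp A m) (mgrp L (m + n))"
  proof (rule homI)
    fix r assume r: "r \<in> carrier (rgrp A m)"
    show "mact L m n r y \<in> carrier (mgrp L (m + n))"
      unfolding x(2) rep_act[OF r x(1), symmetric] by (rule rep_closed[OF xr[OF r x(1)]])
    fix r' assume r': "r' \<in> carrier (rgrp A m)"
    show "mact L m n (r \<otimes>\<^bsub>rgrp A m\<^esub> r') y = mact L m n r y \<otimes>\<^bsub>mgrp L (m + n)\<^esub> mact L m n r' y"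
      unfolding x(2) rep_act[OF r x(1), symmetric] rep_act[OF r' x(1), symmetric]
        rep_act[OF A_add_closed[OF r r'] x(1), symmetric] \<rho>_add[OF r r'] shift_add[OF \<rho>_closed[OF r] \<rho>_closed[OF r']]
        cmp_add_right[OF shift_\<rho>[OF r] shift_\<rho>[OF r'] x(1)]
      by (rule rep_add[OF xr[OF r x(1)] xr[OF r' x(1)]])
  qed
  show "mact L 0 n (rone A) y = y"
    using rep_act[OF A_one_closed x(1)] x(2) by (simp add: \<rho>_one shift_idn[OF G] idn_right[OF x(1)])
  fix r s assume r: "r \<in> carrier (rgrp A l)" and s: "s \<in> carrier (rgrp A m)"
  have "mact L (l + m) n (rmul A l m r s) y = \<tau> (l + m + n) (x \<bullet> shift_arr C n (\<rho> m s \<bullet> shift_arr C m (\<rho> l r)))"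
    using rep_act[OF A_mul_closed[OF r s] x(1)] x(2) \<rho>_mul[OF r s] by simp
  also have "shift_arr C n (\<rho> m s \<bullet> shift_arr C m (\<rho> l r)) = shift_arr C n (\<rho> m s) \<bullet> shift_arr C (m + n) (\<rho> l r)"
    using shift_cmp[OF shift_\<rho>[OF r, of m] \<rho>_closed[OF s], of n] shift_arr_add[OF \<rho>_closed[OF r], of n m]
    by (simp add: add.commute)
  also have "x \<bullet> (shift_arr C n (\<rho> m s) \<bullet> shift_arr C (m + n) (\<rho> l r)) = (x \<bullet> shift_arr C n (\<rho> m s)) \<bullet> shift_arr C (m + n) (\<rho> l r)"
    by (rule cmp_assoc[symmetric, OF shift_\<rho>[OF r] shift_\<rho>[OF s] x(1)])
  also have "\<tau> (l + m + n) \<dots> = mact L l (m + n) r (mact L m n s y)"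
    using rep_act[OF r xr[OF s x(1)]] rep_act[OF s x(1)] x(2) by (simp add: add.assoc)
  finally show "mact L (l + m) n (rmul A l m r s) y = mact L l (m + n) r (mact L m n s y)" .
qed

end

text \<open>Homotopy of \<open>Y\<close> regraded by \<open>k\<close>. For \<open>P_s\<close> the
  choice \<open>k = s\<close> gives the differentials degree zero, and with the action by
  precomposition they are linear without signs.\<close>

definition Hmod :: "'o \<Rightarrow> int \<Rightarrow> ('r, 'a) gr_module" where
  "Hmod Y k = \<lparr>mgrp = (\<lambda>n. Hom C (S (n + k)) Y), mact = (\<lambda>m n r x. x \<bullet> shift_arr C (n + k) (\<rho> m r))\<rparr>"

lemma mgrp_Hmod: "mgrp (Hmod Y k) n = Hom C (S (n + k)) Y"
  and mact_Hmod: "mact (Hmod Y k) m n r x = x \<bullet> shift_arr C (n + k) (\<rho> m r)"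
  by (simp_all add: Hmod_def)

text \<open>Regraded homotopy is the homotopy of a desuspension: \<open>[S (n + k), Y]\<close> is
  \<open>[S n, \<Sigma>^(-k) Y]\<close>.\<close>

lemma Hmod_represents:
  assumes Y: "Y \<in> obj C"
  shows "represents (Hmod Y k) (shift C (- k) Y) (\<lambda>n. shift_arr C k)"
  unfolding represents_def
proof (intro conjI allI ballI)
  have k: "shift C k (shift C (- k) Y) = Y" using shift_shift[OF Y, of k "- k"] by (simp add: shift_0)
  show sY: "shift C (- k) Y \<in> obj C" by (rule shift_closed[OF Y])
  show "comm_group (mgrp (Hmod Y k) n)" for n unfolding mgrp_Hmod by (rule Hom_group[OF S Y])
  show "shift_arr C k \<in> iso (Hom C (S n) (shift C (- k) Y)) (mgrp (Hmod Y k) n)" for n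
    using shift_iso_Hom[OF S[of n] sY, of k] k by (simp add: mgrp_Hmod shift_S add.commute)
  fix m n r x assume r: "r \<in> carrier (rgrp A m)" and x: "x \<in> Mor C (S n) (shift C (- k) Y)"
  show "shift_arr C k (x \<bullet> shift_arr C n (\<rho> m r)) = mact (Hmod Y k) m n r (shift_arr C k x)"
    using shift_cmp[OF shift_\<rho>[OF r] x, of k] shift_arr_add[OF \<rho>_closed[OF r], of k n]
    by (simp add: mact_Hmod add.commute)
qed

lemma Hmod_module: "Y \<in> obj C \<Longrightarrow> graded_module A (Hmod Y k)"
  by (rule rep_module[OF Hmod_represents])

definition induced :: "'o \<Rightarrow> int \<Rightarrow> 'a \<Rightarrow> int \<Rightarrow> 'a \<Rightarrow> 'a" where
  "induced Y k f = (\<lambda>n. \<lambda>x\<in>Mor C (S (n + k)) Y. f \<bullet> x)"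

lemma induced_apply: "x \<in> Mor C (S (n + k)) Y \<Longrightarrow> induced Y k f n x = f \<bullet> x"
  by (simp add: induced_def)

lemma induced_closed:
  assumes f: "f \<in> Mor C Y Z"
  shows "induced Y k f \<in> gr_hom A (Hmod Y k) (Hmod Z k) 0"
proof (rule gr_homI)
  fix n x assume x: "x \<in> carrier (mgrp (Hmod Y k) n)"
  then have x': "x \<in> Mor C (S (n + k)) Y" by (simp add: mgrp_Hmod)
  show "induced Y k f n x \<in> carrier (mgrp (Hmod Z k) (n + 0))"
    using cmp_closed[OF x' f] x' by (simp add: mgrp_Hmod induced_apply)
  fix y assume "y \<in> carrier (mgrp (Hmod Y k) n)"
  then have y': "y \<in> Mor C (S (n + k)) Y" by (simp add: mgrp_Hmod)
  show "induced Y k f n (x \<otimes>\<^bsub>mgrp (Hmod Y k) n\<^esub> y) = induced Y k f n x \<otimes>\<^bsub>mgrp (Hmod Z k) (n + 0)\<^esub> induced Y k f n y"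
    using cmp_add_right[OF x' y' f] by (simp add: mgrp_Hmod induced_apply x' y' add_closed[OF x' y'])
next
  show "induced Y k f n \<in> extensional (carrier (mgrp (Hmod Y k) n))" for n
    by (simp add: induced_def mgrp_Hmod)
  fix m n r x assume r: "r \<in> carrier (rgrp A m)" and "x \<in> carrier (mgrp (Hmod Y k) n)"
  then have x: "x \<in> Mor C (S (n + k)) Y" by (simp add: mgrp_Hmod)
  have s: "shift_arr C (n + k) (\<rho> m r) \<in> Mor C (S (m + n + k)) (S (n + k))" using shift_\<rho>[OF r, of "n + k"] by (simp add: add.assoc)
  show "induced Y k f (m + n) (mact (Hmod Y k) m n r x) = mact (Hmod Z k) m (n + 0) r (induced Y k f n x)"
    using cmp_assoc[OF s x f] by (simp add: mact_Hmod induced_apply x cmp_closed[OF s x])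
qed

lemma induced_cmp:
  assumes f: "f \<in> Mor C X Y" and g: "g \<in> Mor C Y Z"
  shows "gr_comp (Hmod X k) (induced Y k g) (induced X k f) = induced X k (g \<bullet> f)"
proof (rule gr_hom_eqI)
  show "gr_comp (Hmod X k) (induced Y k g) (induced X k f) \<in> gr_hom A (Hmod X k) (Hmod Z k) 0"
    by (rule gr_comp_closed[OF Hmod_module[OF Mor_src[OF f]] induced_closed[OF f] induced_closed[OF g]])
  show "induced X k (g \<bullet> f) \<in> gr_hom A (Hmod X k) (Hmod Z k) 0" by (rule induced_closed[OF cmp_closed[OF f g]])
  fix n x assume x: "x \<in> carrier (mgrp (Hmod X k) n)"
  then have x': "x \<in> Mor C (S (n + k)) X" by (simp add: mgrp_Hmod)
  show "gr_comp (Hmod X k) (induced Y k g) (induced X k f) n x = induced X k (g \<bullet> f) n x"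
    using cmp_assoc[OF x' f g] by (simp add: gr_comp_apply[OF x] induced_apply[OF x'] induced_apply[OF cmp_closed[OF x' f]])
qed

lemma induced_idn: "induced Y k (idn C Y) = gr_id (Hmod Y k)"
  unfolding induced_def gr_id_def mgrp_Hmod by (auto intro!: ext simp: idn_left)

text \<open>Compactness splits \<open>[S (n + k), Q]\<close> into the groups
  \<open>[S (n + k), S (d i)]\<close>, and each of these is the ring in degree
  \<open>n + k - d i\<close>. The inclusions \<open>\<iota> i\<close>, of degree
  \<open>d i - k\<close> after regrading, form the basis.\<close>

lemma Hmod_coproduct_free:
  fixes I :: "'u set"
  assumes I: "|I| <o \<kappa>" and Q: "is_coproduct C I (\<lambda>i. S (d i)) Q \<iota>"
  shows "free_on A (Hmod Q k) I (\<lambda>i. d i - k) \<iota>"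
  unfolding free_on_def
proof (intro conjI allI ballI)
  have Qo: "Q \<in> obj C" and \<iota>: "\<And>i. i \<in> I \<Longrightarrow> \<iota> i \<in> Mor C (S (d i)) Q" using Q by (auto simp: is_coproduct_def)
  show "graded_module A (Hmod Q k)" by (rule Hmod_module[OF Qo])
  show "\<iota> i \<in> carrier (mgrp (Hmod Q k) (d i - k))" if "i \<in> I" for i using \<iota>[OF that] by (simp add: mgrp_Hmod)
  fix n
  let ?d = "\<lambda>i. d i - k"
  \<comment> \<open>Turns a coefficient of the generator \<open>\<iota> i\<close> into a map
    \<open>S (n + k) \<rightarrow> S (d i)\<close>; following it by \<open>\<iota> i\<close> is the
    module action.\<close>
  define \<sigma> where "\<sigma> i r = shift_arr C (d i) (\<rho> (n - ?d i) r)" for i r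
  have deg: "n - ?d i + d i = n + k" for i by simp
  have \<sigma>: "\<sigma> i \<in> iso (rgrp A (n - ?d i)) (Hom C (S (n + k)) (S (d i)))" for i
    using iso_set_trans[OF \<rho>_iso[of "n - ?d i"] shift_iso_Hom[OF S G, of "d i"]]
    by (simp add: shift_S comp_def \<sigma>_def[abs_def] add.commute)
  have \<sigma>c: "\<sigma> i r \<in> Mor C (S (n + k)) (S (d i))" if "r \<in> carrier (rgrp A (n - ?d i))" for i r
    using \<sigma>[of i] that by (auto simp: iso_def hom_def)
  have \<Sigma>: "(\<lambda>c. \<lambda>i\<in>I. \<sigma> i (c i)) \<in> iso (coefs A I ?d n) (sum_group I (\<lambda>i. Hom C (S (n + k)) (S (d i))))"
    unfolding coefs_def
    by (rule sum_group_iso) (use A_group Hom_group[OF S S] \<sigma> in \<open>auto simp: comm_group.axioms(2)\<close>)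
  let ?F = "\<lambda>f. finprod (Hom C (S (n + k)) Q) (\<lambda>i. \<iota> i \<bullet> f i) {i \<in> I. f i \<noteq> zer C (S (n + k)) (S (d i))}"
  from iso_set_trans[OF \<Sigma> compact_S[OF I Q, of "n + k"]]
  have bij: "bij_betw (?F \<circ> (\<lambda>c. \<lambda>i\<in>I. \<sigma> i (c i))) (carrier (coefs A I ?d n)) (carrier (mgrp (Hmod Q k) n))"
    by (simp add: iso_def mgrp_Hmod)
  have "(?F \<circ> (\<lambda>c. \<lambda>i\<in>I. \<sigma> i (c i))) c = lin_comb A (Hmod Q k) I ?d \<iota> n c" if c: "c \<in> carrier (coefs A I ?d n)" for c
  proof -
    interpret H: comm_group "Hom C (S (n + k)) Q" by (rule Hom_group[OF S Qo])
    have z: "\<sigma> i r = zer C (S (n + k)) (S (d i)) \<longleftrightarrow> r = \<one>\<^bsub>rgrp A (n - ?d i)\<^esub>" if r: "r \<in> carrier (rgrp A (n - ?d i))" for i r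
    proof -
      have "\<sigma> i \<one>\<^bsub>rgrp A (n - ?d i)\<^esub> = zer C (S (n + k)) (S (d i))"
        using hom_one[OF iso_imp_homomorphism[OF \<sigma>[of i]] A.R.group_axioms comm_group.axioms(2)[OF Hom_group[OF S S]]] by simp
      moreover have "inj_on (\<sigma> i) (carrier (rgrp A (n - ?d i)))" using \<sigma>[of i] by (simp add: iso_def bij_betw_def)
      ultimately show ?thesis using r A.R.one_closed[of "n - ?d i"] by (metis inj_onD)
    qed
    have ci: "c i \<in> carrier (rgrp A (n - ?d i))" if "i \<in> I" for i
      using A.coefs_closed[where d = ?d, OF c that] .
    have set: "{i \<in> I. (\<lambda>i\<in>I. \<sigma> i (c i)) i \<noteq> zer C (S (n + k)) (S (d i))} = supp A I ?d n c"
      using z ci by (auto simp: supp_def)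
    show ?thesis
      unfolding comp_def set lin_comb_def mgrp_Hmod
    proof (rule H.finprod_cong')
      show "(\<lambda>i. mact (Hmod Q k) (n - ?d i) (?d i) (c i) (\<iota> i)) \<in> supp A I ?d n c \<rightarrow> carrier (Hom C (S (n + k)) Q)"
        using cmp_closed[OF \<sigma>c[OF ci] \<iota>] by (auto simp: supp_def mact_Hmod \<sigma>_def)
      show "\<iota> i \<bullet> (\<lambda>i\<in>I. \<sigma> i (c i)) i = mact (Hmod Q k) (n - ?d i) (?d i) (c i) (\<iota> i)" if "i \<in> supp A I ?d n c" for i
        using that by (simp add: supp_def mact_Hmod \<sigma>_def)
    qed simp
  qed
  then show "bij_betw (lin_comb A (Hmod Q k) I ?d \<iota> n) (carrier (coefs A I ?d n)) (carrier (mgrp (Hmod Q k) n))"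
    using bij bij_betw_cong by blast
qed

lemma proj_retractE:
  assumes "P \<in> projs"
  obtains I :: "'u set" and d Q \<iota> i p where "|I| <o \<kappa>" "is_coproduct C I (\<lambda>i. S (d i)) Q \<iota>"
    "i \<in> Mor C P Q" "p \<in> Mor C Q P" "p \<bullet> i = idn C P"
  using assms unfolding projs_def retract_def by blast

lemma Hmod_proj_lifting:
  assumes P: "P \<in> projs" and Y: "graded_module A Y" and Z: "graded_module A Z"
  shows "lifting A (Hmod P k) Y Z"
proof -
  obtain I :: "'u set" and d Q \<iota> i p where Q: "|I| <o \<kappa>" "is_coproduct C I (\<lambda>i. S (d i)) Q \<iota>"
    and ip: "i \<in> Mor C P Q" "p \<in> Mor C Q P" "p \<bullet> i = idn C P" using proj_retractE[OF P] by blast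
  show ?thesis
  proof (rule lifting_retract[OF Hmod_module[OF Mor_tgt[OF ip(1)]] Hmod_module[OF Mor_src[OF ip(1)]]
        induced_closed[OF ip(1)] induced_closed[OF ip(2)]])
    show "gr_comp (Hmod P k) (induced Q k p) (induced P k i) = gr_id (Hmod P k)"
      unfolding induced_cmp[OF ip(1,2)] ip(3) by (rule induced_idn)
    show "lifting A (Hmod Q k) Y Z" by (rule free_on_lifting[OF Hmod_coproduct_free[OF Q] Y Z])
  qed
qed

text \<open>For a coproduct \<open>Q\<close> of shifts of \<open>G\<close> both sides amount to a
  choice of an element of \<open>[S (d j), Y]\<close> for each summand: on the left by the universal
  property, on the right because the \<open>\<iota> j\<close> are a basis. Precomposing with
  \<open>i\<close> and \<open>p\<close> transfers this to the retract \<open>P\<close>.\<close>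

lemma induced_bij:
  assumes P: "P \<in> projs" and Y: "Y \<in> obj C"
  shows "bij_betw (induced P k) (Mor C P Y) (gr_hom A (Hmod P k) (Hmod Y k) 0)"
proof -
  obtain I :: "'u set" and d Q \<iota> i p where I: "|I| <o \<kappa>" and Q: "is_coproduct C I (\<lambda>i. S (d i)) Q \<iota>"
    and ip: "i \<in> Mor C P Q" "p \<in> Mor C Q P" "p \<bullet> i = idn C P" using proj_retractE[OF P] by blast
  have Qo: "Q \<in> obj C" and \<iota>: "\<And>i. i \<in> I \<Longrightarrow> \<iota> i \<in> Mor C (S (d i)) Q" using Q by (auto simp: is_coproduct_def)
  have \<iota>a: "induced Q k f (d j - k) (\<iota> j) = f \<bullet> \<iota> j" if "j \<in> I" for f j
    by (rule induced_apply) (use \<iota>[OF that] in simp)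
  note free = Hmod_coproduct_free[OF I Q, of k]
  have Pm: "graded_module A (Hmod P k)" and Ym: "graded_module A (Hmod Y k)" and Qm: "graded_module A (Hmod Q k)"
    using Hmod_module projs_obj[OF P] Y Qo by auto
  have fpi: "(f \<bullet> p) \<bullet> i = f" if f: "f \<in> Mor C P Y" for f
    using cmp_assoc[OF ip(1,2) f] ip(3) idn_right[OF f] by simp
  show ?thesis
    unfolding bij_betw_def
  proof (intro conjI equalityI subsetI inj_onI)
    fix f f' assume f: "f \<in> Mor C P Y" "f' \<in> Mor C P Y" and eq: "induced P k f = induced P k f'"
    have "induced Q k (f \<bullet> p) = induced Q k (f' \<bullet> p)"
      using induced_cmp[OF ip(2) f(1), of k] induced_cmp[OF ip(2) f(2), of k] eq by simp
    then have "(f \<bullet> p) \<bullet> \<iota> j = (f' \<bullet> p) \<bullet> \<iota> j" if "j \<in> I" for j using \<iota>a[OF that] by metis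
    then have "f \<bullet> p = f' \<bullet> p" by (rule coproduct_eqI[OF Q cmp_closed[OF ip(2) f(1)] cmp_closed[OF ip(2) f(2)]])
    then show "f = f'" using fpi f by metis
  next
    fix g assume "g \<in> induced P k ` Mor C P Y"
    then show "g \<in> gr_hom A (Hmod P k) (Hmod Y k) 0" using induced_closed by blast
  next
    fix g assume g: "g \<in> gr_hom A (Hmod P k) (Hmod Y k) 0"
    define g' where "g' = gr_comp (Hmod Q k) g (induced Q k p)"
    have g': "g' \<in> gr_hom A (Hmod Q k) (Hmod Y k) 0"
      unfolding g'_def by (rule gr_comp_closed[OF Qm induced_closed[OF ip(2)] g])
    have "g' (d j - k) (\<iota> j) \<in> Mor C (S (d j)) Y" if "j \<in> I" for j
      using gr_hom_closed0[OF g', of "\<iota> j" "d j - k"] \<iota>[OF that] by (simp add: mgrp_Hmod)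
    then obtain f where f: "f \<in> Mor C Q Y" "\<And>j. j \<in> I \<Longrightarrow> f \<bullet> \<iota> j = g' (d j - k) (\<iota> j)"
      using coproductE[OF Q Y, of "\<lambda>j. g' (d j - k) (\<iota> j)"] by blast
    have "induced Q k f = g'"
      by (rule free_on_eqI[OF free Ym induced_closed[OF f(1)] g']) (simp add: \<iota>a f(2))
    then have "induced P k (f \<bullet> i) = gr_comp (Hmod P k) g' (induced P k i)"
      using induced_cmp[OF ip(1) f(1), of k] by simp
    also have "\<dots> = gr_comp (Hmod P k) g (gr_id (Hmod P k))"
      unfolding g'_def gr_comp_assoc[OF induced_closed[OF ip(1)]] induced_cmp[OF ip(1,2)] ip(3) induced_idn ..
    also have "\<dots> = g" by (rule gr_comp_id[OF g])
    finally show "g \<in> induced P k ` Mor C P Y" using cmp_closed[OF ip(1) f(1)] by blast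
  qed
qed

end

section \<open>The second page\<close>

context exact_couple
begin

text \<open>Since \<open>im i = ker j\<close>, the element \<open>k x\<close> lifts one step exactly
  when \<open>j k x\<close> vanishes. With the two lemmas below this makes \<open>E_2\<close> the
  cohomology of \<open>d_1 = j k\<close>.\<close>

lemma cycles_2: "cycles X (Suc (Suc 0)) s t = {x \<in> carrier (cE X s t). cj X (Suc s) t (ck X s t x) = \<one>\<^bsub>cE X (Suc s) t\<^esub>}"
proof -
  have "ci_pow X (Suc 0) (Suc s) t ` carrier (cD X (s + Suc (Suc 0)) (t - int (Suc 0)))
      = kernel (cD X (Suc s) t) (cE X (Suc s) t) (cj X (Suc s) t)"
    using exact_ij[of "Suc s" t] by (simp add: add_Suc_right)
  then show ?thesis unfolding cycles_Suc using k.hom_closed by (auto simp: kernel_def)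
qed

lemma boundaries_2_0: "boundaries X (Suc (Suc 0)) 0 t = {\<one>\<^bsub>cE X 0 t\<^esub>}"
  unfolding boundaries_eq using j.hom_one[of 0 t] by (auto simp: kernel_def)

lemma boundaries_2_Suc:
  "boundaries X (Suc (Suc 0)) (Suc s) t = (\<lambda>x. cj X (Suc s) t (ck X s t x)) ` carrier (cE X s t)"
proof -
  have "kernel (cD X (Suc s) t) (cD X s (t + 1)) (ci_pow X (Suc 0) s (t + 1)) = ck X s t ` carrier (cE X s t)"
    using exact_ki[of s t] by simp
  then show ?thesis unfolding boundaries_eq by (simp add: image_image)
qed

end

locale adams_ext = represented_ring C \<kappa> G A \<rho> + ghost_tower C \<kappa> G M N T
  for C :: "('o, 'a, 'x) tri_cat_scheme" (structure) and \<kappa> :: "'u rel" and G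
    and A :: "'r gr_ring" and \<rho> :: "int \<Rightarrow> 'r \<Rightarrow> 'a" and M N :: 'o and T :: "('o, 'a) adams_res" +
  fixes L :: "('r, 'm) gr_module" and \<tau> :: "int \<Rightarrow> 'a \<Rightarrow> 'm"
    and L' :: "('r, 'n) gr_module" and \<tau>' :: "int \<Rightarrow> 'a \<Rightarrow> 'n"
  assumes L: "represents L M \<tau>" and L': "represents L' N \<tau>'"
begin

section \<open>The resolution of the homotopy of M by the homotopy of the P_s\<close>

definition resolvent :: "nat \<Rightarrow> ('r, 'a) gr_module" where
  "resolvent s = Hmod (objP T s) (int s)"

text \<open>The map \<open>P_(s+1) \<rightarrow> M_(s+1) \<rightarrow> \<Sigma>P_s\<close> on
  homotopy, desuspended once; the regrading by \<open>s\<close> absorbs the change of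
  degree.\<close>

definition resolvent_diff :: "nat \<Rightarrow> int \<Rightarrow> 'a \<Rightarrow> 'a" where
  "resolvent_diff s = (\<lambda>n. \<lambda>x\<in>Mor C (S (n + int (Suc s))) (objP T (Suc s)).
     shift_arr C (- 1) (resB T s \<bullet> resP T (Suc s) \<bullet> x))"

definition resolvent_aug :: "int \<Rightarrow> 'a \<Rightarrow> 'm" where
  "resolvent_aug = (\<lambda>n. \<lambda>x\<in>Mor C (S n) (objP T 0). \<tau> n (resP T 0 \<bullet> x))"

lemma mgrp_resolvent: "mgrp (resolvent s) n = Hom C (S (n + int s)) (objP T s)"
  by (simp add: resolvent_def mgrp_Hmod)

lemma resolvent_module: "graded_module A (resolvent s)"
  unfolding resolvent_def by (rule Hmod_module[OF objP])

lemma bp: "resB T s \<bullet> resP T (Suc s) \<in> Mor C (objP T (Suc s)) (susp C (objP T s))"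
  by (rule cmp_closed[OF resP resB])

lemma bp_cmp: "x \<in> Mor C W (objP T (Suc s)) \<Longrightarrow> resB T s \<bullet> resP T (Suc s) \<bullet> x = (resB T s \<bullet> resP T (Suc s)) \<bullet> x"
  by (rule cmp_assoc[symmetric, OF _ resP resB])

lemma susp_eq_shift: "susp C Y = shift C 1 Y" "susp_arr C f = shift_arr C 1 f"
  by (simp_all add: shift_def shift_arr_def)

lemma bp_closed:
  assumes x: "x \<in> Mor C (S (n + 1)) (objP T (Suc s))"
  shows "shift_arr C (- 1) (resB T s \<bullet> resP T (Suc s) \<bullet> x) \<in> Mor C (S n) (objP T s)"
    and "susp_arr C (shift_arr C (- 1) (resB T s \<bullet> resP T (Suc s) \<bullet> x)) = resB T s \<bullet> resP T (Suc s) \<bullet> x"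
proof -
  have c: "resB T s \<bullet> resP T (Suc s) \<bullet> x \<in> Mor C (shift C 1 (S n)) (shift C 1 (objP T s))"
    unfolding bp_cmp[OF x] using cmp_closed[OF x bp] by (simp add: susp_eq_shift shift_S add.commute)
  note s = shift_mor_surj[OF S objP c]
  show "shift_arr C (- 1) (resB T s \<bullet> resP T (Suc s) \<bullet> x) \<in> Mor C (S n) (objP T s)"
    "susp_arr C (shift_arr C (- 1) (resB T s \<bullet> resP T (Suc s) \<bullet> x)) = resB T s \<bullet> resP T (Suc s) \<bullet> x"
    using s by (simp_all add: susp_eq_shift)
qed

lemma resolvent_diff_closed:
  "x \<in> Mor C (S (n + int (Suc s))) (objP T (Suc s)) \<Longrightarrow> resolvent_diff s n x \<in> Mor C (S (n + int s)) (objP T s)"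
  "x \<in> Mor C (S (n + int (Suc s))) (objP T (Suc s)) \<Longrightarrow> susp_arr C (resolvent_diff s n x) = resB T s \<bullet> resP T (Suc s) \<bullet> x"
  using bp_closed[of x "n + int s" s] by (simp_all add: resolvent_diff_def add.assoc add.commute[of 1])

lemma resolvent_diff: "resolvent_diff s \<in> gr_hom A (resolvent (Suc s)) (resolvent s) 0"
proof (rule gr_homI)
  fix n x assume "x \<in> carrier (mgrp (resolvent (Suc s)) n)"
  then have x: "x \<in> Mor C (S (n + int (Suc s))) (objP T (Suc s))" by (simp add: mgrp_resolvent)
  show "resolvent_diff s n x \<in> carrier (mgrp (resolvent s) (n + 0))"
    using resolvent_diff_closed(1)[OF x] by (simp add: mgrp_resolvent)
  fix y assume "y \<in> carrier (mgrp (resolvent (Suc s)) n)"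
  then have y: "y \<in> Mor C (S (n + int (Suc s))) (objP T (Suc s))" by (simp add: mgrp_resolvent)
  note xy = add_closed[OF x y] and dx = resolvent_diff_closed[OF x] and dy = resolvent_diff_closed[OF y]
  have "resolvent_diff s n (add C x y) = add C (resolvent_diff s n x) (resolvent_diff s n y)"
  proof (rule susp_mor_inj[OF resolvent_diff_closed(1)[OF xy] add_closed[OF dx(1) dy(1)]])
    show "susp_arr C (resolvent_diff s n (add C x y)) = susp_arr C (add C (resolvent_diff s n x) (resolvent_diff s n y))"
      unfolding susp_add[OF dx(1) dy(1)] dx(2) dy(2) resolvent_diff_closed(2)[OF xy] bp_cmp[OF x] bp_cmp[OF y] bp_cmp[OF xy]
      by (rule cmp_add_right[OF x y bp])
  qed
  then show "resolvent_diff s n (x \<otimes>\<^bsub>mgrp (resolvent (Suc s)) n\<^esub> y)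
      = resolvent_diff s n x \<otimes>\<^bsub>mgrp (resolvent s) (n + 0)\<^esub> resolvent_diff s n y"
    by (simp add: mgrp_resolvent)
next
  show "resolvent_diff s n \<in> extensional (carrier (mgrp (resolvent (Suc s)) n))" for n
    by (simp add: resolvent_diff_def mgrp_resolvent)
  fix m n r x assume r: "r \<in> carrier (rgrp A m)" and "x \<in> carrier (mgrp (resolvent (Suc s)) n)"
  then have x: "x \<in> Mor C (S (n + int (Suc s))) (objP T (Suc s))" by (simp add: mgrp_resolvent)
  let ?r = "shift_arr C (n + int (Suc s)) (\<rho> m r)" and ?r' = "shift_arr C (n + int s) (\<rho> m r)"
  have rc: "?r \<in> Mor C (S (m + n + int (Suc s))) (S (n + int (Suc s)))" using shift_\<rho>[OF r, of "n + int (Suc s)"] by (simp add: add.assoc)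
  have rc': "?r' \<in> Mor C (S (m + n + int s)) (S (n + int s))" using shift_\<rho>[OF r, of "n + int s"] by (simp add: add.assoc)
  have rr: "susp_arr C ?r' = ?r" using shift_arr_1[OF \<rho>_closed[OF r], of "n + int s"] by (simp add: algebra_simps)
  note xr = cmp_closed[OF rc x] and dx = resolvent_diff_closed[OF x]
  have "resolvent_diff s (m + n) (x \<bullet> ?r) = resolvent_diff s n x \<bullet> ?r'"
  proof (rule susp_mor_inj[OF resolvent_diff_closed(1)[OF xr] cmp_closed[OF rc' dx(1)]])
    show "susp_arr C (resolvent_diff s (m + n) (x \<bullet> ?r)) = susp_arr C (resolvent_diff s n x \<bullet> ?r')"
      unfolding resolvent_diff_closed(2)[OF xr] susp_cmp[OF rc' dx(1)] dx(2) rr bp_cmp[OF x] bp_cmp[OF xr]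
      by (rule cmp_assoc[symmetric, OF rc x bp])
  qed
  then show "resolvent_diff s (m + n) (mact (resolvent (Suc s)) m n r x) = mact (resolvent s) m (n + 0) r (resolvent_diff s n x)"
    by (simp add: resolvent_def mact_Hmod)
qed

lemma resolvent_aug: "resolvent_aug \<in> gr_hom A (resolvent 0) L 0"
proof (rule gr_homI)
  fix n x assume "x \<in> carrier (mgrp (resolvent 0) n)"
  then have x: "x \<in> Mor C (S n) (objP T 0)" by (simp add: mgrp_resolvent)
  have p: "resP T 0 \<in> Mor C (objP T 0) M" using resP[of 0] objM_0 by simp
  show "resolvent_aug n x \<in> carrier (mgrp L (n + 0))"
    using rep_closed[OF L cmp_closed[OF x p]] x by (simp add: resolvent_aug_def)
  fix y assume "y \<in> carrier (mgrp (resolvent 0) n)"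
  then have y: "y \<in> Mor C (S n) (objP T 0)" by (simp add: mgrp_resolvent)
  show "resolvent_aug n (x \<otimes>\<^bsub>mgrp (resolvent 0) n\<^esub> y) = resolvent_aug n x \<otimes>\<^bsub>mgrp L (n + 0)\<^esub> resolvent_aug n y"
    using rep_add[OF L cmp_closed[OF x p] cmp_closed[OF y p]] cmp_add_right[OF x y p] x y add_closed[OF x y]
    by (simp add: resolvent_aug_def mgrp_resolvent)
next
  show "resolvent_aug n \<in> extensional (carrier (mgrp (resolvent 0) n))" for n
    by (simp add: resolvent_aug_def mgrp_resolvent)
  fix m n r x assume r: "r \<in> carrier (rgrp A m)" and "x \<in> carrier (mgrp (resolvent 0) n)"
  then have x: "x \<in> Mor C (S n) (objP T 0)" by (simp add: mgrp_resolvent)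
  have p: "resP T 0 \<in> Mor C (objP T 0) M" using resP[of 0] objM_0 by simp
  show "resolvent_aug (m + n) (mact (resolvent 0) m n r x) = mact L m (n + 0) r (resolvent_aug n x)"
    using rep_act[OF L r cmp_closed[OF x p]] cmp_assoc[OF shift_\<rho>[OF r] x p] x cmp_closed[OF shift_\<rho>[OF r] x]
    by (simp add: resolvent_aug_def resolvent_def mact_Hmod)
qed

text \<open>\<open>M_s \<rightarrow> M_(s+1)\<close> is zero in homotopy, so each class of
  \<open>M_s\<close> lifts to \<open>P_s\<close> by exactness.\<close>

lemma resP_onto: "x \<in> Mor C (S n) (objM T s) \<Longrightarrow> \<exists>y \<in> Mor C (S n) (objP T s). resP T s \<bullet> y = x"
  using tri_factor_left[OF triT resP resM _ ghostD[OF ghostM resM]] by metis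

text \<open>Exactness gives a preimage under the connecting map from \<open>M_(s+1)\<close>, and
  this lifts further to \<open>P_(s+1)\<close> because \<open>resP\<close> is onto in
  homotopy.\<close>

lemma resP_kernel:
  assumes x: "x \<in> Mor C (S (n + int s)) (objP T s)"
  shows "resP T s \<bullet> x = zer C (S (n + int s)) (objM T s)
    \<longleftrightarrow> x \<in> resolvent_diff s n ` Mor C (S (n + int (Suc s))) (objP T (Suc s))"
proof
  assume z: "resP T s \<bullet> x = zer C (S (n + int s)) (objM T s)"
  have S1: "susp C (S (n + int s)) = S (n + int (Suc s))" using susp_shift[OF G, of "n + int s"] by (simp add: algebra_simps)
  have sx: "susp_arr C x \<in> Mor C (S (n + int (Suc s))) (susp C (objP T s))" using susp_mor[OF x] S1 by simp
  have "susp_arr C (resP T s) \<bullet> susp_arr C x = zer C (S (n + int (Suc s))) (susp C (objM T s))"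
    using susp_cmp[OF x resP] z susp_zer[OF S objM] S1 by simp
  moreover have "neg C (zer C (S (n + int (Suc s))) (susp C (objM T s))) = zer C (S (n + int (Suc s))) (susp C (objM T s))"
    using add_neg[OF zer_closed[OF S susp_closed[OF objM]]] zer_add[OF neg_closed[OF zer_closed[OF S susp_closed[OF objM]]]] by metis
  ultimately have "neg C (susp_arr C (resP T s)) \<bullet> susp_arr C x = zer C (S (n + int (Suc s))) (susp C (objM T s))"
    using neg_cmp[OF sx susp_mor[OF resP]] by simp
  then obtain y where y: "y \<in> Mor C (S (n + int (Suc s))) (objM T (Suc s))" "resB T s \<bullet> y = susp_arr C x"
    using tri_factor_left[OF rotate[OF rotate[OF triT resP resM] resM resB] resB neg_closed[OF susp_mor[OF resP]] sx] by blast
  obtain w where w: "w \<in> Mor C (S (n + int (Suc s))) (objP T (Suc s))" "resP T (Suc s) \<bullet> w = y" using resP_onto[OF y(1)] by blast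
  have "x = resolvent_diff s n w"
    by (rule susp_mor_inj[OF x resolvent_diff_closed(1)[OF w(1)]]) (simp add: resolvent_diff_closed(2)[OF w(1)] w(2) y(2))
  then show "x \<in> resolvent_diff s n ` Mor C (S (n + int (Suc s))) (objP T (Suc s))" using w(1) by blast
next
  assume "x \<in> resolvent_diff s n ` Mor C (S (n + int (Suc s))) (objP T (Suc s))"
  then obtain w where w: "w \<in> Mor C (S (n + int (Suc s))) (objP T (Suc s))" "x = resolvent_diff s n w" by blast
  have S1: "susp C (S (n + int s)) = S (n + int (Suc s))" using susp_shift[OF G, of "n + int s"] by (simp add: algebra_simps)
  note pw = cmp_closed[OF w(1) resP]
  show "resP T s \<bullet> x = zer C (S (n + int s)) (objM T s)"
  proof (rule susp_mor_inj[OF cmp_closed[OF x resP] zer_closed[OF S objM]])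
    have "susp_arr C (resP T s \<bullet> x) = (susp_arr C (resP T s) \<bullet> resB T s) \<bullet> (resP T (Suc s) \<bullet> w)"
      using susp_cmp[OF x resP] w(2) resolvent_diff_closed(2)[OF w(1)] cmp_assoc[OF pw resB susp_mor[OF resP]] by simp
    also have "\<dots> = zer C (S (n + int (Suc s))) (susp C (objM T s))"
      unfolding uw_zero[OF triT resP resM] by (rule zer_cmp[OF pw susp_closed[OF objM]])
    finally show "susp_arr C (resP T s \<bullet> x) = susp_arr C (zer C (S (n + int s)) (objM T s))"
      using susp_zer[OF S objM] S1 by simp
  qed
qed

text \<open>The kernel of \<open>resB\<close> in homotopy is the image of the ghost
  \<open>resM\<close>. Together with \<open>resP_onto\<close> this breaks the long exact sequences
  of the triangles into short ones.\<close>

lemma resB_inj: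
  assumes y: "y \<in> Mor C (S n) (objM T (Suc s))" and z: "resB T s \<bullet> y = zer C (S n) (susp C (objP T s))"
  shows "y = zer C (S n) (objM T (Suc s))"
proof -
  obtain x where "x \<in> Mor C (S n) (objM T s)" "resM T s \<bullet> x = y"
    using tri_factor_left[OF rotate[OF triT resP resM] resM resB y z] by blast
  then show ?thesis using ghostD[OF ghostM resM] by metis
qed

text \<open>The short exact sequences relating the homotopy of \<open>M_(s+1)\<close>,
  \<open>P_s\<close> and \<open>M_s\<close> are spliced together.\<close>

lemma resolvent_resolution: "resolution A L resolvent resolvent_diff resolvent_aug"
  unfolding resolution_def
proof (intro conjI allI)
  show "graded_module A L" by (rule rep_module[OF L])
  fix n s
  have p: "resP T 0 \<in> Mor C (objP T 0) M" using resP[of 0] objM_0 by simp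
  show "resolvent_aug n ` carrier (mgrp (resolvent 0) n) = carrier (mgrp L n)"
  proof (intro equalityI subsetI)
    fix y assume "y \<in> carrier (mgrp L n)"
    then obtain x where x: "x \<in> Mor C (S n) M" "y = \<tau> n x" using rep_surj[OF L] by blast
    then obtain w where w: "w \<in> Mor C (S n) (objP T 0)" "resP T 0 \<bullet> w = x" using resP_onto[of x n 0] objM_0 by auto
    then have "y = resolvent_aug n w" using x(2) by (simp add: resolvent_aug_def)
    then show "y \<in> resolvent_aug n ` carrier (mgrp (resolvent 0) n)" using w(1) by (simp add: mgrp_resolvent)
  qed (use gr_hom_closed0[OF resolvent_aug] in auto)
  show "resolvent_diff 0 n ` carrier (mgrp (resolvent 1) n) = kernel (mgrp (resolvent 0) n) (mgrp L n) (resolvent_aug n)"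
  proof (rule Set.set_eqI)
    fix x
    have "x \<in> resolvent_diff 0 n ` carrier (mgrp (resolvent 1) n)
        \<longleftrightarrow> x \<in> Mor C (S n) (objP T 0) \<and> resP T 0 \<bullet> x = zer C (S n) M"
      using resP_kernel[of x n 0] resolvent_diff_closed(1)[of _ n 0] objM_0 by (auto simp: mgrp_resolvent)
    also have "\<dots> \<longleftrightarrow> x \<in> kernel (mgrp (resolvent 0) n) (mgrp L n) (resolvent_aug n)"
      using rep_zero_iff[OF L cmp_closed[OF _ p]] by (auto simp: kernel_def mgrp_resolvent resolvent_aug_def)
    finally show "x \<in> resolvent_diff 0 n ` carrier (mgrp (resolvent 1) n)
        \<longleftrightarrow> x \<in> kernel (mgrp (resolvent 0) n) (mgrp L n) (resolvent_aug n)" .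
  qed
  show "resolvent_diff (Suc s) n ` carrier (mgrp (resolvent (Suc (Suc s))) n)
      = kernel (mgrp (resolvent (Suc s)) n) (mgrp (resolvent s) n) (resolvent_diff s n)"
  proof (rule Set.set_eqI)
    fix x
    have "resolvent_diff s n x = zer C (S (n + int s)) (objP T s) \<longleftrightarrow> resP T (Suc s) \<bullet> x = zer C (S (n + int (Suc s))) (objM T (Suc s))"
      if x: "x \<in> Mor C (S (n + int (Suc s))) (objP T (Suc s))"
    proof -
      have S1: "susp C (S (n + int s)) = S (n + int (Suc s))" using susp_shift[OF G, of "n + int s"] by (simp add: algebra_simps)
      note px = cmp_closed[OF x resP]
      have "resolvent_diff s n x = zer C (S (n + int s)) (objP T s)
          \<longleftrightarrow> susp_arr C (resolvent_diff s n x) = susp_arr C (zer C (S (n + int s)) (objP T s))"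
        using susp_mor_inj[OF resolvent_diff_closed(1)[OF x] zer_closed[OF S objP]] by auto
      also have "\<dots> \<longleftrightarrow> resB T s \<bullet> (resP T (Suc s) \<bullet> x) = zer C (S (n + int (Suc s))) (susp C (objP T s))"
        unfolding resolvent_diff_closed(2)[OF x] using susp_zer[OF S objP] S1 by simp
      also have "\<dots> \<longleftrightarrow> resP T (Suc s) \<bullet> x = zer C (S (n + int (Suc s))) (objM T (Suc s))"
        using resB_inj[OF px] cmp_zer[OF resB S] by auto
      finally show ?thesis .
    qed
    then show "x \<in> resolvent_diff (Suc s) n ` carrier (mgrp (resolvent (Suc (Suc s))) n)
      \<longleftrightarrow> x \<in> kernel (mgrp (resolvent (Suc s)) n) (mgrp (resolvent s) n) (resolvent_diff s n)"
      using resP_kernel[of x n "Suc s"] resolvent_diff_closed(1)[of _ n "Suc s"] by (auto simp: mgrp_resolvent kernel_def)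
  qed
qed (rule resolvent_module resolvent_diff resolvent_aug)+

lemma resolvent_lifting: "graded_module A Y \<Longrightarrow> graded_module A Z \<Longrightarrow> lifting A (resolvent s) Y Z"
  unfolding resolvent_def by (rule Hmod_proj_lifting[OF projP])

text \<open>\<open>[S (n + s), \<Sigma>^(s+t) N]\<close> is the homotopy of \<open>N\<close> in
  degree \<open>n - t\<close> after a shift by \<open>-(s + t)\<close>. So a map of degree
  \<open>s + t\<close> out of \<open>P_s\<close> lowers the regraded degree by \<open>t\<close>,
  which is the convention for the internal degree of \<open>Ext\<close>.\<close>

definition untwist :: "nat \<Rightarrow> int \<Rightarrow> int \<Rightarrow> 'a \<Rightarrow> 'n" where
  "untwist s t n y = \<tau>' (n - t) (shift_arr C (- (int s + t)) y)"

lemma untwist_iso: "untwist s t n \<in> iso (Hom C (S (n + int s)) (shift C (int s + t) N)) (mgrp L' (n - t))"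
proof -
  have "S (- (int s + t) + (n + int s)) = S (n - t)" by simp
  then have "shift_arr C (- (int s + t)) \<in> iso (Hom C (S (n + int s)) (shift C (int s + t) N)) (Hom C (S (n - t)) N)"
    using shift_iso_Hom[OF S[of "n + int s"] sN[of "int s + t"], of "- (int s + t)"]
    by (simp add: shift_S shift_shift[OF N] shift_0)
  from iso_set_trans[OF this rep_iso[OF L']] show ?thesis by (simp add: comp_def untwist_def[abs_def])
qed

lemma untwist_act:
  assumes r: "r \<in> carrier (rgrp A m)" and y: "y \<in> Mor C (S (n + int s)) (shift C (int s + t) N)"
  shows "untwist s t (m + n) (y \<bullet> shift_arr C (n + int s) (\<rho> m r)) = mact L' m (n - t) r (untwist s t n y)"
proof -
  let ?k = "- (int s + t)"
  have c: "shift_arr C ?k y \<in> Mor C (S (n - t)) N"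
    using shift_mor[OF y, of ?k] by (simp add: shift_S shift_shift[OF N] shift_0)
  have "shift_arr C ?k (y \<bullet> shift_arr C (n + int s) (\<rho> m r)) = shift_arr C ?k y \<bullet> shift_arr C (n - t) (\<rho> m r)"
    using shift_cmp[OF shift_\<rho>[OF r] y, of ?k] shift_arr_add[OF \<rho>_closed[OF r], of ?k "n + int s"] by simp
  then show ?thesis using rep_act[OF L' r c] by (simp add: untwist_def add_diff_eq)
qed

definition comparison :: "nat \<Rightarrow> int \<Rightarrow> 'a \<Rightarrow> int \<Rightarrow> 'a \<Rightarrow> 'n" where
  "comparison s t f = (\<lambda>n. \<lambda>x\<in>Mor C (S (n + int s)) (objP T s). untwist s t n (f \<bullet> x))"

text \<open>\<open>induced_bij\<close> identifies maps
  \<open>P_s \<rightarrow> \<Sigma>^(s+t) N\<close> with module maps between regraded homotopy, and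
  \<open>untwist\<close> replaces the target by \<open>L'\<close>.\<close>

lemma comparison_iso:
  "comparison s t \<in> iso (cE X s t) (gr_Hom A (resolvent s) L' (- t))"
proof (rule isoI)
  let ?N = "shift C (int s + t) N"
  let ?H = "Hmod ?N (int s)"
  note iso = untwist_iso[of s t]
  have add: "untwist s t n (add C x y) = untwist s t n x \<otimes>\<^bsub>mgrp L' (n - t)\<^esub> untwist s t n y"
    if "x \<in> Mor C (S (n + int s)) ?N" "y \<in> Mor C (S (n + int s)) ?N" for n x y
    using iso[of n] that by (auto simp: iso_def hom_def)
  have cl: "untwist s t n x \<in> carrier (mgrp L' (n - t))" if "x \<in> Mor C (S (n + int s)) ?N" for n x
    using iso[of n] that by (auto simp: iso_def hom_def)
  have closed: "comparison s t f \<in> gr_hom A (resolvent s) L' (- t)" if f: "f \<in> Mor C (objP T s) ?N" for f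
  proof (rule gr_homI)
    fix n x assume "x \<in> carrier (mgrp (resolvent s) n)"
    then have x: "x \<in> Mor C (S (n + int s)) (objP T s)" by (simp add: mgrp_resolvent)
    show "comparison s t f n x \<in> carrier (mgrp L' (n + - t))"
      using cl[OF cmp_closed[OF x f]] x by (simp add: comparison_def)
    fix y assume "y \<in> carrier (mgrp (resolvent s) n)"
    then have y: "y \<in> Mor C (S (n + int s)) (objP T s)" by (simp add: mgrp_resolvent)
    show "comparison s t f n (x \<otimes>\<^bsub>mgrp (resolvent s) n\<^esub> y) = comparison s t f n x \<otimes>\<^bsub>mgrp L' (n + - t)\<^esub> comparison s t f n y"
      using x y add_closed[OF x y] cmp_add_right[OF x y f] add[OF cmp_closed[OF x f] cmp_closed[OF y f]]
      by (simp add: comparison_def mgrp_resolvent)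
  next
    show "comparison s t f n \<in> extensional (carrier (mgrp (resolvent s) n))" for n by (simp add: comparison_def mgrp_resolvent)
    fix m n r x assume r: "r \<in> carrier (rgrp A m)" and "x \<in> carrier (mgrp (resolvent s) n)"
    then have x: "x \<in> Mor C (S (n + int s)) (objP T s)" by (simp add: mgrp_resolvent)
    have rc: "shift_arr C (n + int s) (\<rho> m r) \<in> Mor C (S (m + n + int s)) (S (n + int s))"
      using shift_\<rho>[OF r, of "n + int s"] by (simp add: add.assoc)
    show "comparison s t f (m + n) (mact (resolvent s) m n r x) = mact L' m (n + - t) r (comparison s t f n x)"
      using untwist_act[OF r cmp_closed[OF x f]] cmp_assoc[OF rc x f] x cmp_closed[OF rc x]
      by (simp add: comparison_def resolvent_def mact_Hmod)
  qed
  show "comparison s t \<in> hom (cE X s t) (gr_Hom A (resolvent s) L' (- t))"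
  proof (rule homI)
    fix f g assume "f \<in> carrier (cE X s t)" "g \<in> carrier (cE X s t)"
    then have f: "f \<in> Mor C (objP T s) ?N" and g: "g \<in> Mor C (objP T s) ?N" by (simp_all add: couple_simps)
    have "comparison s t (add C f g) n x = comparison s t f n x \<otimes>\<^bsub>mgrp L' (n - t)\<^esub> comparison s t g n x"
      if x: "x \<in> Mor C (S (n + int s)) (objP T s)" for n x
      using x add[OF cmp_closed[OF x f] cmp_closed[OF x g]] cmp_add_left[OF x f g] by (simp add: comparison_def)
    then show "comparison s t (f \<otimes>\<^bsub>cE X s t\<^esub> g) = comparison s t f \<otimes>\<^bsub>gr_Hom A (resolvent s) L' (- t)\<^esub> comparison s t g"
      by (auto simp: couple_simps mult_gr_Hom mgrp_resolvent comparison_def[of s t "add C f g"] intro!: ext)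
  qed (use closed in \<open>simp add: couple_simps\<close>)
  have inj: "inj_on (untwist s t n) (Mor C (S (n + int s)) ?N)" and onto: "untwist s t n ` Mor C (S (n + int s)) ?N = carrier (mgrp L' (n - t))" for n
    using iso[of n] by (auto simp: iso_def bij_betw_def)
  show "bij_betw (comparison s t) (carrier (cE X s t)) (carrier (gr_Hom A (resolvent s) L' (- t)))"
    unfolding bij_betw_def
  proof (intro conjI equalityI subsetI inj_onI)
    fix f f' assume "f \<in> carrier (cE X s t)" "f' \<in> carrier (cE X s t)" and eq: "comparison s t f = comparison s t f'"
    then have f: "f \<in> Mor C (objP T s) ?N" "f' \<in> Mor C (objP T s) ?N" by (simp_all add: couple_simps)
    have "induced (objP T s) (int s) f = induced (objP T s) (int s) f'"
      unfolding induced_def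
    proof (rule ext, rule restrict_ext)
      fix n x assume x: "x \<in> Mor C (S (n + int s)) (objP T s)"
      have "untwist s t n (f \<bullet> x) = untwist s t n (f' \<bullet> x)" using fun_cong[OF fun_cong[OF eq, of n], of x] x by (simp add: comparison_def)
      then show "f \<bullet> x = f' \<bullet> x" by (rule inj_onD[OF inj]) (use cmp_closed[OF x] f in auto)
    qed
    then show "f = f'"
      using bij_betw_imp_inj_on[OF induced_bij[OF projP sN], of s "int s" "int s + t"] f by (auto dest: inj_onD)
  next
    fix h assume "h \<in> comparison s t ` carrier (cE X s t)"
    then show "h \<in> carrier (gr_Hom A (resolvent s) L' (- t))" using closed by (auto simp: couple_simps)
  next
    fix h assume "h \<in> carrier (gr_Hom A (resolvent s) L' (- t))"
    then have h: "h \<in> gr_hom A (resolvent s) L' (- t)" by simp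
    \<comment> \<open>For surjectivity, \<open>h\<close> is carried back along
      \<open>untwist\<close> to a module map into the regraded homotopy of \<open>?N\<close>, and
      such a map is induced by an arrow.\<close>
    define iv where "iv n = inv_into (Mor C (S (n + int s)) ?N) (untwist s t n)" for n
    have iv: "iv n y \<in> Mor C (S (n + int s)) ?N" "untwist s t n (iv n y) = y" if "y \<in> carrier (mgrp L' (n - t))" for n y
      using that onto[of n] unfolding iv_def by (metis inv_into_into f_inv_into_f)+
    have ivI: "iv n (untwist s t n x) = x" if "x \<in> Mor C (S (n + int s)) ?N" for n x
      unfolding iv_def by (rule inv_into_f_f[OF inj that])
    have hc: "h n x \<in> carrier (mgrp L' (n - t))" if "x \<in> Mor C (S (n + int s)) (objP T s)" for n x
      using gr_hom_closed[OF h, of x n] that by (simp add: mgrp_resolvent)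
    let ?g = "\<lambda>n. \<lambda>x\<in>Mor C (S (n + int s)) (objP T s). iv n (h n x)"
    have "?g \<in> gr_hom A (resolvent s) ?H 0"
    proof (rule gr_homI)
      fix n x assume "x \<in> carrier (mgrp (resolvent s) n)"
      then have x: "x \<in> Mor C (S (n + int s)) (objP T s)" by (simp add: mgrp_resolvent)
      show "?g n x \<in> carrier (mgrp ?H (n + 0))" using iv(1)[OF hc[OF x]] x by (simp add: mgrp_Hmod)
      fix y assume "y \<in> carrier (mgrp (resolvent s) n)"
      then have y: "y \<in> Mor C (S (n + int s)) (objP T s)" by (simp add: mgrp_resolvent)
      note ix = iv[OF hc[OF x]] and iy = iv[OF hc[OF y]]
      have "h n (add C x y) = untwist s t n (add C (iv n (h n x)) (iv n (h n y)))"
        using gr_hom_mult[OF h, of x n y] x y add[OF ix(1) iy(1)] ix(2) iy(2) by (simp add: mgrp_resolvent)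
      then have "iv n (h n (add C x y)) = add C (iv n (h n x)) (iv n (h n y))" using ivI[OF add_closed[OF ix(1) iy(1)]] by simp
      then show "?g n (x \<otimes>\<^bsub>mgrp (resolvent s) n\<^esub> y) = ?g n x \<otimes>\<^bsub>mgrp ?H (n + 0)\<^esub> ?g n y"
        using x y add_closed[OF x y] by (simp add: mgrp_resolvent mgrp_Hmod)
    next
      show "?g n \<in> extensional (carrier (mgrp (resolvent s) n))" for n by (simp add: mgrp_resolvent)
      fix m n r x assume r: "r \<in> carrier (rgrp A m)" and xx: "x \<in> carrier (mgrp (resolvent s) n)"
      then have x: "x \<in> Mor C (S (n + int s)) (objP T s)" by (simp add: mgrp_resolvent)
      let ?r = "shift_arr C (n + int s) (\<rho> m r)"
      have rc: "?r \<in> Mor C (S (m + n + int s)) (S (n + int s))" using shift_\<rho>[OF r, of "n + int s"] by (simp add: add.assoc)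
      note ix = iv[OF hc[OF x]]
      have "h (m + n) (x \<bullet> ?r) = untwist s t (m + n) (iv n (h n x) \<bullet> ?r)"
        using gr_hom_act[OF h r xx] untwist_act[OF r ix(1)] ix(2) by (simp add: resolvent_def mact_Hmod)
      then have "iv (m + n) (h (m + n) (x \<bullet> ?r)) = iv n (h n x) \<bullet> ?r" using ivI[OF cmp_closed[OF rc ix(1)]] by simp
      then show "?g (m + n) (mact (resolvent s) m n r x) = mact ?H m (n + 0) r (?g n x)"
        using x cmp_closed[OF rc x] by (simp add: resolvent_def mact_Hmod)
    qed
    then obtain f where f: "f \<in> Mor C (objP T s) ?N" "?g = induced (objP T s) (int s) f"
      using bij_betw_imp_surj_on[OF induced_bij[OF projP sN], of s "int s" "int s + t"] unfolding resolvent_def by blast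
    have "comparison s t f = h"
    proof (rule gr_hom_eqI[OF closed[OF f(1)] h])
      fix n x assume "x \<in> carrier (mgrp (resolvent s) n)"
      then have x: "x \<in> Mor C (S (n + int s)) (objP T s)" by (simp add: mgrp_resolvent)
      have "f \<bullet> x = iv n (h n x)" using fun_cong[OF fun_cong[OF f(2), of n], of x] x by (simp add: induced_def)
      then show "comparison s t f n x = h n x" using x iv(2)[OF hc[OF x]] by (simp add: comparison_def)
    qed
    then show "h \<in> comparison s t ` carrier (cE X s t)" using f(1) by (auto simp: couple_simps)
  qed
qed

text \<open>The suspension in \<open>k\<close> and the desuspension in \<open>resolvent_diff\<close>
  cancel, so \<open>d_1 = j k\<close> corresponds to the coboundary without a sign.\<close>

lemma comparison_diff:
  assumes f: "f \<in> carrier (cE X s t)"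
  shows "comparison (Suc s) t (cj X (Suc s) t (ck X s t f)) = gr_comp (resolvent (Suc s)) (comparison s t f) (resolvent_diff s)"
proof -
  let ?N = "shift C (int s + t) N"
  have f': "f \<in> Mor C (objP T s) ?N" using f by (simp add: couple_simps)
  have "untwist (Suc s) t n (((susp_arr C f \<bullet> resB T s) \<bullet> resP T (Suc s)) \<bullet> x) = untwist s t n (f \<bullet> resolvent_diff s n x)"
    if x: "x \<in> Mor C (S (n + int (Suc s))) (objP T (Suc s))" for n x
  proof -
    note d = resolvent_diff_closed[OF x] and sf = susp_mor[OF f']
    have "((susp_arr C f \<bullet> resB T s) \<bullet> resP T (Suc s)) \<bullet> x = susp_arr C (f \<bullet> resolvent_diff s n x)"
      unfolding susp_cmp[OF d(1) f'] d(2) cmp_assoc[OF x resP cmp_closed[OF resB sf]] cmp_assoc[OF cmp_closed[OF x resP] resB sf] ..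
    also have "\<dots> = shift_arr C 1 (f \<bullet> resolvent_diff s n x)" by (rule susp_eq_shift)
    finally show ?thesis
      using shift_arr_add[OF cmp_closed[OF d(1) f'], of "- (int (Suc s) + t)" 1] by (simp add: untwist_def algebra_simps)
  qed
  then show ?thesis
    using resolvent_diff_closed(1)
    by (auto simp: comparison_def gr_comp_def couple_simps mgrp_resolvent intro!: ext restrict_ext)
qed

text \<open>\<open>comparison\<close> carries the kernel and the image of \<open>j k\<close> to the
  cocycles and coboundaries of the resolution by the homotopy of the \<open>P_s\<close>. This
  resolution is then compared with the free one chosen in \<open>Ext\<close>.\<close>

theorem page_2_Ext: "page X (Suc (Suc 0)) s t \<cong> Ext A L L' s t"
proof -
  interpret E: exact_couple X by (rule hom_couple_exact)
  interpret Q: graded_resolution A L resolvent resolvent_diff resolvent_aug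
    by unfold_locales (rule resolvent_resolution)
  note L'm = rep_module[OF L'] and Lm = rep_module[OF L]
  let ?H = "gr_Hom A (resolvent s) L' (- t)"
  have H: "comm_group (gr_Hom A (resolvent k) L' (- t))" for k by (rule gr_Hom_comm_group[OF resolvent_module L'm])
  interpret H: comm_group "gr_Hom A (resolvent k) L' (- t)" for k by (rule H)
  interpret c: group_hom "cE X k t" "gr_Hom A (resolvent k) L' (- t)" "comparison k t" for k
    by (intro group_hom.intro group_hom_axioms.intro E.E.group_axioms H.group_axioms iso_imp_homomorphism[OF comparison_iso])
  have bij: "bij_betw (comparison s t) (carrier (cE X s t)) (gr_hom A (resolvent s) L' (- t))" for s
    using comparison_iso[of s t] by (simp add: iso_def)
  have zero: "comparison s t x = \<one>\<^bsub>gr_Hom A (resolvent s) L' (- t)\<^esub> \<longleftrightarrow> x = \<one>\<^bsub>cE X s t\<^esub>"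
    if "x \<in> carrier (cE X s t)" for s x
    using bij_betw_imp_inj_on[OF bij[of s]] that c.hom_one[of s] E.E.one_closed[of s t] by (metis inj_onD)
  have jk: "cj X (Suc s) t (ck X s t x) \<in> carrier (cE X (Suc s) t)" if "x \<in> carrier (cE X s t)" for s x
    by (rule E.j.hom_closed[OF E.k.hom_closed[OF that]])
  have Z: "comparison s t x \<in> Q.cocycles L' s t \<longleftrightarrow> x \<in> cycles X (Suc (Suc 0)) s t" if x: "x \<in> carrier (cE X s t)" for s x
    unfolding Q.cocycles_def E.cycles_2 comparison_diff[OF x, symmetric]
    using x zero[OF jk[OF x]] bij_betwE[OF bij[of s]] by (simp add: comparison_diff[OF x, symmetric])
  have B: "comparison s t ` boundaries X (Suc (Suc 0)) s t = Q.cobounds L' s t"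
  proof (cases s)
    case 0
    then show ?thesis unfolding Q.cobounds_def using E.boundaries_2_0 c.hom_one[of 0] by simp
  next
    case (Suc s')
    have "comparison s t ` boundaries X (Suc (Suc 0)) s t
        = (\<lambda>x. gr_comp (resolvent (Suc s')) (comparison s' t x) (resolvent_diff s')) ` carrier (cE X s' t)"
      unfolding Suc E.boundaries_2_Suc image_image by (rule image_cong) (simp_all add: comparison_diff)
    also have "\<dots> = (\<lambda>f. gr_comp (resolvent (Suc s')) f (resolvent_diff s')) ` gr_hom A (resolvent s') L' (- t)"
      unfolding bij_betw_imp_surj_on[OF bij, symmetric] image_image ..
    finally show ?thesis by (simp add: Q.cobounds_def Suc)
  qed
  note sZ = E.subgroup_cycles[of "Suc 0" s t] and sB = E.subgroup_boundaries[of "Suc (Suc 0)" s t]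
  have Zc: "x \<in> carrier (cE X s t)" if "x \<in> cycles X (Suc (Suc 0)) s t" for x using subgroup.mem_carrier[OF sZ that] .
  have 1: "page X (Suc (Suc 0)) s t \<cong> Hom_cohomology A resolvent resolvent_diff L' s t"
    unfolding page_def Q.Hom_cohomology_eq
  proof (rule subquotient_iso[OF E.E_group sZ sB E.boundaries_subset_cycles H Q.cocycles_subgroup[OF L'm]
        Q.cobounds_subgroup[OF L'm] Q.cobounds_cocycles[OF L'm], where a = "comparison s t"])
    fix x assume x: "x \<in> cycles X (Suc (Suc 0)) s t"
    show "comparison s t x \<in> Q.cocycles L' s t" using Z[OF Zc[OF x]] x by simp
    show "comparison s t x \<in> Q.cobounds L' s t \<longleftrightarrow> x \<in> boundaries X (Suc (Suc 0)) s t"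
      unfolding B[symmetric]
      by (rule inj_on_image_mem_iff[OF bij_betw_imp_inj_on[OF bij] Zc[OF x] subgroup.subset[OF sB]])
    fix y assume y: "y \<in> cycles X (Suc (Suc 0)) s t"
    show "comparison s t (x \<otimes>\<^bsub>cE X s t\<^esub> y) = comparison s t x \<otimes>\<^bsub>?H\<^esub> comparison s t y"
      using hom_mult[OF iso_imp_homomorphism[OF comparison_iso] Zc[OF x] Zc[OF y]] .
  next
    fix z assume z: "z \<in> Q.cocycles L' s t"
    then have zc: "z \<in> gr_hom A (resolvent s) L' (- t)" by (simp add: Q.cocycles_def)
    then obtain x where x: "x \<in> carrier (cE X s t)" "z = comparison s t x" using bij_betw_imp_surj_on[OF bij[of s]] by (metis imageE)
    have "x \<in> cycles X (Suc (Suc 0)) s t" using Z[OF x(1)] z x(2) by simp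
    moreover have "comparison s t x \<otimes>\<^bsub>?H\<^esub> inv\<^bsub>?H\<^esub> z = \<one>\<^bsub>?H\<^esub>" unfolding x(2) by (rule H.r_inv[OF c.hom_closed[OF x(1)]])
    ultimately show "\<exists>x\<in>cycles X (Suc (Suc 0)) s t. comparison s t x \<otimes>\<^bsub>?H\<^esub> inv\<^bsub>?H\<^esub> z \<in> Q.cobounds L' s t"
      using subgroup.one_closed[OF Q.cobounds_subgroup[OF L'm]] by metis
  qed
  obtain F :: "nat \<Rightarrow> ('r, ('r \<times> 'm) list) gr_module" and \<delta> \<epsilon> where F: "free_resolution A L F \<delta> \<epsilon>"
    and Ext: "Ext A L L' = Hom_cohomology A F \<delta> L'"
    using Ext_eq[OF Lm] by blast
  note Fr = free_resolution_resolution[OF Lm F]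
  have Fm: "graded_module A (F s)" for s using Fr by (simp add: resolution_def)
  have Fl: "lifting A (F s) Y Z" if "graded_module A Y" "graded_module A Z" for s Y Z
  proof -
    have "graded_free A (F s)" using F by (simp add: free_resolution_def)
    then show ?thesis unfolding graded_free_iff using free_on_lifting that by blast
  qed
  have 2: "Hom_cohomology A resolvent resolvent_diff L' s t \<cong> Hom_cohomology A F \<delta> L' s t"
    by (rule Hom_cohomology_iso[OF resolvent_resolution Fr L'm]; rule resolvent_lifting Fl; rule resolvent_module Fm Lm)
  show ?thesis unfolding Ext by (rule iso_trans[OF 1 2])
qed

end

section \<open>Module categories of ring spectra\<close>

context category
begin

lemma iso_cmp:
  assumes f: "f \<in> Mor C X Y" "iso_arr C f" and g: "g \<in> Mor C Y Z" "iso_arr C g"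
  shows "iso_arr C (g \<bullet> f)"
proof -
  obtain f' where f': "f' \<in> Mor C Y X" "f' \<bullet> f = idn C X" "f \<bullet> f' = idn C Y" using iso_arrE[OF f(2,1)] .
  obtain g' where g': "g' \<in> Mor C Z Y" "g' \<bullet> g = idn C Y" "g \<bullet> g' = idn C Z" using iso_arrE[OF g(2,1)] .
  note gf = cmp_closed[OF f(1) g(1)]
  have "(f' \<bullet> g') \<bullet> (g \<bullet> f) = f' \<bullet> ((g' \<bullet> g) \<bullet> f)"
    using cmp_assoc[OF gf g'(1) f'(1)] cmp_assoc[OF f(1) g(1) g'(1)] by simp
  then have 1: "(f' \<bullet> g') \<bullet> (g \<bullet> f) = idn C X" using g'(2) idn_left[OF f(1)] f'(2) by simp
  have "(g \<bullet> f) \<bullet> (f' \<bullet> g') = g \<bullet> ((f \<bullet> f') \<bullet> g')"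
    using cmp_assoc[OF cmp_closed[OF g'(1) f'(1)] f(1) g(1)] cmp_assoc[OF g'(1) f'(1) f(1)] by simp
  then have 2: "(g \<bullet> f) \<bullet> (f' \<bullet> g') = idn C Z" using f'(3) idn_left[OF g'(1)] g'(3) by simp
  show ?thesis by (rule iso_arrI[OF gf cmp_closed[OF g'(1) f'(1)] 1 2])
qed

lemma iso_idn: "X \<in> obj C \<Longrightarrow> iso_arr C (idn C X)"
  by (rule iso_arrI[OF idn_closed idn_closed]) (auto simp: idn_left[OF idn_closed])

lemma inv_arr:
  assumes f: "f \<in> Mor C X Y" "iso_arr C f"
  shows "inv_arr C f \<in> Mor C Y X" "iso_arr C (inv_arr C f)"
proof -
  obtain g where g: "g \<in> Mor C Y X" "g \<bullet> f = idn C X" "f \<bullet> g = idn C Y" using iso_arrE[OF f(2,1)] .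
  have src: "f \<in> arr C" "src C f = X" "tgt C f = Y" using f(1) by (simp_all add: Mor_def)
  have "inv_arr C f = g" unfolding inv_arr_def
  proof (rule the_equality)
    show "inverse_arrows C f g" unfolding inverse_arrows_def using src g by simp
    fix h assume "inverse_arrows C f h"
    then have h: "h \<in> Mor C Y X" "h \<bullet> f = idn C X" unfolding inverse_arrows_def using src by simp_all
    have "h = h \<bullet> (f \<bullet> g)" using g(3) idn_right[OF h(1)] by simp
    also have "\<dots> = g" using cmp_assoc[OF g(1) f(1) h(1)] h(2) idn_left[OF g(1)] by simp
    finally show "h = g" .
  qed
  then show "inv_arr C f \<in> Mor C Y X" "iso_arr C (inv_arr C f)"
    using g iso_arrI[OF g(1) f(1) g(3,2)] by simp_all
qed

lemma iso_precomp_bij: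
  assumes e: "e \<in> Mor C X Y" "iso_arr C e"
  shows "bij_betw (\<lambda>g. g \<bullet> e) (Mor C Y Z) (Mor C X Z)"
proof -
  obtain d where d: "d \<in> Mor C Y X" "d \<bullet> e = idn C X" "e \<bullet> d = idn C Y" using iso_arrE[OF e(2,1)] .
  have "(g \<bullet> e) \<bullet> d = g" if "g \<in> Mor C Y Z" for g using cmp_assoc[OF d(1) e(1) that] d(3) idn_right[OF that] by simp
  moreover have "(g \<bullet> d) \<bullet> e = g" if "g \<in> Mor C X Z" for g using cmp_assoc[OF e(1) d(1) that] d(2) idn_right[OF that] by simp
  ultimately show ?thesis
    by (intro bij_betw_byWitness[of _ "\<lambda>g. g \<bullet> d"]) (auto simp: cmp_closed[OF e(1)] cmp_closed[OF d(1)])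
qed

end

lemma (in triangulated_category) shift_iso_arr:
  assumes f: "f \<in> Mor C X Y" "iso_arr C f"
  shows "iso_arr C (shift_arr C n f)"
proof -
  obtain g where g: "g \<in> Mor C Y X" "g \<bullet> f = idn C X" "f \<bullet> g = idn C Y" using iso_arrE[OF f(2,1)] .
  show ?thesis
    by (rule iso_arrI[OF shift_mor[OF f(1)] shift_mor[OF g(1)]])
      (simp_all add: shift_cmp[OF f(1) g(1), symmetric] shift_cmp[OF g(1) f(1), symmetric] g(2,3)
        shift_idn[OF Mor_src[OF f(1)]] shift_idn[OF Mor_tgt[OF f(1)]])
qed

text \<open>For \<open>n = - k < 0\<close> the iterate of \<open>\<phi>\<close> at
  \<open>\<Sigma>^n X\<close> is desuspended \<open>k\<close> times, so that it ends at
  \<open>F (\<Sigma>^n X)\<close>, and then inverted.\<close>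

lemma shift_iso_iso_arr:
  assumes C: "triangulated_category C" and D: "triangulated_category D" and F: "exact_functor C D F \<phi>" and X: "X \<in> obj C"
  shows "shift_iso C D F \<phi> n X \<in> Mor D (fobj F (shift C n X)) (shift D n (fobj F X))"
    and "iso_arr D (shift_iso C D F \<phi> n X)"
proof -
  interpret C: triangulated_category C by fact
  interpret D: triangulated_category D by fact
  have Fo: "fobj F Y \<in> obj D" if "Y \<in> obj C" for Y using F that by (simp add: exact_functor_def is_functor_def)
  have \<phi>: "\<phi> Y \<in> Mor D (fobj F (susp C Y)) (susp D (fobj F Y))" "iso_arr D (\<phi> Y)" if "Y \<in> obj C" for Y
    using F that by (simp_all add: exact_functor_def natural_iso_def functor_comp_def)
  have pow: "(susp C ^^ k) Y = shift C (int k) Y" for k Y by (simp add: shift_def)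
  have it: "susp_iterate C D F \<phi> k Y \<in> Mor D (fobj F (shift C (int k) Y)) (shift D (int k) (fobj F Y)) \<and>
      iso_arr D (susp_iterate C D F \<phi> k Y)" if Y: "Y \<in> obj C" for k Y
  proof (induction k)
    case 0
    show ?case using D.idn_closed[OF Fo[OF Y]] D.iso_idn[OF Fo[OF Y]] by (simp add: C.shift_0 D.shift_0)
  next
    case (Suc k)
    let ?Y = "shift C (int k) Y"
    have i: "susp_iterate C D F \<phi> k Y \<in> Mor D (fobj F ?Y) (shift D (int k) (fobj F Y))" "iso_arr D (susp_iterate C D F \<phi> k Y)"
      using Suc by auto
    have s: "susp_arr D (susp_iterate C D F \<phi> k Y) \<in> Mor D (susp D (fobj F ?Y)) (shift D (1 + int k) (fobj F Y))"
      using D.susp_mor[OF i(1)] D.susp_shift[OF Fo[OF Y]] by simp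
    have si: "iso_arr D (susp_arr D (susp_iterate C D F \<phi> k Y))"
      using D.shift_iso_arr[OF i, of 1] by (simp add: shift_arr_def)
    note p = \<phi>[OF C.shift_closed[OF Y, of "int k"]]
    show ?case
      using D.cmp_closed[OF p(1) s] D.iso_cmp[OF p s si] C.susp_shift[OF Y, of "int k"]
      by (simp add: pow)
  qed
  have "shift_iso C D F \<phi> n X \<in> Mor D (fobj F (shift C n X)) (shift D n (fobj F X)) \<and> iso_arr D (shift_iso C D F \<phi> n X)"
  proof (cases "0 \<le> n")
    case True
    then show ?thesis using it[OF X, of "nat n"] by (simp add: shift_iso_def)
  next
    case False
    define k where "k = nat (- n)"
    have k: "int k = - n" using False by (simp add: k_def)
    note nX = C.shift_closed[OF X, of n]
    have i: "susp_iterate C D F \<phi> k (shift C n X) \<in> Mor D (fobj F X) (shift D (- n) (fobj F (shift C n X)))"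
      "iso_arr D (susp_iterate C D F \<phi> k (shift C n X))"
      using it[OF nX, of k] C.shift_shift[OF X, of "- n" n] by (simp_all add: k C.shift_0)
    have "shift_arr D n (susp_iterate C D F \<phi> k (shift C n X)) \<in> Mor D (shift D n (fobj F X)) (fobj F (shift C n X))"
      using D.shift_mor[OF i(1), of n] D.shift_shift[OF Fo[OF nX], of n "- n"] by (simp add: D.shift_0)
    from D.inv_arr[OF this D.shift_iso_arr[OF i]] show ?thesis using False by (simp add: shift_iso_def k_def)
  qed
  then show "shift_iso C D F \<phi> n X \<in> Mor D (fobj F (shift C n X)) (shift D n (fobj F X))"
    "iso_arr D (shift_iso C D F \<phi> n X)" by auto
qed

section \<open>The module category of a ring spectrum and its compact generator\<close>

context A_infinity_ring_spectrum
begin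

abbreviation "\<S> \<equiv> spectra R"
abbreviation "\<M> \<equiv> modules R"
abbreviation "RR \<equiv> ring_module R"
abbreviation "S0 \<equiv> unit_obj (smash R)"

sublocale S: stable_homotopy_category \<kappa> "spectra R" "smash R" by (rule spectra)
sublocale D: triangulated_category "modules R" by (rule modules)

lemma S0: "S0 \<in> obj \<S>" by (rule S.unit_closed)

lemma sphere: "sphere R n \<in> obj \<S>" unfolding sphere_def by (rule S.shift_closed[OF S0])

lemma free_obj: "Y \<in> obj \<S> \<Longrightarrow> fobj (free R) Y \<in> obj \<M>"
  using free_exact by (simp add: exact_functor_def is_functor_def)

lemma forget_obj: "M \<in> obj \<M> \<Longrightarrow> fobj (forget R) M \<in> obj \<S>"
  and forget_mor: "f \<in> Mor \<M> M N \<Longrightarrow> farr (forget R) f \<in> Mor \<S> (fobj (forget R) M) (fobj (forget R) N)"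
  using forget_exact D.Mor_src[of f M N] D.Mor_tgt[of f M N] unfolding exact_functor_def is_functor_def by simp_all

lemma forget_add: "\<lbrakk>f \<in> Mor \<M> M N; g \<in> Mor \<M> M N\<rbrakk>
    \<Longrightarrow> farr (forget R) (add \<M> f g) = add \<S> (farr (forget R) f) (farr (forget R) g)"
  using forget_exact D.Mor_src[of f M N] D.Mor_tgt[of f M N] by (simp add: exact_functor_def)

lemma RR: "RR \<in> obj \<M>" unfolding ring_module_def by (rule free_obj[OF S0])

text \<open>The adjunction is \<open>f \<mapsto> U f \<circ> \<eta>\<close>, hence additive because \<open>U\<close> is.\<close>

lemma adjn_iso:
  assumes Y: "Y \<in> obj \<S>" and M: "M \<in> obj \<M>"
  shows "adjn R Y M \<in> iso (Hom \<M> (fobj (free R) Y) M) (Hom \<S> Y (fobj (forget R) M))"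
proof (rule isoI)
  let ?FY = "fobj (free R) Y"
  have FY: "?FY \<in> obj \<M>" by (rule free_obj[OF Y])
  let ?\<eta> = "adjn R Y ?FY (idn \<M> ?FY)"
  have bij: "bij_betw (adjn R Y N) (Mor \<M> ?FY N) (Mor \<S> Y (fobj (forget R) N))" if "N \<in> obj \<M>" for N
    by (rule adjn_bij[OF Y that])
  show "bij_betw (adjn R Y M) (carrier (Hom \<M> ?FY M)) (carrier (Hom \<S> Y (fobj (forget R) M)))"
    using bij[OF M] by simp
  have \<eta>: "?\<eta> \<in> Mor \<S> Y (fobj (forget R) ?FY)" using bij_betwE[OF bij[OF FY]] D.idn_closed[OF FY] by blast
  have a: "adjn R Y M f = farr (forget R) f \<bullet>\<^bsub>\<S>\<^esub> ?\<eta>" if f: "f \<in> Mor \<M> ?FY M" for f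
    using adjn_natural_right[OF Y D.idn_closed[OF FY] f] D.idn_right[OF f] by simp
  show "adjn R Y M \<in> hom (Hom \<M> ?FY M) (Hom \<S> Y (fobj (forget R) M))"
  proof (rule homI)
    fix f g assume "f \<in> carrier (Hom \<M> ?FY M)" "g \<in> carrier (Hom \<M> ?FY M)"
    then have f: "f \<in> Mor \<M> ?FY M" and g: "g \<in> Mor \<M> ?FY M" by simp_all
    show "adjn R Y M (f \<otimes>\<^bsub>Hom \<M> ?FY M\<^esub> g) = adjn R Y M f \<otimes>\<^bsub>Hom \<S> Y (fobj (forget R) M)\<^esub> adjn R Y M g"
      using a[OF D.add_closed[OF f g]] a[OF f] a[OF g] forget_add[OF f g] S.cmp_add_left[OF \<eta> forget_mor[OF f] forget_mor[OF g]] by simp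
  qed (use bij_betwE[OF bij[OF M]] in simp)
qed

definition free_shift :: "int \<Rightarrow> 'b" where
  "free_shift n = shift_iso \<S> \<M> (free R) (free_susp R) n S0"

lemma free_shift: "free_shift n \<in> Mor \<M> (fobj (free R) (sphere R n)) (shift \<M> n RR)" "iso_arr \<M> (free_shift n)"
  unfolding free_shift_def ring_module_def sphere_def
  by (rule shift_iso_iso_arr[OF S.triangulated_category_axioms modules free_exact S0])+

lemma to_homotopy_eq: "to_homotopy R M n g = adjn R (sphere R n) M (g \<bullet>\<^bsub>\<M>\<^esub> free_shift n)"
  by (simp add: to_homotopy_def free_shift_def)

lemma shift_RR: "shift \<M> n RR \<in> obj \<M>" by (rule D.shift_closed[OF RR])

lemma to_homotopy_iso:
  assumes M: "M \<in> obj \<M>"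
  shows "to_homotopy R M n \<in> iso (Hom \<M> (shift \<M> n RR) M) (homotopy R M n)"
proof -
  have "(\<lambda>g. g \<bullet>\<^bsub>\<M>\<^esub> free_shift n) \<in> iso (Hom \<M> (shift \<M> n RR) M) (Hom \<M> (fobj (free R) (sphere R n)) M)"
    by (rule isoI[OF group_hom.homh[OF D.precomp_group_hom[OF free_shift(1) M]]])
      (simp add: D.iso_precomp_bij[OF free_shift])
  from iso_set_trans[OF this adjn_iso[OF sphere M]] show ?thesis
    by (simp add: homotopy_def to_homotopy_eq[abs_def] comp_def)
qed

lemma carrier_homotopy: "carrier (homotopy R M n) = Mor \<S> (sphere R n) (fobj (forget R) M)"
  by (simp add: homotopy_def)

lemma to_homotopy_bij: "M \<in> obj \<M> \<Longrightarrow> bij_betw (to_homotopy R M n) (Mor \<M> (shift \<M> n RR) M) (carrier (homotopy R M n))"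
  using to_homotopy_iso[of M n] by (simp add: iso_def)

lemma to_homotopy_natural:
  assumes f: "f \<in> Mor \<M> M N" and g: "g \<in> Mor \<M> (shift \<M> n RR) M"
  shows "to_homotopy R N n (f \<bullet>\<^bsub>\<M>\<^esub> g) = homotopy_map R f (to_homotopy R M n g)"
  using adjn_natural_right[OF sphere D.cmp_closed[OF free_shift(1) g] f] D.cmp_assoc[OF free_shift(1) g f]
  by (simp add: to_homotopy_eq homotopy_map_def)

lemma from_to: "\<lbrakk>M \<in> obj \<M>; g \<in> Mor \<M> (shift \<M> n RR) M\<rbrakk> \<Longrightarrow> from_homotopy R M n (to_homotopy R M n g) = g"
  unfolding from_homotopy_def by (rule the_inv_into_f_f[OF bij_betw_imp_inj_on[OF to_homotopy_bij]])

lemma to_from: "\<lbrakk>M \<in> obj \<M>; x \<in> carrier (homotopy R M n)\<rbrakk> \<Longrightarrow> to_homotopy R M n (from_homotopy R M n x) = x"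
  unfolding from_homotopy_def by (rule f_the_inv_into_f_bij_betw[OF to_homotopy_bij])

lemma from_bij: "M \<in> obj \<M> \<Longrightarrow> bij_betw (from_homotopy R M n) (carrier (homotopy R M n)) (Mor \<M> (shift \<M> n RR) M)"
  unfolding from_homotopy_def[abs_def] by (rule bij_betw_the_inv_into[OF to_homotopy_bij])

lemma from_closed: "\<lbrakk>M \<in> obj \<M>; x \<in> carrier (homotopy R M n)\<rbrakk> \<Longrightarrow> from_homotopy R M n x \<in> Mor \<M> (shift \<M> n RR) M"
  using from_bij bij_betwE by blast

lemma to_closed: "\<lbrakk>M \<in> obj \<M>; g \<in> Mor \<M> (shift \<M> n RR) M\<rbrakk> \<Longrightarrow> to_homotopy R M n g \<in> carrier (homotopy R M n)"
  using to_homotopy_bij bij_betwE by blast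

lemma homotopy_comm_group: "M \<in> obj \<M> \<Longrightarrow> comm_group (homotopy R M n)"
  unfolding homotopy_def by (rule S.Hom_group[OF sphere forget_obj])

lemma to_zero_iff:
  assumes M: "M \<in> obj \<M>" and g: "g \<in> Mor \<M> (shift \<M> n RR) M"
  shows "to_homotopy R M n g = \<one>\<^bsub>homotopy R M n\<^esub> \<longleftrightarrow> g = zer \<M> (shift \<M> n RR) M"
proof -
  have "to_homotopy R M n (zer \<M> (shift \<M> n RR) M) = \<one>\<^bsub>homotopy R M n\<^esub>"
    using hom_one[OF iso_imp_homomorphism[OF to_homotopy_iso[OF M]] comm_group.axioms(2)[OF D.Hom_group[OF shift_RR M]]
      comm_group.axioms(2)[OF homotopy_comm_group[OF M]]] by simp
  then show ?thesis using from_to[OF M g] from_to[OF M D.zer_closed[OF shift_RR M]] by metis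
qed

text \<open>\<open>[R, -]\<close> is \<open>[S^0, U -]\<close> by adjunction, \<open>U\<close>
  preserves coproducts and \<open>S^0\<close> is compact. Naturality of the adjunction shows that
  the composite isomorphism is the canonical map.\<close>

lemma RR_compact: "compact_object \<kappa> \<M> RR"
  unfolding compact_object_def
proof (intro conjI allI impI, rule RR)
  fix I :: "'u set" and X P \<iota> assume "|I| <o \<kappa> \<and> X ` I \<subseteq> obj \<M> \<and> is_coproduct \<M> I X P \<iota>"
  then have I: "|I| <o \<kappa>" and X: "X ` I \<subseteq> obj \<M>" and P: "is_coproduct \<M> I X P \<iota>" by auto
  have Po: "P \<in> obj \<M>" and \<iota>: "\<And>i. i \<in> I \<Longrightarrow> \<iota> i \<in> Mor \<M> (X i) P" using P by (auto simp: is_coproduct_def)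
  have Xo: "X i \<in> obj \<M>" if "i \<in> I" for i using X that by blast
  let ?U = "fobj (forget R)" and ?u = "farr (forget R)"
  have "is_coproduct \<S> I (?U \<circ> X) (?U P) (?u \<circ> \<iota>)"
    using forget_coproducts I X P unfolding preserves_coproducts_def by blast
  moreover have "(?U \<circ> X) ` I \<subseteq> obj \<S>" using forget_obj Xo by auto
  ultimately have "(\<lambda>f. finprod (Hom \<S> S0 (?U P)) (\<lambda>i. (?u \<circ> \<iota>) i \<bullet>\<^bsub>\<S>\<^esub> f i) {i \<in> I. f i \<noteq> zer \<S> S0 ((?U \<circ> X) i)})
      \<in> iso (sum_group I (\<lambda>i. Hom \<S> S0 ((?U \<circ> X) i))) (Hom \<S> S0 (?U P))"
    using S.sphere_compact I unfolding compact_object_def by blast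
  then have E: "(\<lambda>f. finprod (Hom \<S> S0 (?U P)) (\<lambda>i. ?u (\<iota> i) \<bullet>\<^bsub>\<S>\<^esub> f i) {i \<in> I. f i \<noteq> zer \<S> S0 (?U (X i))})
      \<in> iso (sum_group I (\<lambda>i. Hom \<S> S0 (?U (X i)))) (Hom \<S> S0 (?U P))" (is "?E \<in> _") by simp
  have ad: "adjn R S0 M \<in> iso (Hom \<M> RR M) (Hom \<S> S0 (?U M))" if "M \<in> obj \<M>" for M
    unfolding ring_module_def by (rule adjn_iso[OF S0 that])
  let ?G = "sum_group I (\<lambda>i. Hom \<M> RR (X i))"
  have gX: "group (Hom \<M> RR (X i))" "group (Hom \<S> S0 (?U (X i)))" if "i \<in> I" for i
    using D.Hom_group[OF RR Xo[OF that]] S.Hom_group[OF S0 forget_obj[OF Xo[OF that]]] by (auto simp: comm_group.axioms(2))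
  have \<alpha>: "(\<lambda>c. \<lambda>i\<in>I. adjn R S0 (X i) (c i)) \<in> iso ?G (sum_group I (\<lambda>i. Hom \<S> S0 (?U (X i))))" (is "?\<alpha> \<in> _")
    by (rule sum_group_iso[OF gX ad[OF Xo]])
  note gP = D.Hom_group[OF RR Po]
  have \<beta>: "inv_into (carrier (Hom \<M> RR P)) (adjn R S0 P) \<in> iso (Hom \<S> S0 (?U P)) (Hom \<M> RR P)" (is "?\<beta> \<in> _")
    by (rule group.iso_set_sym[OF comm_group.axioms(2)[OF gP] ad[OF Po]])
  have comp: "?\<beta> \<circ> (?E \<circ> ?\<alpha>) \<in> iso ?G (Hom \<M> RR P)" by (rule iso_set_trans[OF iso_set_trans[OF \<alpha> E] \<beta>])
  let ?F = "\<lambda>f. finprod (Hom \<M> RR P) (\<lambda>i. \<iota> i \<bullet>\<^bsub>\<M>\<^esub> f i) {i \<in> I. f i \<noteq> zer \<M> RR (X i)}"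
  have eq: "?F c = (?\<beta> \<circ> (?E \<circ> ?\<alpha>)) c" if c: "c \<in> carrier ?G" for c
  proof -
    have ci: "c i \<in> Mor \<M> RR (X i)" if "i \<in> I" for i
      using that c gX by (auto simp: carrier_sum_group PiE_iff)
    have set: "{i \<in> I. ?\<alpha> c i \<noteq> zer \<S> S0 (?U (X i))} = {i \<in> I. c i \<noteq> zer \<M> RR (X i)}"
    proof -
      have "adjn R S0 (X i) (c i) = zer \<S> S0 (?U (X i)) \<longleftrightarrow> c i = zer \<M> RR (X i)" if i: "i \<in> I" for i
      proof -
        have "adjn R S0 (X i) (zer \<M> RR (X i)) = zer \<S> S0 (?U (X i))"
          using hom_one[OF iso_imp_homomorphism[OF ad[OF Xo[OF i]]] gX[OF i]] by simp
        moreover have "inj_on (adjn R S0 (X i)) (Mor \<M> RR (X i))" using ad[OF Xo[OF i]] by (simp add: iso_def bij_betw_def)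
        ultimately show ?thesis using ci[OF i] D.zer_closed[OF RR Xo[OF i]] by (metis inj_onD)
      qed
      then show ?thesis by auto
    qed
    have m: "\<iota> i \<bullet>\<^bsub>\<M>\<^esub> c i \<in> Mor \<M> RR P" if "i \<in> I" for i by (rule D.cmp_closed[OF ci[OF that] \<iota>[OF that]])
    interpret MP: comm_group "Hom \<M> RR P" by (rule gP)
    interpret SP: comm_group "Hom \<S> S0 (?U P)" by (rule S.Hom_group[OF S0 forget_obj[OF Po]])
    have Fc: "?F c \<in> carrier (Hom \<M> RR P)" by (rule MP.finprod_closed) (use m in auto)
    have "adjn R S0 P (?F c) = finprod (Hom \<S> S0 (?U P)) (\<lambda>i. adjn R S0 P (\<iota> i \<bullet>\<^bsub>\<M>\<^esub> c i)) {i \<in> I. c i \<noteq> zer \<M> RR (X i)}"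
      by (rule hom_finprod[OF gP SP.comm_group_axioms iso_imp_homomorphism[OF ad[OF Po]]]) (use m in auto)
    also have "\<dots> = ?E (?\<alpha> c)"
      unfolding set
    proof (rule SP.finprod_cong')
      have n: "adjn R S0 P (\<iota> i \<bullet>\<^bsub>\<M>\<^esub> c i) = ?u (\<iota> i) \<bullet>\<^bsub>\<S>\<^esub> ?\<alpha> c i" if i: "i \<in> I" for i
        using adjn_natural_right[OF S0 _ \<iota>[OF i], of "c i"] ci[OF i] i by (simp add: ring_module_def)
      then show "adjn R S0 P (\<iota> i \<bullet>\<^bsub>\<M>\<^esub> c i) = ?u (\<iota> i) \<bullet>\<^bsub>\<S>\<^esub> ?\<alpha> c i" if "i \<in> {i \<in> I. c i \<noteq> zer \<M> RR (X i)}" for i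
        using that by blast
      have mem: "adjn R S0 P (\<iota> i \<bullet>\<^bsub>\<M>\<^esub> c i) \<in> Mor \<S> S0 (?U P)" if "i \<in> I" for i
        using hom_in_carrier[OF iso_imp_homomorphism[OF ad[OF Po]], of "\<iota> i \<bullet>\<^bsub>\<M>\<^esub> c i"] m[OF that] by simp
      have "?u (\<iota> i) \<bullet>\<^bsub>\<S>\<^esub> ?\<alpha> c i \<in> carrier (Hom \<S> S0 (?U P))" if "i \<in> I" for i
        using mem[OF that] unfolding n[OF that] by (simp only: carrier_Hom)
      then show "(\<lambda>i. ?u (\<iota> i) \<bullet>\<^bsub>\<S>\<^esub> ?\<alpha> c i) \<in> {i \<in> I. c i \<noteq> zer \<M> RR (X i)} \<rightarrow> carrier (Hom \<S> S0 (?U P))" by blast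
    qed simp
    finally have 1: "adjn R S0 P (?F c) = ?E (?\<alpha> c)" .
    have "inj_on (adjn R S0 P) (carrier (Hom \<M> RR P))" using ad[OF Po] by (simp add: iso_def bij_betw_def)
    from inv_into_f_f[OF this Fc] show ?thesis unfolding 1 comp_def by (rule sym)
  qed
  have "group ?G" by (rule sum_group[OF gX(1)])
  then show "?F \<in> iso ?G (Hom \<M> RR P)" by (rule group.iso_eq[OF _ comp eq])
qed

text \<open>Smallness and detection of isomorphisms are transferred along
  \<open>\<pi>_n M = [\<Sigma>^n R, M]\<close>; the latter is the assumption that maps inducing
  isomorphisms of homotopy groups are inverted.\<close>

sublocale D: compact_triangulated "modules R" \<kappa> "ring_module R"
proof
  show "set_cardinal \<kappa>" by (rule S.sets)
  show "has_coproducts \<kappa> \<M>" by (rule modules_coproducts)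
  show "compact_object \<kappa> \<M> RR" by (rule RR_compact)
  show "|Mor \<M> (shift \<M> n RR) M| <o \<kappa>" if M: "M \<in> obj \<M>" for M n
  proof -
    have "|Mor \<M> (shift \<M> n RR) M| =o |carrier (homotopy R M n)|"
      using to_homotopy_bij[OF M, of n] card_of_ordIso by blast
    moreover have "|carrier (homotopy R M n)| <o \<kappa>"
      using S.small_homotopy[OF forget_obj[OF M], of n] by (simp add: carrier_homotopy sphere_def)
    ultimately show ?thesis using ordIso_ordLess_trans by blast
  qed
  fix f M N assume f: "f \<in> Mor \<M> M N"
    and bij: "\<And>n. bij_betw (\<lambda>x. f \<bullet>\<^bsub>\<M>\<^esub> x) (Mor \<M> (shift \<M> n RR) M) (Mor \<M> (shift \<M> n RR) N)"
  note M = D.Mor_src[OF f] and N = D.Mor_tgt[OF f]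
  show "iso_arr \<M> f"
  proof (rule equivalences_inverted[OF f], rule isoI)
    fix n
    show "homotopy_map R f \<in> hom (homotopy R M n) (homotopy R N n)"
      using group_hom.homh[OF S.postcomp_group_hom[OF forget_mor[OF f] sphere]]
      by (simp add: homotopy_def homotopy_map_def[abs_def])
    have "bij_betw (to_homotopy R N n \<circ> ((\<lambda>x. f \<bullet>\<^bsub>\<M>\<^esub> x) \<circ> from_homotopy R M n)) (carrier (homotopy R M n)) (carrier (homotopy R N n))"
      by (rule bij_betw_trans[OF bij_betw_trans[OF from_bij[OF M] bij] to_homotopy_bij[OF N]])
    moreover have "(to_homotopy R N n \<circ> ((\<lambda>x. f \<bullet>\<^bsub>\<M>\<^esub> x) \<circ> from_homotopy R M n)) x = homotopy_map R f x"
      if "x \<in> carrier (homotopy R M n)" for x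
      using to_homotopy_natural[OF f from_closed[OF M that]] to_from[OF M that] by simp
    ultimately show "bij_betw (homotopy_map R f) (carrier (homotopy R M n)) (carrier (homotopy R N n))"
      by (rule bij_betw_cong[THEN iffD1, rotated])
  qed
qed

text \<open>\<open>homotopy_act\<close> is composition read through \<open>from_homotopy\<close>, so
  the product formula holds by construction; associativity and distributivity of \<open>R_*\<close>
  then follow from \<open>A_graded_ring\<close>.\<close>

sublocale D: represented_ring "modules R" \<kappa> "ring_module R" "homotopy_ring R" "from_homotopy R (ring_module R)"
proof (intro represented_ring.intro represented_ring_axioms.intro)
  have grp: "rgrp (homotopy_ring R) = homotopy R RR" by (simp add: homotopy_ring_def)
  have mul: "rmul (homotopy_ring R) m n r s
      = to_homotopy R RR (m + n) (from_homotopy R RR n s \<bullet>\<^bsub>\<M>\<^esub> shift_arr \<M> n (from_homotopy R RR m r))" for m n r s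
    by (simp add: homotopy_ring_def homotopy_act_def)
  have one: "rone (homotopy_ring R) = to_homotopy R RR 0 (idn \<M> RR)" by (simp add: homotopy_ring_def)
  have idn: "idn \<M> RR \<in> Mor \<M> (shift \<M> 0 RR) RR" using D.idn_closed[OF RR] by (simp add: D.shift_0)
  have c: "from_homotopy R RR n s \<bullet>\<^bsub>\<M>\<^esub> shift_arr \<M> n (from_homotopy R RR m r) \<in> Mor \<M> (shift \<M> (m + n) RR) RR"
    if "r \<in> carrier (homotopy R RR m)" "s \<in> carrier (homotopy R RR n)" for r s m n
    using D.cmp_closed[OF D.shift_mor[OF from_closed[OF RR that(1)], of n] from_closed[OF RR that(2)]]
    by (simp add: D.shift_shift[OF RR] add.commute)
  show "compact_triangulated \<M> \<kappa> RR" by (rule D.compact_triangulated_axioms)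
  show "comm_group (rgrp (homotopy_ring R) n)" for n unfolding grp by (rule homotopy_comm_group[OF RR])
  show "from_homotopy R RR n \<in> iso (rgrp (homotopy_ring R) n) (Hom \<M> (shift \<M> n RR) RR)" for n
    unfolding grp
  proof (rule isoI)
    show "bij_betw (from_homotopy R RR n) (carrier (homotopy R RR n)) (carrier (Hom \<M> (shift \<M> n RR) RR))"
      using from_bij[OF RR] by simp
    show "from_homotopy R RR n \<in> hom (homotopy R RR n) (Hom \<M> (shift \<M> n RR) RR)"
    proof (rule homI)
      fix x y assume x: "x \<in> carrier (homotopy R RR n)" and y: "y \<in> carrier (homotopy R RR n)"
      show "from_homotopy R RR n x \<in> carrier (Hom \<M> (shift \<M> n RR) RR)" using from_closed[OF RR x] by simp
      note fx = from_closed[OF RR x] and fy = from_closed[OF RR y]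
      have "to_homotopy R RR n (add \<M> (from_homotopy R RR n x) (from_homotopy R RR n y)) = x \<otimes>\<^bsub>homotopy R RR n\<^esub> y"
        using hom_mult[OF iso_imp_homomorphism[OF to_homotopy_iso[OF RR, of n]], of "from_homotopy R RR n x" "from_homotopy R RR n y"]
          fx fy to_from[OF RR x] to_from[OF RR y] by simp
      then show "from_homotopy R RR n (x \<otimes>\<^bsub>homotopy R RR n\<^esub> y)
          = from_homotopy R RR n x \<otimes>\<^bsub>Hom \<M> (shift \<M> n RR) RR\<^esub> from_homotopy R RR n y"
        using from_to[OF RR D.add_closed[OF fx fy]] by simp
    qed
  qed
  show "rone (homotopy_ring R) \<in> carrier (rgrp (homotopy_ring R) 0)" unfolding grp one by (rule to_closed[OF RR idn])
  show "from_homotopy R RR 0 (rone (homotopy_ring R)) = idn \<M> RR" unfolding one by (rule from_to[OF RR idn])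
  fix r m s n assume r: "r \<in> carrier (rgrp (homotopy_ring R) m)" and s: "s \<in> carrier (rgrp (homotopy_ring R) n)"
  show "rmul (homotopy_ring R) m n r s \<in> carrier (rgrp (homotopy_ring R) (m + n))"
    unfolding mul unfolding grp by (rule to_closed[OF RR c]) (use r s grp in auto)
  show "from_homotopy R RR (m + n) (rmul (homotopy_ring R) m n r s)
      = from_homotopy R RR n s \<bullet>\<^bsub>\<M>\<^esub> shift_arr \<M> n (from_homotopy R RR m r)"
    unfolding mul by (rule from_to[OF RR c]) (use r s grp in auto)
qed

lemma homotopy_module_represents:
  assumes M: "M \<in> obj \<M>"
  shows "D.represents (homotopy_module R M) M (to_homotopy R M)"
  unfolding D.represents_def homotopy_module_def
  using M homotopy_comm_group[OF M] to_homotopy_iso[OF M] from_to[OF M]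
  by (simp add: homotopy_act_def)

lemma null_maps_iff: "f \<in> null_maps R \<longleftrightarrow> D.ghost f"
proof (cases "f \<in> arr \<M>")
  case True
  then have f: "f \<in> Mor \<M> (src \<M> f) (tgt \<M> f)" by (simp add: Mor_def)
  note M = D.Mor_src[OF f] and N = D.Mor_tgt[OF f]
  have "(\<forall>x \<in> carrier (homotopy R (src \<M> f) n). homotopy_map R f x = \<one>\<^bsub>homotopy R (tgt \<M> f) n\<^esub>)
    \<longleftrightarrow> (\<forall>g \<in> Mor \<M> (shift \<M> n RR) (src \<M> f). f \<bullet>\<^bsub>\<M>\<^esub> g = zer \<M> (shift \<M> n RR) (tgt \<M> f))" for n
    unfolding bij_betw_imp_surj_on[OF to_homotopy_bij[OF M], symmetric]
    using to_homotopy_natural[OF f] to_zero_iff[OF N D.cmp_closed[OF _ f]] by auto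
  then show ?thesis using True by (simp add: null_maps_def D.ghost_def)
qed (simp_all add: null_maps_def D.ghost_def)

lemma proj_objects_eq: "proj_objects \<kappa> R = D.projs"
  by (simp add: proj_objects_def D.projs_def)

lemma adams_resolution_iff: "adams_resolution \<kappa> R M T \<longleftrightarrow> D.resolution_tower M T"
  by (simp add: adams_resolution_def D.resolution_tower_def proj_objects_eq null_maps_iff)

lemma proj_length_ghost_length: "M \<in> proj_length \<kappa> R (Suc n) \<Longrightarrow> D.ghost_length (Suc n) M"
proof (induction n arbitrary: M)
  case 0
  then show ?case using D.ghost_length_proj by (simp add: proj_objects_eq)
next
  case (Suc n)
  obtain u v w where t: "(u, v, w) \<in> tri \<M>" and X: "src \<M> u \<in> proj_length \<kappa> R (Suc n)"
    and P: "tgt \<M> v \<in> D.projs" and r: "retract \<M> M (tgt \<M> u)"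
    using Suc.prems unfolding proj_length.simps mem_Collect_eq proj_objects_eq by blast
  have u: "u \<in> Mor \<M> (src \<M> u) (tgt \<M> u)" and v: "v \<in> Mor \<M> (tgt \<M> u) (tgt \<M> v)"
    using D.tri_candidate[OF t] unfolding candidate_triangle_def Mor_def by blast+
  show ?case by (rule D.ghost_length_retract[OF r D.ghost_length_triangle[OF t u v Suc.IH[OF X] P]])
qed

lemma ghost_tower: "\<lbrakk>adams_resolution \<kappa> R M T; N \<in> obj \<M>\<rbrakk> \<Longrightarrow> ghost_tower \<M> \<kappa> RR M N T"
  using D.compact_triangulated_axioms
  by (simp add: ghost_tower_def ghost_tower_axioms_def adams_resolution_iff)

text \<open>For length zero the claim is \<open>E_1 = E_\<infinity>\<close>, which may fail for a
  resolution of a zero object: any projective \<open>P_0\<close> with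
  \<open>M_1 = \<Sigma>P_0\<close> begins one, and \<open>E_1\<close> sees \<open>P_0\<close>. The
  constant resolution by \<open>M\<close> itself avoids this.\<close>

lemma ex_zero_resolution:
  assumes M: "zero_object \<M> M" and N: "N \<in> obj \<M>"
  shows "\<exists>T. adams_resolution \<kappa> R M T \<and> page (adams_couple R N T) (Suc 0) = page_inf (adams_couple R N T)"
proof -
  have Mo: "M \<in> obj \<M>" and idz: "idn \<M> M = zer \<M> M M" using M by (auto simp: D.zero_object_iff)
  define T where "T = \<lparr>objM = (\<lambda>_::nat. M), objP = (\<lambda>_. M), resP = (\<lambda>_. idn \<M> M), resM = (\<lambda>_. zer \<M> M M), resB = (\<lambda>_. zer \<M> M (susp \<M> M))\<rparr>"
  \<comment> \<open>A zero object is an empty coproduct, hence belongs to the projective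
    class.\<close>
  have "is_coproduct \<M> ({} :: 'u set) (\<lambda>i. D.S 0) M (\<lambda>i. undefined)"
    using M by (simp add: is_coproduct_def zero_object_def)
  moreover have "|{} :: 'u set| <o \<kappa>"
  proof -
    have "|{} :: 'u set| \<le>o |UNIV :: nat set|" by (rule card_of_empty)
    then show ?thesis using S.sets ordLeq_ordLess_trans unfolding set_cardinal_def by blast
  qed
  moreover have "retract \<M> M M" unfolding retract_def using Mo D.idn_closed[OF Mo] D.idn_left[OF D.idn_closed[OF Mo]] by blast
  ultimately have P: "M \<in> D.projs" using D.projsI[where d = "\<lambda>_. 0"] by blast
  have "D.ghost (zer \<M> M M)"
    unfolding D.ghost_iff[OF D.zer_closed[OF Mo Mo]] using D.zer_cmp[OF _ Mo] by blast
  then have T: "adams_resolution \<kappa> R M T"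
    unfolding adams_resolution_iff D.resolution_tower_def T_def
    using P D.idn_closed[OF Mo] D.zer_closed[OF Mo Mo] D.zer_closed[OF Mo D.susp_closed[OF Mo]] D.tri_id[OF Mo M] by simp
  interpret T: ghost_tower \<M> \<kappa> RR M N T by (rule ghost_tower[OF T N])
  have "page T.X (Suc 0) = page_inf T.X"
    by (rule T.page_eq_page_inf) (simp only: T.tower_arr.simps add_0_right, simp add: T_def idz)
  then show ?thesis using T by (auto simp: adams_couple_eq)
qed

end

text \<open>The bound for \<open>n \<ge> 1\<close> holds for every resolution, while the one for
  \<open>n = 0\<close> depends on the resolution; so the existence of a single resolution satisfying
  all bounds is asserted separately.\<close>

theorem theorem7p11:
  fixes \<kappa> :: "'u rel" and R :: "('o, 'a, 'p, 'b) ring_spectrum" and M N :: 'p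
  assumes "A_infinity_ring_spectrum \<kappa> R"
    and "M \<in> obj (modules R)" and "N \<in> obj (modules R)"
  shows
    "(\<exists>T. adams_resolution \<kappa> R M T \<and>
        (\<forall>n. M \<in> proj_length \<kappa> R n \<longrightarrow>
           page (adams_couple R N T) (n + 1) = page_inf (adams_couple R N T))) \<and>
     (\<forall>T. adams_resolution \<kappa> R M T \<longrightarrow>
        exact_couple (adams_couple R N T) \<and>
        cD (adams_couple R N T) 0 = graded_Hom (modules R) M N \<and>
        spectral_sequence (page (adams_couple R N T)) (page_diff (adams_couple R N T)) \<and>
        (\<forall>s t. page (adams_couple R N T) 2 s t
                 \<cong> Ext (homotopy_ring R) (homotopy_module R M) (homotopy_module R N) s t) \<and>
        conditionally_convergent (adams_couple R N T) \<and>
        (\<forall>n\<ge>1. M \<in> proj_length \<kappa> R n \<longrightarrow>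
           page (adams_couple R N T) (n + 1) = page_inf (adams_couple R N T)))"
proof -
  interpret A_infinity_ring_spectrum \<kappa> R by fact
  note M = assms(2) and N = assms(3)
  have all: "exact_couple (adams_couple R N T) \<and>
        cD (adams_couple R N T) 0 = graded_Hom (modules R) M N \<and>
        spectral_sequence (page (adams_couple R N T)) (page_diff (adams_couple R N T)) \<and>
        (\<forall>s t. page (adams_couple R N T) 2 s t
                 \<cong> Ext (homotopy_ring R) (homotopy_module R M) (homotopy_module R N) s t) \<and>
        conditionally_convergent (adams_couple R N T) \<and>
        (\<forall>n\<ge>1. M \<in> proj_length \<kappa> R n \<longrightarrow>
           page (adams_couple R N T) (n + 1) = page_inf (adams_couple R N T))"
    if T: "adams_resolution \<kappa> R M T" for T
  proof -
    interpret T: ghost_tower \<M> \<kappa> RR M N T by (rule ghost_tower[OF T N])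
    interpret T: adams_ext \<M> \<kappa> RR "homotopy_ring R" "from_homotopy R RR" M N T
        "homotopy_module R M" "to_homotopy R M" "homotopy_module R N" "to_homotopy R N"
      by (intro adams_ext.intro adams_ext_axioms.intro D.represented_ring_axioms T.ghost_tower_axioms
          homotopy_module_represents M N)
    interpret E: exact_couple "hom_couple \<M> N T" by (rule T.hom_couple_exact)
    have "page (hom_couple \<M> N T) (n + 1) = page_inf (hom_couple \<M> N T)"
      if n: "1 \<le> n" and Mn: "M \<in> proj_length \<kappa> R n" for n
    proof -
      obtain k where k: "n = Suc k" using n by (cases n) auto
      show ?thesis using T.page_collapse[OF proj_length_ghost_length[OF Mn[unfolded k]]] unfolding k Suc_eq_plus1[symmetric] .
    qed
    moreover have "cD (hom_couple \<M> N T) 0 = graded_Hom \<M> M N"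
      using T.objM_0 by (simp add: hom_couple_def)
    ultimately show ?thesis
      unfolding adams_couple_eq
      using T.hom_couple_exact E.spectral_sequence T.conditionally_convergent T.page_2_Ext
      by (simp add: numeral_2_eq_2)
  qed
  have "\<exists>T. adams_resolution \<kappa> R M T \<and>
        (\<forall>n. M \<in> proj_length \<kappa> R n \<longrightarrow>
           page (adams_couple R N T) (n + 1) = page_inf (adams_couple R N T))"
  proof (cases "zero_object \<M> M")
    case True
    obtain T where T: "adams_resolution \<kappa> R M T" "page (adams_couple R N T) (Suc 0) = page_inf (adams_couple R N T)"
      using ex_zero_resolution[OF True N] by blast
    have "page (adams_couple R N T) (n + 1) = page_inf (adams_couple R N T)" if "M \<in> proj_length \<kappa> R n" for n
      using all[OF T(1)] T(2) that by (cases "n = 0") auto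
    then show ?thesis using T(1) by blast
  next
    case False
    obtain T where T: "adams_resolution \<kappa> R M T" using D.ex_resolution_tower[OF M] adams_resolution_iff by blast
    \<comment> \<open>Length zero means being a zero object, so here every bound is one that holds
      for arbitrary resolutions.\<close>
    have "1 \<le> n" if "M \<in> proj_length \<kappa> R n" for n using False that by (cases n) auto
    then show ?thesis using T all[OF T] by blast
  qed
  then show ?thesis using all by blast
qed

end
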